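(* Let $n\ge 0$ and let $\mathbb{F}_n$ be the rational ruled surface $\mathbb{P}(\mathcal{O}_{\mathbb{P}^1}\oplus\mathcal{O}_{\mathbb{P}^1}(n))$ over $\mathbb{P}^1$, with zero section $C$ and fiber $F$ (so $C^2=-n$, $C\cdot F=1$, $F^2=0$). Let $a\ge 4$ and $b\ge\max(4+n,\,3+an)$ be integers. Then for a sufficiently general curve $D\in|aC+bF|$ on $\mathbb{F}_n$, the complement $\mathbb{F}_n\setminus D$ is algebraic hyperbolic.
   Context: All varieties are over $\mathbb{C}$. "Sufficiently general" means that $D$ lies in the linear system $|aC+bF|$ with countably many closed proper subvarieties removed. A quasi-projective variety is called algebraic hyperbolic if it does not contain a curve whose normalization is an elliptic curve or a rational curve with two points removed, i.e. $\mathbb{P}^1\setminus\{p,q\}\cong\mathbb{C}^*\cong\operatorname{Spec}\mathbb{C}[x,x^{-1}]$. *)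

theory Defs
  imports "HOL-Analysis.Abstract_Topology" "HOL-Library.Extended_Nat" Complex_Main
begin

section \<open>Varieties over the complex numbers as spaces with functions\<close>

text \<open>
  A variety is given by its set of closed points with the Zariski topology, together with its sheaf
  of regular functions: \<open>regular X U f\<close> says that \<open>U\<close> is open and that the restriction of \<open>f\<close>
  to \<open>U\<close> is a section over \<open>U\<close>. Values of \<open>f\<close> outside \<open>U\<close> are irrelevant.
\<close>

record 'a fspace =
  zariski :: "'a topology"
  regular :: "'a set \<Rightarrow> ('a \<Rightarrow> complex) \<Rightarrow> bool"

abbreviation points :: "'a fspace \<Rightarrow> 'a set" where
  "points X \<equiv> topspace (zariski X)"

definition subvar :: "'a fspace \<Rightarrow> 'a set \<Rightarrow> 'a fspace" where
  "subvar X S = \<lparr>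
     zariski = subtopology (zariski X) S,
     regular = (\<lambda>U f. openin (subtopology (zariski X) S) U \<and>
       (\<forall>x\<in>U. \<exists>W g. openin (zariski X) W \<and> x \<in> W \<and> regular X W g \<and> (\<forall>y\<in>W \<inter> U. f y = g y)))\<rparr>"

text \<open>The quotient by the equivalence relation whose classes are the fibres of \<open>q\<close>.\<close>

definition quotient_by :: "'a fspace \<Rightarrow> ('a \<Rightarrow> 'b) \<Rightarrow> 'b fspace" where
  "quotient_by X q =
    (let pre = (\<lambda>V. {x \<in> points X. q x \<in> V});
         opn = (\<lambda>V. V \<subseteq> q ` points X \<and> openin (zariski X) (pre V))
     in \<lparr>zariski = topology opn, regular = (\<lambda>V f. opn V \<and> regular X (pre V) (f \<circ> q))\<rparr>)"

lemma openin_quotient_by: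
  "openin (zariski (quotient_by X q)) V \<longleftrightarrow>
     V \<subseteq> q ` points X \<and> openin (zariski X) {x \<in> points X. q x \<in> V}"
proof -
  have 1: "{x \<in> points X. q x \<in> S \<inter> T} = {x \<in> points X. q x \<in> S} \<inter> {x \<in> points X. q x \<in> T}" for S T
    by auto
  have 2: "{x \<in> points X. q x \<in> \<Union>K} = (\<Union>S\<in>K. {x \<in> points X. q x \<in> S})" for K
    by auto
  have "istopology (\<lambda>V. V \<subseteq> q ` points X \<and> openin (zariski X) {x \<in> points X. q x \<in> V})"
    unfolding istopology_def 1 2 by (auto intro!: openin_Int openin_Union)
  then show ?thesis
    by (simp add: quotient_by_def Let_def topology_inverse')
qed


subsection \<open>Affine space\<close>

inductive_set poly_fun :: "nat \<Rightarrow> (complex list \<Rightarrow> complex) set" for m :: nat where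
  const: "(\<lambda>_. c) \<in> poly_fun m"
| coord: "i < m \<Longrightarrow> (\<lambda>z. z ! i) \<in> poly_fun m"
| add: "f \<in> poly_fun m \<Longrightarrow> g \<in> poly_fun m \<Longrightarrow> (\<lambda>z. f z + g z) \<in> poly_fun m"
| mult: "f \<in> poly_fun m \<Longrightarrow> g \<in> poly_fun m \<Longrightarrow> (\<lambda>z. f z * g z) \<in> poly_fun m"

definition open_locus :: "nat \<Rightarrow> (complex list \<Rightarrow> complex) set \<Rightarrow> complex list set" where
  "open_locus m P = {z. length z = m \<and> (\<exists>f\<in>P. f z \<noteq> 0)}"

definition affine_space :: "nat \<Rightarrow> complex list fspace" where
  "affine_space m = (let opn = (\<lambda>U. \<exists>P \<subseteq> poly_fun m. U = open_locus m P) in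
     \<lparr>zariski = topology opn,
      regular = (\<lambda>U f. opn U \<and>
        (\<forall>z\<in>U. \<exists>g\<in>poly_fun m. \<exists>h\<in>poly_fun m.
           h z \<noteq> 0 \<and> (\<forall>w\<in>U. h w \<noteq> 0 \<longrightarrow> f w = g w / h w)))\<rparr>)"

lemma openin_affine_space:
  "openin (zariski (affine_space m)) U \<longleftrightarrow> (\<exists>P \<subseteq> poly_fun m. U = open_locus m P)"
proof -
  have "istopology (\<lambda>U. \<exists>P \<subseteq> poly_fun m. U = open_locus m P)"
    unfolding istopology_def
  proof (intro conjI allI impI)
    fix S T
    assume "\<exists>P \<subseteq> poly_fun m. S = open_locus m P" "\<exists>P \<subseteq> poly_fun m. T = open_locus m P"
    then obtain P Q where "P \<subseteq> poly_fun m" "S = open_locus m P" "Q \<subseteq> poly_fun m" "T = open_locus m Q"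
      by blast
    then show "\<exists>R \<subseteq> poly_fun m. S \<inter> T = open_locus m R"
      by (intro exI[of _ "{\<lambda>z. f z * g z | f g. f \<in> P \<and> g \<in> Q}"])
         (fastforce simp: open_locus_def intro: poly_fun.mult)
  next
    fix K assume K: "\<forall>S\<in>K. \<exists>P \<subseteq> poly_fun m. S = open_locus m P"
    then obtain P where P: "\<forall>S\<in>K. P S \<subseteq> poly_fun m \<and> S = open_locus m (P S)"
      by metis
    have mem: "x \<in> S \<longleftrightarrow> length x = m \<and> (\<exists>f\<in>P S. f x \<noteq> 0)" if "S \<in> K" for x S
    proof -
      have "S = open_locus m (P S)" using P that by blast
      then have "x \<in> S \<longleftrightarrow> x \<in> open_locus m (P S)" by simp
      then show ?thesis by (simp add: open_locus_def)
    qed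
    have "(\<Union>S\<in>K. P S) \<subseteq> poly_fun m" using P by blast
    moreover have "\<Union>K = open_locus m (\<Union>S\<in>K. P S)"
      unfolding set_eq_iff Union_iff by (auto simp: mem open_locus_def)
    ultimately show "\<exists>P \<subseteq> poly_fun m. \<Union>K = open_locus m P" by blast
  qed
  then show ?thesis
    by (simp add: affine_space_def Let_def topology_inverse')
qed

lemma points_affine_space: "points (affine_space m) = {z. length z = m}"
proof
  show "points (affine_space m) \<subseteq> {z. length z = m}"
    by (auto simp: topspace_def openin_affine_space open_locus_def)
  have "openin (zariski (affine_space m)) {z. length z = m}"
    unfolding openin_affine_space
    by (intro exI[of _ "{\<lambda>_. 1}"]) (auto simp: open_locus_def intro: poly_fun.const)
  then show "{z. length z = m} \<subseteq> points (affine_space m)"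
    by (rule openin_subset)
qed


subsection \<open>Irreducibility, dimension, curves\<close>

definition irreducible_top :: "'a topology \<Rightarrow> bool" where
  "irreducible_top T \<longleftrightarrow> topspace T \<noteq> {} \<and>
     (\<forall>A B. closedin T A \<and> closedin T B \<and> topspace T = A \<union> B \<longrightarrow> A = topspace T \<or> B = topspace T)"

definition irreducible_closed :: "'a topology \<Rightarrow> 'a set \<Rightarrow> bool" where
  "irreducible_closed T Z \<longleftrightarrow> closedin T Z \<and> irreducible_top (subtopology T Z)"

definition krull_dim :: "'a topology \<Rightarrow> enat" where
  "krull_dim T = Sup {enat d | d. \<exists>Z :: nat \<Rightarrow> 'a set.
     (\<forall>i\<le>d. irreducible_closed T (Z i)) \<and> (\<forall>i<d. Z i \<subset> Z (Suc i))}"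

text \<open>
  Curves in a quasi-projective variety are only required to be locally closed. In particular a
  variety containing an affine or projective line contains a curve isomorphic to
  \<open>\<complex>\<^sup>*\<close>.
\<close>

definition curve_in :: "'a fspace \<Rightarrow> 'a set \<Rightarrow> bool" where
  "curve_in X G \<longleftrightarrow>
     (\<exists>U A. openin (zariski X) U \<and> closedin (zariski X) A \<and> G = U \<inter> A) \<and>
     irreducible_top (subtopology (zariski X) G) \<and>
     krull_dim (subtopology (zariski X) G) = 1"


subsection \<open>Morphisms and normalization\<close>

abbreviation preim :: "'a fspace \<Rightarrow> ('a \<Rightarrow> 'b) \<Rightarrow> 'b set \<Rightarrow> 'a set" where
  "preim X \<phi> V \<equiv> {x \<in> points X. \<phi> x \<in> V}"

definition morphism :: "'a fspace \<Rightarrow> 'b fspace \<Rightarrow> ('a \<Rightarrow> 'b) \<Rightarrow> bool" where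
  "morphism X Y \<phi> \<longleftrightarrow> continuous_map (zariski X) (zariski Y) \<phi> \<and>
     (\<forall>V f. regular Y V f \<longrightarrow> regular X (preim X \<phi> V) (f \<circ> \<phi>))"

definition isomorphism :: "'a fspace \<Rightarrow> 'b fspace \<Rightarrow> ('a \<Rightarrow> 'b) \<Rightarrow> bool" where
  "isomorphism X Y \<phi> \<longleftrightarrow> morphism X Y \<phi> \<and>
     (\<exists>\<psi>. morphism Y X \<psi> \<and> (\<forall>x\<in>points X. \<psi> (\<phi> x) = x) \<and> (\<forall>y\<in>points Y. \<phi> (\<psi> y) = y))"

definition affine :: "'a fspace \<Rightarrow> bool" where
  "affine X \<longleftrightarrow> (\<exists>m A \<phi>. closedin (zariski (affine_space m)) A \<and>
     isomorphism X (subvar (affine_space m) A) \<phi>)"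

definition finite_morphism :: "'a fspace \<Rightarrow> 'b fspace \<Rightarrow> ('a \<Rightarrow> 'b) \<Rightarrow> bool" where
  "finite_morphism X Y \<phi> \<longleftrightarrow> morphism X Y \<phi> \<and>
     (\<forall>y\<in>points Y. \<exists>V. openin (zariski Y) V \<and> y \<in> V \<and>
        affine (subvar Y V) \<and> affine (subvar X (preim X \<phi> V)) \<and>
        (\<exists>(m::nat) e. (\<forall>i<m. regular X (preim X \<phi> V) (e i)) \<and>
           (\<forall>g. regular X (preim X \<phi> V) g \<longrightarrow>
              (\<exists>c. (\<forall>i<m. regular Y V (c i)) \<and>
                 (\<forall>x\<in>preim X \<phi> V. g x = (\<Sum>i<m. c i (\<phi> x) * e i x))))))"

definition birational_morphism :: "'a fspace \<Rightarrow> 'b fspace \<Rightarrow> ('a \<Rightarrow> 'b) \<Rightarrow> bool" where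
  "birational_morphism X Y \<phi> \<longleftrightarrow>
     irreducible_top (zariski X) \<and> irreducible_top (zariski Y) \<and> morphism X Y \<phi> \<and>
     (\<exists>V. openin (zariski Y) V \<and> V \<noteq> {} \<and> isomorphism (subvar X (preim X \<phi> V)) (subvar Y V) \<phi>)"

text \<open>
  A rational function is represented by a regular function \<open>f\<close> on a nonempty open set \<open>U\<close>; the
  condition below says that each local ring is integrally closed in the function field.
\<close>

definition normal_variety :: "'a fspace \<Rightarrow> bool" where
  "normal_variety X \<longleftrightarrow> irreducible_top (zariski X) \<and>
     (\<forall>x\<in>points X. \<forall>U f. openin (zariski X) U \<and> U \<noteq> {} \<and> regular X U f \<and>
        (\<exists>V (d::nat) c. openin (zariski X) V \<and> x \<in> V \<and> (\<forall>i<d. regular X V (c i)) \<and>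
           (\<forall>y\<in>U \<inter> V. f y ^ d + (\<Sum>i<d. c i y * f y ^ i) = 0)) \<longrightarrow>
        (\<exists>W g. openin (zariski X) W \<and> x \<in> W \<and> regular X W g \<and> (\<forall>y\<in>U \<inter> W. f y = g y)))"

definition is_normalization :: "'a fspace \<Rightarrow> 'b fspace \<Rightarrow> ('a \<Rightarrow> 'b) \<Rightarrow> bool" where
  "is_normalization N Y \<nu> \<longleftrightarrow>
     normal_variety N \<and> finite_morphism N Y \<nu> \<and> birational_morphism N Y \<nu>"


subsection \<open>Projective space, elliptic curves, algebraic hyperbolicity\<close>

definition proj_point :: "complex list \<Rightarrow> complex list set" where
  "proj_point z = {map ((*) \<alpha>) z | \<alpha>. \<alpha> \<noteq> 0}"

definition proj_space :: "nat \<Rightarrow> complex list set fspace" where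
  "proj_space m = quotient_by (subvar (affine_space (Suc m)) {z. \<exists>i\<le>m. z ! i \<noteq> 0}) proj_point"

definition weierstrass_curve :: "complex \<Rightarrow> complex \<Rightarrow> complex list set fspace" where
  "weierstrass_curve A B = subvar (proj_space 2)
     {proj_point [x, y, z] | x y z.
        [x, y, z] \<noteq> [0, 0, 0] \<and> y^2 * z = x^3 + A * x * z^2 + B * z^3}"

definition Cstar :: "complex list fspace" where
  "Cstar = subvar (affine_space 1) {[x] | x. x \<noteq> 0}"

text \<open>
  Elliptic curves are given by Weierstrass equations with nonzero discriminant. A normalization is
  unique up to isomorphism, so ``the normalization of \<open>Y\<close> is isomorphic to \<open>N\<close>'' is expressed by
  some \<open>\<nu>\<close> making \<open>N\<close> a normalization of \<open>Y\<close>.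
\<close>

definition elliptic_normalization :: "'a fspace \<Rightarrow> bool" where
  "elliptic_normalization Y \<longleftrightarrow>
     (\<exists>A B \<nu>. 4 * A^3 + 27 * B^2 \<noteq> 0 \<and> is_normalization (weierstrass_curve A B) Y \<nu>)"

definition Cstar_normalization :: "'a fspace \<Rightarrow> bool" where
  "Cstar_normalization Y \<longleftrightarrow> (\<exists>\<nu>. is_normalization Cstar Y \<nu>)"

definition algebraic_hyperbolic :: "'a fspace \<Rightarrow> bool" where
  "algebraic_hyperbolic X \<longleftrightarrow>
     \<not> (\<exists>G. curve_in X G \<and>
          (elliptic_normalization (subvar X G) \<or> Cstar_normalization (subvar X G)))"


section \<open>Divisors and linear systems\<close>

text \<open>
  Weil divisors on a smooth variety are integer-valued functions supported on the prime divisors.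
\<close>

type_synonym 'a divisor = "'a set \<Rightarrow> int"

definition prime_divisor :: "'a fspace \<Rightarrow> 'a set \<Rightarrow> bool" where
  "prime_divisor X Y \<longleftrightarrow> irreducible_closed (zariski X) Y \<and> Y \<subset> points X \<and>
     \<not> (\<exists>Z. irreducible_closed (zariski X) Z \<and> Y \<subset> Z \<and> Z \<subset> points X)"

definition of_prime :: "'a set \<Rightarrow> 'a divisor" where
  "of_prime Y = (\<lambda>Y'. if Y' = Y then 1 else 0)"

text \<open>\<open>t\<close>, regular on \<open>V\<close>, generates the maximal ideal of the local ring of \<open>X\<close> along \<open>Y\<close>.\<close>

definition uniformizer :: "'a fspace \<Rightarrow> 'a set \<Rightarrow> 'a set \<Rightarrow> ('a \<Rightarrow> complex) \<Rightarrow> bool" where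
  "uniformizer X Y V t \<longleftrightarrow>
     openin (zariski X) V \<and> V \<inter> Y \<noteq> {} \<and> regular X V t \<and> (\<forall>y\<in>V \<inter> Y. t y = 0) \<and>
     (\<forall>W g. openin (zariski X) W \<and> W \<inter> Y \<noteq> {} \<and> regular X W g \<and> (\<forall>y\<in>W \<inter> Y. g y = 0) \<longrightarrow>
        (\<exists>W' h. openin (zariski X) W' \<and> W' \<inter> Y \<noteq> {} \<and> W' \<subseteq> V \<inter> W \<and> regular X W' h \<and>
           (\<forall>x\<in>W'. g x = h x * t x)))"

text \<open>
  The rational function represented by \<open>(U, f)\<close> has valuation \<open>k\<close> along \<open>Y\<close>: it is a unit of the
  local ring times the \<open>k\<close>-th power of a uniformizer.
\<close>

definition has_order :: "'a fspace \<Rightarrow> 'a set \<Rightarrow> 'a set \<Rightarrow> ('a \<Rightarrow> complex) \<Rightarrow> int \<Rightarrow> bool" where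
  "has_order X Y U f k \<longleftrightarrow> (\<exists>V t u. uniformizer X Y V t \<and> regular X V u \<and> (\<forall>x\<in>V. u x \<noteq> 0) \<and>
     (\<forall>x\<in>U \<inter> V. t x \<noteq> 0 \<longrightarrow> f x = u x * t x powi k))"

definition has_divisor :: "'a fspace \<Rightarrow> 'a set \<Rightarrow> ('a \<Rightarrow> complex) \<Rightarrow> 'a divisor \<Rightarrow> bool" where
  "has_divisor X U f E \<longleftrightarrow> regular X U f \<and> openin (zariski X) U \<and> (\<exists>x\<in>U. f x \<noteq> 0) \<and>
     (\<forall>Y. if prime_divisor X Y then has_order X Y U f (E Y) else E Y = 0)"

definition linear_system :: "'a fspace \<Rightarrow> 'a divisor \<Rightarrow> 'a divisor set" where
  "linear_system X D = {E. (\<forall>Y. 0 \<le> E Y) \<and> (\<exists>U f. has_divisor X U f (\<lambda>Y. E Y - D Y))}"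

definition div_support :: "'a divisor \<Rightarrow> 'a set" where
  "div_support E = \<Union>{Y. E Y \<noteq> 0}"

text \<open>
  The Zariski topology of the linear system \<open>|D|\<close>, viewed as the projective space of lines in
  \<open>L(D) = {s. s = 0 \<or> div s + D \<ge> 0}\<close>: a subset \<open>Z\<close> of \<open>|D|\<close> is closed iff its affine cone in
  \<open>L(D)\<close> is closed, i.e. iff the preimage of that cone under every linear map
  \<open>c \<mapsto> \<Sum>i<m. c\<^sub>i * s\<^sub>i\<close> from \<open>\<complex>\<^sup>m\<close> to \<open>L(D)\<close> is Zariski closed.
\<close>

definition in_cone ::
    "'a fspace \<Rightarrow> 'a divisor \<Rightarrow> 'a divisor set \<Rightarrow> 'a set \<Rightarrow> ('a \<Rightarrow> complex) \<Rightarrow> bool" where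
  "in_cone X D Z U s \<longleftrightarrow>
     (\<forall>x\<in>U. s x = 0) \<or> (\<exists>E\<in>Z. has_divisor X U s (\<lambda>Y. E Y - D Y))"

definition lin_comb :: "(nat \<Rightarrow> 'a \<Rightarrow> complex) \<Rightarrow> complex list \<Rightarrow> 'a \<Rightarrow> complex" where
  "lin_comb s c x = (\<Sum>i<length c. c ! i * s i x)"

definition closed_in_linear_system :: "'a fspace \<Rightarrow> 'a divisor \<Rightarrow> 'a divisor set \<Rightarrow> bool" where
  "closed_in_linear_system X D Z \<longleftrightarrow> Z \<subseteq> linear_system X D \<and>
     (\<forall>m U s. openin (zariski X) U \<and> U \<noteq> {} \<and> (\<forall>i<m. regular X U (s i)) \<and>
        (\<forall>c. length c = m \<longrightarrow> in_cone X D (linear_system X D) U (lin_comb s c)) \<longrightarrow>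
        closedin (zariski (affine_space m)) {c. length c = m \<and> in_cone X D Z U (lin_comb s c)})"

definition sufficiently_general :: "'a fspace \<Rightarrow> 'a divisor \<Rightarrow> ('a divisor \<Rightarrow> bool) \<Rightarrow> bool" where
  "sufficiently_general X D P \<longleftrightarrow>
     (\<exists>Z :: nat \<Rightarrow> 'a divisor set.
        (\<forall>k. closed_in_linear_system X D (Z k) \<and> Z k \<noteq> linear_system X D) \<and>
        (\<forall>E \<in> linear_system X D - (\<Union>k. Z k). P E))"


section \<open>The rational ruled surfaces\<close>

text \<open>
  The projective bundle of \<open>\<O> \<oplus> \<O>(n)\<close> over the projective line, as the quotient of
  \<open>(\<complex>\<^sup>2 - 0) \<times> (\<complex>\<^sup>2 - 0)\<close> by the two-dimensional torus: \<open>x0, x1\<close> are homogeneous coordinates on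
  the base and \<open>y0\<close>, \<open>y1\<close> are fibre coordinates in the two summands. The functions \<open>y0\<close> and \<open>y1\<close>
  have bidegrees \<open>(0,1)\<close> and \<open>(n,1)\<close>, so \<open>{y1 = 0}\<close> is linearly equivalent to
  \<open>{y0 = 0} + n * fibre\<close> and disjoint from \<open>{y0 = 0}\<close>, which therefore has self-intersection \<open>-n\<close>.
\<close>

definition ruled_point :: "nat \<Rightarrow> complex list \<Rightarrow> complex list set" where
  "ruled_point n z =
     {[\<alpha> * z!0, \<alpha> * z!1, \<beta> * z!2, \<alpha>^n * \<beta> * z!3] | \<alpha> \<beta>. \<alpha> \<noteq> 0 \<and> \<beta> \<noteq> 0}"

definition ruled_coords :: "complex list set" where
  "ruled_coords = {[x0, x1, y0, y1] | x0 x1 y0 y1. (x0, x1) \<noteq> (0, 0) \<and> (y0, y1) \<noteq> (0, 0)}"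

definition ruled_surface :: "nat \<Rightarrow> complex list set fspace" where
  "ruled_surface n = quotient_by (subvar (affine_space 4) ruled_coords) (ruled_point n)"

definition zero_section :: "nat \<Rightarrow> complex list set set" where
  "zero_section n =
     {ruled_point n [x0, x1, y0, y1] | x0 x1 y0 y1. [x0, x1, y0, y1] \<in> ruled_coords \<and> y0 = 0}"

definition fibre :: "nat \<Rightarrow> complex list set \<Rightarrow> complex list set set" where
  "fibre n p =
     {ruled_point n [x0, x1, y0, y1] | x0 x1 y0 y1.
        [x0, x1, y0, y1] \<in> ruled_coords \<and> proj_point [x0, x1] = p}"

end

theory Submission
  imports Defs "HOL-Library.Countable" "HOL-Computational_Algebra.Computational_Algebra"
    "HOL-Computational_Algebra.Field_as_Ring" "HOL-Analysis.Line_Segment"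
begin

text \<open>
  In torus coordinates the members of \<open>|aC+bF|\<close> are the zero loci of polynomials \<open>P\<close> of bidegree \<open>(a,b)\<close>.
  A map from \<open>\<complex>\<^sup>*\<close> to the complement of \<open>{P = 0}\<close> lifts to a quadruple \<open>\<gamma>\<close> of polynomials in \<open>t\<close>
  with \<open>P(\<gamma>) = c t^m\<close>. If the coefficients of \<open>P\<close> satisfy no nontrivial algebraic relation over the
  rationals, then for every \<open>Q\<close> of the same bidegree some derivation of \<open>\<complex>\<close> moves \<open>P\<close> in the direction \<open>Q\<close>,
  and applied to \<open>P(\<gamma>)\<close> it gives a vector field \<open>\<xi>\<close> along \<open>\<gamma>\<close> such that \<open>Q(\<gamma>) + dP(\<xi>)\<close> is a multiple of
  \<open>t^m\<close>. Let \<open>\<nu>\<^sub>Q\<close> be the determinant of \<open>\<xi>\<close>, \<open>t d\<gamma>/dt\<close> and the two torus directions. As the logarithmic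
  canonical bundle of the complement is positive enough (this is where the bounds on \<open>a\<close> and \<open>b\<close> enter), linear
  relations \<open>g Q = g' Q'\<close> of low degree force \<open>g \<nu>\<^sub>Q = g' \<nu>\<^sub>Q'\<close>. Chains of such relations between monomials show that
  the monomial \<open>Q(\<gamma>)\<close> divides \<open>\<nu>\<^sub>Q\<close>, which therefore vanishes for degree reasons; then the Wronskians of
  \<open>\<gamma>\<close> vanish too, and \<open>\<gamma>\<close> is constant up to the torus.

  On a Weierstrass curve every regular function is constant, because it is bounded. Applied to the quotients
  \<open>Q / P\<close> of sections this excludes maps from elliptic curves.
\<close>

section \<open>Derivations and generic points\<close>

text \<open>The usual argument spreads a curve out over the parameter space of divisors and
  differentiates there. Here a derivation of the complex numbers plays the part of the parameter:
  applied to the coefficients of \<open>P\<close> and of the curve, it differentiates the identity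
  directly, and no family has to be constructed. There is one exceptional closed set for each
  integer polynomial, so they are countable; smoothness of the divisor comes from the same
  derivations. The obstacle is contact of unknown order at 0 and infinity. By Euler's relations the
  torus directions, like \<open>t d/dt\<close>, change \<open>P\<close> by multiples of
  \<open>t^m\<close>; so in Cramer's rule all uncontrolled terms carry the factor
  \<open>t^m\<close>, and smoothness over 0 and infinity allows it to be divided out. With
  \<open>d\<close> and \<open>e\<close> the degrees of the curve against \<open>F\<close> and
  \<open>C\<close>, the anticanonical degree is \<open>2e + (n+2)d\<close>. Relations between
  neighbouring monomials have the degrees of \<open>F\<close> and \<open>C + nF\<close>, and the log
  canonical degree must exceed both: for a fibre this reads \<open>a > 3\<close>, for a curve
  disjoint from \<open>C\<close> it needs \<open>b > n + 3\<close>, and for \<open>C\<close> itself,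
  if \<open>n > 0\<close>, it follows from \<open>b \<ge> a n + 3\<close>.\<close>

definition derivation_graph :: "('a :: comm_ring_1 \<times> 'a) set \<Rightarrow> bool" where
  "derivation_graph S \<longleftrightarrow> (1, 0) \<in> S \<and> (\<forall>w. (0, w) \<in> S \<longrightarrow> w = 0) \<and>
     (\<forall>x x' y y'. (x, x') \<in> S \<longrightarrow> (y, y') \<in> S \<longrightarrow>
        (x - y, x' - y') \<in> S \<and> (x * y, x * y' + x' * y) \<in> S)"

text \<open>Derivations are handled as graphs over a subring, so that extensions are ordered by
  inclusion. Single-valuedness, the last item, comes from the condition on \<open>(0, w)\<close> by
  subtracting two pairs.\<close>

lemma derivation_graphD:
  assumes "derivation_graph S"
  shows "(1, 0) \<in> S" "(0, 0) \<in> S" "(0, w) \<in> S \<Longrightarrow> w = 0"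
    "(x, x') \<in> S \<Longrightarrow> (y, y') \<in> S \<Longrightarrow> (x - y, x' - y') \<in> S"
    "(x, x') \<in> S \<Longrightarrow> (y, y') \<in> S \<Longrightarrow> (x + y, x' + y') \<in> S"
    "(x, x') \<in> S \<Longrightarrow> (y, y') \<in> S \<Longrightarrow> (x * y, x * y' + x' * y) \<in> S"
    "(x, x') \<in> S \<Longrightarrow> (x, x'') \<in> S \<Longrightarrow> x' = x''"
proof -
  show *: "(1, 0) \<in> S" "(0, w) \<in> S \<Longrightarrow> w = 0"
    "(x, x') \<in> S \<Longrightarrow> (y, y') \<in> S \<Longrightarrow> (x * y, x * y' + x' * y) \<in> S" for w x x' y y'
    using assms unfolding derivation_graph_def by blast+
  show m: "(x, x') \<in> S \<Longrightarrow> (y, y') \<in> S \<Longrightarrow> (x - y, x' - y') \<in> S" for x x' y y'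
    using assms unfolding derivation_graph_def by blast
  show z: "(0, 0) \<in> S" using m[OF *(1) *(1)] by simp
  show "(x, x') \<in> S \<Longrightarrow> (y, y') \<in> S \<Longrightarrow> (x + y, x' + y') \<in> S"
    using m[OF _ m[OF z]] by force
  show "(x, x') \<in> S \<Longrightarrow> (x, x'') \<in> S \<Longrightarrow> x' = x''"
    using m[of x x' x x''] *(2) by force
qed

lemma derivation_graph_sum:
  assumes "derivation_graph S" "\<And>i. i \<in> A \<Longrightarrow> (f i, g i) \<in> S"
  shows "(sum f A, sum g A) \<in> S"
  using assms(2)
  by (induction A rule: infinite_finite_induct) (auto intro: derivation_graphD[OF assms(1)])

lemma derivation_graph_of_nat:
  assumes "derivation_graph S"
  shows "(of_nat k, 0) \<in> S"
  using derivation_graph_sum[OF assms, of "{..<k}" "\<lambda>_. 1" "\<lambda>_. 0"] derivation_graphD(1)[OF assms]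
  by simp

definition poly_graph :: "('a :: comm_ring_1 \<times> 'a) set \<Rightarrow> ('a poly \<times> 'a poly) set" where
  "poly_graph S = {(g, h). \<forall>i. (coeff g i, coeff h i) \<in> S}"

text \<open>Once \<open>z\<close> is sent to \<open>\<zeta>\<close>, the chain rule prescribes the
  derivation on all polynomials in \<open>z\<close>; it is well defined iff every relation satisfied
  by \<open>z\<close> is respected. A relation of least degree determines \<open>\<zeta>\<close>,
  and division with remainder carries the property over to all others; if there is no relation, 0
  will do.\<close>

lemma derivation_graph_extend:
  fixes S :: "('a :: field_char_0 \<times> 'a) set"
  assumes S: "derivation_graph S"
  obtains S' \<zeta> where "derivation_graph S'" "S \<subseteq> S'" "(z, \<zeta>) \<in> S'"
proof -
  note SD = derivation_graphD[OF S]
  define SP where "SP = poly_graph S"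
  have SP_mult: "(g1 * g2, g1 * h2 + h1 * g2) \<in> SP" if "(g1, h1) \<in> SP" "(g2, h2) \<in> SP" for g1 h1 g2 h2
  proof -
    have "(coeff (g1 * g2) i, coeff (g1 * h2 + h1 * g2) i) \<in> S" for i
    proof -
      have "((\<Sum>j\<le>i. coeff g1 j * coeff g2 (i - j)),
          (\<Sum>j\<le>i. coeff g1 j * coeff h2 (i - j) + coeff h1 j * coeff g2 (i - j))) \<in> S"
        by (rule derivation_graph_sum[OF S]) (use that SD(6) in \<open>auto simp: SP_def poly_graph_def\<close>)
      then show ?thesis by (simp add: coeff_mult sum.distrib)
    qed
    then show ?thesis by (auto simp: SP_def poly_graph_def)
  qed
  have SP_diff: "(g1 - g2, h1 - h2) \<in> SP" if "(g1, h1) \<in> SP" "(g2, h2) \<in> SP" for g1 h1 g2 h2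
    using that SD(4) by (auto simp: SP_def poly_graph_def)
  have SP_monom: "(monom c k, monom c' k) \<in> SP" if "(c, c') \<in> S" for c c' k
    using that SD(2) by (auto simp: SP_def poly_graph_def)
  have SP_pderiv: "(pderiv g, pderiv h) \<in> SP" if "(g, h) \<in> SP" for g h
  proof -
    have "(of_nat (Suc i) * coeff g (Suc i), of_nat (Suc i) * coeff h (Suc i)) \<in> S" for i
      using SD(6)[OF derivation_graph_of_nat[OF S, of "Suc i"], of "coeff g (Suc i)" "coeff h (Suc i)"] that
      by (auto simp: SP_def poly_graph_def)
    then show ?thesis by (auto simp: SP_def poly_graph_def coeff_pderiv)
  qed
  have SP_0: "h = 0" if "(0, h) \<in> SP" for h
    using that SD(3) by (auto simp: SP_def poly_graph_def poly_eq_iff)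
  define L where "L \<zeta> g h = poly h z + poly (pderiv g) z * \<zeta>" for \<zeta> and g h :: "'a poly"
  have L_mult: "L \<zeta> (g1 * g2) (g1 * h2 + h1 * g2) = poly g1 z * L \<zeta> g2 h2 + L \<zeta> g1 h1 * poly g2 z"
    for \<zeta> g1 g2 h1 h2 by (simp add: L_def pderiv_mult algebra_simps)
  have L_diff: "L \<zeta> (g1 - g2) (h1 - h2) = L \<zeta> g1 h1 - L \<zeta> g2 h2" for \<zeta> g1 g2 h1 h2
    by (simp add: L_def pderiv_diff algebra_simps)
  have "\<exists>\<zeta>. \<forall>g h. (g, h) \<in> SP \<longrightarrow> poly g z = 0 \<longrightarrow> L \<zeta> g h = 0"
  proof (cases "\<exists>g h. (g, h) \<in> SP \<and> g \<noteq> 0 \<and> poly g z = 0")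
    case False
    then have "L 0 g h = 0" if "(g, h) \<in> SP" "poly g z = 0" for g h
      using that SP_0[of h] by (auto simp: L_def)
    then show ?thesis by blast
  next
    case True
    define Q where "Q d \<longleftrightarrow> (\<exists>g h. (g, h) \<in> SP \<and> g \<noteq> 0 \<and> poly g z = 0 \<and> degree g = d)" for d
    have "\<exists>d. Q d" using True by (auto simp: Q_def)
    then obtain d where d: "Q d" "\<And>d'. d' < d \<Longrightarrow> \<not> Q d'"
      by (metis LeastI not_less_Least)
    then obtain f k where f: "(f, k) \<in> SP" "f \<noteq> 0" "poly f z = 0" "degree f = d"
      by (auto simp: Q_def)
    have fpos: "degree f > 0"
    proof (rule ccontr)
      assume "\<not> degree f > 0"
      then obtain c where "f = [:c:]" using degree_eq_zeroE by blast
      then show False using f by simp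
    qed
    \<comment> \<open>Characteristic 0: \<open>pderiv f\<close> is nonzero of smaller degree and
      again has coefficients in the domain of \<open>S\<close>, so by minimality \<open>z\<close> is
      a simple root of \<open>f\<close> and \<open>\<zeta>\<close> can be solved for.\<close>
    have df: "poly (pderiv f) z \<noteq> 0"
    proof
      assume "poly (pderiv f) z = 0"
      moreover have "pderiv f \<noteq> 0" using fpos by (simp add: pderiv_eq_0_iff)
      ultimately have "Q (degree (pderiv f))" using SP_pderiv[OF f(1)] by (auto simp: Q_def)
      then show False using d(2) fpos f(4) by (simp add: degree_pderiv)
    qed
    define \<zeta> where "\<zeta> = - poly k z / poly (pderiv f) z"
    have Lf: "L \<zeta> f k = 0" using df by (simp add: L_def \<zeta>_def)
    have "L \<zeta> g h = 0" if "(g, h) \<in> SP" "poly g z = 0" for g h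
      using that
    proof (induction "degree g" arbitrary: g h rule: less_induct)
      case less
      show ?case
      proof (cases "g = 0")
        case True
        moreover have "h = 0" using SP_0 less.prems(1) True by blast
        ultimately show ?thesis by (simp add: L_def)
      next
        case False
        then have dg: "degree g \<ge> d" using d(2)[of "degree g"] less.prems by (auto simp: Q_def not_less[symmetric])
        define c where "c = lead_coeff f"
        define c' where "c' = coeff k (degree f)"
        define e where "e = lead_coeff g"
        define e' where "e' = coeff h (degree g)"
        have cc: "(c, c') \<in> S" "(e, e') \<in> S" using f(1) less.prems
          by (auto simp: SP_def poly_graph_def c_def c'_def e_def e'_def)
        define m m' where "m = monom e (degree g - d)" and "m' = monom e' (degree g - d)"
        have cM: "(monom c 0, monom c' 0) \<in> SP" and mM: "(m, m') \<in> SP"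
          using cc SP_monom by (auto simp: m_def m'_def)
        \<comment> \<open>The coefficients form only a ring, so \<open>g\<close> is multiplied by
          the leading coefficient of \<open>f\<close> before its top term is cancelled.\<close>
        let ?g = "monom c 0 * g - m * f" and ?h = "(monom c 0 * h + monom c' 0 * g) - (m * k + m' * f)"
        have SP': "(?g, ?h) \<in> SP" by (intro SP_diff SP_mult cM mM less.prems f)
        have LL: "L \<zeta> ?g ?h = c * L \<zeta> g h"
          unfolding L_diff L_mult Lf using f(3) less.prems(2) by (simp add: poly_monom)
        have pz: "poly ?g z = 0" using f(3) less.prems(2) by simp
        have "L \<zeta> ?g ?h = 0"
        proof (cases "?g = 0")
          case True
          then have "?h = 0" using SP' SP_0 by metis
          then show ?thesis using True by (simp only: L_def) simp
        next
          case False
          have "degree ?g \<le> degree g"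
          proof (rule degree_diff_le)
            show "degree (monom c 0 * g) \<le> degree g"
              using degree_mult_le[of "monom c 0" g] degree_monom_le[of c 0] by linarith
            show "degree (m * f) \<le> degree g"
              using degree_mult_le[of m f] degree_monom_le[of e "degree g - d"] dg f(4)
              by (simp add: m_def)
          qed
          moreover have "coeff ?g (degree g) = 0"
          proof -
            have "coeff (m * f) (degree g) = e * coeff f (degree g - (degree g - d))"
              unfolding m_def using coeff_monom_mult[of e "degree g - d" f "degree g"] by simp
            also have "\<dots> = e * c" using dg f(4) by (simp add: c_def)
            finally show ?thesis by (simp add: coeff_monom_mult e_def)
          qed
          ultimately have "degree ?g < degree g" using False
            by (metis le_neq_implies_less leading_coeff_0_iff)
          then show ?thesis using less.hyps SP' pz by blast
        qed
        then show ?thesis using LL f(2) by (simp add: c_def)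
      qed
    qed
    then show ?thesis by blast
  qed
  then obtain \<zeta> where \<zeta>: "\<And>g h. (g, h) \<in> SP \<Longrightarrow> poly g z = 0 \<Longrightarrow> L \<zeta> g h = 0" by blast
  define S' where "S' = {(poly g z, L \<zeta> g h) | g h. (g, h) \<in> SP}"
  have const: "(c, c') \<in> S'" if "(c, c') \<in> S" for c c'
    using SP_monom[OF that, of 0] unfolding S'_def
    by (intro CollectI exI[of _ "monom c 0"] exI[of _ "monom c' 0"]) (simp add: poly_monom L_def pderiv_monom)
  have "derivation_graph S'"
    unfolding derivation_graph_def
  proof (intro conjI allI impI)
    show "(1, 0) \<in> S'" using const SD(1) by blast
    show "w = 0" if "(0, w) \<in> S'" for w using that \<zeta> by (auto simp: S'_def)
    fix x x' y y' assume "(x, x') \<in> S'" "(y, y') \<in> S'"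
    then obtain g1 h1 g2 h2 where *: "(g1, h1) \<in> SP" "(g2, h2) \<in> SP" "x = poly g1 z" "y = poly g2 z"
      "x' = L \<zeta> g1 h1" "y' = L \<zeta> g2 h2" by (auto simp: S'_def)
    show "(x - y, x' - y') \<in> S'" using SP_diff[OF *(1,2)] unfolding S'_def *
      by (intro CollectI exI[of _ "g1 - g2"] exI[of _ "h1 - h2"]) (simp add: L_diff)
    show "(x * y, x * y' + x' * y) \<in> S'" using SP_mult[OF *(1,2)] unfolding S'_def *
      by (intro CollectI exI[of _ "g1 * g2"] exI[of _ "g1 * h2 + h1 * g2"]) (simp add: L_mult)
  qed
  moreover have "(z, \<zeta>) \<in> S'"
    using SP_monom[OF SD(1), of 1] unfolding S'_def
    by (intro CollectI exI[of _ "monom 1 1"] exI[of _ 0]) (simp add: poly_monom L_def pderiv_monom)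
  moreover have "S \<subseteq> S'" using const by auto
  ultimately show thesis by (intro that)
qed

text \<open>By \<open>derivation_graph_extend\<close>, an extension of \<open>S\<close> that is
  maximal under inclusion is defined everywhere; Zorn's lemma provides one.\<close>

lemma derivation_exists:
  fixes S :: "('a :: field_char_0 \<times> 'a) set"
  assumes "derivation_graph S"
  obtains \<delta> :: "'a \<Rightarrow> 'a" where "\<And>x y. \<delta> (x + y) = \<delta> x + \<delta> y" "\<And>x y. \<delta> (x * y) = x * \<delta> y + \<delta> x * y"
    "\<And>x x'. (x, x') \<in> S \<Longrightarrow> \<delta> x = x'"
proof -
  let ?A = "{S'. derivation_graph S' \<and> S \<subseteq> S'}"
  have "\<exists>M\<in>?A. \<forall>X\<in>?A. M \<subseteq> X \<longrightarrow> X = M"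
  proof (rule subset_Zorn_nonempty)
    show "?A \<noteq> {}" using assms by blast
    fix C assume C: "C \<noteq> {}" "subset.chain ?A C"
    have CA: "derivation_graph T" "S \<subseteq> T" if "T \<in> C" for T
      using C(2) that by (auto simp: subset_chain_def)
    have two: "\<exists>T\<in>C. p \<in> T \<and> q \<in> T" if pq: "p \<in> \<Union>C" "q \<in> \<Union>C" for p q
    proof -
      from pq obtain T1 T2 where T: "T1 \<in> C" "T2 \<in> C" "p \<in> T1" "q \<in> T2" by blast
      then have "T1 \<subseteq> T2 \<or> T2 \<subseteq> T1" using C(2) by (auto simp: subset_chain_def)
      then show ?thesis using T by blast
    qed
    have "derivation_graph (\<Union>C)"
      unfolding derivation_graph_def
    proof (intro conjI allI impI)
      show "(1, 0) \<in> \<Union>C" using C(1) CA derivation_graphD(1) by blast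
      show "w = 0" if "(0, w) \<in> \<Union>C" for w using that CA derivation_graphD(3) by blast
      fix x x' y y' assume "(x, x') \<in> \<Union>C" "(y, y') \<in> \<Union>C"
      then obtain T where T: "T \<in> C" "(x, x') \<in> T" "(y, y') \<in> T" using two by blast
      show "(x - y, x' - y') \<in> \<Union>C" using T derivation_graphD(4)[OF CA(1)[OF T(1)]] by blast
      show "(x * y, x * y' + x' * y) \<in> \<Union>C" using T derivation_graphD(6)[OF CA(1)[OF T(1)]] by blast
    qed
    then show "\<Union>C \<in> ?A" using C(1) CA(2) by blast
  qed
  then obtain M where M: "derivation_graph M" "S \<subseteq> M"
    "\<And>X. derivation_graph X \<Longrightarrow> M \<subseteq> X \<Longrightarrow> X = M" by auto
  have "\<exists>\<zeta>. (z, \<zeta>) \<in> M" for z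
    using derivation_graph_extend[OF M(1), of z] M(3) by metis
  then obtain \<delta> where \<delta>: "\<And>z. (z, \<delta> z) \<in> M" by metis
  note MD = derivation_graphD[OF M(1)]
  show thesis
  proof (rule that[of \<delta>])
    show "\<delta> (x + y) = \<delta> x + \<delta> y" for x y using MD(5,7) \<delta> by blast
    show "\<delta> (x * y) = x * \<delta> y + \<delta> x * y" for x y using MD(6,7) \<delta> by blast
    show "\<delta> x = x'" if "(x, x') \<in> S" for x x' using that M(2) MD(7) \<delta> by blast
  qed
qed

text \<open>Integer polynomials as syntax: there are countably many, and each gives a closed set to be removed
  from the linear system.\<close>

datatype pexp = Const int | Var nat nat | Add pexp pexp | Mul pexp pexp

instance pexp :: countable by countable_datatype

primrec eval_pexp :: "pexp \<Rightarrow> (nat \<Rightarrow> nat \<Rightarrow> 'a :: comm_ring_1) \<Rightarrow> 'a" where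
  "eval_pexp (Const c) r = of_int c"
| "eval_pexp (Var i j) r = r i j"
| "eval_pexp (Add e f) r = eval_pexp e r + eval_pexp f r"
| "eval_pexp (Mul e f) r = eval_pexp e r * eval_pexp f r"

primrec deriv_pexp :: "pexp \<Rightarrow> (nat \<Rightarrow> nat \<Rightarrow> 'a :: comm_ring_1) \<Rightarrow> (nat \<Rightarrow> nat \<Rightarrow> 'a) \<Rightarrow> 'a" where
  "deriv_pexp (Const c) r q = 0"
| "deriv_pexp (Var i j) r q = q i j"
| "deriv_pexp (Add e f) r q = deriv_pexp e r q + deriv_pexp f r q"
| "deriv_pexp (Mul e f) r q = eval_pexp e r * deriv_pexp f r q + deriv_pexp e r q * eval_pexp f r"

lemma poly_eval_pexp_line:
  "poly (eval_pexp e (\<lambda>i j. [:r i j, q i j:])) s = eval_pexp e (\<lambda>i j. r i j + s * q i j)"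
  by (induction e) auto

lemma coeff_eval_pexp_line:
  "coeff (eval_pexp e (\<lambda>i j. [:r i j, q i j:])) 0 = eval_pexp e r"
  "coeff (eval_pexp e (\<lambda>i j. [:r i j, q i j:])) 1 = deriv_pexp e r q"
proof -
  show 0: "coeff (eval_pexp e (\<lambda>i j. [:r i j, q i j:])) 0 = eval_pexp e r" for e
    by (induction e) (auto simp: coeff_mult of_int_poly)
  show "coeff (eval_pexp e (\<lambda>i j. [:r i j, q i j:])) 1 = deriv_pexp e r q"
    by (induction e) (auto simp: coeff_mult 0[simplified] of_int_poly)
qed

text \<open>\<open>r\<close> is a generic point of \<open>V\<close>, a variety defined over the rationals.\<close>

definition generic_in :: "(nat \<Rightarrow> nat \<Rightarrow> 'a :: comm_ring_1) set \<Rightarrow> (nat \<Rightarrow> nat \<Rightarrow> 'a) \<Rightarrow> bool" where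
  "generic_in V r \<longleftrightarrow> r \<in> V \<and> (\<forall>e. eval_pexp e r = 0 \<longrightarrow> (\<forall>r'\<in>V. eval_pexp e r' = 0))"

text \<open>On the subring of values at \<open>r\<close>, each \<open>eval_pexp e r\<close> is sent
  to the slope of \<open>e\<close> along the line through \<open>r\<close> in direction
  \<open>q\<close>. This is well defined because a relation that holds at the generic point holds on
  the whole line, where its slope is 0.\<close>

lemma generic_derivation:
  fixes r q :: "nat \<Rightarrow> nat \<Rightarrow> 'a :: field_char_0"
  assumes "generic_in V r" and V: "\<And>s. (\<lambda>i j. r i j + s * q i j) \<in> V"
  obtains \<delta> :: "'a \<Rightarrow> 'a" where "\<And>x y. \<delta> (x + y) = \<delta> x + \<delta> y" "\<And>x y. \<delta> (x * y) = x * \<delta> y + \<delta> x * y"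
    "\<And>i j. \<delta> (r i j) = q i j"
proof -
  let ?S = "{(eval_pexp e r, deriv_pexp e r q) | e. True}"
  have "derivation_graph ?S"
    unfolding derivation_graph_def
  proof (intro conjI allI impI)
    show "(1, 0) \<in> ?S" by (intro CollectI exI[of _ "Const 1"]) simp
    show "w = 0" if "(0, w) \<in> ?S" for w
    proof -
      from that obtain e where e: "eval_pexp e r = 0" "w = deriv_pexp e r q" by auto
      have "poly (eval_pexp e (\<lambda>i j. [:r i j, q i j:])) s = 0" for s
        unfolding poly_eval_pexp_line using assms e by (auto simp: generic_in_def)
      then have "eval_pexp e (\<lambda>i j. [:r i j, q i j:]) = 0" using poly_all_0_iff_0 by blast
      then show ?thesis using coeff_eval_pexp_line(2)[of e r q] e(2) by simp
    qed
    fix x x' y y' assume "(x, x') \<in> ?S" "(y, y') \<in> ?S"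
    then obtain e f where *: "x = eval_pexp e r" "x' = deriv_pexp e r q" "y = eval_pexp f r" "y' = deriv_pexp f r q"
      by auto
    show "(x - y, x' - y') \<in> ?S"
      by (intro CollectI exI[of _ "Add e (Mul (Const (-1)) f)"]) (simp add: *)
    show "(x * y, x * y' + x' * y) \<in> ?S"
      by (intro CollectI exI[of _ "Mul e f"]) (simp add: *)
  qed
  then obtain \<delta> where \<delta>: "\<And>x y. \<delta> (x + y) = \<delta> x + \<delta> y" "\<And>x y. \<delta> (x * y) = x * \<delta> y + \<delta> x * y"
    "\<And>x x'. (x, x') \<in> ?S \<Longrightarrow> \<delta> x = x'"
    by (rule derivation_exists) blast
  have "\<delta> (r i j) = q i j" for i j
    by (rule \<delta>(3)) (auto intro!: exI[of _ "Var i j"])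
  then show thesis using that \<delta> by blast
qed

section \<open>Polynomial sections on the projective line\<close>

text \<open>\<open>degb f k\<close>: \<open>f\<close> is a section of \<open>\<O>(k)\<close> on the projective line, where \<open>k\<close> may be negative;
  \<open>lcoef f k\<close> is then its value at infinity.\<close>

definition degb :: "'a :: comm_ring_1 poly \<Rightarrow> int \<Rightarrow> bool" where
  "degb f k \<longleftrightarrow> (\<forall>i. k < int i \<longrightarrow> coeff f i = 0)"

definition lcoef :: "'a :: comm_ring_1 poly \<Rightarrow> int \<Rightarrow> 'a" where
  "lcoef f k = (if k < 0 then 0 else coeff f (nat k))"

lemma degb_0 [simp]: "degb 0 k" by (simp add: degb_def)
lemma degb_const: "degb [:c:] 0" by (auto simp: degb_def coeff_pCons split: nat.split)
lemma degb_1: "degb 1 0" using degb_const[of 1] by (simp add: one_pCons)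
lemma degb_of_nat: "degb (of_nat c) 0" using degb_const[of "of_nat c"] by (simp add: of_nat_poly)
lemma degb_add: "degb f k \<Longrightarrow> degb g k \<Longrightarrow> degb (f + g) k" by (simp add: degb_def)
lemma degb_minus: "degb f k \<Longrightarrow> degb (- f) k" by (simp add: degb_def)
lemma degb_diff: "degb f k \<Longrightarrow> degb g k \<Longrightarrow> degb (f - g) k" by (simp add: degb_def)
lemma degb_mono: "degb f k \<Longrightarrow> k \<le> l \<Longrightarrow> degb f l" by (simp add: degb_def)
lemma degb_sum: "(\<And>i. i \<in> A \<Longrightarrow> degb (f i) k) \<Longrightarrow> degb (sum f A) k"
  by (induction A rule: infinite_finite_induct) (auto intro: degb_add)
lemma degb_neg: "degb f k \<Longrightarrow> k < 0 \<Longrightarrow> f = 0" by (auto simp: degb_def poly_eq_iff)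
lemma degb_degree: "degb f (int (degree f))" by (simp add: degb_def coeff_eq_0)

lemma degb_mult:
  assumes "degb f j" "degb g k" shows "degb (f * g) (j + k)"
  unfolding degb_def
proof (intro allI impI)
  fix i assume i: "j + k < int i"
  have "coeff f p * coeff g (i - p) = 0" if "p \<le> i" for p
  proof -
    have "j < int p \<or> k < int (i - p)" using i that by linarith
    then show ?thesis using assms by (auto simp: degb_def)
  qed
  then show "coeff (f * g) i = 0" by (simp add: coeff_mult)
qed

lemma degb_power: "degb f k \<Longrightarrow> degb (f ^ m) (int m * k)"
  by (induction m) (auto simp: degb_1 algebra_simps intro: degb_mult)

lemma lcoef_0 [simp]: "lcoef 0 k = 0" by (simp add: lcoef_def)
lemma lcoef_const: "lcoef [:c:] 0 = c" by (simp add: lcoef_def)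
lemma lcoef_1: "lcoef 1 0 = 1" by (simp add: lcoef_def)
lemma lcoef_of_nat: "lcoef (of_nat c) 0 = of_nat c" by (simp add: lcoef_def of_nat_poly)
lemma lcoef_sum: "lcoef (sum f A) k = (\<Sum>i\<in>A. lcoef (f i) k)" by (simp add: lcoef_def coeff_sum)

lemma lcoef_mult:
  assumes "degb f j" "degb g k" shows "lcoef (f * g) (j + k) = lcoef f j * lcoef g k"
proof (cases "j < 0 \<or> k < 0")
  case True
  then have "f = 0 \<or> g = 0" using degb_neg assms by blast
  then show ?thesis by auto
next
  case False
  have "coeff f p * coeff g (nat (j + k) - p) = (if p = nat j then coeff f (nat j) * coeff g (nat k) else 0)"
    if "p \<le> nat (j + k)" for p
  proof -
    consider "p = nat j" | "j < int p" | "k < int (nat (j + k) - p)" using False that by linarith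
    then show ?thesis using assms False by cases (auto simp: degb_def nat_add_distrib)
  qed
  then have "coeff (f * g) (nat (j + k)) = (\<Sum>p\<le>nat (j + k). if p = nat j then coeff f (nat j) * coeff g (nat k) else 0)"
    unfolding coeff_mult by (intro sum.cong) auto
  also have "\<dots> = coeff f (nat j) * coeff g (nat k)" using False by (auto simp: sum.delta)
  finally show ?thesis using False by (simp add: lcoef_def)
qed

lemma lcoef_power: "degb f k \<Longrightarrow> lcoef (f ^ m) (int m * k) = lcoef f k ^ m"
proof (induction m)
  case (Suc m)
  then show ?case using lcoef_mult[of f k "f ^ m" "int m * k"] degb_power[of f k m] by (simp add: algebra_simps)
qed (simp add: lcoef_1)

lemma degree_of_lcoef:
  assumes "degb f k" "lcoef f k \<noteq> 0" shows "int (degree f) = k" "f \<noteq> 0"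
proof -
  show "f \<noteq> 0" using assms by auto
  have k: "k \<ge> 0" "coeff f (nat k) \<noteq> 0" using assms by (auto simp: lcoef_def split: if_splits)
  have "degree f \<le> nat k" using assms(1) k by (intro degree_le) (auto simp: degb_def)
  then show "int (degree f) = k" using le_degree[OF k(2)] k(1) by linarith
qed

lemma degb_iff_degree: "f \<noteq> 0 \<Longrightarrow> degb f k \<longleftrightarrow> int (degree f) \<le> k"
proof
  assume "f \<noteq> 0" "degb f k"
  then show "int (degree f) \<le> k" 
    unfolding degb_def by (meson leading_coeff_0_iff not_le)
next
  assume "int (degree f) \<le> k" then show "degb f k" using degb_mono degb_degree by blast
qed

text \<open>A section that does not vanish at infinity has exact degree \<open>k\<close>, so it can
  be divided out of a degree bound. At 0 the same role is played by
  \<open>coprime_mult_monom_dvd\<close>.\<close>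

lemma degb_cancel:
  fixes f g :: "'a :: idom poly"
  assumes "degb (f * g) m" "degb f k" "lcoef f k \<noteq> 0" shows "degb g (m - k)"
proof (cases "g = 0")
  case False
  have "f \<noteq> 0" "int (degree f) = k" using degree_of_lcoef[OF assms(2,3)] by auto
  then show ?thesis using assms(1) False by (simp add: degb_iff_degree degree_mult_eq)
qed simp

lemma dvd_of_dvd_mult_coprime:
  fixes u v w k :: "'a :: factorial_ring_gcd"
  assumes "k dvd u * w" "k dvd v * w" "coprime u v" shows "k dvd w"
proof -
  have "k dvd gcd (w * u) (w * v)" using assms by (simp add: mult.commute)
  then show ?thesis using assms(3)
    by (simp add: gcd_mult_left coprime_iff_gcd_eq_1)
qed

lemma coprime_poly_no_common_root:
  fixes f g :: "'a :: field poly"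
  assumes "coprime f g" shows "poly f z \<noteq> 0 \<or> poly g z \<noteq> 0"
proof (rule ccontr)
  assume "\<not> ?thesis"
  then have "[:-z, 1:] dvd f" "[:-z, 1:] dvd g" by (auto simp: poly_eq_0_iff_dvd)
  then have "is_unit [:-z, 1:]" using assms coprime_common_divisor by blast
  then show False by (simp add: is_unit_poly_iff)
qed

lemma coprime_monom_poly:
  fixes f :: "complex poly"
  assumes "poly f 0 \<noteq> 0" shows "coprime (monom 1 m) f"
proof -
  have "coprime [:0, 1:] f"
  proof (rule coprimeI)
    fix c assume c: "c dvd [:0, 1:]" "c dvd f"
    have "is_unit c \<or> [:0, 1:] dvd c"
      using irreducibleD'[OF irreducible_linear_field_poly[of 1 "0::complex", OF one_neq_zero] c(1)] by blast
    moreover have "\<not> [:0, 1:] dvd c"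
    proof
      assume "[:0, 1:] dvd c"
      then have "[:0, 1:] dvd f" using c(2) dvd_trans by blast
      then show False using assms poly_eq_0_iff_dvd[of f 0] by simp
    qed
    ultimately show "is_unit c" by blast
  qed
  moreover have "monom 1 m = ([:0, 1:] :: complex poly) ^ m" by (simp add: monom_altdef)
  ultimately show ?thesis by (simp only: coprime_power_left_iff simp_thms)
qed

text \<open>Coprimality makes \<open>f\<close> divide \<open>pderiv f\<close>, which in
  characteristic 0 is impossible by degrees for nonconstant \<open>f\<close>.\<close>

lemma wronskian_zero_imp_const:
  fixes f g :: "complex poly"
  assumes "coprime f g" "pderiv f * g = f * pderiv g" shows "degree f = 0" "degree g = 0"
proof -
  have *: "degree f = 0" if "coprime f g" "pderiv f * g = f * pderiv g" for f g :: "complex poly"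
  proof -
    have "f dvd pderiv f * g" using that(2) by simp
    then have d: "f dvd pderiv f" using coprime_dvd_mult_left_iff[OF that(1), of "pderiv f"] by simp
    show ?thesis
    proof (rule ccontr)
      assume "degree f \<noteq> 0"
      then show False using not_dvd_pderiv[of f] d by simp
    qed
  qed
  show "degree f = 0" using * assms by blast
  show "degree g = 0" using *[of g f] assms by (simp add: coprime_commute mult.commute)
qed

locale derivation =
  fixes D :: "'a :: comm_ring_1 \<Rightarrow> 'a"
  assumes add: "D (x + y) = D x + D y" and mult: "D (x * y) = x * D y + D x * y"
begin

lemma zero: "D 0 = 0" using add[of 0 0] by simp
lemma sum: "D (sum f A) = (\<Sum>i\<in>A. D (f i))"
  by (induction A rule: infinite_finite_induct) (auto simp: zero add)
lemma one: "D 1 = 0" using mult[of 1 1] by simp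
lemma power: "D (x ^ k) = of_nat k * x ^ (k - 1) * D x"
proof (induction k)
  case (Suc k)
  have *: "x * x ^ (k - Suc 0) * of_nat k = of_nat k * x ^ k" by (cases k) (simp_all add: mult_ac)
  have "D (x ^ Suc k) = (x * x ^ (k - Suc 0) * of_nat k) * D x + D x * x ^ k"
    by (simp add: mult Suc mult_ac)
  then show ?case unfolding * by (simp add: algebra_simps)
qed (simp add: one)

lemma map_poly: "derivation (map_poly D)"
proof
  fix x y :: "'a poly"
  show "map_poly D (x + y) = map_poly D x + map_poly D y"
    by (intro poly_eqI) (simp add: coeff_map_poly zero add)
  show "map_poly D (x * y) = x * map_poly D y + map_poly D x * y"
    by (intro poly_eqI) (simp add: coeff_map_poly zero coeff_mult sum mult sum.distrib)
qed

end

section \<open>Bihomogeneous polynomials on the ruled surface\<close>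

locale bidegree =
  fixes n a b :: nat
  assumes a4: "4 \<le> a" and b4: "4 + n \<le> b" and ban: "3 + a * n \<le> b"
begin

text \<open>The exponents of \<open>x1\<close> and \<open>y1\<close>: the lattice points of a
  trapezoid with vertices \<open>(0, 0)\<close>, \<open>(b, 0)\<close>, \<open>(0, a)\<close> and
  \<open>(b - n * a, a)\<close>. The exponents of \<open>x0\<close> and \<open>y0\<close> make up
  the bidegree.\<close>

definition Idx :: "(nat \<times> nat) set" where
  "Idx = {(i, j). j \<le> a \<and> i + n * j \<le> b}"

definition mono :: "nat \<Rightarrow> nat \<Rightarrow> 'r :: comm_ring_1 \<Rightarrow> 'r \<Rightarrow> 'r \<Rightarrow> 'r \<Rightarrow> 'r" where
  "mono i j x0 x1 y0 y1 = x0 ^ (b - i - n * j) * x1 ^ i * y0 ^ (a - j) * y1 ^ j"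

definition Pev :: "(nat \<Rightarrow> nat \<Rightarrow> 'r) \<Rightarrow> 'r :: comm_ring_1 \<Rightarrow> 'r \<Rightarrow> 'r \<Rightarrow> 'r \<Rightarrow> 'r" where
  "Pev k x0 x1 y0 y1 = (\<Sum>(i, j)\<in>Idx. k i j * mono i j x0 x1 y0 y1)"

text \<open>\<open>P0\<close> to \<open>P3\<close> are the partial derivatives of \<open>Pev\<close>
  in its four arguments.\<close>

definition P0 :: "(nat \<Rightarrow> nat \<Rightarrow> 'r) \<Rightarrow> 'r :: comm_ring_1 \<Rightarrow> 'r \<Rightarrow> 'r \<Rightarrow> 'r \<Rightarrow> 'r" where
  "P0 k x0 x1 y0 y1 = (\<Sum>(i, j)\<in>Idx. k i j *
     (of_nat (b - i - n * j) * x0 ^ (b - i - n * j - 1) * x1 ^ i * y0 ^ (a - j) * y1 ^ j))"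

definition P1 :: "(nat \<Rightarrow> nat \<Rightarrow> 'r) \<Rightarrow> 'r :: comm_ring_1 \<Rightarrow> 'r \<Rightarrow> 'r \<Rightarrow> 'r \<Rightarrow> 'r" where
  "P1 k x0 x1 y0 y1 = (\<Sum>(i, j)\<in>Idx. k i j *
     (x0 ^ (b - i - n * j) * (of_nat i * x1 ^ (i - 1)) * y0 ^ (a - j) * y1 ^ j))"

definition P2 :: "(nat \<Rightarrow> nat \<Rightarrow> 'r) \<Rightarrow> 'r :: comm_ring_1 \<Rightarrow> 'r \<Rightarrow> 'r \<Rightarrow> 'r \<Rightarrow> 'r" where
  "P2 k x0 x1 y0 y1 = (\<Sum>(i, j)\<in>Idx. k i j *
     (x0 ^ (b - i - n * j) * x1 ^ i * (of_nat (a - j) * y0 ^ (a - j - 1)) * y1 ^ j))"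

definition P3 :: "(nat \<Rightarrow> nat \<Rightarrow> 'r) \<Rightarrow> 'r :: comm_ring_1 \<Rightarrow> 'r \<Rightarrow> 'r \<Rightarrow> 'r \<Rightarrow> 'r" where
  "P3 k x0 x1 y0 y1 = (\<Sum>(i, j)\<in>Idx. k i j *
     (x0 ^ (b - i - n * j) * x1 ^ i * y0 ^ (a - j) * (of_nat j * y1 ^ (j - 1))))"

definition supported :: "(nat \<Rightarrow> nat \<Rightarrow> 'r :: zero) \<Rightarrow> bool" where
  "supported k \<longleftrightarrow> (\<forall>i j. (i, j) \<notin> Idx \<longrightarrow> k i j = 0)"

text \<open>The equation of a divisor matters only up to a factor. Fixing one coefficient leaves an
  affine space defined over the rationals, at whose generic points the remaining coefficients are
  algebraically independent.\<close>

definition normalized :: "(nat \<Rightarrow> nat \<Rightarrow> 'r :: comm_ring_1) set" where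
  "normalized = {k. supported k \<and> k 0 0 = 1}"

definition single :: "nat \<Rightarrow> nat \<Rightarrow> nat \<Rightarrow> nat \<Rightarrow> 'r :: comm_ring_1" where
  "single i j = (\<lambda>i' j'. if i' = i \<and> j' = j then 1 else 0)"

lemma finite_Idx: "finite Idx"
proof (rule finite_subset)
  show "Idx \<subseteq> {..b} \<times> {..a}" by (auto simp: Idx_def)
qed simp

lemma n_mult_le: "j \<le> a \<Longrightarrow> n * j \<le> b"
  using ban mult_le_mono2[of j a n] mult.commute[of n a] by linarith

lemma Idx_corner: "(0, j) \<in> Idx" "(b - n * j, j) \<in> Idx" if "j \<le> a"
  using n_mult_le[OF that] that by (auto simp: Idx_def)

lemma supported_single: "(i, j) \<in> Idx \<Longrightarrow> supported (single i j)"
  by (auto simp: supported_def single_def)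

lemma Pev_single:
  assumes "(i, j) \<in> Idx" shows "Pev (single i j) x0 x1 y0 y1 = mono i j x0 x1 y0 y1"
proof -
  have "Pev (single i j) x0 x1 y0 y1 = (\<Sum>p\<in>Idx. if p = (i, j) then mono i j x0 x1 y0 y1 else 0)"
    unfolding Pev_def by (intro sum.cong) (auto simp: single_def split: if_splits)
  then show ?thesis using assms finite_Idx by simp
qed

lemma Pev_linear:
  "Pev (\<lambda>i j. k i j + s * l i j) x0 x1 y0 y1 = Pev k x0 x1 y0 y1 + s * Pev l x0 x1 y0 y1"
  unfolding Pev_def by (simp add: sum_distrib_left sum.distrib[symmetric] case_prod_unfold algebra_simps)

lemma Pev_derivation:
  assumes "derivation D"
  shows "D (Pev k x0 x1 y0 y1) = Pev (\<lambda>i j. D (k i j)) x0 x1 y0 y1 + P0 k x0 x1 y0 y1 * D x0 +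
    P1 k x0 x1 y0 y1 * D x1 + P2 k x0 x1 y0 y1 * D y0 + P3 k x0 x1 y0 y1 * D y1"
proof -
  interpret derivation D by fact
  show ?thesis
    unfolding Pev_def P0_def P1_def P2_def P3_def sum sum_distrib_right sum.distrib[symmetric]
    by (intro sum.cong refl) (clarsimp simp: mult power mono_def algebra_simps)
qed

lemma power_pred: "of_nat k * x ^ (k - 1) * x = of_nat k * (x :: 'r :: comm_ring_1) ^ k"
  by (cases k) (simp_all add: mult_ac)

text \<open>Euler's relations for the two factors of the torus, in which \<open>y1\<close> has
  weights \<open>n\<close> and 1.\<close>

lemma Pev_euler:
  "x0 * P0 k x0 x1 y0 y1 + x1 * P1 k x0 x1 y0 y1 + of_nat n * y1 * P3 k x0 x1 y0 y1 =
     of_nat b * Pev k x0 x1 y0 y1"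
  "y0 * P2 k x0 x1 y0 y1 + y1 * P3 k x0 x1 y0 y1 = of_nat a * Pev k x0 x1 y0 y1"
proof -
  have e: "of_nat b = (of_nat (b - i - n * j) + of_nat i + of_nat n * of_nat j :: 'r :: comm_ring_1)"
    "of_nat a = (of_nat (a - j) + of_nat j :: 'r)" if "(i, j) \<in> Idx" for i j
  proof -
    have "b = (b - i - n * j) + i + n * j" "a = (a - j) + j" using that by (auto simp: Idx_def)
    then show "of_nat b = (of_nat (b - i - n * j) + of_nat i + of_nat n * of_nat j :: 'r)"
      "of_nat a = (of_nat (a - j) + of_nat j :: 'r)" by (metis of_nat_add of_nat_mult)+
  qed
  show "x0 * P0 k x0 x1 y0 y1 + x1 * P1 k x0 x1 y0 y1 + of_nat n * y1 * P3 k x0 x1 y0 y1 =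
     of_nat b * Pev k x0 x1 y0 y1"
    unfolding Pev_def P0_def P1_def P3_def mono_def sum_distrib_left sum.distrib[symmetric]
  proof (intro sum.cong refl, unfold split_paired_all prod.case)
    fix i j assume ij: "(i, j) \<in> Idx"
    let ?m = "b - i - n * j"
    have "x0 * (k i j * (of_nat ?m * x0 ^ (?m - 1) * x1 ^ i * y0 ^ (a - j) * y1 ^ j)) +
      x1 * (k i j * (x0 ^ ?m * (of_nat i * x1 ^ (i - 1)) * y0 ^ (a - j) * y1 ^ j)) +
      of_nat n * y1 * (k i j * (x0 ^ ?m * x1 ^ i * y0 ^ (a - j) * (of_nat j * y1 ^ (j - 1)))) =
      k i j * ((of_nat ?m * x0 ^ (?m - 1) * x0) * x1 ^ i * y0 ^ (a - j) * y1 ^ j +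
      x0 ^ ?m * (of_nat i * x1 ^ (i - 1) * x1) * y0 ^ (a - j) * y1 ^ j +
      of_nat n * (x0 ^ ?m * x1 ^ i * y0 ^ (a - j) * (of_nat j * y1 ^ (j - 1) * y1)))"
      by (simp add: algebra_simps)
    also have "\<dots> = of_nat b * (k i j * (x0 ^ ?m * x1 ^ i * y0 ^ (a - j) * y1 ^ j))"
      unfolding power_pred e(1)[OF ij] by (simp add: algebra_simps)
    finally show "x0 * (k i j * (of_nat ?m * x0 ^ (?m - 1) * x1 ^ i * y0 ^ (a - j) * y1 ^ j)) +
      x1 * (k i j * (x0 ^ ?m * (of_nat i * x1 ^ (i - 1)) * y0 ^ (a - j) * y1 ^ j)) +
      of_nat n * y1 * (k i j * (x0 ^ ?m * x1 ^ i * y0 ^ (a - j) * (of_nat j * y1 ^ (j - 1)))) =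
      of_nat b * (k i j * (x0 ^ ?m * x1 ^ i * y0 ^ (a - j) * y1 ^ j))" .
  qed
  show "y0 * P2 k x0 x1 y0 y1 + y1 * P3 k x0 x1 y0 y1 = of_nat a * Pev k x0 x1 y0 y1"
    unfolding Pev_def P2_def P3_def mono_def sum_distrib_left sum.distrib[symmetric]
  proof (intro sum.cong refl, unfold split_paired_all prod.case)
    fix i j assume ij: "(i, j) \<in> Idx"
    let ?m = "b - i - n * j"
    have "y0 * (k i j * (x0 ^ ?m * x1 ^ i * (of_nat (a - j) * y0 ^ (a - j - 1)) * y1 ^ j)) +
      y1 * (k i j * (x0 ^ ?m * x1 ^ i * y0 ^ (a - j) * (of_nat j * y1 ^ (j - 1)))) =
      k i j * (x0 ^ ?m * x1 ^ i * (of_nat (a - j) * y0 ^ (a - j - 1) * y0) * y1 ^ j +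
      x0 ^ ?m * x1 ^ i * y0 ^ (a - j) * (of_nat j * y1 ^ (j - 1) * y1))"
      by (simp add: algebra_simps)
    also have "\<dots> = of_nat a * (k i j * (x0 ^ ?m * x1 ^ i * y0 ^ (a - j) * y1 ^ j))"
      unfolding power_pred e(2)[OF ij] by (simp add: algebra_simps)
    finally show "y0 * (k i j * (x0 ^ ?m * x1 ^ i * (of_nat (a - j) * y0 ^ (a - j - 1)) * y1 ^ j)) +
      y1 * (k i j * (x0 ^ ?m * x1 ^ i * y0 ^ (a - j) * (of_nat j * y1 ^ (j - 1)))) =
      of_nat a * (k i j * (x0 ^ ?m * x1 ^ i * y0 ^ (a - j) * y1 ^ j))" .
  qed
qed

text \<open>Each vertex of the trapezoid is a power of one base coordinate times a power of one
  fibre coordinate, and all four pairings occur. These monomials therefore detect every point, in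
  particular the values of a curve at 0 and at infinity.\<close>

lemma corner_nonzero:
  fixes x0 x1 y0 y1 :: "'r :: idom"
  assumes "x0 \<noteq> 0 \<or> x1 \<noteq> 0" "y0 \<noteq> 0 \<or> y1 \<noteq> 0"
  obtains i j where "(i, j) \<in> {(0, 0), (b, 0), (0, a), (b - n * a, a)}" "mono i j x0 x1 y0 y1 \<noteq> 0"
proof -
  have "mono 0 0 x0 x1 y0 y1 \<noteq> 0 \<or> mono b 0 x0 x1 y0 y1 \<noteq> 0 \<or> mono 0 a x0 x1 y0 y1 \<noteq> 0 \<or>
     mono (b - n * a) a x0 x1 y0 y1 \<noteq> 0"
    using assms by (auto simp: mono_def)
  then show thesis using that by blast
qed

lemma corner_Idx: "p \<in> {(0, 0), (b, 0), (0, a), (b - n * a, a)} \<Longrightarrow> p \<in> Idx"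
  using Idx_corner[of 0] Idx_corner[of a] by auto

lemma shift_normalized:
  assumes "r \<in> normalized" "supported q" "q 0 0 = 0"
  shows "(\<lambda>i j. r i j + s * q i j) \<in> normalized"
  using assms by (auto simp: normalized_def supported_def)

text \<open>At a singular point Euler's relation gives \<open>P = 0\<close> as well. A derivation
  moving \<open>r\<close> in direction \<open>q\<close> is applied to this equation: the terms with
  partial derivatives drop out, so \<open>q\<close> vanishes at the point. Then all sections of the
  bidegree would vanish there, the vertex monomials included.\<close>

lemma generic_smooth:
  fixes x0 x1 y0 y1 :: complex
  assumes r: "generic_in normalized r" and z: "x0 \<noteq> 0 \<or> x1 \<noteq> 0" "y0 \<noteq> 0 \<or> y1 \<noteq> 0"
  shows "P0 r x0 x1 y0 y1 \<noteq> 0 \<or> P1 r x0 x1 y0 y1 \<noteq> 0 \<or> P2 r x0 x1 y0 y1 \<noteq> 0 \<or> P3 r x0 x1 y0 y1 \<noteq> 0"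
proof (rule ccontr)
  assume "\<not> ?thesis"
  then have P: "P0 r x0 x1 y0 y1 = 0" "P1 r x0 x1 y0 y1 = 0" "P2 r x0 x1 y0 y1 = 0" "P3 r x0 x1 y0 y1 = 0"
    by auto
  have rn: "r \<in> normalized" using r by (simp add: generic_in_def)
  have "of_nat a * Pev r x0 x1 y0 y1 = 0"
    using Pev_euler(2)[where ?x0.0 = x0 and ?x1.0 = x1 and ?y0.0 = y0 and ?y1.0 = y1 and k = r] P by simp
  then have Pr: "Pev r x0 x1 y0 y1 = 0" using a4 by simp
  have Pq: "Pev q x0 x1 y0 y1 = 0" if q: "supported q" "q 0 0 = 0" for q
  proof -
    obtain \<delta> :: "complex \<Rightarrow> complex" where \<delta>: "\<And>x y. \<delta> (x + y) = \<delta> x + \<delta> y"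
      "\<And>x y. \<delta> (x * y) = x * \<delta> y + \<delta> x * y" "\<And>i j. \<delta> (r i j) = q i j"
      using generic_derivation[OF r shift_normalized[OF rn q]] by metis
    interpret derivation \<delta> by standard (use \<delta> in auto)
    show ?thesis using Pev_derivation[OF derivation_axioms, of r x0 x1 y0 y1] Pr P zero by (simp add: \<delta>(3))
  qed
  \<comment> \<open>The normalization only allows directions with \<open>q 0 0 = 0\<close>;
    subtracting a multiple of \<open>r\<close>, which vanishes at the point, reduces the general
    case to these.\<close>
  have "Pev q x0 x1 y0 y1 = 0" if "supported q" for q
  proof -
    have "Pev (\<lambda>i j. q i j + (- q 0 0) * r i j) x0 x1 y0 y1 = 0"
      by (rule Pq) (use that rn in \<open>auto simp: normalized_def supported_def\<close>)
    then show ?thesis unfolding Pev_linear using Pr by simp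
  qed
  then show False
    using corner_nonzero[OF z] Pev_single supported_single corner_Idx by metis
qed

lemma degb_term:
  assumes "degb x0 d" "degb x1 d" "degb y0 e" "degb y1 (e + int n * d)" "degb k 0"
    and "int p * d + int i * d + int q * e + int j * (e + int n * d) = t"
  shows "degb (k * (x0 ^ p * x1 ^ i * y0 ^ q * y1 ^ j)) t"
    and "lcoef (k * (x0 ^ p * x1 ^ i * y0 ^ q * y1 ^ j)) t =
      lcoef k 0 * (lcoef x0 d ^ p * lcoef x1 d ^ i * lcoef y0 e ^ q * lcoef y1 (e + int n * d) ^ j)"
proof -
  note dp = degb_power[OF assms(1), of p] degb_power[OF assms(2), of i] degb_power[OF assms(3), of q]
    degb_power[OF assms(4), of j]
  have t: "t = 0 + (int p * d + int i * d + int q * e + int j * (e + int n * d))" using assms(6) by simp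
  show "degb (k * (x0 ^ p * x1 ^ i * y0 ^ q * y1 ^ j)) t"
    unfolding t by (intro degb_mult dp assms(5))
  show "lcoef (k * (x0 ^ p * x1 ^ i * y0 ^ q * y1 ^ j)) t =
      lcoef k 0 * (lcoef x0 d ^ p * lcoef x1 d ^ i * lcoef y0 e ^ q * lcoef y1 (e + int n * d) ^ j)"
    unfolding t
    by (simp only: lcoef_mult degb_mult dp assms(5) lcoef_power[OF assms(1)] lcoef_power[OF assms(2)]
      lcoef_power[OF assms(3)] lcoef_power[OF assms(4)])
qed

context
  fixes x0 x1 y0 y1 :: "complex poly" and d e D :: int and k :: "nat \<Rightarrow> nat \<Rightarrow> complex"
  assumes dg: "degb x0 d" "degb x1 d" "degb y0 e" "degb y1 (e + int n * d)"
  and D: "D = int b * d + int a * e"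
begin

lemma mono_weight:
  assumes "(i, j) \<in> Idx"
  shows "int (b - i - n * j) * d + int i * d + int (a - j) * e + int j * (e + int n * d) = D"
proof -
  have *: "int (b - i - n * j) = int b - int i - int n * int j" "int (a - j) = int a - int j"
    using assms by (auto simp: Idx_def of_nat_diff)
  show ?thesis unfolding * D by (simp add: algebra_simps)
qed

lemma mono_degb:
  assumes "(i, j) \<in> Idx"
  shows "degb (mono i j x0 x1 y0 y1) D"
    "lcoef (mono i j x0 x1 y0 y1) D = mono i j (lcoef x0 d) (lcoef x1 d) (lcoef y0 e) (lcoef y1 (e + int n * d))"
  using degb_term[OF dg degb_1 mono_weight[OF assms]] by (simp_all add: mono_def lcoef_1)

lemma sum_degb:
  assumes "\<And>i j. (i, j) \<in> Idx \<Longrightarrow> degb (f i j) t \<and> lcoef (f i j) t = g i j"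
  shows "degb (\<Sum>(i, j)\<in>Idx. [:k i j:] * f i j) t \<and> lcoef (\<Sum>(i, j)\<in>Idx. [:k i j:] * f i j) t = (\<Sum>(i, j)\<in>Idx. k i j * g i j)"
proof -
  have *: "degb (smult (k i j) (f i j)) t" "lcoef (smult (k i j) (f i j)) t = k i j * g i j" if "(i, j) \<in> Idx" for i j
    using degb_mult[OF degb_const[of "k i j"], of "f i j" t] lcoef_mult[OF degb_const[of "k i j"], of "f i j" t]
      assms[OF that] by (simp_all add: lcoef_const)
  show ?thesis unfolding lcoef_sum by (auto intro!: degb_sum sum.cong simp: *)
qed

text \<open>Along a curve of the given degrees the partial derivatives are sections of line bundles,
  and their values at infinity are the partial derivatives at the limit point; so smoothness can be
  used there too.\<close>

lemma P_degb:
  fixes z0 z1 w0 w1 :: complex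
  defines "z0 \<equiv> lcoef x0 d" and "z1 \<equiv> lcoef x1 d" and "w0 \<equiv> lcoef y0 e" and "w1 \<equiv> lcoef y1 (e + int n * d)"
  shows "degb (P0 (\<lambda>i j. [:k i j:]) x0 x1 y0 y1) (D - d)" "lcoef (P0 (\<lambda>i j. [:k i j:]) x0 x1 y0 y1) (D - d) = P0 k z0 z1 w0 w1"
    "degb (P1 (\<lambda>i j. [:k i j:]) x0 x1 y0 y1) (D - d)" "lcoef (P1 (\<lambda>i j. [:k i j:]) x0 x1 y0 y1) (D - d) = P1 k z0 z1 w0 w1"
    "degb (P2 (\<lambda>i j. [:k i j:]) x0 x1 y0 y1) (D - e)" "lcoef (P2 (\<lambda>i j. [:k i j:]) x0 x1 y0 y1) (D - e) = P2 k z0 z1 w0 w1"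
    "degb (P3 (\<lambda>i j. [:k i j:]) x0 x1 y0 y1) (D - (e + int n * d))"
    "lcoef (P3 (\<lambda>i j. [:k i j:]) x0 x1 y0 y1) (D - (e + int n * d)) = P3 k z0 z1 w0 w1"
proof -
  \<comment> \<open>For exponent 0 the truncated difference \<open>m - 1\<close> would give a wrong
    weight, but then the numerical factor kills the term; hence the case distinctions below.\<close>
  have pred: "int (m - 1) * t = int m * t - t" if "m \<noteq> 0" for m t
    using that by (cases m) (auto simp: algebra_simps)
  note T = degb_term[OF dg degb_of_nat]
  have 0: "degb (of_nat (b - i - n * j) * x0 ^ (b - i - n * j - 1) * x1 ^ i * y0 ^ (a - j) * y1 ^ j) (D - d) \<and>
    lcoef (of_nat (b - i - n * j) * x0 ^ (b - i - n * j - 1) * x1 ^ i * y0 ^ (a - j) * y1 ^ j) (D - d) =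
     of_nat (b - i - n * j) * z0 ^ (b - i - n * j - 1) * z1 ^ i * w0 ^ (a - j) * w1 ^ j" if "(i, j) \<in> Idx" for i j
  proof (cases "b - i - n * j = 0")
    case False
    have "int (b - i - n * j - 1) * d + int i * d + int (a - j) * e + int j * (e + int n * d) = D - d"
      unfolding pred[OF False] using mono_weight[OF that] by linarith
    from T[OF this, of "b - i - n * j"] show ?thesis
      by (simp add: lcoef_of_nat z0_def z1_def w0_def w1_def mult.assoc)
  qed simp
  show "degb (P0 (\<lambda>i j. [:k i j:]) x0 x1 y0 y1) (D - d)" "lcoef (P0 (\<lambda>i j. [:k i j:]) x0 x1 y0 y1) (D - d) = P0 k z0 z1 w0 w1"
    unfolding P0_def using sum_degb[OF 0] by auto
  have 1: "degb (x0 ^ (b - i - n * j) * (of_nat i * x1 ^ (i - 1)) * y0 ^ (a - j) * y1 ^ j) (D - d) \<and>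
    lcoef (x0 ^ (b - i - n * j) * (of_nat i * x1 ^ (i - 1)) * y0 ^ (a - j) * y1 ^ j) (D - d) =
     z0 ^ (b - i - n * j) * (of_nat i * z1 ^ (i - 1)) * w0 ^ (a - j) * w1 ^ j" if "(i, j) \<in> Idx" for i j
  proof (cases "i = 0")
    case False
    have "int (b - i - n * j) * d + int (i - 1) * d + int (a - j) * e + int j * (e + int n * d) = D - d"
      unfolding pred[OF False] using mono_weight[OF that] by linarith
    from T[OF this, of i] show ?thesis
      by (simp add: lcoef_of_nat z0_def z1_def w0_def w1_def mult_ac)
  qed simp
  show "degb (P1 (\<lambda>i j. [:k i j:]) x0 x1 y0 y1) (D - d)" "lcoef (P1 (\<lambda>i j. [:k i j:]) x0 x1 y0 y1) (D - d) = P1 k z0 z1 w0 w1"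
    unfolding P1_def using sum_degb[OF 1] by auto
  have 2: "degb (x0 ^ (b - i - n * j) * x1 ^ i * (of_nat (a - j) * y0 ^ (a - j - 1)) * y1 ^ j) (D - e) \<and>
    lcoef (x0 ^ (b - i - n * j) * x1 ^ i * (of_nat (a - j) * y0 ^ (a - j - 1)) * y1 ^ j) (D - e) =
     z0 ^ (b - i - n * j) * z1 ^ i * (of_nat (a - j) * w0 ^ (a - j - 1)) * w1 ^ j" if "(i, j) \<in> Idx" for i j
  proof (cases "a - j = 0")
    case False
    have "int (b - i - n * j) * d + int i * d + int (a - j - 1) * e + int j * (e + int n * d) = D - e"
      unfolding pred[OF False] using mono_weight[OF that] by linarith
    from T[OF this, of "a - j"] show ?thesis
      by (simp add: lcoef_of_nat z0_def z1_def w0_def w1_def mult_ac)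
  qed simp
  show "degb (P2 (\<lambda>i j. [:k i j:]) x0 x1 y0 y1) (D - e)" "lcoef (P2 (\<lambda>i j. [:k i j:]) x0 x1 y0 y1) (D - e) = P2 k z0 z1 w0 w1"
    unfolding P2_def using sum_degb[OF 2] by auto
  have 3: "degb (x0 ^ (b - i - n * j) * x1 ^ i * y0 ^ (a - j) * (of_nat j * y1 ^ (j - 1))) (D - (e + int n * d)) \<and>
    lcoef (x0 ^ (b - i - n * j) * x1 ^ i * y0 ^ (a - j) * (of_nat j * y1 ^ (j - 1))) (D - (e + int n * d)) =
     z0 ^ (b - i - n * j) * z1 ^ i * w0 ^ (a - j) * (of_nat j * w1 ^ (j - 1))" if "(i, j) \<in> Idx" for i j
  proof (cases "j = 0")
    case False
    have "int (b - i - n * j) * d + int i * d + int (a - j) * e + int (j - 1) * (e + int n * d) = D - (e + int n * d)"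
      unfolding pred[OF False] using mono_weight[OF that] by linarith
    from T[OF this, of j] show ?thesis
      by (simp add: lcoef_of_nat z0_def z1_def w0_def w1_def mult_ac)
  qed simp
  show "degb (P3 (\<lambda>i j. [:k i j:]) x0 x1 y0 y1) (D - (e + int n * d))"
    "lcoef (P3 (\<lambda>i j. [:k i j:]) x0 x1 y0 y1) (D - (e + int n * d)) = P3 k z0 z1 w0 w1"
    unfolding P3_def using sum_degb[OF 3] by auto
qed

end

lemma poly_Pev: "poly (Pev (\<lambda>i j. [:k i j:]) x0 x1 y0 y1) t = Pev k (poly x0 t) (poly x1 t) (poly y0 t) (poly y1 t)"
  by (simp add: Pev_def mono_def poly_sum case_prod_unfold)

lemma poly_P:
  fixes k :: "nat \<Rightarrow> nat \<Rightarrow> 'r :: comm_ring_1"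
  shows "poly (P0 (\<lambda>i j. [:k i j:]) x0 x1 y0 y1) t = P0 k (poly x0 t) (poly x1 t) (poly y0 t) (poly y1 t)"
    "poly (P1 (\<lambda>i j. [:k i j:]) x0 x1 y0 y1) t = P1 k (poly x0 t) (poly x1 t) (poly y0 t) (poly y1 t)"
    "poly (P2 (\<lambda>i j. [:k i j:]) x0 x1 y0 y1) t = P2 k (poly x0 t) (poly x1 t) (poly y0 t) (poly y1 t)"
    "poly (P3 (\<lambda>i j. [:k i j:]) x0 x1 y0 y1) t = P3 k (poly x0 t) (poly x1 t) (poly y0 t) (poly y1 t)"
  by (simp_all add: P0_def P1_def P2_def P3_def poly_sum case_prod_unfold)

end

section \<open>Curves meeting a generic divisor in at most two points\<close>

lemma monom_const_mult: "monom (c * d) m = [:c:] * monom d m"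
  by (simp add: smult_monom)

lemma coprime_mult_monom_dvd:
  fixes f g :: "complex poly"
  assumes "monom 1 m dvd f * g" "poly f 0 \<noteq> 0" shows "monom 1 m dvd g"
  using coprime_dvd_mult_right_iff[OF coprime_monom_poly[OF assms(2)], of m g] assms(1) by simp

text \<open>A map from the projective line to the surface, in coprime homogeneous coordinates, that
  meets the divisor over 0 and infinity only. Its degrees against \<open>F\<close> and
  \<open>C\<close> are \<open>d\<close> and \<open>e\<close>; \<open>lX\<close> and
  \<open>lY\<close> say that the coordinates of a pair do not vanish together at infinity.\<close>

locale generic_curve = bidegree +
  fixes r :: "nat \<Rightarrow> nat \<Rightarrow> complex" and X0 X1 Y0 Y1 :: "complex poly" and c :: complex and m0 :: nat
    and d e :: int
  assumes r: "generic_in normalized r"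
    and dX: "degb X0 d" "degb X1 d" and dY: "degb Y0 e" "degb Y1 (e + int n * d)"
    and lX: "lcoef X0 d \<noteq> 0 \<or> lcoef X1 d \<noteq> 0" and lY: "lcoef Y0 e \<noteq> 0 \<or> lcoef Y1 (e + int n * d) \<noteq> 0"
    and cX: "coprime X0 X1" and cY: "coprime Y0 Y1"
    and avoid: "Pev (\<lambda>i j. [:r i j:]) X0 X1 Y0 Y1 = monom c m0" and c: "c \<noteq> 0"
    and nonconst: "d > 0 \<or> (d = 0 \<and> e > 0)"
begin

abbreviation "e1 \<equiv> e + int n * d"
abbreviation "Q0 \<equiv> P0 (\<lambda>i j. [:r i j:]) X0 X1 Y0 Y1"
abbreviation "Q1 \<equiv> P1 (\<lambda>i j. [:r i j:]) X0 X1 Y0 Y1"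
abbreviation "Q2 \<equiv> P2 (\<lambda>i j. [:r i j:]) X0 X1 Y0 Y1"
abbreviation "Q3 \<equiv> P3 (\<lambda>i j. [:r i j:]) X0 X1 Y0 Y1"
abbreviation "ev q \<equiv> Pev (\<lambda>i j. [:q i j:]) X0 X1 Y0 Y1"
abbreviation "mon i j \<equiv> mono i j X0 X1 Y0 Y1"

text \<open>The degree of the divisor on the curve; \<open>K\<close> is the anticanonical degree,
  that is \<open>d + d + e + e1\<close>, so \<open>Deg - K\<close> is the degree of the logarithmic
  canonical bundle.\<close>

definition Deg :: int where "Deg = int b * d + int a * e"
definition K :: int where "K = 2 * d + 2 * e + int n * d"

lemma d0: "0 \<le> d" using nonconst by auto

text \<open>Only a curve inside the zero section meets it negatively; there \<open>Y0 = 0\<close>,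
  and its coprime partner \<open>Y1\<close> is a constant, which gives
  \<open>e1 = 0\<close>.\<close>

lemma e_cases: "0 \<le> e \<or> (Y0 = 0 \<and> e = - int n * d)"
proof (cases "Y0 = 0")
  case True
  then have "is_unit Y1" using cY by simp
  then have "Y1 \<noteq> 0" by auto
  moreover have "degree Y1 = 0" using is_unit_iff_degree[OF \<open>Y1 \<noteq> 0\<close>] \<open>is_unit Y1\<close> by simp
  ultimately have "degree Y1 = 0" by simp
  moreover have "int (degree Y1) = e1" using degree_of_lcoef(1)[OF dY(2)] lY True by simp
  ultimately show ?thesis using True by auto
next
  case False
  then show ?thesis using dY(1) by (meson degb_neg not_le)
qed

text \<open>Room for relations of degree \<open>d\<close>. The difference is the degree of
  \<open>(a - 2) C + (b - 3 - n) F\<close>; on the zero section it equals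
  \<open>(b - a n + n - 3) d\<close>, which \<open>3 + a n \<le> b\<close> makes positive for
  \<open>n > 0\<close>.\<close>

lemma K_d_less: "K + d < Deg"
proof (cases "0 \<le> e")
  case True
  have b: "int b \<ge> 4 + int n" using b4 by simp
  have "Deg - (K + d) = (int b - 3 - int n) * d + (int a - 2) * e"
    by (simp add: Deg_def K_def algebra_simps)
  moreover have "(int b - 3 - int n) * d \<ge> 0" "(int a - 2) * e \<ge> 0" using b d0 True a4 by simp_all
  moreover have "(int b - 3 - int n) * d > 0 \<or> (int a - 2) * e > 0"
    using b nonconst a4 by auto
  ultimately show ?thesis by linarith
next
  case False
  then have e: "e = - int n * d" using e_cases by simp
  have "int n * d > 0" using False e by linarith
  then have n: "n > 0" "d > 0" using d0 by (auto simp: zero_less_mult_iff)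
  have "Deg - (K + d) = (int b - int (a * n) + int n - 3) * d"
    unfolding Deg_def K_def unfolding e by (simp add: algebra_simps)
  moreover have "int b - int (a * n) + int n - 3 > 0" using ban n by linarith
  ultimately show ?thesis using n by (smt (verit) mult_pos_pos)
qed

text \<open>Room for relations of the degree of \<open>C + n F\<close>. On a fibre the difference is
  \<open>(a - 3) e\<close>, whence \<open>a \<ge> 4\<close>; on the zero section
  \<open>e1 = 0\<close>.\<close>

lemma K_e1_less: "K + e1 < Deg"
proof (cases "0 \<le> e")
  case True
  have an: "4 * n \<le> a * n" using a4 by simp
  then have b: "int b - 2 - 2 * int n > 0" using ban by linarith
  have "Deg - (K + e1) = (int b - 2 - 2 * int n) * d + (int a - 3) * e"
    by (simp add: Deg_def K_def algebra_simps)
  moreover have "(int b - 2 - 2 * int n) * d \<ge> 0" "(int a - 3) * e \<ge> 0" using b d0 True a4 by simp_all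
  moreover have "(int b - 2 - 2 * int n) * d > 0 \<or> (int a - 3) * e > 0"
    using b nonconst a4 by auto
  ultimately show ?thesis by linarith
next
  case False
  then have e: "e = - int n * d" using e_cases by simp
  then show ?thesis using K_d_less d0 by simp
qed

lemma K_less: "K < Deg" using K_d_less d0 by linarith

lemma normalized_r: "r \<in> normalized" using r by (simp add: generic_in_def)

text \<open>Acting on coefficients, a derivation that moves \<open>r\<close> in direction
  \<open>q'\<close> turns \<open>avoid\<close> into a linear equation for the derivatives of the
  coordinates, which keep their degree bounds. Replacing \<open>q\<close> by
  \<open>q' = q - q 0 0 * r\<close> only changes the multiple of \<open>t^m0\<close>.\<close>

lemma lift:
  assumes "supported q"
  obtains u0 u1 v0 v1 :: "complex poly" and c' where "degb u0 d" "degb u1 d" "degb v0 e" "degb v1 e1"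
    "Q0 * u0 + Q1 * u1 + Q2 * v0 + Q3 * v1 = monom c' m0 - ev q"
proof -
  define q' where "q' i j = q i j + (- q 0 0) * r i j" for i j
  have q': "supported q'" "q' 0 0 = 0"
    using assms normalized_r by (auto simp: q'_def normalized_def supported_def)
  obtain \<delta> :: "complex \<Rightarrow> complex" where \<delta>: "\<And>x y. \<delta> (x + y) = \<delta> x + \<delta> y"
    "\<And>x y. \<delta> (x * y) = x * \<delta> y + \<delta> x * y" "\<And>i j. \<delta> (r i j) = q' i j"
    using generic_derivation[OF r shift_normalized[OF normalized_r q']] by metis
  interpret derivation \<delta> by standard (use \<delta> in auto)
  let ?D = "map_poly \<delta>"
  have dD: "degb (?D f) k" if "degb f k" for f k
    using that by (simp add: degb_def coeff_map_poly zero)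
  have "?D (monom c m0) = ev q' + Q0 * ?D X0 + Q1 * ?D X1 + Q2 * ?D Y0 + Q3 * ?D Y1"
    using Pev_derivation[OF map_poly, of "\<lambda>i j. [:r i j:]" X0 X1 Y0 Y1] avoid \<delta>(3)
    by (simp add: map_poly_pCons zero)
  moreover have "?D (monom c m0) = monom (\<delta> c) m0" by (simp add: map_poly_monom zero)
  moreover have "ev q' = ev q - [:q 0 0:] * ev r"
    using Pev_linear[of "\<lambda>i j. [:q i j:]" "- [:q 0 0:]" "\<lambda>i j. [:r i j:]" X0 X1 Y0 Y1]
    by (simp add: q'_def mult.commute)
  ultimately have "Q0 * ?D X0 + Q1 * ?D X1 + Q2 * ?D Y0 + Q3 * ?D Y1 = monom (\<delta> c + q 0 0 * c) m0 - ev q"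
    unfolding avoid by (simp add: algebra_simps smult_monom add_monom[symmetric])
  then show thesis using that[of "?D X0" "?D X1" "?D Y0" "?D Y1"] dD dX dY by blast
qed

text \<open>The logarithmic vector field \<open>t d/dt\<close>: it respects degree bounds and maps
  every monomial to a multiple of itself.\<close>

definition th :: "complex poly \<Rightarrow> complex poly" where "th f = [:0, 1:] * pderiv f"

lemma th_derivation: "derivation th"
  by standard (auto simp: th_def pderiv_add pderiv_mult algebra_simps)

lemma degb_th: "degb f k \<Longrightarrow> degb (th f) k"
  by (auto simp: th_def degb_def coeff_pCons coeff_pderiv split: nat.split)

text \<open>The minors of the three vectors \<open>th (X0, X1, Y0, Y1)\<close>, \<open>(X0, X1, 0, n Y1)\<close>, \<open>(0, 0, Y0, Y1)\<close>, the last two of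
  which span the tangent space of the torus orbit.\<close>

definition "W = th X0 * X1 - th X1 * X0"
definition "U = th Y0 * Y1 - th Y1 * Y0"
definition "M0 = - (of_nat n * th X1 * Y0 * Y1) - X1 * U"
definition "M1 = - (of_nat n * th X0 * Y0 * Y1) - X0 * U"
definition "M2 = Y1 * W"
definition "M3 = Y0 * W"

definition nu :: "complex poly \<Rightarrow> complex poly \<Rightarrow> complex poly \<Rightarrow> complex poly \<Rightarrow> complex poly" where
  "nu u0 u1 v0 v1 = u0 * M0 - u1 * M1 + v0 * M2 - v1 * M3"

lemma th_avoid: "Q0 * th X0 + Q1 * th X1 + Q2 * th Y0 + Q3 * th Y1 = of_nat m0 * monom c m0"
proof -
  have "th (monom c m0) = ev (\<lambda>i j. 0) + Q0 * th X0 + Q1 * th X1 + Q2 * th Y0 + Q3 * th Y1"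
    using Pev_derivation[OF th_derivation, of "\<lambda>i j. [:r i j:]" X0 X1 Y0 Y1] avoid
    by (simp add: th_def pderiv_pCons)
  moreover have "ev (\<lambda>i j. 0) = 0" by (simp add: Pev_def)
  moreover have "th (monom c m0) = of_nat m0 * monom c m0"
    by (intro poly_eqI) (auto simp: th_def coeff_pCons coeff_pderiv of_nat_poly split: nat.split)
  ultimately show ?thesis by simp
qed

lemma euler: "X0 * Q0 + X1 * Q1 + of_nat n * Y1 * Q3 = of_nat b * monom c m0"
  "Y0 * Q2 + Y1 * Q3 = of_nat a * monom c m0"
  using Pev_euler[where ?x0.0 = X0 and ?x1.0 = X1 and ?y0.0 = Y0 and ?y1.0 = Y1 and k = "\<lambda>i j. [:r i j:]"]
  by (simp_all add: avoid)

text \<open>Cramer's rule for \<open>Q0\<close> to \<open>Q3\<close> as unknowns of four linear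
  equations: the given one, \<open>th_avoid\<close> and the two Euler relations. The last three have
  multiples of \<open>monom c m0\<close> on the right, so their minors are collected in
  \<open>R0\<close> to \<open>R3\<close>; only \<open>S\<close> keeps the minors \<open>M0\<close>
  to \<open>M3\<close>. Each degree is \<open>K + \<mu>\<close> minus the weight of the omitted
  coordinate.\<close>

lemma cramer:
  fixes u0 u1 v0 v1 :: "complex poly"
  assumes S: "Q0 * u0 + Q1 * u1 + Q2 * v0 + Q3 * v1 = S"
  and du: "degb u0 (d + \<mu>)" "degb u1 (d + \<mu>)" "degb v0 (e + \<mu>)" "degb v1 (e1 + \<mu>)"
  obtains R0 R1 R2 R3 where "Q0 * nu u0 u1 v0 v1 = S * M0 + monom c m0 * R0" "degb R0 (K - d + \<mu>)"
    "Q1 * nu u0 u1 v0 v1 = - S * M1 + monom c m0 * R1" "degb R1 (K - d + \<mu>)"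
    "Q2 * nu u0 u1 v0 v1 = S * M2 + monom c m0 * R2" "degb R2 (K - e + \<mu>)"
    "Q3 * nu u0 u1 v0 v1 = - S * M3 + monom c m0 * R3" "degb R3 (K - e1 + \<mu>)"
proof -
  define h0 h1 g0 g1 where "h0 = th X0" "h1 = th X1" "g0 = th Y0" "g1 = th Y1"
  note h = this
  let ?n = "of_nat n :: complex poly" and ?m = "of_nat m0 :: complex poly" and ?a = "of_nat a :: complex poly"
    and ?b = "of_nat b :: complex poly" and ?N = "nu u0 u1 v0 v1" and ?z = "monom c m0"
  \<comment> \<open>3-by-3 minors of the columns (u, h, E1), (u, h, E2), (u, E1, E2)\<close>
  define d3 where "d3 p1 p2 p3 q1 q2 q3 r1 r2 r3 =
    p1 * (q2 * r3 - q3 * r2) - p2 * (q1 * r3 - q3 * r1) + p3 * (q1 * r2 - q2 * r1)"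
    for p1 p2 p3 q1 q2 q3 r1 r2 r3 :: "complex poly"
  have T: "Q0 * h0 + Q1 * h1 + Q2 * g0 + Q3 * g1 = ?m * ?z" using th_avoid by (simp add: h)
  note E = euler
  define R where "R p1 p2 p3 q1 q2 q3 r1 r2 r3 s1 s2 s3 =
    - ?m * d3 p1 p2 p3 r1 r2 r3 s1 s2 s3 + ?b * d3 p1 p2 p3 q1 q2 q3 s1 s2 s3 - ?a * d3 p1 p2 p3 q1 q2 q3 r1 r2 r3"
    for p1 p2 p3 q1 q2 q3 r1 r2 r3 s1 s2 s3 :: "complex poly"
  define R0 where "R0 = R u1 v0 v1 h1 g0 g1 X1 0 (?n * Y1) 0 Y0 Y1"
  define R1 where "R1 = - R u0 v0 v1 h0 g0 g1 X0 0 (?n * Y1) 0 Y0 Y1"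
  define R2 where "R2 = R u0 u1 v1 h0 h1 g1 X0 X1 (?n * Y1) 0 0 Y1"
  define R3 where "R3 = - R u0 u1 v0 h0 h1 g0 X0 X1 0 0 0 Y0"
  have z: "?z * R p1 p2 p3 q1 q2 q3 r1 r2 r3 s1 s2 s3 =
    - (?m * ?z) * d3 p1 p2 p3 r1 r2 r3 s1 s2 s3 + (?b * ?z) * d3 p1 p2 p3 q1 q2 q3 s1 s2 s3
     - (?a * ?z) * d3 p1 p2 p3 q1 q2 q3 r1 r2 r3" for p1 p2 p3 q1 q2 q3 r1 r2 r3 s1 s2 s3
    by (simp add: R_def algebra_simps)
  note U = W_def U_def M0_def M1_def M2_def M3_def nu_def h[symmetric]
  have "Q0 * ?N = S * M0 + ?z * R0" "Q1 * ?N = - S * M1 + ?z * R1" 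
    "Q2 * ?N = S * M2 + ?z * R2" "Q3 * ?N = - S * M3 + ?z * R3"
    unfolding R0_def R1_def R2_def R3_def mult_minus_right z T[symmetric] E[symmetric] S[symmetric] U d3_def
    by (simp_all add: algebra_simps)
  moreover
  have dh: "degb h0 d" "degb h1 d" "degb g0 e" "degb g1 e1" using dX dY by (auto simp: h degb_th)
  have dn: "degb (?n * Y1) e1" using degb_mult[OF degb_of_nat[of n] dY(2)] by simp
  have d3: "degb (d3 p1 p2 p3 q1 q2 q3 r1 r2 r3) t"
    if "degb p1 (ka + \<mu>)" "degb p2 (kb + \<mu>)" "degb p3 (kc + \<mu>)" "degb q1 ka" "degb q2 kb" "degb q3 kc"
      "degb r1 ka" "degb r2 kb" "degb r3 kc" "t = ka + kb + kc + \<mu>"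
    for p1 p2 p3 q1 q2 q3 r1 r2 r3 ka kb kc t
  proof -
    have A: "degb (x * (y * z - y' * z')) t"
      if "degb x i" "degb y j" "degb z k" "degb y' k" "degb z' j" "i + j + k = t" for x y z y' z' i j k
      using degb_mult[OF that(1) degb_diff[OF degb_mult[OF that(2,3)] degb_mult[OF that(4,5), unfolded add.commute[of k]]]]
        that(6) by (simp add: add.assoc)
    show ?thesis unfolding d3_def
      by (intro degb_add degb_diff; rule A; (rule that)?) (auto simp: that(10))
  qed
  have dR: "degb (R p1 p2 p3 q1 q2 q3 r1 r2 r3 s1 s2 s3) t"
    if "degb p1 (ka + \<mu>)" "degb p2 (kb + \<mu>)" "degb p3 (kc + \<mu>)" "degb q1 ka" "degb q2 kb" "degb q3 kc"
      "degb r1 ka" "degb r2 kb" "degb r3 kc" "degb s1 ka" "degb s2 kb" "degb s3 kc" "t = ka + kb + kc + \<mu>"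
    for p1 p2 p3 q1 q2 q3 r1 r2 r3 s1 s2 s3 ka kb kc t
  proof -
    have A: "degb (of_nat k * f) t" if "degb f t" for k and f :: "complex poly"
      using degb_mult[OF degb_of_nat that, of k] by simp
    show ?thesis unfolding R_def mult_minus_left
      by (intro degb_add degb_diff degb_minus A d3[OF that(1-3) that(7-9) that(10-12)]
        d3[OF that(1-3) that(4-6) that(10-12)] d3[OF that(1-3) that(4-6) that(7-9)] that(13))
  qed
  have "degb R0 (K - d + \<mu>)" unfolding R0_def
    by (rule dR[OF du(2,3,4) dh(2,3,4) dX(2) degb_0 dn degb_0 dY]) (simp add: K_def)
  moreover have "degb R1 (K - d + \<mu>)" unfolding R1_def
    by (intro degb_minus dR[OF du(1,3,4) dh(1,3,4) dX(1) degb_0 dn degb_0 dY]) (simp add: K_def)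
  moreover have "degb R2 (K - e + \<mu>)" unfolding R2_def
    by (rule dR[OF du(1,2,4) dh(1,2,4) dX dn degb_0 degb_0 dY(2)]) (simp add: K_def)
  moreover have "degb R3 (K - e1 + \<mu>)" unfolding R3_def
    by (intro degb_minus dR[OF du(1,2,3) dh(1,2,3) dX degb_0 degb_0 degb_0 dY(1)]) (simp add: K_def)
  ultimately show thesis using that by blast
qed

lemma M_degb: "degb M0 (K - d)" "degb M1 (K - d)" "degb M2 (K - e)" "degb M3 (K - e1)"
proof -
  note th = degb_th[OF dX(1)] degb_th[OF dX(2)] degb_th[OF dY(1)] degb_th[OF dY(2)]
  have W: "degb W (2 * d)" unfolding W_def
    using degb_diff[OF degb_mult[OF th(1) dX(2)] degb_mult[OF th(2) dX(1)]] by simp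
  have U: "degb U (e + e1)" unfolding U_def
    using degb_diff[OF degb_mult[OF th(3) dY(2)] degb_mult[OF th(4) dY(1), unfolded add.commute[of e1]]] by simp
  have V: "degb (of_nat n * f * Y0 * Y1) (K - d)" if "degb f d" for f
    using degb_mult[OF degb_mult[OF degb_mult[OF degb_of_nat[of n] that] dY(1)] dY(2)]
    by (simp add: K_def algebra_simps)
  have X: "degb (f * U) (K - d)" if "degb f d" for f
    using degb_mult[OF that U] by (simp add: K_def algebra_simps)
  show "degb M0 (K - d)" "degb M1 (K - d)" unfolding M0_def M1_def
    by (intro degb_diff degb_minus V X th dX)+
  show "degb M2 (K - e)" "degb M3 (K - e1)" unfolding M2_def M3_def
    using degb_mult[OF dY(1) W] degb_mult[OF dY(2) W] by (simp_all add: K_def algebra_simps)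
qed

lemma Q_smooth_0: "poly Q0 0 \<noteq> 0 \<or> poly Q1 0 \<noteq> 0 \<or> poly Q2 0 \<noteq> 0 \<or> poly Q3 0 \<noteq> 0"
  unfolding poly_P
  by (rule generic_smooth[OF r coprime_poly_no_common_root[OF cX] coprime_poly_no_common_root[OF cY]])

lemmas Q_degb = P_degb[OF dX dY Deg_def, of r]

lemma Q_smooth_inf: "lcoef Q0 (Deg - d) \<noteq> 0 \<or> lcoef Q1 (Deg - d) \<noteq> 0 \<or> lcoef Q2 (Deg - e) \<noteq> 0 \<or> lcoef Q3 (Deg - e1) \<noteq> 0"
  unfolding Q_degb by (rule generic_smooth[OF r lX lY])

lemma monom_c: "monom c m0 = monom 1 m0 * [:c:]" by (simp add: smult_monom)

text \<open>\<open>nu u\<close> is a section of the line bundle \<open>-(K + D)\<close>, of negative degree, twisted by \<open>\<mu>\<close>.\<close>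

lemma nu_zero:
  assumes S: "Q0 * u0 + Q1 * u1 + Q2 * v0 + Q3 * v1 = monom 1 m0 * g" and g: "degb g \<mu>"
  and du: "degb u0 (d + \<mu>)" "degb u1 (d + \<mu>)" "degb v0 (e + \<mu>)" "degb v1 (e1 + \<mu>)"
  and \<mu>: "K + \<mu> < Deg"
  shows "nu u0 u1 v0 v1 = 0"
proof -
  let ?N = "nu u0 u1 v0 v1" and ?t = "monom 1 m0 :: complex poly"
  obtain R0 R1 R2 R3 where R: "Q0 * ?N = ?t * g * M0 + monom c m0 * R0" "degb R0 (K - d + \<mu>)"
    "Q1 * ?N = - (?t * g) * M1 + monom c m0 * R1" "degb R1 (K - d + \<mu>)"
    "Q2 * ?N = ?t * g * M2 + monom c m0 * R2" "degb R2 (K - e + \<mu>)"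
    "Q3 * ?N = - (?t * g) * M3 + monom c m0 * R3" "degb R3 (K - e1 + \<mu>)"
    using cramer[OF S du] by metis
  define T0 T1 T2 T3 where T: "T0 = g * M0 + [:c:] * R0" "T1 = [:c:] * R1 - g * M1"
     "T2 = g * M2 + [:c:] * R2" "T3 = [:c:] * R3 - g * M3"
  have TQ: "Q0 * ?N = ?t * T0" "Q1 * ?N = ?t * T1" "Q2 * ?N = ?t * T2" "Q3 * ?N = ?t * T3"
    unfolding R(1,3,5,7) T monom_c by (simp_all add: algebra_simps)
  have gM: "degb (g * f) (k + \<mu>)" if "degb f k" for f k
    using degb_mult[OF g that] by (simp add: add.commute)
  have cR: "degb ([:c:] * f) k" if "degb f k" for f k using degb_mult[OF degb_const[of c] that] by simp
  have Td: "degb T0 (K - d + \<mu>)" "degb T1 (K - d + \<mu>)" "degb T2 (K - e + \<mu>)" "degb T3 (K - e1 + \<mu>)"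
    unfolding T using gM[OF M_degb(1)] gM[OF M_degb(2)] gM[OF M_degb(3)] gM[OF M_degb(4)]
    by (auto intro!: degb_add degb_diff cR R simp del: mult_pCons_left)
  \<comment> \<open>Over 0 some partial derivative is nonzero, hence coprime to \<open>t\<close>;
    below, a partial derivative that is nonzero at infinity transfers the degree bound.\<close>
  have "?t dvd ?N"
    using Q_smooth_0 coprime_mult_monom_dvd[of m0 _ ?N] TQ by (metis dvd_triv_left)
  then obtain N' where N': "?N = ?t * N'" by blast
  have QN: "Q0 * N' = T0" "Q1 * N' = T1" "Q2 * N' = T2" "Q3 * N' = T3"
  proof -
    have t: "?t \<noteq> 0" by simp
    show "Q0 * N' = T0" "Q1 * N' = T1" "Q2 * N' = T2" "Q3 * N' = T3"
      using TQ unfolding N' using t by (simp_all only: mult.left_commute[of _ ?t] mult_cancel_left simp_thms)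
  qed
  have "degb N' (K + \<mu> - Deg)"
    using Q_smooth_inf
  proof (elim disjE)
    assume "lcoef Q0 (Deg - d) \<noteq> 0"
    then show ?thesis using degb_cancel[OF Td(1)[folded QN(1)] Q_degb(1)] by (simp add: algebra_simps)
  next
    assume "lcoef Q1 (Deg - d) \<noteq> 0"
    then show ?thesis using degb_cancel[OF Td(2)[folded QN(2)] Q_degb(3)] by (simp add: algebra_simps)
  next
    assume "lcoef Q2 (Deg - e) \<noteq> 0"
    then show ?thesis using degb_cancel[OF Td(3)[folded QN(3)] Q_degb(5)] by (simp add: algebra_simps)
  next
    assume "lcoef Q3 (Deg - e1) \<noteq> 0"
    then show ?thesis using degb_cancel[OF Td(4)[folded QN(4)] Q_degb(7)] by (simp add: algebra_simps)
  qed
  then have "N' = 0" using \<mu> by (intro degb_neg) auto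
  then show ?thesis using N' by simp
qed

text \<open>A relation, because \<open>lift\<close> involves the choice of a derivation; by
  \<open>lift_rel\<close> with \<open>g = g' = 1\<close>, the value \<open>N\<close> depends on
  \<open>q\<close> alone.\<close>

definition is_lift :: "(nat \<Rightarrow> nat \<Rightarrow> complex) \<Rightarrow> complex poly \<Rightarrow> bool" where
  "is_lift q N \<longleftrightarrow> (\<exists>u0 u1 v0 v1 c'. degb u0 d \<and> degb u1 d \<and> degb v0 e \<and> degb v1 e1 \<and>
    Q0 * u0 + Q1 * u1 + Q2 * v0 + Q3 * v1 = monom c' m0 - ev q \<and> N = nu u0 u1 v0 v1)"

lemma lift_ex: "supported q \<Longrightarrow> \<exists>N. is_lift q N"
  unfolding is_lift_def using lift by metis

lemma nu_linear: "nu (g * u0 - g' * u0') (g * u1 - g' * u1') (g * v0 - g' * v0') (g * v1 - g' * v1') =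
    g * nu u0 u1 v0 v1 - g' * nu u0' u1' v0' v1'"
  by (simp add: nu_def algebra_simps)

text \<open>In the combination of the two vector fields with factors \<open>g\<close> and
  \<open>g'\<close> the sections cancel by \<open>eq\<close>, leaving a multiple of
  \<open>t^m0\<close>; so \<open>nu_zero\<close> applies, and \<open>nu\<close> is linear.\<close>

lemma lift_rel:
  assumes "is_lift q N" "is_lift q' N'" and g: "degb g \<mu>" "degb g' \<mu>"
    and eq: "g * ev q = g' * ev q'" and \<mu>: "K + \<mu> < Deg"
  shows "g * N = g' * N'"
proof -
  obtain u0 u1 v0 v1 c1 where u: "degb u0 d" "degb u1 d" "degb v0 e" "degb v1 e1"
    "Q0 * u0 + Q1 * u1 + Q2 * v0 + Q3 * v1 = monom c1 m0 - ev q" "N = nu u0 u1 v0 v1"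
    using assms(1) unfolding is_lift_def by blast
  obtain u0' u1' v0' v1' c2 where u': "degb u0' d" "degb u1' d" "degb v0' e" "degb v1' e1"
    "Q0 * u0' + Q1 * u1' + Q2 * v0' + Q3 * v1' = monom c2 m0 - ev q'" "N' = nu u0' u1' v0' v1'"
    using assms(2) unfolding is_lift_def by blast
  have dd: "degb (g * f - g' * f') (k + \<mu>)" if "degb f k" "degb f' k" for f f' k
    using degb_diff[OF degb_mult[OF g(1) that(1)] degb_mult[OF g(2) that(2)]] by (simp add: add.commute)
  have "nu (g * u0 - g' * u0') (g * u1 - g' * u1') (g * v0 - g' * v0') (g * v1 - g' * v1') = 0"
  proof (rule nu_zero[OF _ _ _ _ _ _ \<mu>])
    have "Q0 * (g * u0 - g' * u0') + Q1 * (g * u1 - g' * u1') + Q2 * (g * v0 - g' * v0') + Q3 * (g * v1 - g' * v1')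
      = g * (Q0 * u0 + Q1 * u1 + Q2 * v0 + Q3 * v1) - g' * (Q0 * u0' + Q1 * u1' + Q2 * v0' + Q3 * v1')"
      by (simp add: algebra_simps)
    also have "\<dots> = g * monom c1 m0 - g' * monom c2 m0 + (g' * ev q' - g * ev q)"
      unfolding u u' by (simp add: algebra_simps)
    also have "\<dots> = monom 1 m0 * ([:c1:] * g - [:c2:] * g')"
      unfolding eq using monom_const_mult[of c1 1 m0] monom_const_mult[of c2 1 m0]
      by (simp add: algebra_simps)
    finally show "Q0 * (g * u0 - g' * u0') + Q1 * (g * u1 - g' * u1') + Q2 * (g * v0 - g' * v0') + Q3 * (g * v1 - g' * v1')
      = monom 1 m0 * ([:c1:] * g - [:c2:] * g')" .
    show "degb ([:c1:] * g - [:c2:] * g') \<mu>"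
      using degb_diff[OF degb_mult[OF degb_const g(1)] degb_mult[OF degb_const g(2)]] by simp
  qed (intro dd u u')+
  then show ?thesis unfolding nu_linear u u' by simp
qed

lemma lift_degb: "is_lift q N \<Longrightarrow> degb N K"
proof -
  assume "is_lift q N"
  then obtain u0 u1 v0 v1 where u: "degb u0 d" "degb u1 d" "degb v0 e" "degb v1 e1" "N = nu u0 u1 v0 v1"
    unfolding is_lift_def by blast
  show ?thesis unfolding u(5) nu_def
    using degb_mult[OF u(1) M_degb(1)] degb_mult[OF u(2) M_degb(2)] degb_mult[OF u(3) M_degb(3)] degb_mult[OF u(4) M_degb(4)]
    by (auto intro!: degb_add degb_diff)
qed

end

section \<open>Chains of monomials along the sides of the trapezoid\<close>

context generic_curve
begin

definition corners :: "(nat \<times> nat) set" where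
  "corners = {(0, 0), (b, 0), (0, a), (b - n * a, a)}"

definition N :: "nat \<Rightarrow> nat \<Rightarrow> complex poly" where
  "N i j = (SOME N. is_lift (single i j) N)"

lemma N: "(i, j) \<in> Idx \<Longrightarrow> is_lift (single i j) (N i j)"
  unfolding N_def by (rule someI_ex) (rule lift_ex[OF supported_single])

lemma ev_single:
  assumes "(i, j) \<in> Idx" shows "ev (single i j) = mon i j"
proof -
  have "(\<lambda>i' j'. [:single i j i' j':]) = (single i j :: nat \<Rightarrow> nat \<Rightarrow> complex poly)"
    by (auto simp: single_def fun_eq_iff one_pCons)
  then show ?thesis using Pev_single[OF assms, of X0 X1 Y0 Y1] by simp
qed

lemma N_rel:
  assumes "(i, j) \<in> Idx" "(i', j') \<in> Idx" "degb g \<mu>" "degb g' \<mu>" "K + \<mu> < Deg" "g * mon i j = g' * mon i' j'"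
  shows "g * N i j = g' * N i' j'"
  using lift_rel[OF N[OF assms(1)] N[OF assms(2)] assms(3,4) _ assms(5)] assms(6) ev_single assms(1,2) by simp

text \<open>Neighbours in a row of the trapezoid differ by the factor \<open>X1 / X0\<close>, so
  their relation has degree \<open>d\<close>.\<close>

lemma x_step:
  assumes "j \<le> a" "Suc i + n * j \<le> b"
  shows "X0 * N (Suc i) j = X1 * N i j"
proof (rule N_rel[OF _ _ dX K_d_less])
  show "(Suc i, j) \<in> Idx" "(i, j) \<in> Idx" using assms by (auto simp: Idx_def)
  have "b - i - n * j = Suc (b - Suc i - n * j)" using assms by simp
  then show "X0 * mon (Suc i) j = X1 * mon i j" by (simp add: mono_def)
qed

lemma x_chain:
  assumes "j \<le> a" "i + n * j \<le> b"
  shows "X0 ^ i * N i j = X1 ^ i * N 0 j"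
  using assms(2)
proof (induction i)
  case (Suc i)
  have "X0 ^ Suc i * N (Suc i) j = X0 ^ i * (X0 * N (Suc i) j)" by (simp add: mult_ac)
  also have "\<dots> = X1 * (X0 ^ i * N i j)" using x_step[OF assms(1) Suc.prems] by (simp add: mult_ac)
  also have "\<dots> = X1 ^ Suc i * N 0 j" using Suc by (simp add: mult_ac)
  finally show ?case .
qed simp

lemma degb_Y0_X: "degb (Y0 * X0 ^ n) e1" "degb (Y0 * X1 ^ n) e1"
  using degb_mult[OF dY(1) degb_power[OF dX(1)]] degb_mult[OF dY(1) degb_power[OF dX(2)]] by auto

text \<open>A step up the side \<open>i = 0\<close>: the higher row is shorter by \<open>n\<close>,
  so \<open>Y1\<close> is exchanged for \<open>Y0 * X0 ^ n\<close>, of the same degree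
  \<open>e1\<close>.\<close>

lemma y_step0:
  assumes "j < a"
  shows "(Y0 * X0 ^ n) * N 0 (Suc j) = Y1 * N 0 j"
proof (rule N_rel[OF _ _ degb_Y0_X(1) dY(2) K_e1_less])
  show "(0, Suc j) \<in> Idx" "(0, j) \<in> Idx" using assms Idx_corner by auto
  have 1: "b - n * j = n + (b - n * Suc j)" using n_mult_le[of "Suc j"] assms by simp
  have 2: "a - j = Suc (a - Suc j)" using assms by simp
  have "(Y0 * X0 ^ n) * mon 0 (Suc j) = (X0 ^ n * X0 ^ (b - n * Suc j)) * (Y0 * Y0 ^ (a - Suc j)) * (Y1 * Y1 ^ j)"
    by (simp add: mono_def mult_ac)
  also have "\<dots> = X0 ^ (b - n * j) * Y0 ^ (a - j) * (Y1 * Y1 ^ j)"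
    unfolding 1 2 by (simp only: power_add power_Suc)
  also have "\<dots> = Y1 * mon 0 j" by (simp add: mono_def mult_ac)
  finally show "(Y0 * X0 ^ n) * mon 0 (Suc j) = Y1 * mon 0 j" .
qed

lemma y_chain0: "j \<le> a \<Longrightarrow> (Y0 * X0 ^ n) ^ j * N 0 j = Y1 ^ j * N 0 0"
proof (induction j)
  case (Suc j)
  have "(Y0 * X0 ^ n) ^ Suc j * N 0 (Suc j) = (Y0 * X0 ^ n) ^ j * ((Y0 * X0 ^ n) * N 0 (Suc j))"
    by (simp only: power_Suc mult_ac)
  also have "\<dots> = Y1 * ((Y0 * X0 ^ n) ^ j * N 0 j)" unfolding y_step0[OF Suc_le_lessD[OF Suc.prems]] by (simp only: mult_ac)
  also have "\<dots> = Y1 ^ Suc j * N 0 0" using Suc by (simp add: mult_ac)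
  finally show ?case .
qed simp

text \<open>A step up the opposite side, where \<open>X1\<close> carries the whole base
  degree.\<close>

lemma y_step1:
  assumes "j < a"
  shows "(Y0 * X1 ^ n) * N (b - n * Suc j) (Suc j) = Y1 * N (b - n * j) j"
proof (rule N_rel[OF _ _ degb_Y0_X(2) dY(2) K_e1_less])
  show "(b - n * Suc j, Suc j) \<in> Idx" "(b - n * j, j) \<in> Idx" using assms Idx_corner[of "Suc j"] Idx_corner[of j] by auto
  have 1: "b - n * j = n + (b - n * Suc j)" using n_mult_le[of "Suc j"] assms by simp
  have 2: "a - j = Suc (a - Suc j)" using assms by simp
  have "(Y0 * X1 ^ n) * mon (b - n * Suc j) (Suc j) = (X1 ^ n * X1 ^ (b - n * Suc j)) * (Y0 * Y0 ^ (a - Suc j)) * (Y1 * Y1 ^ j)"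
    using n_mult_le[of "Suc j"] assms by (simp add: mono_def mult_ac)
  also have "\<dots> = X1 ^ (b - n * j) * Y0 ^ (a - j) * (Y1 * Y1 ^ j)"
    unfolding 1 2 by (simp only: power_add power_Suc)
  also have "\<dots> = Y1 * mon (b - n * j) j" using n_mult_le[of j] assms by (simp add: mono_def mult_ac)
  finally show "(Y0 * X1 ^ n) * mon (b - n * Suc j) (Suc j) = Y1 * mon (b - n * j) j" .
qed

lemma y_chain1: "j \<le> a \<Longrightarrow> (Y0 * X1 ^ n) ^ j * N (b - n * j) j = Y1 ^ j * N b 0"
proof (induction j)
  case (Suc j)
  have "(Y0 * X1 ^ n) ^ Suc j * N (b - n * Suc j) (Suc j) = (Y0 * X1 ^ n) ^ j * ((Y0 * X1 ^ n) * N (b - n * Suc j) (Suc j))"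
    by (simp only: power_Suc mult_ac)
  also have "\<dots> = Y1 * ((Y0 * X1 ^ n) ^ j * N (b - n * j) j)" unfolding y_step1[OF Suc_le_lessD[OF Suc.prems]] by (simp only: mult_ac)
  also have "\<dots> = Y1 ^ Suc j * N b 0" using Suc by (simp add: mult_ac)
  finally show ?case .
qed simp

text \<open>The length of the row \<open>j = a\<close>.\<close>

definition "B = b - n * a"

lemma B: "B \<ge> 3" "b = B + n * a" using ban by (simp_all add: B_def mult.commute)

lemma mon_corner: "mon 0 0 = X0 ^ b * Y0 ^ a" "mon b 0 = X1 ^ b * Y0 ^ a" "mon 0 a = X0 ^ B * Y1 ^ a"
  "mon B a = X1 ^ B * Y1 ^ a"
proof -
  have "b - n * a = B" "b - B - n * a = 0" using B(2) by simp_all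
  then show "mon 0 0 = X0 ^ b * Y0 ^ a" "mon b 0 = X1 ^ b * Y0 ^ a" "mon 0 a = X0 ^ B * Y1 ^ a"
    "mon B a = X1 ^ B * Y1 ^ a" by (simp_all add: mono_def)
qed

lemma power_b: "f ^ b = f ^ B * f ^ (n * a)" for f :: "complex poly"
  using B(2) power_add by metis

text \<open>The steps along each side telescope; common factors are then restored so that full
  vertex monomials appear.\<close>

lemma edges:
  "mon 0 0 * N b 0 = mon b 0 * N 0 0" "mon 0 a * N B a = mon B a * N 0 a"
  "mon 0 0 * N 0 a = mon 0 a * N 0 0" "mon b 0 * N B a = mon B a * N b 0"
proof -
  show "mon 0 0 * N b 0 = mon b 0 * N 0 0"
    using x_chain[of 0 b] unfolding mon_corner by (simp add: mult_ac)
  show "mon 0 a * N B a = mon B a * N 0 a"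
    using x_chain[of a B] B unfolding mon_corner by (simp add: mult_ac)
  have y0: "Y0 ^ a * X0 ^ (n * a) * N 0 a = Y1 ^ a * N 0 0"
    using y_chain0[of a] by (simp add: power_mult_distrib power_mult)
  have "mon 0 0 * N 0 a = X0 ^ B * (Y0 ^ a * X0 ^ (n * a) * N 0 a)"
    unfolding mon_corner power_b by (simp only: mult_ac)
  also have "\<dots> = mon 0 a * N 0 0" unfolding y0 mon_corner by (simp only: mult_ac)
  finally show "mon 0 0 * N 0 a = mon 0 a * N 0 0" .
  have y1: "Y0 ^ a * X1 ^ (n * a) * N B a = Y1 ^ a * N b 0"
    using y_chain1[of a] by (simp add: power_mult_distrib power_mult B_def[symmetric])
  have "mon b 0 * N B a = X1 ^ B * (Y0 ^ a * X1 ^ (n * a) * N B a)"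
    unfolding mon_corner power_b by (simp only: mult_ac)
  also have "\<dots> = mon B a * N b 0" unfolding y1 mon_corner by (simp only: mult_ac)
  finally show "mon b 0 * N B a = mon B a * N b 0" .
qed

lemma mult_trans:
  fixes p q s x y z :: "complex poly"
  assumes "p * y = q * x" "q * z = s * y" "q \<noteq> 0"
  shows "p * z = s * x"
proof -
  have "q * (p * z) = p * (q * z)" by (simp only: mult_ac)
  also have "\<dots> = s * (p * y)" unfolding assms(2) by (simp only: mult_ac)
  also have "\<dots> = q * (s * x)" unfolding assms(1) by (simp only: mult_ac)
  finally show ?thesis using assms(3) by simp
qed

text \<open>Sides join adjacent vertices. A diagonal needs a third vertex, whose monomial must be
  cancelled; it is nonzero because its base coordinate occurs at one end of the diagonal and its
  fibre coordinate at the other.\<close>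

lemma corner_rel:
  assumes "(i, j) \<in> corners" "(i', j') \<in> corners" "mon i j \<noteq> 0" "mon i' j' \<noteq> 0"
  shows "mon i j * N i' j' = mon i' j' * N i j"
proof -
  have b: "b \<noteq> 0" "a \<noteq> 0" "B \<noteq> 0" using a4 b4 B by auto
  have 1: "mon 0 0 * N B a = mon B a * N 0 0" if "mon 0 0 \<noteq> 0" "mon B a \<noteq> 0"
  proof -
    have "mon 0 a \<noteq> 0" using that b by (simp add: mon_corner)
    then show ?thesis using mult_trans[OF edges(3) edges(2)] by blast
  qed
  have 2: "mon b 0 * N 0 a = mon 0 a * N b 0" if "mon b 0 \<noteq> 0" "mon 0 a \<noteq> 0"
  proof -
    have "mon 0 0 \<noteq> 0" using that b by (simp add: mon_corner)
    then show ?thesis using mult_trans[OF edges(1)[symmetric] edges(3)] by blast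
  qed
  define rel where "rel i j i' j' \<longleftrightarrow>
    (mon i j \<noteq> 0 \<longrightarrow> mon i' j' \<noteq> 0 \<longrightarrow> mon i j * N i' j' = mon i' j' * N i j)" for i j i' j'
  have rel: "rel i j i j" for i j by (simp add: rel_def)
  have rel_sym: "rel i j i' j' \<Longrightarrow> rel i' j' i j" for i j i' j' unfolding rel_def by metis
  have r: "rel 0 0 b 0" "rel 0 a B a" "rel 0 0 0 a" "rel b 0 B a" "rel 0 0 B a" "rel b 0 0 a"
    unfolding rel_def using edges 1 2 by blast+
  have c: "corners = {(0, 0), (b, 0), (0, a), (B, a)}" by (simp add: corners_def B_def)
  have "rel i j i' j'"
    using assms(1,2) rel r r[THEN rel_sym] unfolding c by (elim insertE emptyE; simp only: prod.inject; blast)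
  then show ?thesis using assms(3,4) by (simp only: rel_def simp_thms)
qed

lemma corner_Idx': "(i, j) \<in> corners \<Longrightarrow> (i, j) \<in> Idx"
  using corner_Idx by (simp add: corners_def)

lemma corner_inf: obtains i j where "(i, j) \<in> corners" "lcoef (mon i j) Deg \<noteq> 0"
proof -
  obtain i j where "(i, j) \<in> corners" "mono i j (lcoef X0 d) (lcoef X1 d) (lcoef Y0 e) (lcoef Y1 e1) \<noteq> 0"
    using corner_nonzero[OF lX lY] unfolding corners_def by metis
  then show thesis using that mono_degb(2)[OF dX dY Deg_def corner_Idx'] by metis
qed

lemma poly_mon: "poly (mon i j) t = mono i j (poly X0 t) (poly X1 t) (poly Y0 t) (poly Y1 t)"
  by (simp add: mono_def)

lemma corner_0: obtains i j where "(i, j) \<in> corners" "poly (mon i j) 0 \<noteq> 0"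
  using corner_nonzero[OF coprime_poly_no_common_root[OF cX, of 0] coprime_poly_no_common_root[OF cY, of 0]]
  unfolding corners_def poly_mon by metis

text \<open>Coprimality is used twice: first for \<open>X0\<close>, \<open>X1\<close> in each of the
  two rows, then for \<open>Y0\<close>, \<open>Y1\<close>.\<close>

lemma corner_gcd:
  assumes "\<And>i j. (i, j) \<in> corners \<Longrightarrow> f dvd mon i j * g"
  shows "f dvd g"
proof -
  have c: "(0, 0) \<in> corners" "(b, 0) \<in> corners" "(0, a) \<in> corners" "(B, a) \<in> corners"
    by (auto simp: corners_def B_def)
  have "f dvd X0 ^ b * (Y0 ^ a * g)" "f dvd X1 ^ b * (Y0 ^ a * g)" "f dvd X0 ^ B * (Y1 ^ a * g)" "f dvd X1 ^ B * (Y1 ^ a * g)"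
    using assms[OF c(1)] assms[OF c(2)] assms[OF c(3)] assms[OF c(4)] by (simp_all add: mon_corner mult.assoc)
  moreover have "coprime (X0 ^ b) (X1 ^ b)" "coprime (X0 ^ B) (X1 ^ B)" "coprime (Y0 ^ a) (Y1 ^ a)"
    using cX cY by (simp_all add: coprime_power_left_iff coprime_power_right_iff)
  ultimately show ?thesis by (meson dvd_of_dvd_mult_coprime)
qed

text \<open>A vertex monomial that is nonzero at infinity divides, by proportionality, the product
  of its own \<open>N\<close> with every vertex monomial, hence \<open>N\<close> itself; the
  quotient has degree at most \<open>K - Deg < 0\<close>. Proportionality then spreads the vanishing
  to the other vertices.\<close>

lemma N_corner_zero:
  assumes "(i, j) \<in> corners" "mon i j \<noteq> 0" shows "N i j = 0"
proof -
  obtain k l where kl: "(k, l) \<in> corners" "lcoef (mon k l) Deg \<noteq> 0" using corner_inf by blast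
  have nz: "mon k l \<noteq> 0" using kl(2) by auto
  have "mon k l dvd N k l"
  proof (rule corner_gcd)
    fix i j assume ij: "(i, j) \<in> corners"
    show "mon k l dvd mon i j * N k l"
    proof (cases "mon i j = 0")
      case False
      then show ?thesis using corner_rel[OF kl(1) ij nz] by (metis dvd_triv_left)
    qed simp
  qed
  then obtain q where q: "N k l = mon k l * q" by blast
  have "degb (mon k l * q) K" using lift_degb[OF N[OF corner_Idx'[OF kl(1)]]] q by simp
  then have "degb q (K - Deg)" using degb_cancel mono_degb(1)[OF dX dY Deg_def corner_Idx'[OF kl(1)]] kl(2) by blast
  then have "q = 0" using K_less by (intro degb_neg) auto
  then have "mon k l * N i j = 0" using corner_rel[OF kl(1) assms(1) nz assms(2)] q by simp
  then show ?thesis using nz by simp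
qed

text \<open>With \<open>nu = 0\<close> Cramer's rule becomes a divisibility for the minors: the
  vertex monomial is the only part of \<open>S\<close> that is not visibly a multiple of
  \<open>t^m0\<close>.\<close>

lemma corner_minors:
  assumes "(i, j) \<in> corners" "mon i j \<noteq> 0"
  obtains R0 R1 R2 R3 where "mon i j * M0 = monom 1 m0 * R0" "mon i j * M1 = monom 1 m0 * R1"
    "mon i j * M2 = monom 1 m0 * R2" "mon i j * M3 = monom 1 m0 * R3"
    "degb R0 (K - d)" "degb R1 (K - d)" "degb R2 (K - e)" "degb R3 (K - e1)"
proof -
  obtain u0 u1 v0 v1 c' where u: "degb u0 d" "degb u1 d" "degb v0 e" "degb v1 e1"
    "Q0 * u0 + Q1 * u1 + Q2 * v0 + Q3 * v1 = monom c' m0 - mon i j" "nu u0 u1 v0 v1 = 0"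
    using N[OF corner_Idx'[OF assms(1)]] N_corner_zero[OF assms] ev_single[OF corner_Idx'[OF assms(1)]]
    unfolding is_lift_def by metis
  obtain R0 R1 R2 R3 where R: "Q0 * nu u0 u1 v0 v1 = (monom c' m0 - mon i j) * M0 + monom c m0 * R0" "degb R0 (K - d + 0)"
    "Q1 * nu u0 u1 v0 v1 = - (monom c' m0 - mon i j) * M1 + monom c m0 * R1" "degb R1 (K - d + 0)"
    "Q2 * nu u0 u1 v0 v1 = (monom c' m0 - mon i j) * M2 + monom c m0 * R2" "degb R2 (K - e + 0)"
    "Q3 * nu u0 u1 v0 v1 = - (monom c' m0 - mon i j) * M3 + monom c m0 * R3" "degb R3 (K - e1 + 0)"
    by (rule cramer[OF u(5), of 0]) (use u in auto)
  have mc: "monom k m0 = monom 1 m0 * [:k:]" for k :: complex by (simp add: smult_monom)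
  have dc: "degb ([:k:] * f) t" if "degb f t" for k :: complex and f t using degb_mult[OF degb_const that, of k] by simp
  note E = R(1,3,5,7)[unfolded u(6) mult_zero_right mc[of c'] mc[of c]]
  show thesis
  proof (rule that[of "[:c':] * M0 + [:c:] * R0" "[:c':] * M1 - [:c:] * R1" "[:c':] * M2 + [:c:] * R2" "[:c':] * M3 - [:c:] * R3"])
    show "mon i j * M0 = monom 1 m0 * ([:c':] * M0 + [:c:] * R0)" using E(1) by algebra
    show "mon i j * M1 = monom 1 m0 * ([:c':] * M1 - [:c:] * R1)" using E(2) by algebra
    show "mon i j * M2 = monom 1 m0 * ([:c':] * M2 + [:c:] * R2)" using E(3) by algebra
    show "mon i j * M3 = monom 1 m0 * ([:c':] * M3 - [:c:] * R3)" using E(4) by algebra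
  qed (use R M_degb in \<open>auto intro!: degb_add degb_diff dc simp del: mult_pCons_left\<close>)
qed

text \<open>A vertex monomial nonzero at 0 gives the divisibility by \<open>t^m0\<close>, one
  nonzero at infinity the degree bounds; they may be different vertices.\<close>

lemma minors:
  obtains R0 R1 R2 R3 where "M0 = monom 1 m0 * R0" "M1 = monom 1 m0 * R1" "M2 = monom 1 m0 * R2" "M3 = monom 1 m0 * R3"
    "degb R0 (K - d - Deg)" "degb R1 (K - d - Deg)" "degb R2 (K - e - Deg)" "degb R3 (K - e1 - Deg)"
proof -
  let ?t = "monom 1 m0 :: complex poly"
  obtain i j where ij: "(i, j) \<in> corners" "poly (mon i j) 0 \<noteq> 0" using corner_0 by blast
  then have "mon i j \<noteq> 0" by (metis poly_0)
  then obtain R0 R1 R2 R3 where "mon i j * M0 = ?t * R0" "mon i j * M1 = ?t * R1" "mon i j * M2 = ?t * R2" "mon i j * M3 = ?t * R3"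
    using corner_minors[OF ij(1)] by metis
  then have "?t dvd M0" "?t dvd M1" "?t dvd M2" "?t dvd M3"
    using coprime_mult_monom_dvd[OF _ ij(2)] by (metis dvd_triv_left)+
  then obtain S0 S1 S2 S3 where S: "M0 = ?t * S0" "M1 = ?t * S1" "M2 = ?t * S2" "M3 = ?t * S3" by (meson dvdE)
  obtain k l where kl: "(k, l) \<in> corners" "lcoef (mon k l) Deg \<noteq> 0" using corner_inf by blast
  have nz: "mon k l \<noteq> 0" using kl(2) by auto
  obtain T0 T1 T2 T3 where T: "mon k l * M0 = ?t * T0" "mon k l * M1 = ?t * T1"
    "mon k l * M2 = ?t * T2" "mon k l * M3 = ?t * T3"
    "degb T0 (K - d)" "degb T1 (K - d)" "degb T2 (K - e)" "degb T3 (K - e1)"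
    using corner_minors[OF kl(1) nz] by metis
  have "?t \<noteq> 0" by simp
  then have "mon k l * S0 = T0" "mon k l * S1 = T1" "mon k l * S2 = T2" "mon k l * S3 = T3"
    using T(1-4) unfolding S by (simp_all only: mult.left_commute[of _ ?t] mult_cancel_left simp_thms)
  then have "degb S0 (K - d - Deg)" "degb S1 (K - d - Deg)" "degb S2 (K - e - Deg)" "degb S3 (K - e1 - Deg)"
    using T(5-8) degb_cancel[OF _ mono_degb(1)[OF dX dY Deg_def corner_Idx'[OF kl(1)]] kl(2)] by blast+
  then show thesis using that S by blast
qed

text \<open>\<open>W\<close> is \<open>t\<close> times the Wronskian of the map to the base. Cleared
  of \<open>t^m0\<close> it is a section of degree \<open>2 * d - Deg\<close>, which is negative for
  \<open>d > 0\<close>.\<close>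

lemma d_zero: "d = 0"
proof (rule ccontr)
  assume "d \<noteq> 0"
  then have dpos: "d > 0" using d0 by simp
  let ?t = "monom 1 m0 :: complex poly"
  obtain R0 R1 R2 R3 where R: "M2 = ?t * R2" "M3 = ?t * R3" "degb R2 (K - e - Deg)" "degb R3 (K - e1 - Deg)"
    by (rule minors)
  have t: "?t \<noteq> 0" by simp
  have "?t dvd Y1 * W" "?t dvd Y0 * W" using R(1,2) unfolding M2_def M3_def by simp_all
  then have "?t dvd W" using dvd_of_dvd_mult_coprime cY by blast
  then obtain W' where W': "W = ?t * W'" by blast
  have "Y1 * W' = R2" "Y0 * W' = R3" using R(1,2) t unfolding M2_def M3_def W'
    by (simp_all only: mult.left_commute[of _ ?t] mult_cancel_left simp_thms)
  then have "degb W' (2 * d - Deg)"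
    using lY degb_cancel[OF _ dY(1), of W' "K - e1 - Deg"] degb_cancel[OF _ dY(2), of W' "K - e - Deg"] R(3,4)
    by (auto simp: K_def algebra_simps)
  moreover have "2 * d < Deg"
  proof (cases "0 \<le> e")
    case True
    have "2 * d < int b * d" using b4 dpos by simp
    moreover have "0 \<le> int a * e" using True by simp
    ultimately show ?thesis unfolding Deg_def by linarith
  next
    case False
    then have e: "e = - int n * d" using e_cases by simp
    have "Deg = (int b - int (a * n)) * d" unfolding Deg_def unfolding e by (simp add: algebra_simps)
    moreover have "int b - int (a * n) \<ge> 3" using ban by linarith
    ultimately show ?thesis using dpos mult_right_mono[of 3 "int b - int (a * n)" d] by linarith
  qed
  ultimately have "W' = 0" by (intro degb_neg) auto
  then have "W = 0" using W' by simp
  then have "th X0 * X1 = th X1 * X0" by (simp add: W_def)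
  then have "[:0, 1:] * (pderiv X0 * X1) = [:0, 1:] * (X0 * pderiv X1)"
    by (simp only: th_def mult_ac)
  then have "pderiv X0 * X1 = X0 * pderiv X1" by (simp only: mult_cancel_left) simp
  from wronskian_zero_imp_const[OF cX this]
  have "d = 0" using lX degree_of_lcoef(1)[OF dX(1)] degree_of_lcoef(1)[OF dX(2)] by auto
  then show False using dpos by simp
qed

text \<open>The curve now lies in a fibre: \<open>th X0\<close> and \<open>th X1\<close> vanish, and
  \<open>M0\<close>, \<open>M1\<close> reduce to multiples of \<open>U\<close>, which is
  \<open>t\<close> times the Wronskian of the fibre coordinates.\<close>

theorem contradiction: False
proof -
  have epos: "e > 0" using nonconst d_zero by simp
  let ?t = "monom 1 m0 :: complex poly"
  obtain R0 R1 R2 R3 where R: "M0 = ?t * R0" "M1 = ?t * R1" "degb R0 (K - d - Deg)" "degb R1 (K - d - Deg)"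
    by (rule minors)
  have "degree X0 = 0" "degree X1 = 0" using dX d_zero degb_iff_degree[of X0 0] degb_iff_degree[of X1 0]
    by (cases "X0 = 0"; cases "X1 = 0"; simp)+
  then have "th X0 = 0" "th X1 = 0" by (auto simp: th_def pderiv_eq_0_iff)
  then have M: "M0 = - (X1 * U)" "M1 = - (X0 * U)" by (simp_all add: M0_def M1_def)
  have t: "?t \<noteq> 0" by simp
  have "X1 * U = ?t * (- R0)" "X0 * U = ?t * (- R1)" using R(1,2) unfolding M by (metis mult_minus_right minus_minus)+
  note XU = this
  then have "?t dvd X1 * U" "?t dvd X0 * U" by simp_all
  then have "?t dvd U" using dvd_of_dvd_mult_coprime cX by blast
  then obtain U' where U': "U = ?t * U'" by blast
  have "X1 * U' = - R0" "X0 * U' = - R1" using XU t unfolding U'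
    by (simp_all only: mult.left_commute[of _ ?t] mult_cancel_left simp_thms)
  then have "degb U' (K - d - Deg - d)"
    using lX degb_cancel[OF _ dX(1), of U' "K - d - Deg"] degb_cancel[OF _ dX(2), of U' "K - d - Deg"]
      degb_minus[OF R(3)] degb_minus[OF R(4)] by auto
  moreover have "K - d - Deg - d < 0" using K_less d_zero by simp
  ultimately have "U' = 0" by (intro degb_neg) auto
  then have "U = 0" using U' by simp
  then have "th Y0 * Y1 = th Y1 * Y0" by (simp add: U_def)
  then have "[:0, 1:] * (pderiv Y0 * Y1) = [:0, 1:] * (Y0 * pderiv Y1)"
    by (simp only: th_def mult_ac)
  then have "pderiv Y0 * Y1 = Y0 * pderiv Y1" by (simp only: mult_cancel_left) simp
  from wronskian_zero_imp_const[OF cY this]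
  have "e = 0" using lY degree_of_lcoef(1)[OF dY(1)] degree_of_lcoef(1)[OF dY(2)] d_zero by auto
  then show False using epos by simp
qed

end

section \<open>Plane curves\<close>

text \<open>Polynomials in \<open>u, v\<close> are elements of \<open>\<complex>[u][v]\<close>.\<close>

definition ev2 :: "complex poly poly \<Rightarrow> complex \<Rightarrow> complex \<Rightarrow> complex" where
  "ev2 f u v = poly (poly f [:v:]) u"

lemma ev2_simps [simp]: "ev2 (f + g) u v = ev2 f u v + ev2 g u v" "ev2 (f - g) u v = ev2 f u v - ev2 g u v"
  "ev2 (f * g) u v = ev2 f u v * ev2 g u v" "ev2 (f ^ k) u v = ev2 f u v ^ k" "ev2 0 u v = 0" "ev2 1 u v = 1"
  "ev2 (- f) u v = - ev2 f u v" "ev2 [:[:c:]:] u v = c" "ev2 [:[:0, 1:]:] u v = u" "ev2 [:0, 1:] u v = v"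
  "ev2 [:c':] u v = poly c' u"
  by (simp_all add: ev2_def)

lemma ev2_sum: "ev2 (sum f A) u v = (\<Sum>i\<in>A. ev2 (f i) u v)"
  by (simp add: ev2_def poly_sum)

lemma infinite_UNIV_complex: "infinite (UNIV :: complex set)"
  by (rule infinite_UNIV_char_0)

lemma ev2_nonzero_ex:
  assumes "f \<noteq> 0" shows "\<exists>u v. ev2 f u v \<noteq> 0"
proof -
  have "finite {x. poly f x = 0}" using assms by (rule poly_roots_finite)
  moreover have "infinite (range (\<lambda>v :: complex. [:v:]))"
    using infinite_UNIV_complex by (subst finite_image_iff) (auto simp: inj_on_def)
  ultimately have "\<not> range (\<lambda>v. [:v:]) \<subseteq> {x. poly f x = 0}" using finite_subset by blast
  then obtain v where v: "poly f [:v:] \<noteq> 0" by auto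
  then obtain u where "poly (poly f [:v:]) u \<noteq> 0" using poly_all_0_iff_0 by blast
  then show ?thesis by (auto simp: ev2_def)
qed

text \<open>Turns identities known on an open part of the plane into identities of
  polynomials.\<close>

lemma ev2_eqI:
  assumes "d \<noteq> 0" "\<And>u v. ev2 d u v \<noteq> 0 \<Longrightarrow> ev2 f u v = ev2 g u v" shows "f = g"
proof -
  have "ev2 (d * (f - g)) u v = 0" for u v using assms(2)[of u v] by auto
  then have "d * (f - g) = 0" using ev2_nonzero_ex by blast
  then show ?thesis using assms(1) by simp
qed

lemma irreducible_bipoly_prime: "irreducible (g :: complex poly poly) \<Longrightarrow> prime_elem g"
  by (rule irreducible_imp_prime_elem)

text \<open>An element of minimal degree in \<open>v\<close> of the ideal generated by \<open>g\<close> and \<open>h\<close> lies in \<open>\<complex>[u]\<close>.\<close>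

lemma eliminate:
  fixes g h :: "complex poly poly"
  assumes g: "irreducible g" "degree g > 0" and h: "\<not> g dvd h"
  obtains s t c where "s * g + t * h = [:c:]" "c \<noteq> 0"
proof -
  define J where "J = {s * g + t * h | s t. True}"
  have JI: "s * x + t * y \<in> J" if "x \<in> J" "y \<in> J" for s t x y
  proof -
    obtain s1 t1 s2 t2 where "x = s1 * g + t1 * h" "y = s2 * g + t2 * h" using \<open>x \<in> J\<close> \<open>y \<in> J\<close> by (auto simp: J_def)
    then have "s * x + t * y = (s * s1 + t * s2) * g + (s * t1 + t * t2) * h" by (simp add: algebra_simps)
    then show ?thesis unfolding J_def by blast
  qed
  have gJ: "g \<in> J" unfolding J_def by (intro CollectI exI[of _ 1] exI[of _ 0]) simp
  have hJ: "h \<in> J" unfolding J_def by (intro CollectI exI[of _ 0] exI[of _ 1]) simp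
  have "\<exists>f. f \<in> J \<and> f \<noteq> 0" using gJ g by auto
  then obtain f where f: "f \<in> J" "f \<noteq> 0" "\<And>f'. f' \<in> J \<Longrightarrow> f' \<noteq> 0 \<Longrightarrow> degree f \<le> degree f'"
    using ex_has_least_nat[of "\<lambda>f. f \<in> J \<and> f \<noteq> 0" _ degree] by blast
  \<comment> \<open>Up to a factor in \<open>u\<close> alone, \<open>f\<close> divides every element
    of the ideal, as a nonzero pseudo-remainder would have smaller degree.\<close>
  have div: "\<exists>l q. l \<noteq> 0 \<and> [:l:] * x = f * q" if "x \<in> J" for x
  proof -
    obtain l q where l: "l \<noteq> 0" "smult l x = f * q + pseudo_mod x f" using pseudo_mod(1)[OF f(2), of x] by auto
    have "[:l:] * x + (- q) * f \<in> J" using JI that f(1) by blast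
    then have "pseudo_mod x f \<in> J" using l(2) by (simp add: algebra_simps)
    then have "pseudo_mod x f = 0" using f(3) pseudo_mod(2)[OF f(2), of x] by force
    then show ?thesis using l by auto
  qed
  have p: "prime_elem g" using g(1) by (rule irreducible_bipoly_prime)
  have gl: "\<not> g dvd [:l:]" if "l \<noteq> 0" for l using dvd_imp_degree_le[of g "[:l:]"] that g(2) by auto
  \<comment> \<open>The prime \<open>g\<close> divides \<open>f\<close> or the cofactor. The latter
    would make \<open>f\<close> a divisor of a polynomial in \<open>u\<close> alone, the former
    would make \<open>g\<close> a divisor of \<open>h\<close>.\<close>
  have "degree f = 0"
  proof (rule ccontr)
    assume df: "degree f \<noteq> 0"
    obtain l q where l: "l \<noteq> 0" "[:l:] * g = f * q" using div[OF gJ] by blast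
    have "g dvd f * q" using l(2) by (metis dvd_triv_right)
    then have "g dvd f"
    proof (rule prime_elem_dvd_multD[OF p, THEN disjE])
      assume "g dvd q"
      then obtain q' where "q = g * q'" by blast
      then have "g * (f * q') = g * [:l:]" using l(2) by (simp add: mult_ac)
      moreover have "g \<noteq> 0" using g by auto
      ultimately have "f * q' = [:l:]" by (simp only: mult_cancel_left simp_thms)
      then have "f dvd [:l:]" by (metis dvd_triv_left)
      then show ?thesis using dvd_imp_degree_le[of f "[:l:]"] l df by auto
    qed
    moreover obtain l' q' where l': "l' \<noteq> 0" "[:l':] * h = f * q'" using div[OF hJ] by blast
    ultimately have "g dvd [:l':] * h" by (metis dvd_mult2)
    then show False using prime_elem_dvd_multD[OF p] gl[OF l'(1)] h by blast
  qed
  then obtain c where "f = [:c:]" using degree_eq_zeroE by blast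
  moreover obtain s t where "f = s * g + t * h" using f(1) unfolding J_def by blast
  ultimately show thesis using f(2) that[of s t c] by simp
qed

lemma poly_map_poly_eval: "poly (map_poly (\<lambda>c. poly c u) g) v = ev2 g u v"
  unfolding ev2_def by (induction g) (simp_all add: map_poly_pCons)

lemma ev2_root_ex:
  assumes "poly (lead_coeff g) u \<noteq> 0" "degree g > 0"
  obtains v where "ev2 g u v = 0"
proof -
  let ?f = "map_poly (\<lambda>c. poly c u) g"
  have "coeff ?f (degree g) \<noteq> 0" using assms(1) by (simp add: coeff_map_poly)
  then have "degree ?f > 0" using assms(2) le_degree by fastforce
  then have "\<not> constant (poly ?f)" by (simp add: constant_degree)
  then obtain v where "poly ?f v = 0" using fundamental_theorem_of_algebra by blast
  then show thesis using that poly_map_poly_eval by simp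
qed

text \<open>If \<open>g\<close> involves \<open>v\<close> and does not divide \<open>h\<close>,
  \<open>eliminate\<close> gives a nonzero polynomial in \<open>u\<close> that vanishes on the
  projection of the curve \<open>g = 0\<close>; but almost every \<open>u\<close> carries a point of
  that curve. Otherwise \<open>g\<close> is, up to a unit, linear in \<open>u\<close> alone, and
  every coefficient of \<open>h\<close> vanishes at its root.\<close>

theorem nullstellensatz:
  assumes g: "irreducible g" and h: "\<And>u v. ev2 g u v = 0 \<Longrightarrow> ev2 h u v = 0"
  shows "g dvd h"
proof (cases "degree g > 0")
  case True
  show ?thesis
  proof (rule ccontr)
    assume "\<not> g dvd h"
    then obtain s t c where c: "s * g + t * h = [:c:]" "c \<noteq> 0" using eliminate[OF g True] by blast
    have "g \<noteq> 0" using g by auto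
    then have "lead_coeff g * c \<noteq> 0" using c(2) by simp
    then obtain u where u: "poly (lead_coeff g * c) u \<noteq> 0" using poly_all_0_iff_0 by blast
    then obtain v where v: "ev2 g u v = 0" using ev2_root_ex[of g u] True by auto
    have "ev2 (s * g + t * h) u v = 0" using v h by simp
    then show False using u c(1) by simp
  qed
next
  case False
  then obtain c where c: "g = [:c:]" using degree_eq_zeroE by blast
  have c0: "c \<noteq> 0" "\<not> is_unit c" using g unfolding c by (auto simp: irreducible_def is_unit_const_poly_iff)
  then have "degree c > 0" using is_unit_iff_degree by blast
  then have "\<not> constant (poly c)" by (simp add: constant_degree)
  then obtain u0 where "poly c u0 = 0" using fundamental_theorem_of_algebra by blast
  then obtain c' where c': "c = [:-u0, 1:] * c'" by (metis poly_eq_0_iff_dvd dvdE)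
  then have "g = [:[:-u0, 1:]:] * [:c':]" unfolding c by simp
  then have "is_unit [:[:-u0, 1:]:] \<or> is_unit [:c':]" using g irreducibleD by blast
  moreover have "\<not> is_unit [:[:-u0, 1 :: complex:]:]" by (simp add: is_unit_const_poly_iff is_unit_poly_iff) 
  ultimately have "is_unit c'" by (simp add: is_unit_const_poly_iff)
  then have cd: "c dvd [:-u0, 1:]" unfolding c' by (subst mult_unit_dvd_iff) auto
  have "c dvd coeff h k" for k
  proof -
    let ?f = "map_poly (\<lambda>c. poly c u0) h"
    have "poly ?f v = 0" for v
      unfolding poly_map_poly_eval by (rule h) (simp add: c \<open>poly c u0 = 0\<close>)
    then have "?f = 0" using poly_all_0_iff_0 by blast
    then have "coeff ?f k = 0" by simp
    then have "poly (coeff h k) u0 = 0" by (simp add: coeff_map_poly)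
    then have "[:-u0, 1:] dvd coeff h k" by (simp add: poly_eq_0_iff_dvd)
    then show ?thesis using cd dvd_trans by blast
  qed
  then show ?thesis unfolding c const_poly_dvd_iff by blast
qed

lemma nullstellensatz_open:
  assumes "irreducible g" "\<not> g dvd d" "\<And>u v. ev2 g u v = 0 \<Longrightarrow> ev2 d u v \<noteq> 0 \<Longrightarrow> ev2 h u v = 0"
  shows "g dvd h"
proof -
  have "g dvd d * h" by (rule nullstellensatz) (use assms in auto)
  then show ?thesis using assms(1,2) prime_elem_dvd_multD irreducible_bipoly_prime by blast
qed

lemma not_dvd_point_ex:
  assumes "irreducible g" "\<not> g dvd d"
  obtains u v where "ev2 g u v = 0" "ev2 d u v \<noteq> 0"
  using nullstellensatz[OF assms(1), of d] assms(2) by blast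

lemma not_dvd_of_ev2: "ev2 g u v = 0 \<Longrightarrow> ev2 d u v \<noteq> 0 \<Longrightarrow> \<not> g dvd d"
  by (auto elim!: dvdE)

lemma irreducible_dvd_mult_iff: "irreducible g \<Longrightarrow> g dvd x * y \<longleftrightarrow> g dvd x \<or> g dvd (y :: complex poly poly)"
  using prime_elem_dvd_mult_iff irreducible_bipoly_prime by blast

lemma bipoly_unit:
  assumes "is_unit (f :: complex poly poly)"
  obtains c where "c \<noteq> 0" "f = [:[:c:]:]"
proof -
  obtain p where p: "f = [:p:]" "is_unit p" using assms by (auto simp: is_unit_poly_iff)
  then obtain c where "p = [:c:]" "c \<noteq> 0" by (auto simp: is_unit_poly_iff dvd_field_iff)
  then show thesis using that p by blast
qed

text \<open>The last hypothesis expresses irreducibility of \<open>Z\<close>, so in the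
  factorization of \<open>f\<close> some prime factor already vanishes on \<open>Z\<close>.\<close>

lemma vanishing_factor:
  assumes "f \<noteq> 0" "Z \<noteq> {}" "\<And>u v. (u, v) \<in> Z \<Longrightarrow> ev2 f u v = 0"
    and "\<And>f g. (\<And>u v. (u, v) \<in> Z \<Longrightarrow> ev2 (f * g) u v = 0) \<Longrightarrow>
       (\<forall>(u, v)\<in>Z. ev2 f u v = 0) \<or> (\<forall>(u, v)\<in>Z. ev2 g u v = 0)"
  obtains g where "irreducible g" "g dvd f" "\<And>u v. (u, v) \<in> Z \<Longrightarrow> ev2 g u v = 0"
proof -
  have "\<exists>g. irreducible g \<and> g dvd f \<and> (\<forall>(u, v)\<in>Z. ev2 g u v = 0)"
    if "f \<noteq> 0" "\<forall>(u, v)\<in>Z. ev2 f u v = 0" for f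
    using that
  proof (induction f rule: prime_divisors_induct)
    case (unit x)
    then obtain c where "c \<noteq> 0" "x = [:[:c:]:]" using bipoly_unit by blast
    then show ?case using unit assms(2) by auto
  next
    case (factor p x)
    have "(\<forall>(u, v)\<in>Z. ev2 p u v = 0) \<or> (\<forall>(u, v)\<in>Z. ev2 x u v = 0)"
      by (rule assms(4)) (use factor in auto)
    then show ?case
    proof
      assume "\<forall>(u, v)\<in>Z. ev2 p u v = 0"
      then show ?case using factor(1) by (intro exI[of _ p]) (auto intro: prime_elem_imp_irreducible)
    next
      assume "\<forall>(u, v)\<in>Z. ev2 x u v = 0"
      then show ?case using factor by (metis dvd_mult mult_zero_right)
    qed
  qed simp
  then show thesis using assms(1,3) that by (metis (mono_tags, lifting) case_prodI2 case_prodD)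
qed

lemma root_factor:
  assumes "f \<noteq> 0" "ev2 f u v = 0"
  obtains g where "irreducible g" "g dvd f" "ev2 g u v = 0"
  using vanishing_factor[of f "{(u, v)}"] assms by auto

lemma multiplicity_eq_imp_smult:
  fixes f g :: "complex poly poly"
  assumes "f \<noteq> 0" "g \<noteq> 0" "\<And>h. irreducible h \<Longrightarrow> multiplicity h f = multiplicity h g"
  obtains c where "c \<noteq> 0" "g = [:[:c:]:] * f"
proof -
  have "f dvd g" "g dvd f"
    by (rule multiplicity_le_imp_dvd; use assms prime_elem_imp_irreducible in \<open>force simp: prime_imp_prime_elem\<close>)+
  then obtain k where k: "g = f * k" "is_unit k" 
    by (metis assms(1) dvd_mult_cancel_left dvdE mult.right_neutral)
  then show thesis using that bipoly_unit by (metis mult.commute)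
qed

lemma multiplicity_mult: "irreducible g \<Longrightarrow> x \<noteq> 0 \<Longrightarrow> y \<noteq> 0 \<Longrightarrow>
    multiplicity g (x * y) = multiplicity g x + multiplicity g (y :: complex poly poly)"
  by (simp add: irreducible_bipoly_prime prime_elem_multiplicity_mult_distrib)

lemma multiplicity_power: "irreducible g \<Longrightarrow> x \<noteq> 0 \<Longrightarrow> multiplicity g (x ^ k) = k * multiplicity g (x :: complex poly poly)"
  by (simp add: irreducible_bipoly_prime prime_elem_multiplicity_power_distrib)

lemma multiplicity_split:
  assumes "irreducible g" "(x :: complex poly poly) \<noteq> 0"
  obtains x' where "x = g ^ multiplicity g x * x'" "\<not> g dvd x'"
proof -
  have "\<not> is_unit g" using assms(1) by (simp add: irreducible_def)
  then show thesis using multiplicity_decompose'[OF assms(2)] that by metis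
qed

section \<open>Affine charts and orders along curves\<close>

lemma irreducible_closed_alt:
  "irreducible_closed T Y \<longleftrightarrow> closedin T Y \<and> Y \<noteq> {} \<and>
     (\<forall>U V. openin T U \<longrightarrow> openin T V \<longrightarrow> U \<inter> Y \<noteq> {} \<longrightarrow> V \<inter> Y \<noteq> {} \<longrightarrow> U \<inter> V \<inter> Y \<noteq> {})"
  (is "?L \<longleftrightarrow> ?R")
proof
  assume L: ?L
  then have Y: "closedin T Y" "topspace (subtopology T Y) = Y" "Y \<noteq> {}"
    by (auto simp: irreducible_closed_def irreducible_top_def dest: closedin_subset)
  have "U \<inter> V \<inter> Y \<noteq> {}" if UV: "openin T U" "openin T V" "U \<inter> Y \<noteq> {}" "V \<inter> Y \<noteq> {}" for U V
  proof
    assume e: "U \<inter> V \<inter> Y = {}"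
    have "closedin (subtopology T Y) (Y - U)" "closedin (subtopology T Y) (Y - V)"
      using UV closedin_diff[OF Y(1)] by (auto simp: closedin_closed_subtopology[OF Y(1)])
    moreover have "Y = (Y - U) \<union> (Y - V)" using e by blast
    ultimately have "Y - U = Y \<or> Y - V = Y"
      using L Y(2) unfolding irreducible_closed_def irreducible_top_def by metis
    then show False using UV by blast
  qed
  then show ?R using Y by blast
next
  assume R: ?R
  then have Y: "closedin T Y" "topspace (subtopology T Y) = Y" "Y \<noteq> {}" by (auto dest: closedin_subset)
  have "A = Y \<or> B = Y" if AB: "closedin (subtopology T Y) A" "closedin (subtopology T Y) B" "Y = A \<union> B" for A B
  proof (rule ccontr)
    assume n: "\<not> (A = Y \<or> B = Y)"
    have c: "closedin T A" "closedin T B" "A \<subseteq> Y" "B \<subseteq> Y"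
      using AB(1,2) closedin_closed_subtopology[OF Y(1)] by blast+
    let ?U = "topspace T - A" and ?V = "topspace T - B"
    have "?U \<inter> Y \<noteq> {}" "?V \<inter> Y \<noteq> {}" using n c Y by (auto dest: closedin_subset)
    then have "?U \<inter> ?V \<inter> Y \<noteq> {}" using R c by (simp add: openin_diff)
    then show False using AB(3) by blast
  qed
  then show ?L unfolding irreducible_closed_def irreducible_top_def Y(2) using Y(1,3) by blast
qed

text \<open>An open dense copy of the affine plane in \<open>X\<close>: the axioms translate open
  sets and regular functions of \<open>X\<close> into polynomials in the coordinates
  \<open>u\<close>, \<open>v\<close>, and back.\<close>

locale chart =
  fixes X :: "'p fspace" and s :: "complex \<Rightarrow> complex \<Rightarrow> 'p"
  assumes inj: "s u v = s u' v' \<Longrightarrow> u = u' \<and> v = v'"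
    and open_in: "openin (zariski X) V \<Longrightarrow> s u v \<in> V \<Longrightarrow>
      \<exists>f. ev2 f u v \<noteq> 0 \<and> (\<forall>u' v'. ev2 f u' v' \<noteq> 0 \<longrightarrow> s u' v' \<in> V)"
    and open_D: "openin (zariski X) {s u v | u v. ev2 f u v \<noteq> 0}"
    and regular_in: "regular X V F \<Longrightarrow> s u v \<in> V \<Longrightarrow>
      \<exists>f g. ev2 g u v \<noteq> 0 \<and> (\<forall>u' v'. s u' v' \<in> V \<longrightarrow> ev2 g u' v' \<noteq> 0 \<longrightarrow> F (s u' v') = ev2 f u' v' / ev2 g u' v')"
    and regular_quot: "(\<And>u v. ev2 d u v \<noteq> 0 \<Longrightarrow> ev2 g u v \<noteq> 0) \<Longrightarrow>
      (\<And>u v. ev2 d u v \<noteq> 0 \<Longrightarrow> F (s u v) = ev2 f u v / ev2 g u v) \<Longrightarrow>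
      regular X {s u v | u v. ev2 d u v \<noteq> 0} F"
    and dense: "openin (zariski X) V \<Longrightarrow> V \<noteq> {} \<Longrightarrow> \<exists>u v. s u v \<in> V"
    and regular_openin: "regular X V F \<Longrightarrow> openin (zariski X) V"
begin

definition D :: "complex poly poly \<Rightarrow> 'p set" where
  "D f = {s u v | u v. ev2 f u v \<noteq> 0}"

lemma mem_D: "s u v \<in> D f \<longleftrightarrow> ev2 f u v \<noteq> 0" using inj by (auto simp: D_def)
lemma openin_D: "openin (zariski X) (D f)" using open_D by (simp add: D_def)
lemma D_1: "D 1 = {s u v | u v. True}" by (simp add: D_def)

lemma s_points: "s u v \<in> points X"
  using openin_subset[OF openin_D[of 1]] by (auto simp: D_def)

text \<open>As \<open>g\<close> runs through the irreducible polynomials, these are exactly the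
  prime divisors of \<open>X\<close> that meet the chart (\<open>clo_prime_divisor\<close>,
  \<open>prime_divisor_clo\<close>).\<close>

definition clo :: "complex poly poly \<Rightarrow> 'p set" where
  "clo g = (zariski X) closure_of {s u v | u v. ev2 g u v = 0}"

lemma clo_meets:
  assumes "openin (zariski X) V"
  shows "V \<inter> clo g \<noteq> {} \<longleftrightarrow> (\<exists>u v. ev2 g u v = 0 \<and> s u v \<in> V)"
  using openin_Int_closure_of_eq_empty[OF assms, of "{s u v | u v. ev2 g u v = 0}"] unfolding clo_def by blast

lemma mem_clo: "s u v \<in> clo g \<longleftrightarrow> ev2 g u v = 0"
proof
  assume "s u v \<in> clo g"
  show "ev2 g u v = 0"
  proof (rule ccontr)
    assume "ev2 g u v \<noteq> 0"
    then have "D g \<inter> clo g \<noteq> {}" using \<open>s u v \<in> clo g\<close> mem_D by blast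
    then show False using clo_meets[OF openin_D] mem_D by blast
  qed
next
  assume "ev2 g u v = 0"
  then show "s u v \<in> clo g" unfolding clo_def
    using closure_of_subset[of "{s u v | u v. ev2 g u v = 0}" "zariski X"] s_points by blast
qed

lemma clo_meets_D:
  assumes "irreducible g" "openin (zariski X) V" "V \<inter> clo g \<noteq> {}" "\<not> g dvd f"
  obtains u v d where "ev2 g u v = 0" "s u v \<in> V" "ev2 f u v \<noteq> 0" "ev2 d u v \<noteq> 0" "D d \<subseteq> V"
proof -
  obtain u v where "ev2 g u v = 0" "s u v \<in> V" using assms clo_meets by blast
  then obtain d where d: "ev2 d u v \<noteq> 0" "\<forall>u' v'. ev2 d u' v' \<noteq> 0 \<longrightarrow> s u' v' \<in> V" using open_in assms(2) by blast
  then have "\<not> g dvd d" using \<open>ev2 g u v = 0\<close> not_dvd_of_ev2 by blast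
  then have "\<not> g dvd d * f" using assms(1,4) irreducible_dvd_mult_iff by blast
  then obtain u v where "ev2 g u v = 0" "ev2 (d * f) u v \<noteq> 0" using not_dvd_point_ex assms(1) by blast
  then show thesis using that[of u v d] d by (auto simp: D_def)
qed

lemma clo_irreducible_closed: "irreducible g \<Longrightarrow> irreducible_closed (zariski X) (clo g)"
proof -
  assume g: "irreducible g"
  show ?thesis unfolding irreducible_closed_alt
  proof (intro conjI allI impI)
    show "closedin (zariski X) (clo g)" by (simp add: clo_def)
    have "\<not> g dvd 1" using g by (simp add: irreducible_def)
    then show "clo g \<noteq> {}" using not_dvd_point_ex[OF g] mem_clo by (metis empty_iff)
    fix U V assume U: "openin (zariski X) U" "openin (zariski X) V" "U \<inter> clo g \<noteq> {}" "V \<inter> clo g \<noteq> {}"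
    obtain u v d where d: "ev2 g u v = 0" "ev2 d u v \<noteq> 0" "D d \<subseteq> U"
      using clo_meets_D[OF g U(1,3)] g \<open>\<not> g dvd 1\<close> by metis
    have "\<not> g dvd d" using d not_dvd_of_ev2 by blast
    then obtain u' v' where "ev2 g u' v' = 0" "s u' v' \<in> V" "ev2 d u' v' \<noteq> 0"
      using clo_meets_D[OF g U(2,4)] by metis
    then show "U \<inter> V \<inter> clo g \<noteq> {}" using d mem_D mem_clo by blast
  qed
qed

text \<open>The open complement of \<open>Y\<close> contains a basic open set of the chart, so a
  nonzero polynomial vanishes on the chart part of \<open>Y\<close>. Irreducibility passes this on
  to one factor, and then from the chart part, which is dense in \<open>Y\<close>, to all of
  \<open>Y\<close>.\<close>

lemma irreducible_closed_subset_clo: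
  assumes Y: "irreducible_closed (zariski X) Y" "Y \<noteq> points X" "s u0 v0 \<in> Y"
  obtains g where "irreducible g" "Y \<subseteq> clo g"
proof -
  have cY: "closedin (zariski X) Y" using Y(1) by (simp add: irreducible_closed_def)
  then have "openin (zariski X) (points X - Y)" "points X - Y \<noteq> {}"
    using Y(2) closedin_subset by (auto simp: openin_diff)
  then obtain u v where "s u v \<in> points X - Y" using dense by blast
  then obtain f where f: "ev2 f u v \<noteq> 0" "\<And>u' v'. ev2 f u' v' \<noteq> 0 \<Longrightarrow> s u' v' \<in> points X - Y"
    using open_in \<open>openin (zariski X) (points X - Y)\<close> by meson
  define Z where "Z = {(u, v). s u v \<in> Y}"
  have "f \<noteq> 0" using f(1) by auto
  then obtain g where g: "irreducible g" "\<And>u v. (u, v) \<in> Z \<Longrightarrow> ev2 g u v = 0"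
  proof (rule vanishing_factor[of f Z])
    show "Z \<noteq> {}" using Y(3) by (auto simp: Z_def)
    show "ev2 f u v = 0" if "(u, v) \<in> Z" for u v using f(2)[of u v] that by (auto simp: Z_def)
    show "(\<forall>(u, v)\<in>Z. ev2 p u v = 0) \<or> (\<forall>(u, v)\<in>Z. ev2 q u v = 0)"
      if pq: "\<And>u v. (u, v) \<in> Z \<Longrightarrow> ev2 (p * q) u v = 0" for p q
    proof (rule ccontr)
      assume "\<not> ?thesis"
      then have "D p \<inter> Y \<noteq> {}" "D q \<inter> Y \<noteq> {}" using mem_D by (fastforce simp: Z_def)+
      then have "D p \<inter> D q \<inter> Y \<noteq> {}" using Y(1) openin_D unfolding irreducible_closed_alt by blast
      then obtain u v where "s u v \<in> Y" "s u v \<in> D p" "s u v \<in> D q" by (auto simp: D_def)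
      then show False using pq[of u v] by (auto simp: mem_D Z_def)
    qed
  qed blast
  have "Y \<subseteq> clo g"
  proof (rule ccontr)
    assume "\<not> Y \<subseteq> clo g"
    moreover have "closedin (zariski X) (clo g)" by (simp add: clo_def)
    ultimately have "openin (zariski X) (points X - clo g)" "(points X - clo g) \<inter> Y \<noteq> {}"
      using closedin_subset[OF cY] by (auto simp: openin_diff)
    moreover have "D 1 \<inter> Y \<noteq> {}" using Y(3) mem_D[of u0 v0 1] by auto
    ultimately have "(points X - clo g) \<inter> D 1 \<inter> Y \<noteq> {}" using Y(1) openin_D unfolding irreducible_closed_alt by blast
    then show False using g(2) mem_clo by (fastforce simp: D_def Z_def)
  qed
  then show thesis using that g by blast
qed

lemma clo_mono:
  assumes "g dvd h" shows "clo g \<subseteq> clo h"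
proof -
  have "ev2 h u v = 0" if "ev2 g u v = 0" for u v using that assms by (auto elim!: dvdE)
  then show ?thesis unfolding clo_def by (intro closure_of_mono) blast
qed

lemma clo_subset_iff: "irreducible g \<Longrightarrow> clo g \<subseteq> clo h \<Longrightarrow> g dvd h"
  by (rule nullstellensatz) (auto simp: mem_clo[symmetric])

lemma irreducible_dvd_sym: "irreducible g \<Longrightarrow> irreducible h \<Longrightarrow> g dvd h \<Longrightarrow> h dvd (g :: complex poly poly)"
  by (metis irreducibleD' irreducible_def)

lemma clo_proper: "irreducible g \<Longrightarrow> clo g \<subset> points X"
proof -
  assume g: "irreducible g"
  then have "g \<noteq> 0" by auto
  then obtain u v where "ev2 g u v \<noteq> 0" using ev2_nonzero_ex by blast
  then have "s u v \<notin> clo g" "s u v \<in> points X" using mem_clo s_points by auto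
  moreover have "clo g \<subseteq> points X" by (simp add: clo_def closure_of_subset_topspace)
  ultimately show ?thesis by blast
qed

lemma clo_point_ex: "irreducible g \<Longrightarrow> \<exists>u v. s u v \<in> clo g"
  using not_dvd_point_ex[of g 1] mem_clo by (metis irreducible_def)

theorem clo_prime_divisor: "irreducible g \<Longrightarrow> prime_divisor X (clo g)"
  unfolding prime_divisor_def
proof (intro conjI notI)
  assume g: "irreducible g"
  show "irreducible_closed (zariski X) (clo g)" "clo g \<subset> points X"
    using clo_irreducible_closed clo_proper g by auto
  assume "\<exists>Z. irreducible_closed (zariski X) Z \<and> clo g \<subset> Z \<and> Z \<subset> points X"
  then obtain Z where Z: "irreducible_closed (zariski X) Z" "clo g \<subset> Z" "Z \<subset> points X" by blast
  moreover obtain u v where "s u v \<in> clo g" using clo_point_ex[OF g] by blast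
  ultimately obtain h where h: "irreducible h" "Z \<subseteq> clo h"
    using irreducible_closed_subset_clo[of Z u v] by blast
  then have "g dvd h" using clo_subset_iff[OF g] Z by blast
  then have "clo h \<subseteq> clo g" using irreducible_dvd_sym g h clo_mono by blast
  then show False using Z h by blast
qed

theorem prime_divisor_clo:
  assumes "prime_divisor X Y" "s u v \<in> Y"
  obtains g where "irreducible g" "Y = clo g"
proof -
  have Y: "irreducible_closed (zariski X) Y" "Y \<noteq> points X" using assms by (auto simp: prime_divisor_def)
  obtain g where g: "irreducible g" "Y \<subseteq> clo g" by (rule irreducible_closed_subset_clo[OF Y assms(2)])
  have "\<not> (Y \<subset> clo g)"
    using assms(1) clo_irreducible_closed[OF g(1)] clo_proper[OF g(1)] unfolding prime_divisor_def by metis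
  then have "Y = clo g" using g(2) by blast
  then show thesis using that g by blast
qed

definition lift :: "(complex \<Rightarrow> complex \<Rightarrow> complex) \<Rightarrow> 'p \<Rightarrow> complex" where
  "lift F x = (case SOME p. x = s (fst p) (snd p) of (u, v) \<Rightarrow> F u v)"

lemma lift: "lift F (s u v) = F u v"
proof -
  have "(SOME p. s u v = s (fst p) (snd p)) = (u, v)"
    by (rule some_equality) (use inj in \<open>auto simp: prod_eq_iff\<close>)
  then show ?thesis by (simp add: lift_def)
qed

lemma regular_D:
  assumes "\<And>u v. ev2 d u v \<noteq> 0 \<Longrightarrow> ev2 g u v \<noteq> 0" "\<And>u v. ev2 d u v \<noteq> 0 \<Longrightarrow> F (s u v) = ev2 f u v / ev2 g u v"
  shows "regular X (D d) F"
  unfolding D_def by (rule regular_quot) (use assms in auto)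

text \<open>A regular function that vanishes on the curve is near it a fraction whose numerator
  vanishes on an open part of \<open>g = 0\<close>; the Nullstellensatz extracts a factor
  \<open>g\<close>.\<close>

lemma local_equation_uniformizer:
  assumes g: "irreducible g" and d: "\<not> g dvd d"
  shows "uniformizer X (clo g) (D d) (lift (ev2 g))"
  unfolding uniformizer_def
proof (intro conjI allI impI ballI)
  show "openin (zariski X) (D d)" by (rule openin_D)
  show "D d \<inter> clo g \<noteq> {}" unfolding clo_meets[OF openin_D] using not_dvd_point_ex[OF g d] mem_D by metis
  show "regular X (D d) (lift (ev2 g))" by (rule regular_D[of d 1 _ g]) (auto simp: lift)
  show "lift (ev2 g) y = 0" if "y \<in> D d \<inter> clo g" for y
    using that by (auto simp: D_def lift mem_clo)
  fix W h assume W: "openin (zariski X) W \<and> W \<inter> clo g \<noteq> {} \<and> regular X W h \<and> (\<forall>y\<in>W \<inter> clo g. h y = 0)"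
  obtain u v e where e: "ev2 g u v = 0" "s u v \<in> W" "ev2 d u v \<noteq> 0" "ev2 e u v \<noteq> 0" "D e \<subseteq> W"
    using clo_meets_D[OF g _ _ d] W by metis
  obtain p q where pq: "ev2 q u v \<noteq> 0" "\<And>u' v'. s u' v' \<in> W \<Longrightarrow> ev2 q u' v' \<noteq> 0 \<Longrightarrow> h (s u' v') = ev2 p u' v' / ev2 q u' v'"
    using regular_in W e(2) by meson
  have nd: "\<not> g dvd e * q" by (rule not_dvd_of_ev2[OF e(1)]) (use e pq in auto)
  have "g dvd p"
  proof (rule nullstellensatz_open[OF g nd])
    fix u v assume uv: "ev2 g u v = 0" "ev2 (e * q) u v \<noteq> 0"
    then have "s u v \<in> W" using e(5) mem_D by fastforce
    then have "h (s u v) = 0" using W uv(1) mem_clo by blast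
    then show "ev2 p u v = 0" using pq(2)[OF \<open>s u v \<in> W\<close>] uv by auto
  qed
  then obtain p' where p': "p = g * p'" by blast
  let ?W = "D (e * q * d)" and ?h = "lift (\<lambda>u v. ev2 p' u v / ev2 q u v)"
  have "h x = ?h x * lift (ev2 g) x" if x: "x \<in> ?W" for x
  proof -
    obtain u v where uv: "x = s u v" "ev2 (e * q * d) u v \<noteq> 0" using x unfolding D_def by blast
    then have "s u v \<in> W" using e(5) mem_D by fastforce
    then show ?thesis using pq(2)[OF \<open>s u v \<in> W\<close>] uv by (simp add: lift p' mult_ac)
  qed
  moreover have "?W \<subseteq> D d \<inter> W"
    using e(5) by (fastforce simp: D_def)
  moreover have "?W \<inter> clo g \<noteq> {}" unfolding clo_meets[OF openin_D] mem_D using e pq(1) by auto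
  moreover have "regular X ?W ?h" by (rule regular_D) (auto simp: lift)
  ultimately show "\<exists>W' h'. openin (zariski X) W' \<and> W' \<inter> clo g \<noteq> {} \<and> W' \<subseteq> D d \<inter> W \<and>
      regular X W' h' \<and> (\<forall>x\<in>W'. h x = h' x * lift (ev2 g) x)"
    using openin_D by blast
qed

text \<open>After the powers of \<open>g\<close> are split off, numerator and denominator are
  nonzero off a set that does not contain the curve, so their quotient is a unit along it.\<close>

theorem has_order_clo:
  assumes g: "irreducible g" and ab: "a \<noteq> 0" "b \<noteq> 0"
    and F: "\<And>u v. s u v \<in> U \<Longrightarrow> F (s u v) * ev2 b u v = ev2 a u v"
  shows "has_order X (clo g) U F (int (multiplicity g a) - int (multiplicity g b))"
proof -
  let ?i = "multiplicity g a" and ?j = "multiplicity g b"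
  obtain a' where a': "a = g ^ ?i * a'" "\<not> g dvd a'" using multiplicity_split[OF g ab(1)] by blast
  obtain b' where b': "b = g ^ ?j * b'" "\<not> g dvd b'" using multiplicity_split[OF g ab(2)] by blast
  have d: "\<not> g dvd a' * b'" using a' b' irreducible_dvd_mult_iff g by blast
  let ?u = "lift (\<lambda>u v. ev2 a' u v / ev2 b' u v)"
  show ?thesis unfolding has_order_def
  proof (intro exI conjI ballI impI)
    show "uniformizer X (clo g) (D (a' * b')) (lift (ev2 g))" by (rule local_equation_uniformizer[OF g d])
    show "regular X (D (a' * b')) ?u" by (rule regular_D) (auto simp: lift)
    show "?u x \<noteq> 0" if "x \<in> D (a' * b')" for x using that by (auto simp: D_def lift)
    fix x assume x: "x \<in> U \<inter> D (a' * b')" "lift (ev2 g) x \<noteq> 0"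
    then obtain u v where uv: "x = s u v" "ev2 a' u v \<noteq> 0" "ev2 b' u v \<noteq> 0" by (auto simp: D_def)
    have g0: "ev2 g u v \<noteq> 0" using x(2) by (simp add: uv lift)
    have "F x * (ev2 g u v ^ ?j * ev2 b' u v) = ev2 g u v ^ ?i * ev2 a' u v"
      using F[of u v] x(1) arg_cong[OF a'(1), of "\<lambda>p. ev2 p u v"] arg_cong[OF b'(1), of "\<lambda>p. ev2 p u v"] by (simp add: uv)
    then have "F x = ev2 a' u v / ev2 b' u v * (ev2 g u v ^ ?i / ev2 g u v ^ ?j)"
      using uv g0 by (simp add: field_simps)
    also have "ev2 g u v ^ ?i / ev2 g u v ^ ?j = ev2 g u v powi (int ?i - int ?j)"
      using g0 by (simp add: power_int_diff)
    finally show "F x = ?u x * lift (ev2 g) x powi (int ?i - int ?j)" by (simp add: uv lift)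
  qed
qed

text \<open>An order is witnessed by an arbitrary uniformizer \<open>t\<close>, which must be
  compared with \<open>g\<close>: near the curve \<open>t = g * T' / B\<close>, and since
  \<open>g\<close> is conversely a multiple of \<open>t\<close>, the factor \<open>T'\<close> is not
  divisible by \<open>g\<close>. The equation for \<open>F\<close> becomes an identity of
  polynomials in which the powers of \<open>g\<close> are counted.\<close>

theorem has_order_clo_unique:
  assumes g: "irreducible g" and ab: "a \<noteq> 0" "b \<noteq> 0"
    and F: "\<And>u v. s u v \<in> U \<Longrightarrow> F (s u v) * ev2 b u v = ev2 a u v"
    and U: "openin (zariski X) U" "U \<noteq> {}" and k: "has_order X (clo g) U F k"
  shows "k = int (multiplicity g a) - int (multiplicity g b)"
proof -
  have g1: "\<not> g dvd 1" using g by (simp add: irreducible_def)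
  have g0: "g \<noteq> 0" using g by auto
  obtain V t w where V: "uniformizer X (clo g) V t" "regular X V w" "\<And>x. x \<in> V \<Longrightarrow> w x \<noteq> 0"
    "\<And>x. x \<in> U \<inter> V \<Longrightarrow> t x \<noteq> 0 \<Longrightarrow> F x = w x * t x powi k"
    using k unfolding has_order_def by blast
  have tV: "openin (zariski X) V" "V \<inter> clo g \<noteq> {}" "regular X V t" "\<And>y. y \<in> V \<inter> clo g \<Longrightarrow> t y = 0"
    using V(1) unfolding uniformizer_def by blast+
  obtain u v e where e: "ev2 g u v = 0" "s u v \<in> V" "ev2 e u v \<noteq> 0" "D e \<subseteq> V"
    using clo_meets_D[OF g tV(1,2) g1] by metis
  obtain T B where T: "ev2 B u v \<noteq> 0" "\<And>u' v'. s u' v' \<in> V \<Longrightarrow> ev2 B u' v' \<noteq> 0 \<Longrightarrow> t (s u' v') = ev2 T u' v' / ev2 B u' v'"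
    using regular_in[OF tV(3) e(2)] by blast
  obtain R S where R: "ev2 S u v \<noteq> 0" "\<And>u' v'. s u' v' \<in> V \<Longrightarrow> ev2 S u' v' \<noteq> 0 \<Longrightarrow> w (s u' v') = ev2 R u' v' / ev2 S u' v'"
    using regular_in[OF V(2) e(2)] by blast
  have eV: "ev2 e u' v' \<noteq> 0 \<Longrightarrow> s u' v' \<in> V" for u' v' using e(4) mem_D by blast
  have R0: "ev2 R u v \<noteq> 0" using V(3)[OF e(2)] R e(2) by auto
  have nd: "\<not> g dvd e" "\<not> g dvd B" "\<not> g dvd S" "\<not> g dvd R" using e T R R0 not_dvd_of_ev2 by blast+
  have "g dvd T"
  proof (rule nullstellensatz_open[OF g])
    show "\<not> g dvd e * B" using nd irreducible_dvd_mult_iff[OF g] by blast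
    fix u v assume uv: "ev2 g u v = 0" "ev2 (e * B) u v \<noteq> 0"
    then have "s u v \<in> V" using eV by auto
    then have "t (s u v) = 0" using tV(4) uv(1) mem_clo by blast
    then show "ev2 T u v = 0" using T(2)[OF \<open>s u v \<in> V\<close>] uv by auto
  qed
  then obtain T' where T': "T = g * T'" by blast
  have "uniformizer X (clo g) (D 1) (lift (ev2 g))" by (rule local_equation_uniformizer[OF g g1])
  then have "openin (zariski X) (D 1) \<and> D 1 \<inter> clo g \<noteq> {} \<and> regular X (D 1) (lift (ev2 g)) \<and>
      (\<forall>y\<in>D 1 \<inter> clo g. lift (ev2 g) y = 0)" unfolding uniformizer_def by blast
  then obtain W h where W: "openin (zariski X) W" "W \<inter> clo g \<noteq> {}" "W \<subseteq> V" "regular X W h"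
    "\<And>x. x \<in> W \<Longrightarrow> lift (ev2 g) x = h x * t x"
    using V(1) unfolding uniformizer_def by (metis le_infE)
  obtain u1 v1 e1 where e1: "ev2 g u1 v1 = 0" "s u1 v1 \<in> W" "ev2 B u1 v1 \<noteq> 0" "ev2 e1 u1 v1 \<noteq> 0" "D e1 \<subseteq> W"
    using clo_meets_D[OF g W(1,2) nd(2)] by metis
  obtain H C where H: "ev2 C u1 v1 \<noteq> 0" "\<And>u' v'. s u' v' \<in> W \<Longrightarrow> ev2 C u' v' \<noteq> 0 \<Longrightarrow> h (s u' v') = ev2 H u' v' / ev2 C u' v'"
    using regular_in[OF W(4) e1(2)] by blast
  have "g * (C * B) = g * (H * T')"
  proof (rule ev2_eqI)
    show "e1 * C * B \<noteq> 0" using e1 H by auto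
    fix u v assume uv: "ev2 (e1 * C * B) u v \<noteq> 0"
    then have sW: "s u v \<in> W" using e1(5) mem_D by fastforce
    then have "s u v \<in> V" using W(3) by blast
    moreover have "ev2 B u v \<noteq> 0" "ev2 C u v \<noteq> 0" using uv by auto
    ultimately have "ev2 g u v = ev2 H u v / ev2 C u v * (ev2 g u v * ev2 T' u v / ev2 B u v)"
      using W(5)[OF sW] H(2)[OF sW] T(2)[of u v] unfolding lift T' ev2_simps by metis
    then show "ev2 (g * (C * B)) u v = ev2 (g * (H * T')) u v" using uv by (simp add: field_simps)
  qed
  then have "C * B = H * T'" using g0 by simp
  then have "ev2 C u1 v1 * ev2 B u1 v1 = ev2 H u1 v1 * ev2 T' u1 v1" by (metis ev2_simps(3))
  then have "ev2 T' u1 v1 \<noteq> 0" using H e1 by auto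
  then have nT: "\<not> g dvd T'" using e1(1) not_dvd_of_ev2 by blast
  obtain u2 v2 where u2: "s u2 v2 \<in> U" using dense[OF U] by blast
  then obtain e2 where e2: "ev2 e2 u2 v2 \<noteq> 0" "\<And>u' v'. ev2 e2 u' v' \<noteq> 0 \<Longrightarrow> s u' v' \<in> U"
    using open_in[OF U(1)] by blast
  have nz: "e2 \<noteq> 0" "e \<noteq> 0" "B \<noteq> 0" "S \<noteq> 0" "R \<noteq> 0" "T' \<noteq> 0" using e2 e T R R0 nT by auto
  define E where "E = e2 * e * B * S * g * T'"
  have E: "E \<noteq> 0" using nz g0 by (simp add: E_def)
  have key: "ev2 a u v * ev2 S u v = ev2 b u v * ev2 R u v * (ev2 g u v * ev2 T' u v / ev2 B u v) powi k"
    if "ev2 E u v \<noteq> 0" for u v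
  proof -
    have uv: "s u v \<in> U" "s u v \<in> V" "ev2 B u v \<noteq> 0" "ev2 S u v \<noteq> 0" "ev2 g u v \<noteq> 0" "ev2 T' u v \<noteq> 0"
      using that e2(2) eV by (auto simp: E_def)
    have t: "t (s u v) = ev2 g u v * ev2 T' u v / ev2 B u v" using T(2)[OF uv(2,3)] by (simp add: T')
    then have "t (s u v) \<noteq> 0" using uv by simp
    then have "F (s u v) * ev2 S u v = ev2 R u v * (ev2 g u v * ev2 T' u v / ev2 B u v) powi k"
      using V(4)[of "s u v"] uv R(2)[OF uv(2,4)] t by simp
    then show ?thesis using F[OF uv(1)] by algebra
  qed
  note mult = multiplicity_mult[OF g] multiplicity_power[OF g]
  have m0: "multiplicity g x = 0" if "\<not> g dvd x" for x using that by (rule not_dvd_imp_multiplicity_0)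
  have mg: "multiplicity g g = 1" using g0 g by (intro multiplicity_self) (auto simp: irreducible_def)
  show ?thesis
  \<comment> \<open>The two signs of \<open>k\<close> are separated so that only nonnegative powers,
    hence polynomials, occur.\<close>
  proof (cases "k \<ge> 0")
    case True
    define m where "m = nat k"
    have k: "k = int m" using True by (simp add: m_def)
    have "a * S * B ^ m = b * R * (g ^ m * T' ^ m)"
    proof (rule ev2_eqI[OF E])
      fix u v assume uv: "ev2 E u v \<noteq> 0"
      then have "ev2 B u v \<noteq> 0" by (simp add: E_def)
      then show "ev2 (a * S * B ^ m) u v = ev2 (b * R * (g ^ m * T' ^ m)) u v"
        using key[OF uv] by (simp add: k power_divide power_mult_distrib field_simps)
    qed
    then have "multiplicity g (a * S * B ^ m) = multiplicity g (b * R * (g ^ m * T' ^ m))" by simp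
    then show ?thesis using ab nz g0 nd nT by (simp add: mult m0 mg k)
  next
    case False
    define m where "m = nat (- k)"
    have k: "k = - int m" using False by (simp add: m_def)
    have "a * S * (g ^ m * T' ^ m) = b * R * B ^ m"
    proof (rule ev2_eqI[OF E])
      fix u v assume uv: "ev2 E u v \<noteq> 0"
      then have "ev2 B u v \<noteq> 0" "ev2 g u v \<noteq> 0" "ev2 T' u v \<noteq> 0" by (simp_all add: E_def)
      then show "ev2 (a * S * (g ^ m * T' ^ m)) u v = ev2 (b * R * B ^ m) u v"
        using key[OF uv] by (simp add: k power_int_minus power_divide power_mult_distrib field_simps)
    qed
    then have "multiplicity g (a * S * (g ^ m * T' ^ m)) = multiplicity g (b * R * B ^ m)" by simp
    then show ?thesis using ab nz g0 nd nT by (simp add: mult m0 mg k)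
  qed
qed

end

section \<open>The ruled surface\<close>

lemma openin_sub_affine:
  assumes S: "S \<subseteq> {z. length z = m}"
  shows "openin (subtopology (zariski (affine_space m)) S) U \<longleftrightarrow>
    U \<subseteq> S \<and> (\<forall>z\<in>U. \<exists>h\<in>poly_fun m. h z \<noteq> 0 \<and> (\<forall>w\<in>S. h w \<noteq> 0 \<longrightarrow> w \<in> U))"
proof
  assume "openin (subtopology (zariski (affine_space m)) S) U"
  then obtain P where P: "P \<subseteq> poly_fun m" "U = open_locus m P \<inter> S"
    unfolding openin_subtopology openin_affine_space by blast
  show "U \<subseteq> S \<and> (\<forall>z\<in>U. \<exists>h\<in>poly_fun m. h z \<noteq> 0 \<and> (\<forall>w\<in>S. h w \<noteq> 0 \<longrightarrow> w \<in> U))"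
  proof (intro conjI ballI)
    show "U \<subseteq> S" using P by blast
    fix z assume "z \<in> U"
    then obtain f where f: "f \<in> P" "f z \<noteq> 0" using P(2) by (auto simp: open_locus_def)
    have "w \<in> U" if "w \<in> S" "f w \<noteq> 0" for w
      using that S f(1) unfolding P(2) open_locus_def by blast
    then show "\<exists>h\<in>poly_fun m. h z \<noteq> 0 \<and> (\<forall>w\<in>S. h w \<noteq> 0 \<longrightarrow> w \<in> U)" using f P(1) by blast
  qed
next
  assume R: "U \<subseteq> S \<and> (\<forall>z\<in>U. \<exists>h\<in>poly_fun m. h z \<noteq> 0 \<and> (\<forall>w\<in>S. h w \<noteq> 0 \<longrightarrow> w \<in> U))"
  let ?P = "{h \<in> poly_fun m. \<forall>w\<in>S. h w \<noteq> 0 \<longrightarrow> w \<in> U}"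
  have "U = open_locus m ?P \<inter> S"
  proof (intro equalityI subsetI)
    fix z assume z: "z \<in> U"
    then obtain h where "h \<in> ?P" "h z \<noteq> 0" using R by blast
    moreover have "z \<in> S" "length z = m" using R S z by auto
    ultimately show "z \<in> open_locus m ?P \<inter> S" unfolding open_locus_def by blast
  next
    fix z assume "z \<in> open_locus m ?P \<inter> S"
    then obtain h where "h \<in> ?P" "h z \<noteq> 0" "z \<in> S" unfolding open_locus_def by blast
    then show "z \<in> U" by simp
  qed
  moreover have "?P \<subseteq> poly_fun m" by blast
  ultimately show "openin (subtopology (zariski (affine_space m)) S) U"
    unfolding openin_subtopology openin_affine_space by blast
qed

lemma regular_affine_space:
  "regular (affine_space m) U f \<longleftrightarrow> openin (zariski (affine_space m)) U \<and>
     (\<forall>z\<in>U. \<exists>g\<in>poly_fun m. \<exists>h\<in>poly_fun m. h z \<noteq> 0 \<and> (\<forall>w\<in>U. h w \<noteq> 0 \<longrightarrow> f w = g w / h w))"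
  unfolding openin_affine_space by (simp add: affine_space_def Let_def)

lemma zariski_subvar: "zariski (subvar X S) = subtopology (zariski X) S"
  by (simp add: subvar_def)

lemma regular_subvar: "regular (subvar X S) U f \<longleftrightarrow> openin (subtopology (zariski X) S) U \<and>
       (\<forall>x\<in>U. \<exists>W g. openin (zariski X) W \<and> x \<in> W \<and> regular X W g \<and> (\<forall>y\<in>W \<inter> U. f y = g y))"
  by (simp add: subvar_def)

lemma regular_sub_affine:
  assumes S: "S \<subseteq> {z. length z = m}"
  shows "regular (subvar (affine_space m) S) U f \<longleftrightarrow> openin (subtopology (zariski (affine_space m)) S) U \<and>
    (\<forall>z\<in>U. \<exists>g\<in>poly_fun m. \<exists>h\<in>poly_fun m. h z \<noteq> 0 \<and> (\<forall>w\<in>U. h w \<noteq> 0 \<longrightarrow> f w = g w / h w))"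
  (is "?L \<longleftrightarrow> ?R")
proof
  assume L: ?L
  show ?R
  proof (intro conjI ballI)
    show o: "openin (subtopology (zariski (affine_space m)) S) U" using L by (simp add: regular_subvar)
    fix z assume z: "z \<in> U"
    obtain W f' where W: "openin (zariski (affine_space m)) W" "z \<in> W" "regular (affine_space m) W f'" "\<forall>y\<in>W \<inter> U. f y = f' y"
      using L z unfolding regular_subvar by blast
    obtain g h where gh: "g \<in> poly_fun m" "h \<in> poly_fun m" "h z \<noteq> 0" "\<forall>w\<in>W. h w \<noteq> 0 \<longrightarrow> f' w = g w / h w"
      using W(2,3) unfolding regular_affine_space by blast
    obtain P where P: "P \<subseteq> poly_fun m" "W = open_locus m P" using W(1) unfolding openin_affine_space by blast
    then obtain k where k: "k \<in> P" "k z \<noteq> 0" using W(2) by (auto simp: open_locus_def)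
    have US: "U \<subseteq> S" using o S by (simp add: openin_sub_affine[OF S])
    show "\<exists>g\<in>poly_fun m. \<exists>h\<in>poly_fun m. h z \<noteq> 0 \<and> (\<forall>w\<in>U. h w \<noteq> 0 \<longrightarrow> f w = g w / h w)"
    proof (rule bexI[of _ "\<lambda>w. g w * k w"], rule bexI[of _ "\<lambda>w. h w * k w"], intro conjI ballI impI)
      show "(\<lambda>w. g w * k w) \<in> poly_fun m" "(\<lambda>w. h w * k w) \<in> poly_fun m"
        using gh k P by (auto intro: poly_fun.mult)
      show "h z * k z \<noteq> 0" using gh k by simp
      fix w assume w: "w \<in> U" "h w * k w \<noteq> 0"
      then have "w \<in> W" using US S k P by (auto simp: open_locus_def)
      then show "f w = g w * k w / (h w * k w)" using W(4) gh(4) w by auto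
    qed
  qed
next
  assume R: ?R
  show ?L unfolding regular_subvar
  proof (intro conjI ballI)
    show o: "openin (subtopology (zariski (affine_space m)) S) U" using R by simp
    fix z assume z: "z \<in> U"
    then obtain g h where gh: "g \<in> poly_fun m" "h \<in> poly_fun m" "h z \<noteq> 0" "\<forall>w\<in>U. h w \<noteq> 0 \<longrightarrow> f w = g w / h w"
      using R by blast
    let ?W = "open_locus m {h}"
    have "z \<in> S" using o z by (auto simp: openin_sub_affine[OF S])
    have oW: "openin (zariski (affine_space m)) ?W" unfolding openin_affine_space using gh by blast
    moreover have "regular (affine_space m) ?W (\<lambda>w. g w / h w)"
      unfolding regular_affine_space using oW gh by (auto simp: open_locus_def)
    moreover have "z \<in> ?W" using gh S \<open>z \<in> S\<close> by (auto simp: open_locus_def)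
    moreover have "\<forall>y\<in>?W \<inter> U. f y = g y / h y" using gh by (auto simp: open_locus_def)
    ultimately show "\<exists>W g. openin (zariski (affine_space m)) W \<and> z \<in> W \<and> regular (affine_space m) W g \<and> (\<forall>y\<in>W \<inter> U. f y = g y)"
      by blast
  qed
qed

lemma points_sub_affine: "S \<subseteq> {z. length z = m} \<Longrightarrow> points (subvar (affine_space m) S) = S"
  by (auto simp: zariski_subvar points_affine_space)

lemma points_quotient_by: "points (quotient_by X q) = q ` points X"
proof
  show "points (quotient_by X q) \<subseteq> q ` points X"
    using openin_topspace[of "zariski (quotient_by X q)"] unfolding openin_quotient_by by blast
  have "{x \<in> points X. q x \<in> q ` points X} = points X" by auto
  then have "openin (zariski (quotient_by X q)) (q ` points X)" by (simp add: openin_quotient_by)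
  then show "q ` points X \<subseteq> points (quotient_by X q)" by (rule openin_subset)
qed

lemma openin_quotient_affine:
  assumes S: "S \<subseteq> {z. length z = m}"
  shows "openin (zariski (quotient_by (subvar (affine_space m) S) q)) V \<longleftrightarrow> V \<subseteq> q ` S \<and>
    (\<forall>z\<in>S. q z \<in> V \<longrightarrow> (\<exists>h\<in>poly_fun m. h z \<noteq> 0 \<and> (\<forall>w\<in>S. h w \<noteq> 0 \<longrightarrow> q w \<in> V)))"
  unfolding openin_quotient_by unfolding points_sub_affine[OF S] unfolding zariski_subvar openin_sub_affine[OF S] by auto

lemma regular_quotient_affine:
  assumes S: "S \<subseteq> {z. length z = m}"
  shows "regular (quotient_by (subvar (affine_space m) S) q) V f \<longleftrightarrow>
    openin (zariski (quotient_by (subvar (affine_space m) S) q)) V \<and>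
    (\<forall>z\<in>S. q z \<in> V \<longrightarrow> (\<exists>g\<in>poly_fun m. \<exists>h\<in>poly_fun m. h z \<noteq> 0 \<and>
      (\<forall>w\<in>S. q w \<in> V \<longrightarrow> h w \<noteq> 0 \<longrightarrow> f (q w) = g w / h w)))"
proof -
  let ?X = "subvar (affine_space m) S"
  have "regular (quotient_by ?X q) V f \<longleftrightarrow> openin (zariski (quotient_by ?X q)) V \<and> regular ?X {x \<in> points ?X. q x \<in> V} (f \<circ> q)"
    unfolding openin_quotient_by by (auto simp: quotient_by_def Let_def)
  also have "\<dots> \<longleftrightarrow> openin (zariski (quotient_by ?X q)) V \<and>
    (\<forall>z\<in>S. q z \<in> V \<longrightarrow> (\<exists>g\<in>poly_fun m. \<exists>h\<in>poly_fun m. h z \<noteq> 0 \<and>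
      (\<forall>w\<in>S. q w \<in> V \<longrightarrow> h w \<noteq> 0 \<longrightarrow> f (q w) = g w / h w)))"
    unfolding regular_sub_affine[OF S] openin_quotient_by unfolding points_sub_affine[OF S] unfolding zariski_subvar
    by (auto simp only: Ball_def mem_Collect_eq imp_conjL comp_def)
  finally show ?thesis .
qed

lemma poly_fun_power: "f \<in> poly_fun m \<Longrightarrow> (\<lambda>z. f z ^ k) \<in> poly_fun m"
  by (induction k) (auto intro: poly_fun.intros)

lemma poly_fun_diff: "f \<in> poly_fun m \<Longrightarrow> g \<in> poly_fun m \<Longrightarrow> (\<lambda>z. f z - g z) \<in> poly_fun m"
  using poly_fun.add[OF _ poly_fun.mult[OF poly_fun.const[of "-1"]], of f m g] by simp

lemma poly_fun_compose:
  assumes "f \<in> poly_fun m" "\<And>i. i < m \<Longrightarrow> L i \<in> poly_fun k"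
  shows "(\<lambda>z. f (map (\<lambda>i. L i z) [0..<m])) \<in> poly_fun k"
  using assms(1)
proof induction
  case (coord i)
  have "(\<lambda>z. map (\<lambda>i. L i z) [0..<m] ! i) = L i" using coord by auto
  then show ?case using assms(2) coord by simp
qed (auto intro: poly_fun.intros)

lemma poly_fun_bipoly:
  assumes "f \<in> poly_fun m"
  shows "\<exists>F. \<forall>u v. ev2 F u v = f (map (\<lambda>i. ev2 (L i) u v) [0..<m])"
  using assms
proof induction
  case (const c) then show ?case by (intro exI[of _ "[:[:c:]:]"]) simp
next
  case (coord i) then show ?case by (intro exI[of _ "L i"]) simp
next
  case (add f g) then show ?case by (metis ev2_simps(1))
next
  case (mult f g) then show ?case by (metis ev2_simps(3))
qed

lemma poly_fun_poly:
  assumes "f \<in> poly_fun m"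
  shows "\<exists>F :: complex poly. \<forall>t. poly F t = f (map (\<lambda>i. poly (L i) t) [0..<m])"
  using assms
proof induction
  case (const c) then show ?case by (intro exI[of _ "[:c:]"]) simp
next
  case (coord i) then show ?case by (intro exI[of _ "L i"]) simp
next
  case (add f g) then show ?case by (metis poly_add)
next
  case (mult f g) then show ?case by (metis poly_mult)
qed

text \<open>Clearing denominators: a polynomial in the chart coordinates, which are quotients on the
  total space, becomes polynomial there after multiplication by a power of
  \<open>du * dv\<close>.\<close>

lemma poly_fun_homogenize:
  assumes "nu \<in> poly_fun m" "du \<in> poly_fun m" "nv \<in> poly_fun m" "dv \<in> poly_fun m"
  shows "\<exists>F\<in>poly_fun m. \<exists>N. \<forall>z. du z \<noteq> 0 \<longrightarrow> dv z \<noteq> 0 \<longrightarrow>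
    F z = (du z * dv z) ^ N * ev2 f (nu z / du z) (nv z / dv z)"
proof (induction f)
  case 0
  then show ?case by (intro bexI[of _ "\<lambda>_. 0"] exI[of _ 0]) (auto intro: poly_fun.intros)
next
  case (pCons c f)
  have "\<exists>F\<in>poly_fun m. \<exists>N. \<forall>z. du z \<noteq> 0 \<longrightarrow> dv z \<noteq> 0 \<longrightarrow>
    F z = (du z * dv z) ^ N * poly c (nu z / du z)"
  proof (induction c)
    case 0
    then show ?case by (intro bexI[of _ "\<lambda>_. 0"] exI[of _ 0]) (auto intro: poly_fun.intros)
  next
    case (pCons c f)
    then obtain F N where F: "F \<in> poly_fun m" "\<forall>z. du z \<noteq> 0 \<longrightarrow> dv z \<noteq> 0 \<longrightarrow>
      F z = (du z * dv z) ^ N * poly f (nu z / du z)" by blast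
    show ?case
    proof (intro bexI exI allI impI)
      show "(\<lambda>z. (du z * dv z) ^ Suc N * c + nu z * (dv z * F z)) \<in> poly_fun m"
        by (intro poly_fun.intros poly_fun_power assms F)
      fix z assume z: "du z \<noteq> 0" "dv z \<noteq> 0"
      then obtain x where x: "nu z = du z * x" by (metis nonzero_mult_div_cancel_left times_divide_eq_right)
      have "F z = (du z * dv z) ^ N * poly f x" using F(2) z by (simp add: x)
      then show "(du z * dv z) ^ Suc N * c + nu z * (dv z * F z) = (du z * dv z) ^ Suc N * poly (pCons c f) (nu z / du z)"
        using z by (simp add: x algebra_simps)
    qed
  qed
  then obtain G M where G: "G \<in> poly_fun m" "\<forall>z. du z \<noteq> 0 \<longrightarrow> dv z \<noteq> 0 \<longrightarrow>
    G z = (du z * dv z) ^ M * poly c (nu z / du z)" by blast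
  obtain F N where F: "F \<in> poly_fun m" "\<forall>z. du z \<noteq> 0 \<longrightarrow> dv z \<noteq> 0 \<longrightarrow>
    F z = (du z * dv z) ^ N * ev2 f (nu z / du z) (nv z / dv z)" using pCons by blast
  show ?case
  proof (intro bexI exI allI impI)
    show "(\<lambda>z. (du z * dv z) ^ Suc N * G z + (du z * dv z) ^ M * (nv z * (du z * F z))) \<in> poly_fun m"
      by (intro poly_fun.intros poly_fun_power assms F G)
    fix z assume z: "du z \<noteq> 0" "dv z \<noteq> 0"
    obtain x where x: "nu z = du z * x" using z by (metis nonzero_mult_div_cancel_left times_divide_eq_right)
    obtain y where y: "nv z = dv z * y" using z by (metis nonzero_mult_div_cancel_left times_divide_eq_right)
    have "F z = (du z * dv z) ^ N * ev2 f x y" "G z = (du z * dv z) ^ M * poly c x"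
      using F(2) G(2) z by (simp_all add: x y)
    moreover have "ev2 (pCons c f) x y = poly c x + y * ev2 f x y"
      by (simp add: ev2_def)
    ultimately show "(du z * dv z) ^ Suc N * G z + (du z * dv z) ^ M * (nv z * (du z * F z)) =
      (du z * dv z) ^ (Suc N + M) * ev2 (pCons c f) (nu z / du z) (nv z / dv z)"
      using z by (simp add: x y power_add algebra_simps)
  qed
qed

lemma finite_avoid: "(f :: complex poly) \<noteq> 0 \<Longrightarrow> \<exists>t. poly f t \<noteq> 0"
  using poly_all_0_iff_0 by blast

lemma upt_4: "[0..<4] = [0, 1, 2, 3 :: nat]" by (simp add: upt_conv_Cons)

lemma ruled_coords_length: "ruled_coords \<subseteq> {z. length z = 4}"
  by (auto simp: ruled_coords_def)

text \<open>Coordinates \<open>l, m\<close> on the base with \<open>l = 0\<close> at the chosen point \<open>[p0 : p1]\<close>.\<close>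

locale ruled =
  fixes n :: nat and p0 p1 g0 g1 :: complex
  assumes pg: "p1 * g1 + p0 * g0 = 1"
begin

abbreviation "X \<equiv> ruled_surface n"

text \<open>The inverse of the substitution \<open>l = p1 * x0 - p0 * x1\<close>,
  \<open>m = g0 * x0 + g1 * x1\<close>, which has determinant 1 by \<open>pg\<close>.\<close>

definition pt :: "complex \<Rightarrow> complex \<Rightarrow> complex \<Rightarrow> complex \<Rightarrow> complex list set" where
  "pt l m y0 y1 = ruled_point n [g1 * l + p0 * m, p1 * m - g0 * l, y0, y1]"

definition valid :: "complex \<Rightarrow> complex \<Rightarrow> complex \<Rightarrow> complex \<Rightarrow> bool" where
  "valid l m y0 y1 \<longleftrightarrow> (l \<noteq> 0 \<or> m \<noteq> 0) \<and> (y0 \<noteq> 0 \<or> y1 \<noteq> 0)"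

lemma lm_inverse:
  "p1 * (g1 * l + p0 * m) - p0 * (p1 * m - g0 * l) = l" "g0 * (g1 * l + p0 * m) + g1 * (p1 * m - g0 * l) = m"
  "g1 * (p1 * x0 - p0 * x1) + p0 * (g0 * x0 + g1 * x1) = x0" "p1 * (g0 * x0 + g1 * x1) - g0 * (p1 * x0 - p0 * x1) = x1"
  using pg by algebra+

lemma valid_coords: "[g1 * l + p0 * m, p1 * m - g0 * l, y0, y1] \<in> ruled_coords \<longleftrightarrow> valid l m y0 y1"
proof -
  have "g1 * l + p0 * m = 0 \<and> p1 * m - g0 * l = 0 \<longleftrightarrow> l = 0 \<and> m = 0"
    using lm_inverse(1,2)[of l m] by auto
  then show ?thesis by (auto simp: ruled_coords_def valid_def)
qed

lemma coords_ex:
  assumes "z \<in> ruled_coords"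
  obtains l m y0 y1 where "valid l m y0 y1" "z = [g1 * l + p0 * m, p1 * m - g0 * l, y0, y1]" "ruled_point n z = pt l m y0 y1"
    "l = p1 * z ! 0 - p0 * z ! 1"
proof -
  obtain x0 x1 y0 y1 where z: "z = [x0, x1, y0, y1]" using assms by (auto simp: ruled_coords_def)
  define l m where "l = p1 * x0 - p0 * x1" "m = g0 * x0 + g1 * x1"
  have zl: "z = [g1 * l + p0 * m, p1 * m - g0 * l, y0, y1]" using lm_inverse(3,4)[of x0 x1] by (simp add: z l_m_def)
  have "l = p1 * z ! 0 - p0 * z ! 1" by (simp add: z l_m_def)
  moreover have "valid l m y0 y1" using assms unfolding zl valid_coords .
  moreover have "ruled_point n z = pt l m y0 y1" unfolding zl pt_def ..
  ultimately show thesis using that zl by blast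
qed

lemma pt_eq: "pt l m y0 y1 = pt l' m' y0' y1' \<longleftrightarrow>
  (\<exists>c d. c \<noteq> 0 \<and> d \<noteq> 0 \<and> l' = c * l \<and> m' = c * m \<and> y0' = d * y0 \<and> y1' = c ^ n * d * y1)"
proof
  assume "pt l m y0 y1 = pt l' m' y0' y1'"
  moreover have "[g1 * l' + p0 * m', p1 * m' - g0 * l', y0', y1'] \<in> pt l' m' y0' y1'"
    unfolding pt_def ruled_point_def by (intro CollectI exI[of _ 1]) simp
  ultimately have "[g1 * l' + p0 * m', p1 * m' - g0 * l', y0', y1'] \<in> pt l m y0 y1" by simp
  then obtain c d where cd: "c \<noteq> 0" "d \<noteq> 0" "g1 * l' + p0 * m' = c * (g1 * l + p0 * m)"
    "p1 * m' - g0 * l' = c * (p1 * m - g0 * l)" "y0' = d * y0" "y1' = c ^ n * d * y1"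
    unfolding pt_def ruled_point_def by auto
  have "l' = c * (p1 * (g1 * l + p0 * m) - p0 * (p1 * m - g0 * l))"
    using lm_inverse(1)[of l' m'] unfolding cd(3,4) by (simp add: algebra_simps)
  moreover have "m' = c * (g0 * (g1 * l + p0 * m) + g1 * (p1 * m - g0 * l))"
    using lm_inverse(2)[of l' m'] unfolding cd(3,4) by (simp add: algebra_simps)
  ultimately have "l' = c * l" "m' = c * m" unfolding lm_inverse by simp_all
  then show "\<exists>c d. c \<noteq> 0 \<and> d \<noteq> 0 \<and> l' = c * l \<and> m' = c * m \<and> y0' = d * y0 \<and> y1' = c ^ n * d * y1"
    using cd by blast
next
  assume "\<exists>c d. c \<noteq> 0 \<and> d \<noteq> 0 \<and> l' = c * l \<and> m' = c * m \<and> y0' = d * y0 \<and> y1' = c ^ n * d * y1"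
  then obtain c d where cd: "c \<noteq> 0" "d \<noteq> 0" "l' = c * l" "m' = c * m" "y0' = d * y0" "y1' = c ^ n * d * y1" by blast
  have *: "g1 * l' + p0 * m' = c * (g1 * l + p0 * m)" "p1 * m' - g0 * l' = c * (p1 * m - g0 * l)"
    by (simp_all add: cd algebra_simps)
  show "pt l m y0 y1 = pt l' m' y0' y1'"
  proof (intro set_eqI iffI)
    fix z assume "z \<in> pt l m y0 y1"
    then obtain e f where ef: "e \<noteq> 0" "f \<noteq> 0" "z = [e * (g1 * l + p0 * m), e * (p1 * m - g0 * l), f * y0, e ^ n * f * y1]"
      unfolding pt_def ruled_point_def by auto
    then show "z \<in> pt l' m' y0' y1'" unfolding pt_def ruled_point_def * cd(5,6)
      using cd(1,2) by (intro CollectI exI[of _ "e / c"] exI[of _ "f / d"]) (simp add: power_divide)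
  next
    fix z assume "z \<in> pt l' m' y0' y1'"
    then obtain e f where ef: "e \<noteq> 0" "f \<noteq> 0" "z = [e * (c * (g1 * l + p0 * m)), e * (c * (p1 * m - g0 * l)), f * (d * y0), e ^ n * f * (c ^ n * d * y1)]"
      unfolding pt_def ruled_point_def * cd(5,6) by auto
    then show "z \<in> pt l m y0 y1" unfolding pt_def ruled_point_def
      using cd(1,2) by (intro CollectI exI[of _ "e * c"] exI[of _ "f * d"]) (simp add: power_mult_distrib mult_ac)
  qed
qed

lemma points_X: "points X = {pt l m y0 y1 | l m y0 y1. valid l m y0 y1}"
proof -
  have "points X = ruled_point n ` ruled_coords"
    unfolding ruled_surface_def points_quotient_by points_sub_affine[OF ruled_coords_length] ..
  also have "\<dots> = {pt l m y0 y1 | l m y0 y1. valid l m y0 y1}"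
  proof (intro set_eqI iffI)
    fix x assume "x \<in> ruled_point n ` ruled_coords"
    then obtain z where z: "z \<in> ruled_coords" "x = ruled_point n z" by blast
    show "x \<in> {pt l m y0 y1 | l m y0 y1. valid l m y0 y1}"
      by (rule coords_ex[OF z(1)]) (unfold z(2), blast)
  next
    fix x assume "x \<in> {pt l m y0 y1 | l m y0 y1. valid l m y0 y1}"
    then obtain l m y0 y1 where "x = pt l m y0 y1" "valid l m y0 y1" by blast
    then show "x \<in> ruled_point n ` ruled_coords" unfolding pt_def valid_coords[symmetric] by blast
  qed
  finally show ?thesis .
qed

lemma zero_section_pt: "zero_section n = {pt l m 0 y1 | l m y1. valid l m 0 y1}"
proof (intro set_eqI iffI)
  fix x assume "x \<in> zero_section n"
  then obtain x0 x1 y1 where x: "x = ruled_point n [x0, x1, 0, y1]" "[x0, x1, 0, y1] \<in> ruled_coords"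
    by (auto simp: zero_section_def)
  then show "x \<in> {pt l m 0 y1 | l m y1. valid l m 0 y1}"
    by (rule_tac coords_ex[OF x(2)]) (unfold x(1) list.inject, blast)
next
  fix x assume "x \<in> {pt l m 0 y1 | l m y1. valid l m 0 y1}"
  then obtain l m y1 where x: "x = pt l m 0 y1" "valid l m 0 y1" by blast
  show "x \<in> zero_section n" unfolding zero_section_def x(1) pt_def
    by (intro CollectI exI conjI) (use x(2) in \<open>auto simp: valid_coords\<close>)
qed

lemma fibre_pt: "fibre n (proj_point [p0, p1]) = {pt 0 m y0 y1 | m y0 y1. valid 0 m y0 y1}"
proof (intro set_eqI iffI)
  fix x assume "x \<in> fibre n (proj_point [p0, p1])"
  then obtain x0 x1 y0 y1 where x: "x = ruled_point n [x0, x1, y0, y1]" "[x0, x1, y0, y1] \<in> ruled_coords"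
    "proj_point [x0, x1] = proj_point [p0, p1]" by (auto simp: fibre_def)
  have "[x0, x1] \<in> proj_point [x0, x1]" unfolding proj_point_def by (intro CollectI exI[of _ 1]) simp
  then obtain c where c: "c \<noteq> 0" "x0 = c * p0" "x1 = c * p1" unfolding x(3) by (auto simp: proj_point_def)
  obtain l m y0' y1' where lm: "valid l m y0' y1'" "x = pt l m y0' y1'" "l = p1 * x0 - p0 * x1"
  proof (rule coords_ex[OF x(2)])
    fix l m y0' y1'
    assume *: "valid l m y0' y1'" "ruled_point n [x0, x1, y0, y1] = pt l m y0' y1'"
      "l = p1 * [x0, x1, y0, y1] ! 0 - p0 * [x0, x1, y0, y1] ! 1"
    show thesis by (rule that[OF *(1)]) (simp_all only: x(1) *(2), simp add: *(3))
  qed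
  have "l = 0" unfolding lm(3) c by simp
  then show "x \<in> {pt 0 m y0 y1 | m y0 y1. valid 0 m y0 y1}" using lm by blast
next
  fix x assume "x \<in> {pt 0 m y0 y1 | m y0 y1. valid 0 m y0 y1}"
  then obtain m y0 y1 where x: "x = pt 0 m y0 y1" "valid 0 m y0 y1" by blast
  then have m: "m \<noteq> 0" by (auto simp: valid_def)
  have "proj_point [p0 * m, p1 * m] = proj_point [p0, p1]"
  proof (intro set_eqI iffI)
    fix z assume "z \<in> proj_point [p0 * m, p1 * m]"
    then obtain c where "c \<noteq> 0" "z = [c * (p0 * m), c * (p1 * m)]" by (auto simp: proj_point_def)
    then show "z \<in> proj_point [p0, p1]" unfolding proj_point_def using m
      by (intro CollectI exI[of _ "c * m"]) (simp add: mult_ac)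
  next
    fix z assume "z \<in> proj_point [p0, p1]"
    then obtain c where "c \<noteq> 0" "z = [c * p0, c * p1]" by (auto simp: proj_point_def)
    then show "z \<in> proj_point [p0 * m, p1 * m]" unfolding proj_point_def using m
      by (intro CollectI exI[of _ "c / m"]) simp
  qed
  moreover have "[g1 * 0 + p0 * m, p1 * m - g0 * 0, y0, y1] \<in> ruled_coords" using x valid_coords by blast
  ultimately show "x \<in> fibre n (proj_point [p0, p1])" unfolding fibre_def x(1) pt_def
    by (intro CollectI exI[of _ "p0 * m"] exI[of _ "p1 * m"] exI[of _ y0] exI[of _ y1]) simp
qed

lemma poly_fun_to_lm:
  assumes "h \<in> poly_fun 4"
  shows "\<exists>h'\<in>poly_fun 4. \<forall>l m y0 y1. h' [l, m, y0, y1] = h [g1 * l + p0 * m, p1 * m - g0 * l, y0, y1]"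
proof -
  define L where "L = (\<lambda>i z. [g1 * z ! 0 + p0 * z ! 1, p1 * z ! 1 + (- g0) * z ! 0, z ! 2, z ! 3] ! i)"
  have "L i \<in> poly_fun 4" if i: "i < 4" for i
  proof -
    consider "i = 0" | "i = 1" | "i = 2" | "i = 3" using i by linarith
    then show ?thesis by cases (auto simp: L_def intro!: poly_fun.intros poly_fun_diff)
  qed
  then show ?thesis using poly_fun_compose[OF assms, of L 4]
    by (intro bexI) (auto simp: L_def upt_4)
qed

lemma poly_fun_from_lm:
  assumes "h \<in> poly_fun 4"
  shows "\<exists>h'\<in>poly_fun 4. \<forall>l m y0 y1. h' [g1 * l + p0 * m, p1 * m - g0 * l, y0, y1] = h [l, m, y0, y1]"
proof -
  define L where "L = (\<lambda>i z. [p1 * z ! 0 + (- p0) * z ! 1, g0 * z ! 0 + g1 * z ! 1, z ! 2, z ! 3] ! i)"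
  have "L i \<in> poly_fun 4" if i: "i < 4" for i
  proof -
    consider "i = 0" | "i = 1" | "i = 2" | "i = 3" using i by linarith
    then show ?thesis by cases (auto simp: L_def intro!: poly_fun.intros poly_fun_diff)
  qed
  moreover have "p1 * (g1 * l + p0 * m) + - p0 * (p1 * m - g0 * l) = l" for l m
    using lm_inverse(1)[of l m] by simp
  ultimately show ?thesis using poly_fun_compose[OF assms, of L 4]
    by (intro bexI) (auto simp: L_def upt_4 lm_inverse(2))
qed

lemma openin_X: "openin (zariski X) V \<longleftrightarrow> V \<subseteq> points X \<and>
  (\<forall>l m y0 y1. valid l m y0 y1 \<longrightarrow> pt l m y0 y1 \<in> V \<longrightarrow>
    (\<exists>h\<in>poly_fun 4. h [l, m, y0, y1] \<noteq> 0 \<and>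
      (\<forall>l' m' y0' y1'. valid l' m' y0' y1' \<longrightarrow> h [l', m', y0', y1'] \<noteq> 0 \<longrightarrow> pt l' m' y0' y1' \<in> V)))"
  (is "_ \<longleftrightarrow> ?R")
proof -
  have P: "points X = ruled_point n ` ruled_coords"
    unfolding ruled_surface_def points_quotient_by points_sub_affine[OF ruled_coords_length] ..
  note O = openin_quotient_affine[OF ruled_coords_length, folded ruled_surface_def, of "ruled_point n", folded ruled_surface_def P]
  show ?thesis
  proof
    assume L: "openin (zariski X) V"
    show ?R
    proof (intro conjI allI impI)
      show "V \<subseteq> points X" using L O by blast
      fix l m y0 y1 assume v: "valid l m y0 y1" "pt l m y0 y1 \<in> V"
      obtain h where h: "h \<in> poly_fun 4" "h [g1 * l + p0 * m, p1 * m - g0 * l, y0, y1] \<noteq> 0"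
        "\<And>w. w \<in> ruled_coords \<Longrightarrow> h w \<noteq> 0 \<Longrightarrow> ruled_point n w \<in> V"
        using L v valid_coords unfolding O pt_def by blast
      then show "\<exists>h\<in>poly_fun 4. h [l, m, y0, y1] \<noteq> 0 \<and>
        (\<forall>l' m' y0' y1'. valid l' m' y0' y1' \<longrightarrow> h [l', m', y0', y1'] \<noteq> 0 \<longrightarrow> pt l' m' y0' y1' \<in> V)"
        using poly_fun_to_lm[OF h(1)] valid_coords unfolding pt_def by metis
    qed
  next
    assume R: ?R
    show "openin (zariski X) V" unfolding O
    proof (intro conjI ballI impI)
      show "V \<subseteq> points X" using R by blast
      fix z assume z: "z \<in> ruled_coords" "ruled_point n z \<in> V"
      obtain l m y0 y1 where lm: "valid l m y0 y1" "z = [g1 * l + p0 * m, p1 * m - g0 * l, y0, y1]" "ruled_point n z = pt l m y0 y1"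
        by (rule coords_ex[OF z(1)])
      obtain h where h: "h \<in> poly_fun 4" "h [l, m, y0, y1] \<noteq> 0"
        "\<And>l' m' y0' y1'. valid l' m' y0' y1' \<Longrightarrow> h [l', m', y0', y1'] \<noteq> 0 \<Longrightarrow> pt l' m' y0' y1' \<in> V"
        using R lm z(2) by metis
      obtain h' where h': "h' \<in> poly_fun 4" "\<And>l m y0 y1. h' [g1 * l + p0 * m, p1 * m - g0 * l, y0, y1] = h [l, m, y0, y1]"
        using poly_fun_from_lm[OF h(1)] by blast
      show "\<exists>h\<in>poly_fun 4. h z \<noteq> 0 \<and> (\<forall>w\<in>ruled_coords. h w \<noteq> 0 \<longrightarrow> ruled_point n w \<in> V)"
      proof (intro bexI[of _ h'] conjI ballI impI)
        show "h' z \<noteq> 0" using h h' lm by simp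
        fix w assume w: "w \<in> ruled_coords" "h' w \<noteq> 0"
        obtain l m y0 y1 where lm: "valid l m y0 y1" "w = [g1 * l + p0 * m, p1 * m - g0 * l, y0, y1]" "ruled_point n w = pt l m y0 y1"
          by (rule coords_ex[OF w(1)])
        show "ruled_point n w \<in> V" unfolding lm(3) using h(3)[OF lm(1)] w(2) h'(2) lm(2) by simp
      qed (rule h'(1))
    qed
  qed
qed

lemma regular_X: "regular X V f \<longleftrightarrow> openin (zariski X) V \<and>
  (\<forall>l m y0 y1. valid l m y0 y1 \<longrightarrow> pt l m y0 y1 \<in> V \<longrightarrow>
    (\<exists>g\<in>poly_fun 4. \<exists>h\<in>poly_fun 4. h [l, m, y0, y1] \<noteq> 0 \<and>
      (\<forall>l' m' y0' y1'. valid l' m' y0' y1' \<longrightarrow> pt l' m' y0' y1' \<in> V \<longrightarrow> h [l', m', y0', y1'] \<noteq> 0 \<longrightarrow>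
         f (pt l' m' y0' y1') = g [l', m', y0', y1'] / h [l', m', y0', y1'])))"
  (is "_ \<longleftrightarrow> ?R")
proof -
  note O = regular_quotient_affine[OF ruled_coords_length, of "ruled_point n", folded ruled_surface_def]
  show ?thesis
  proof
    assume L: "regular X V f"
    show ?R
    proof (intro conjI allI impI)
      show "openin (zariski X) V" using L O by blast
      fix l m y0 y1 assume v: "valid l m y0 y1" "pt l m y0 y1 \<in> V"
      obtain g h where h: "g \<in> poly_fun 4" "h \<in> poly_fun 4" "h [g1 * l + p0 * m, p1 * m - g0 * l, y0, y1] \<noteq> 0"
        "\<And>w. w \<in> ruled_coords \<Longrightarrow> ruled_point n w \<in> V \<Longrightarrow> h w \<noteq> 0 \<Longrightarrow> f (ruled_point n w) = g w / h w"
        using L v valid_coords unfolding O pt_def by blast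
      obtain h' where h': "h' \<in> poly_fun 4" "\<And>l m y0 y1. h' [l, m, y0, y1] = h [g1 * l + p0 * m, p1 * m - g0 * l, y0, y1]"
        using poly_fun_to_lm[OF h(2)] by blast
      obtain g' where g': "g' \<in> poly_fun 4" "\<And>l m y0 y1. g' [l, m, y0, y1] = g [g1 * l + p0 * m, p1 * m - g0 * l, y0, y1]"
        using poly_fun_to_lm[OF h(1)] by blast
      show "\<exists>g\<in>poly_fun 4. \<exists>h\<in>poly_fun 4. h [l, m, y0, y1] \<noteq> 0 \<and>
      (\<forall>l' m' y0' y1'. valid l' m' y0' y1' \<longrightarrow> pt l' m' y0' y1' \<in> V \<longrightarrow> h [l', m', y0', y1'] \<noteq> 0 \<longrightarrow>
         f (pt l' m' y0' y1') = g [l', m', y0', y1'] / h [l', m', y0', y1'])"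
        using h h' g' valid_coords
        by (rule_tac bexI[of _ g'], rule_tac bexI[of _ h']) (auto simp: pt_def)
    qed
  next
    assume R: ?R
    show "regular X V f" unfolding O
    proof (intro conjI ballI impI)
      show "openin (zariski X) V" using R by blast
      fix z assume z: "z \<in> ruled_coords" "ruled_point n z \<in> V"
      obtain l m y0 y1 where lm: "valid l m y0 y1" "z = [g1 * l + p0 * m, p1 * m - g0 * l, y0, y1]" "ruled_point n z = pt l m y0 y1"
        by (rule coords_ex[OF z(1)])
      obtain g h where h: "g \<in> poly_fun 4" "h \<in> poly_fun 4" "h [l, m, y0, y1] \<noteq> 0"
        "\<And>l' m' y0' y1'. valid l' m' y0' y1' \<Longrightarrow> pt l' m' y0' y1' \<in> V \<Longrightarrow> h [l', m', y0', y1'] \<noteq> 0 \<Longrightarrow>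
          f (pt l' m' y0' y1') = g [l', m', y0', y1'] / h [l', m', y0', y1']"
        using R lm z(2) by metis
      obtain h' where h': "h' \<in> poly_fun 4" "\<And>l m y0 y1. h' [g1 * l + p0 * m, p1 * m - g0 * l, y0, y1] = h [l, m, y0, y1]"
        using poly_fun_from_lm[OF h(2)] by blast
      obtain g' where g': "g' \<in> poly_fun 4" "\<And>l m y0 y1. g' [g1 * l + p0 * m, p1 * m - g0 * l, y0, y1] = g [l, m, y0, y1]"
        using poly_fun_from_lm[OF h(1)] by blast
      show "\<exists>g\<in>poly_fun 4. \<exists>h\<in>poly_fun 4. h z \<noteq> 0 \<and>
        (\<forall>w\<in>ruled_coords. ruled_point n w \<in> V \<longrightarrow> h w \<noteq> 0 \<longrightarrow> f (ruled_point n w) = g w / h w)"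
      proof (rule bexI[of _ g'], rule bexI[of _ h'], intro conjI ballI impI)
        show "h' z \<noteq> 0" using h h' lm by simp
        fix w assume w: "w \<in> ruled_coords" "ruled_point n w \<in> V" "h' w \<noteq> 0"
        obtain l m y0 y1 where lm: "valid l m y0 y1" "w = [g1 * l + p0 * m, p1 * m - g0 * l, y0, y1]" "ruled_point n w = pt l m y0 y1"
          by (rule coords_ex[OF w(1)])
        have "h [l, m, y0, y1] \<noteq> 0" using w(3) h'(2) lm(2) by simp
        then show "f (ruled_point n w) = g' w / h' w"
          using h(4)[OF lm(1)] w(2) unfolding lm(3) unfolding lm(2) g'(2) h'(2) by simp
      qed (use h' g' in auto)
    qed
  qed
qed

end

lemma inverse_unique': "1 = c * l \<Longrightarrow> (c :: 'a :: field) = 1 / l"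
  by (metis mult_zero_right nonzero_eq_divide_eq zero_neq_one)

context ruled
begin

text \<open>One verification serves all charts: the chart map has polynomial coordinates
  \<open>L\<close>, \<open>M\<close>, \<open>S\<close>, \<open>T\<close>, and its inverse consists
  of the quotients \<open>nu / du\<close> and \<open>nv / dv\<close>. Their denominators are nonzero
  at \<open>(1, 1, 1, 1)\<close>, which yields density.\<close>

lemma chartI:
  fixes s :: "complex \<Rightarrow> complex \<Rightarrow> complex list set" and L M S T :: "complex poly poly"
  assumes s: "\<And>u v. s u v = pt (ev2 L u v) (ev2 M u v) (ev2 S u v) (ev2 T u v)"
    and val: "\<And>u v. valid (ev2 L u v) (ev2 M u v) (ev2 S u v) (ev2 T u v)"
    and pf: "nu \<in> poly_fun 4" "du \<in> poly_fun 4" "nv \<in> poly_fun 4" "dv \<in> poly_fun 4"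
    and inv: "\<And>l m y0 y1. valid l m y0 y1 \<Longrightarrow> du [l, m, y0, y1] \<noteq> 0 \<Longrightarrow> dv [l, m, y0, y1] \<noteq> 0 \<Longrightarrow>
      pt l m y0 y1 = s (nu [l, m, y0, y1] / du [l, m, y0, y1]) (nv [l, m, y0, y1] / dv [l, m, y0, y1])"
    and inv': "\<And>l m y0 y1 u v. valid l m y0 y1 \<Longrightarrow> pt l m y0 y1 = s u v \<Longrightarrow>
      du [l, m, y0, y1] \<noteq> 0 \<and> dv [l, m, y0, y1] \<noteq> 0 \<and>
      nu [l, m, y0, y1] / du [l, m, y0, y1] = u \<and> nv [l, m, y0, y1] / dv [l, m, y0, y1] = v"
    and valD: "\<And>l m y0 y1. du [l, m, y0, y1] \<noteq> 0 \<Longrightarrow> dv [l, m, y0, y1] \<noteq> 0 \<Longrightarrow> valid l m y0 y1"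
    and ones: "du [1, 1, 1, 1] \<noteq> 0" "dv [1, 1, 1, 1] \<noteq> 0"
  shows "chart X s"
proof -
  define z where "z u v = [ev2 L u v, ev2 M u v, ev2 S u v, ev2 T u v]" for u v
  have sinj: "u = u' \<and> v = v'" if "s u v = s u' v'" for u v u' v'
    using inv'[OF val[of u v], of u v] inv'[OF val[of u v], of u' v'] that by (simp add: s)
  have comp: "\<exists>F. \<forall>u v. ev2 F u v = h (z u v)" if h: "h \<in> poly_fun 4" for h
    using poly_fun_bipoly[OF h, of "\<lambda>i. [L, M, S, T] ! i"] by (auto simp: z_def upt_4)
  have homog: "\<exists>F\<in>poly_fun 4. \<exists>N. \<forall>z. du z \<noteq> 0 \<longrightarrow> dv z \<noteq> 0 \<longrightarrow> F z = (du z * dv z) ^ N * ev2 f (nu z / du z) (nv z / dv z)" for f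
    by (rule poly_fun_homogenize[OF pf])
  have spt: "s u v \<in> points X" for u v unfolding points_X s using val by blast
  have D_open: "openin (zariski X) {s u v | u v. ev2 f u v \<noteq> 0}" for f
    unfolding openin_X
  proof (intro conjI allI impI)
    show "{s u v | u v. ev2 f u v \<noteq> 0} \<subseteq> points X" using spt by blast
    fix l m y0 y1 assume v: "valid l m y0 y1" and "pt l m y0 y1 \<in> {s u v | u v. ev2 f u v \<noteq> 0}"
    then obtain u w where uw: "pt l m y0 y1 = s u w" "ev2 f u w \<noteq> 0" by blast
    obtain F N where F: "F \<in> poly_fun 4" "\<And>z. du z \<noteq> 0 \<Longrightarrow> dv z \<noteq> 0 \<Longrightarrow> F z = (du z * dv z) ^ N * ev2 f (nu z / du z) (nv z / dv z)"
      using homog[of f] by blast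
    show "\<exists>h\<in>poly_fun 4. h [l, m, y0, y1] \<noteq> 0 \<and> (\<forall>l' m' y0' y1'. valid l' m' y0' y1' \<longrightarrow>
        h [l', m', y0', y1'] \<noteq> 0 \<longrightarrow> pt l' m' y0' y1' \<in> {s u v | u v. ev2 f u v \<noteq> 0})"
    proof (rule bexI[of _ "\<lambda>z. F z * (du z * dv z)"], intro conjI allI impI)
      show "F [l, m, y0, y1] * (du [l, m, y0, y1] * dv [l, m, y0, y1]) \<noteq> 0"
        using inv'[OF v uw(1)] F(2) uw(2) by auto
      fix l' m' y0' y1' assume v': "valid l' m' y0' y1'"
        "F [l', m', y0', y1'] * (du [l', m', y0', y1'] * dv [l', m', y0', y1']) \<noteq> 0"
      let ?z = "[l', m', y0', y1']"
      have d: "du ?z \<noteq> 0" "dv ?z \<noteq> 0" "F ?z \<noteq> 0" using v'(2) by auto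
      then have "ev2 f (nu ?z / du ?z) (nv ?z / dv ?z) \<noteq> 0" using F(2) by auto
      then show "pt l' m' y0' y1' \<in> {s u v | u v. ev2 f u v \<noteq> 0}" unfolding inv[OF v'(1) d(1,2)] by blast
    qed (intro poly_fun.intros F(1) pf)
  qed
  show ?thesis
  proof
    show "u = u' \<and> v = v'" if "s u v = s u' v'" for u v u' v' by (rule sinj[OF that])
    show "openin (zariski X) {s u v | u v. ev2 f u v \<noteq> 0}" for f by (rule D_open)
    show "openin (zariski X) V" if "regular X V F" for V F using that regular_X by blast
    show "\<exists>f. ev2 f u v \<noteq> 0 \<and> (\<forall>u' v'. ev2 f u' v' \<noteq> 0 \<longrightarrow> s u' v' \<in> V)"
      if V: "openin (zariski X) V" "s u v \<in> V" for V u v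
    proof -
      obtain h where h: "h \<in> poly_fun 4" "h (z u v) \<noteq> 0"
        "\<And>l' m' y0' y1'. valid l' m' y0' y1' \<Longrightarrow> h [l', m', y0', y1'] \<noteq> 0 \<Longrightarrow> pt l' m' y0' y1' \<in> V"
        using V val[of u v] unfolding openin_X s z_def by meson
      obtain F where F: "\<And>u v. ev2 F u v = h (z u v)" using comp[OF h(1)] by blast
      have "s u' v' \<in> V" if "ev2 F u' v' \<noteq> 0" for u' v'
        using h(3)[OF val[of u' v']] that unfolding F z_def s by blast
      then show ?thesis using h(2) F by metis
    qed
    show "\<exists>f g. ev2 g u v \<noteq> 0 \<and> (\<forall>u' v'. s u' v' \<in> V \<longrightarrow> ev2 g u' v' \<noteq> 0 \<longrightarrow> F (s u' v') = ev2 f u' v' / ev2 g u' v')"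
      if V: "regular X V F" "s u v \<in> V" for V F u v
    proof -
      have R: "\<exists>g\<in>poly_fun 4. \<exists>h\<in>poly_fun 4. h (z u v) \<noteq> 0 \<and>
        (\<forall>l' m' y0' y1'. valid l' m' y0' y1' \<longrightarrow> pt l' m' y0' y1' \<in> V \<longrightarrow> h [l', m', y0', y1'] \<noteq> 0 \<longrightarrow>
         F (pt l' m' y0' y1') = g [l', m', y0', y1'] / h [l', m', y0', y1'])"
        unfolding z_def
        by (rule conjunct2[OF V(1)[unfolded regular_X], rule_format, OF val[of u v] V(2)[unfolded s]])
      then obtain g h where h: "g \<in> poly_fun 4" "h \<in> poly_fun 4" "h (z u v) \<noteq> 0"
        "\<And>l' m' y0' y1'. valid l' m' y0' y1' \<Longrightarrow> pt l' m' y0' y1' \<in> V \<Longrightarrow> h [l', m', y0', y1'] \<noteq> 0 \<Longrightarrow>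
          F (pt l' m' y0' y1') = g [l', m', y0', y1'] / h [l', m', y0', y1']"
        by blast
      obtain G where G: "\<And>u v. ev2 G u v = g (z u v)" using comp[OF h(1)] by blast
      obtain H where H: "\<And>u v. ev2 H u v = h (z u v)" using comp[OF h(2)] by blast
      have "F (s u' v') = ev2 G u' v' / ev2 H u' v'" if "s u' v' \<in> V" "ev2 H u' v' \<noteq> 0" for u' v'
        using h(4)[OF val[of u' v']] that unfolding G H z_def s by blast
      then show ?thesis using h(3) H by metis
    qed
    show "regular X {s u v | u v. ev2 d u v \<noteq> 0} F"
      if dg: "\<And>u v. ev2 d u v \<noteq> 0 \<Longrightarrow> ev2 g u v \<noteq> 0" "\<And>u v. ev2 d u v \<noteq> 0 \<Longrightarrow> F (s u v) = ev2 f u v / ev2 g u v"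
      for d f g F
      unfolding regular_X
    proof (intro conjI allI impI D_open)
      fix l m y0 y1 assume v: "valid l m y0 y1" and "pt l m y0 y1 \<in> {s u v | u v. ev2 d u v \<noteq> 0}"
      then obtain u w where uw: "pt l m y0 y1 = s u w" "ev2 d u w \<noteq> 0" by blast
      obtain P N where P: "P \<in> poly_fun 4" "\<And>z. du z \<noteq> 0 \<Longrightarrow> dv z \<noteq> 0 \<Longrightarrow> P z = (du z * dv z) ^ N * ev2 f (nu z / du z) (nv z / dv z)"
        using homog[of f] by blast
      obtain Q M where Q: "Q \<in> poly_fun 4" "\<And>z. du z \<noteq> 0 \<Longrightarrow> dv z \<noteq> 0 \<Longrightarrow> Q z = (du z * dv z) ^ M * ev2 g (nu z / du z) (nv z / dv z)"
        using homog[of g] by blast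
      show "\<exists>p\<in>poly_fun 4. \<exists>q\<in>poly_fun 4. q [l, m, y0, y1] \<noteq> 0 \<and> (\<forall>l' m' y0' y1'. valid l' m' y0' y1' \<longrightarrow>
          pt l' m' y0' y1' \<in> {s u v | u v. ev2 d u v \<noteq> 0} \<longrightarrow> q [l', m', y0', y1'] \<noteq> 0 \<longrightarrow>
          F (pt l' m' y0' y1') = p [l', m', y0', y1'] / q [l', m', y0', y1'])"
      proof (rule bexI[of _ "\<lambda>z. P z * (du z * dv z) ^ M"], rule bexI[of _ "\<lambda>z. Q z * (du z * dv z) ^ N"], intro conjI allI impI)
        show "Q [l, m, y0, y1] * (du [l, m, y0, y1] * dv [l, m, y0, y1]) ^ N \<noteq> 0"
          using inv'[OF v uw(1)] Q(2) dg(1) uw(2) by auto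
        fix l' m' y0' y1' assume v': "valid l' m' y0' y1'" "pt l' m' y0' y1' \<in> {s u v | u v. ev2 d u v \<noteq> 0}"
        let ?z = "[l', m', y0', y1']"
        obtain u' w' where uw': "pt l' m' y0' y1' = s u' w'" "ev2 d u' w' \<noteq> 0" using v'(2) by blast
        note i = inv'[OF v'(1) uw'(1)]
        have "P ?z = (du ?z * dv ?z) ^ N * ev2 f u' w'" "Q ?z = (du ?z * dv ?z) ^ M * ev2 g u' w'"
          using i P(2)[of ?z] Q(2)[of ?z] by auto
        moreover have "ev2 g u' w' \<noteq> 0" "du ?z * dv ?z \<noteq> 0" using dg(1) uw'(2) i by auto
        ultimately show "F (pt l' m' y0' y1') = P ?z * (du ?z * dv ?z) ^ M / (Q ?z * (du ?z * dv ?z) ^ N)"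
          unfolding uw'(1) dg(2)[OF uw'(2)] by simp
      qed (intro poly_fun.intros poly_fun_power P Q pf)+
    qed
    show "\<exists>u v. s u v \<in> V" if V: "openin (zariski X) V" "V \<noteq> {}" for V
    proof -
      obtain l m y0 y1 where lm: "valid l m y0 y1" "pt l m y0 y1 \<in> V"
        using V openin_subset[OF V(1)] unfolding points_X by blast
      obtain h where h: "h \<in> poly_fun 4" "h [l, m, y0, y1] \<noteq> 0"
        "\<And>l' m' y0' y1'. valid l' m' y0' y1' \<Longrightarrow> h [l', m', y0', y1'] \<noteq> 0 \<Longrightarrow> pt l' m' y0' y1' \<in> V"
        using V(1) lm unfolding openin_X by meson
      \<comment> \<open>restrict to the line through this point and \<open>(1, 1, 1, 1)\<close>\<close>
      define zl where "zl t = [l + t * (1 - l), m + t * (1 - m), y0 + t * (1 - y0), y1 + t * (1 - y1)]" for t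
      have line: "\<exists>F. \<forall>t. poly F t = f (zl t)" if f: "f \<in> poly_fun 4" for f
        using poly_fun_poly[OF f, of "\<lambda>i. [[:l, 1 - l:], [:m, 1 - m:], [:y0, 1 - y0:], [:y1, 1 - y1:]] ! i"]
        by (auto simp: zl_def upt_4)
      obtain H where H: "\<And>t. poly H t = h (zl t)" using line[OF h(1)] by blast
      obtain A where A: "\<And>t. poly A t = du (zl t)" using line[OF pf(2)] by blast
      obtain B where B: "\<And>t. poly B t = dv (zl t)" using line[OF pf(4)] by blast
      have "poly H 0 \<noteq> 0" "poly A 1 \<noteq> 0" "poly B 1 \<noteq> 0" unfolding H A B using h(2) ones by (simp_all add: zl_def)
      then have "H * A * B \<noteq> 0" by auto
      then obtain t where t: "poly (H * A * B) t \<noteq> 0" using finite_avoid by blast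
      obtain l' m' y0' y1' where z': "zl t = [l', m', y0', y1']" by (simp add: zl_def)
      have "h [l', m', y0', y1'] \<noteq> 0" "du [l', m', y0', y1'] \<noteq> 0" "dv [l', m', y0', y1'] \<noteq> 0"
        using t H[of t] A[of t] B[of t] z' by auto
      then have "pt l' m' y0' y1' \<in> V" "pt l' m' y0' y1' = s (nu [l', m', y0', y1'] / du [l', m', y0', y1']) (nv [l', m', y0', y1'] / dv [l', m', y0', y1'])"
        using h(3) inv valD by blast+
      then show ?thesis by metis
    qed
  qed
qed

text \<open>\<open>s0\<close> covers the complement of the zero section and of the chosen fibre;
  \<open>v = 0\<close> in \<open>sC\<close> is a dense part of the zero section,
  \<open>u = 0\<close> in \<open>sF\<close> of the fibre.\<close>

definition s0 :: "complex \<Rightarrow> complex \<Rightarrow> complex list set" where "s0 u v = pt 1 u 1 v"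
definition sC :: "complex \<Rightarrow> complex \<Rightarrow> complex list set" where "sC u v = pt 1 u v 1"
definition sF :: "complex \<Rightarrow> complex \<Rightarrow> complex list set" where "sF u v = pt u 1 1 v"

lemma chart_s0: "chart X s0"
proof (rule chartI[where L = 1 and M = "[:[:0, 1:]:]" and S = 1 and T = "[:0, 1:]"
      and nu = "\<lambda>z. z ! 1" and du = "\<lambda>z. z ! 0" and nv = "\<lambda>z. z ! 3" and dv = "\<lambda>z. z ! 2 * z ! 0 ^ n"])
  show "s0 u v = pt (ev2 1 u v) (ev2 [:[:0, 1:]:] u v) (ev2 1 u v) (ev2 [:0, 1:] u v)" for u v
    by (simp add: s0_def)
  show "pt l m y0 y1 = s0 ([l, m, y0, y1] ! 1 / [l, m, y0, y1] ! 0) ([l, m, y0, y1] ! 3 / ([l, m, y0, y1] ! 2 * [l, m, y0, y1] ! 0 ^ n))"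
    if "[l, m, y0, y1] ! 0 \<noteq> 0" "[l, m, y0, y1] ! 2 * [l, m, y0, y1] ! 0 ^ n \<noteq> 0" for l m y0 y1
    unfolding s0_def pt_eq by (rule exI[of _ "1 / l"], rule exI[of _ "1 / y0"]) (use that in \<open>simp add: power_divide\<close>)
  show "[l, m, y0, y1] ! 0 \<noteq> 0 \<and> [l, m, y0, y1] ! 2 * [l, m, y0, y1] ! 0 ^ n \<noteq> 0 \<and>
    [l, m, y0, y1] ! 1 / [l, m, y0, y1] ! 0 = u \<and> [l, m, y0, y1] ! 3 / ([l, m, y0, y1] ! 2 * [l, m, y0, y1] ! 0 ^ n) = v"
    if eq: "pt l m y0 y1 = s0 u v" for l m y0 y1 u v
  proof -
    obtain c d where cd: "c \<noteq> 0" "d \<noteq> 0" "1 = c * l" "u = c * m" "1 = d * y0" "v = c ^ n * d * y1"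
      using eq unfolding s0_def pt_eq by blast
    have "l \<noteq> 0" "y0 \<noteq> 0" using cd(3,5) by auto
    moreover have "c = 1 / l" "d = 1 / y0" using inverse_unique'[OF cd(3)] inverse_unique'[OF cd(5)] by auto
    ultimately show ?thesis unfolding cd(4,6) by (simp add: power_divide)
  qed
qed (auto simp: valid_def intro!: poly_fun.intros poly_fun_power)

lemma chart_sC: "chart X sC"
proof (rule chartI[where L = 1 and M = "[:[:0, 1:]:]" and S = "[:0, 1:]" and T = 1
      and nu = "\<lambda>z. z ! 1" and du = "\<lambda>z. z ! 0" and nv = "\<lambda>z. z ! 2 * z ! 0 ^ n" and dv = "\<lambda>z. z ! 3"])
  show "sC u v = pt (ev2 1 u v) (ev2 [:[:0, 1:]:] u v) (ev2 [:0, 1:] u v) (ev2 1 u v)" for u v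
    by (simp add: sC_def)
  show "pt l m y0 y1 = sC ([l, m, y0, y1] ! 1 / [l, m, y0, y1] ! 0) ([l, m, y0, y1] ! 2 * [l, m, y0, y1] ! 0 ^ n / [l, m, y0, y1] ! 3)"
    if "[l, m, y0, y1] ! 0 \<noteq> 0" "[l, m, y0, y1] ! 3 \<noteq> 0" for l m y0 y1
    unfolding sC_def pt_eq by (rule exI[of _ "1 / l"], rule exI[of _ "l ^ n / y1"]) (use that in \<open>simp add: power_divide\<close>)
  show "[l, m, y0, y1] ! 0 \<noteq> 0 \<and> [l, m, y0, y1] ! 3 \<noteq> 0 \<and>
    [l, m, y0, y1] ! 1 / [l, m, y0, y1] ! 0 = u \<and> [l, m, y0, y1] ! 2 * [l, m, y0, y1] ! 0 ^ n / [l, m, y0, y1] ! 3 = v"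
    if eq: "pt l m y0 y1 = sC u v" for l m y0 y1 u v
  proof -
    obtain c d where cd: "c \<noteq> 0" "d \<noteq> 0" "1 = c * l" "u = c * m" "v = d * y0" "1 = c ^ n * d * y1"
      using eq unfolding sC_def pt_eq by blast
    have l: "l \<noteq> 0" "y1 \<noteq> 0" using cd(3,6) by auto
    have c: "c = 1 / l" using inverse_unique'[OF cd(3)] by simp
    have "d = l ^ n / y1" using cd(6) l unfolding c by (simp add: power_divide divide_eq_eq eq_divide_eq)
    then show ?thesis unfolding cd(4,5) using l c by simp
  qed
qed (auto simp: valid_def intro!: poly_fun.intros poly_fun_power)

lemma chart_sF: "chart X sF"
proof (rule chartI[where L = "[:[:0, 1:]:]" and M = 1 and S = 1 and T = "[:0, 1:]"
      and nu = "\<lambda>z. z ! 0" and du = "\<lambda>z. z ! 1" and nv = "\<lambda>z. z ! 3" and dv = "\<lambda>z. z ! 2 * z ! 1 ^ n"])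
  show "sF u v = pt (ev2 [:[:0, 1:]:] u v) (ev2 1 u v) (ev2 1 u v) (ev2 [:0, 1:] u v)" for u v
    by (simp add: sF_def)
  show "pt l m y0 y1 = sF ([l, m, y0, y1] ! 0 / [l, m, y0, y1] ! 1) ([l, m, y0, y1] ! 3 / ([l, m, y0, y1] ! 2 * [l, m, y0, y1] ! 1 ^ n))"
    if "[l, m, y0, y1] ! 1 \<noteq> 0" "[l, m, y0, y1] ! 2 * [l, m, y0, y1] ! 1 ^ n \<noteq> 0" for l m y0 y1
    unfolding sF_def pt_eq by (rule exI[of _ "1 / m"], rule exI[of _ "1 / y0"]) (use that in \<open>simp add: power_divide\<close>)
  show "[l, m, y0, y1] ! 1 \<noteq> 0 \<and> [l, m, y0, y1] ! 2 * [l, m, y0, y1] ! 1 ^ n \<noteq> 0 \<and>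
    [l, m, y0, y1] ! 0 / [l, m, y0, y1] ! 1 = u \<and> [l, m, y0, y1] ! 3 / ([l, m, y0, y1] ! 2 * [l, m, y0, y1] ! 1 ^ n) = v"
    if eq: "pt l m y0 y1 = sF u v" for l m y0 y1 u v
  proof -
    obtain c d where cd: "c \<noteq> 0" "d \<noteq> 0" "u = c * l" "1 = c * m" "1 = d * y0" "v = c ^ n * d * y1"
      using eq unfolding sF_def pt_eq by blast
    have "m \<noteq> 0" "y0 \<noteq> 0" using cd(4,5) by auto
    moreover have "c = 1 / m" "d = 1 / y0" using inverse_unique'[OF cd(4)] inverse_unique'[OF cd(5)] by auto
    ultimately show ?thesis unfolding cd(3,6) by (simp add: power_divide)
  qed
qed (auto simp: valid_def intro!: poly_fun.intros poly_fun_power)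

end

section \<open>Divisors of sections\<close>

lemma ev2_smult [simp]: "ev2 (smult p f) u v = poly p u * ev2 f u v"
  and ev2_pCons [simp]: "ev2 (pCons p f) u v = poly p u + v * ev2 f u v"
  by (simp_all add: ev2_def)

lemma multiplicity_irreducible:
  fixes g h :: "complex poly poly"
  assumes "irreducible g" "irreducible h" "g dvd h" shows "multiplicity g h = 1"
proof (rule multiplicity_eqI)
  show "g ^ 1 dvd h" using assms(3) by simp
  have "h dvd g" using assms irreducibleD'[OF assms(2,3)] by (auto simp: irreducible_def)
  show "\<not> g ^ Suc 1 dvd h"
  proof
    assume "g ^ Suc 1 dvd h"
    then have "g * g dvd g" using dvd_trans[OF _ \<open>h dvd g\<close>, of "g ^ Suc 1"] by simp
    moreover have "g \<noteq> 0" using assms(1) by auto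
    ultimately have "g dvd 1" using dvd_times_left_cancel_iff[of g g 1] by simp
    then show False using assms(1) by (simp add: irreducible_def)
  qed
qed

locale ruled_system = ruled n p0 p1 g0 g1 + bidegree n a b
  for n :: nat and p0 p1 g0 g1 :: complex and a b :: nat
begin

sublocale c0: chart X s0 by (rule chart_s0)
sublocale cC: chart X sC by (rule chart_sC)
sublocale cF: chart X sF by (rule chart_sF)

abbreviation "vU \<equiv> [:[:0, 1:]:] :: complex poly poly"
abbreviation "vV \<equiv> [:0, 1:] :: complex poly poly"
abbreviation "cst k \<equiv> (\<lambda>i j. [:[:k i j:]:]) :: nat \<Rightarrow> nat \<Rightarrow> complex poly poly"
abbreviation "Fib \<equiv> fibre n (proj_point [p0, p1])"
abbreviation "Zer \<equiv> zero_section n"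

text \<open>Local equations of one section in the charts \<open>s0\<close>, \<open>sC\<close> and
  \<open>sF\<close>.\<close>

definition "A k = Pev (cst k) 1 vU 1 vV"
definition "AC k = Pev (cst k) 1 vU vV 1"
definition "AF k = Pev (cst k) vU 1 1 vV"

abbreviation "U0 \<equiv> c0.D 1"

text \<open>The section divided by \<open>l ^ b * y0 ^ a\<close>; its poles are therefore bounded by
  \<open>Dv\<close>.\<close>

definition rf :: "(nat \<Rightarrow> nat \<Rightarrow> complex) \<Rightarrow> complex list set \<Rightarrow> complex" where
  "rf k = c0.lift (ev2 (A k))"

definition Dv :: "complex list set divisor" where
  "Dv = (\<lambda>Y. int a * of_prime Zer Y + int b * of_prime Fib Y)"

lemma ev2_Pev: "ev2 (Pev (cst k) x0 x1 y0 y1) u v = Pev k (ev2 x0 u v) (ev2 x1 u v) (ev2 y0 u v) (ev2 y1 u v)"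
  by (simp add: Pev_def mono_def ev2_sum case_prod_unfold)

lemma ev2_A: "ev2 (A k) u v = Pev k 1 u 1 v" "ev2 (AC k) u v = Pev k 1 u v 1" "ev2 (AF k) u v = Pev k u 1 1 v"
  by (simp_all add: A_def AC_def AF_def ev2_Pev)

lemma Pev_scale: "Pev k (c * l) (c * m) (d * y0) (c ^ n * d * y1) = c ^ b * d ^ a * Pev k l m y0 (y1 :: complex)"
  unfolding Pev_def sum_distrib_left
proof (intro sum.cong refl, unfold split_paired_all prod.case)
  fix i j assume "(i, j) \<in> Idx"
  then have ij: "b = (b - i - n * j) + i + n * j" "a = (a - j) + j" by (auto simp: Idx_def)
  have "c ^ b * d ^ a = c ^ (b - i - n * j) * c ^ i * (c ^ n) ^ j * (d ^ (a - j) * d ^ j)"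
  proof -
    have "c ^ b = c ^ (b - i - n * j) * c ^ i * (c ^ n) ^ j" using ij(1) by (metis power_add power_mult)
    moreover have "d ^ a = d ^ (a - j) * d ^ j" using ij(2) by (metis power_add)
    ultimately show ?thesis by simp
  qed
  then show "k i j * mono i j (c * l) (c * m) (d * y0) (c ^ n * d * y1) = c ^ b * d ^ a * (k i j * mono i j l m y0 y1)"
    by (simp add: mono_def power_mult_distrib mult_ac power_mult[symmetric])
qed

lemma sC_s0: "w \<noteq> 0 \<Longrightarrow> sC u w = s0 u (1 / w)"
  unfolding sC_def s0_def pt_eq by (rule exI[of _ 1], rule exI[of _ "1 / w"]) simp

lemma sF_s0: "u \<noteq> 0 \<Longrightarrow> sF u v = s0 (1 / u) (v / u ^ n)"
  unfolding sF_def s0_def pt_eq by (rule exI[of _ "1 / u"], rule exI[of _ 1]) (simp add: power_divide)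

lemma pt_U0: "valid l m y0 y1 \<Longrightarrow> pt l m y0 y1 \<in> U0 \<longleftrightarrow> l \<noteq> 0 \<and> y0 \<noteq> 0"
proof
  assume "pt l m y0 y1 \<in> U0"
  then obtain u v where "pt l m y0 y1 = s0 u v" by (auto simp: c0.D_1)
  then obtain c d where "1 = c * l" "1 = d * y0" unfolding s0_def pt_eq by blast
  then show "l \<noteq> 0 \<and> y0 \<noteq> 0" by auto
next
  assume "l \<noteq> 0 \<and> y0 \<noteq> 0"
  then have "pt l m y0 y1 = s0 (m / l) (y1 / (y0 * l ^ n))"
    unfolding s0_def pt_eq by (intro exI[of _ "1 / l"] exI[of _ "1 / y0"]) (simp add: power_divide)
  then show "pt l m y0 y1 \<in> U0" by (auto simp: c0.D_1)
qed

lemma sC_U0: "sC u w \<in> U0 \<longleftrightarrow> w \<noteq> 0"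
  using pt_U0[of 1 u w 1] by (simp add: sC_def valid_def)

lemma sF_U0: "sF u v \<in> U0 \<longleftrightarrow> u \<noteq> 0"
  using pt_U0[of u 1 1 v] by (simp add: sF_def valid_def)

lemma rf_s0: "rf k (s0 u v) = ev2 (A k) u v" by (simp add: rf_def c0.lift)

lemma rf_sC: "w \<noteq> 0 \<Longrightarrow> rf k (sC u w) * ev2 (vV ^ a) u w = ev2 (AC k) u w"
  using Pev_scale[of k 1 1 u w 1 "1 / w"] by (simp add: sC_s0 rf_s0 ev2_A mult_ac)

lemma rf_sF: "u \<noteq> 0 \<Longrightarrow> rf k (sF u v) * ev2 (vU ^ b) u v = ev2 (AF k) u v"
  using Pev_scale[of k u 1 "1 / u" 1 1 "v / u ^ n"] by (simp add: sF_s0 rf_s0 ev2_A mult_ac)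

lemma coeff_A: "supported k \<Longrightarrow> coeff (coeff (A k) j) i = k i j"
proof -
  assume k: "supported k"
  have "A k = (\<Sum>(i, j)\<in>Idx. monom (monom (k i j) i) j)"
    unfolding A_def Pev_def mono_def
  proof (intro sum.cong refl, unfold split_paired_all prod.case)
    fix i j
    have "[:[:k i j:]:] * (vU ^ i * vV ^ j) = monom (monom (k i j) i) j"
    proof -
      have "vU ^ i = [:monom 1 i:]" by (simp add: monom_altdef poly_const_pow)
      then show ?thesis by (simp add: monom_altdef[of 1] monom_altdef smult_monom mult.commute)
    qed
    then show "[:[:k i j:]:] * (1 ^ (b - i - n * j) * vU ^ i * 1 ^ (a - j) * vV ^ j) = monom (monom (k i j) i) j"
      by (simp add: mult.assoc)
  qed
  then have "coeff (coeff (A k) j) i = (\<Sum>p\<in>Idx. if p = (i, j) then k i j else 0)"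
    by (auto simp: coeff_sum case_prod_unfold intro!: sum.cong split: prod.splits)
  also have "\<dots> = k i j" using k finite_Idx by (auto simp: supported_def)
  finally show ?thesis .
qed

lemma A_nonzero_transfer:
  assumes "A k \<noteq> 0" shows "AC k \<noteq> 0" "AF k \<noteq> 0"
proof -
  have "A k * vV \<noteq> 0" "A k * vU \<noteq> 0" using assms by auto
  then obtain u v u' v' where "ev2 (A k * vV) u v \<noteq> 0" "ev2 (A k * vU) u' v' \<noteq> 0" using ev2_nonzero_ex by meson
  then have v: "ev2 (A k) u v \<noteq> 0" "v \<noteq> 0" "ev2 (A k) u' v' \<noteq> 0" "u' \<noteq> 0" by auto
  have "ev2 (AC k) u (1 / v) = ev2 (A k) u v * (1 / v) ^ a" using rf_sC[of "1 / v" k u] v by (simp add: sC_s0 rf_s0)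
  then have "ev2 (AC k) u (1 / v) \<noteq> 0" using v by simp
  moreover have "ev2 (AF k) (1 / u') (v' / u' ^ n) = ev2 (A k) u' v' * (1 / u') ^ b"
    using rf_sF[of "1 / u'" k "v' / u' ^ n"] v by (simp add: sF_s0 rf_s0 power_divide)
  then have "ev2 (AF k) (1 / u') (v' / u' ^ n) \<noteq> 0" using v by simp
  ultimately show "AC k \<noteq> 0" "AF k \<noteq> 0" by auto
qed

lemma irreducible_vV: "irreducible vV"
  by (rule irreducible_linear_poly) auto

lemma irreducible_vU: "irreducible vU"
  unfolding irreducible_const_poly_iff by (rule irreducible_linear_field_poly) simp

lemma closedin_lm:
  assumes "h \<in> poly_fun 4"
    and inv: "\<And>l m y0 y1 l' m' y0' y1'. valid l m y0 y1 \<Longrightarrow> valid l' m' y0' y1' \<Longrightarrow>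
      pt l m y0 y1 = pt l' m' y0' y1' \<Longrightarrow> h [l, m, y0, y1] = 0 \<Longrightarrow> h [l', m', y0', y1'] = 0"
  shows "closedin (zariski X) {pt l m y0 y1 | l m y0 y1. valid l m y0 y1 \<and> h [l, m, y0, y1] = 0}" (is "closedin _ ?S")
  unfolding closedin_def
proof
  show "?S \<subseteq> points X" unfolding points_X by blast
  have mem: "pt l m y0 y1 \<in> ?S \<longleftrightarrow> h [l, m, y0, y1] = 0" if v: "valid l m y0 y1" for l m y0 y1
  proof
    assume "pt l m y0 y1 \<in> ?S"
    then obtain l' m' y0' y1' where "pt l m y0 y1 = pt l' m' y0' y1'" "valid l' m' y0' y1'" "h [l', m', y0', y1'] = 0" by blast
    then show "h [l, m, y0, y1] = 0" using inv v by metis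
  qed (use v in blast)
  show "openin (zariski X) (points X - ?S)" unfolding openin_X
  proof (intro conjI allI impI)
    fix l m y0 y1 assume "valid l m y0 y1" "pt l m y0 y1 \<in> points X - ?S"
    then have h0: "h [l, m, y0, y1] \<noteq> 0" using mem by blast
    have "pt l' m' y0' y1' \<in> points X - ?S" if "valid l' m' y0' y1'" "h [l', m', y0', y1'] \<noteq> 0" for l' m' y0' y1'
      using mem[OF that(1)] that unfolding points_X by blast
    then show "\<exists>h\<in>poly_fun 4. h [l, m, y0, y1] \<noteq> 0 \<and>
        (\<forall>l' m' y0' y1'. valid l' m' y0' y1' \<longrightarrow> h [l', m', y0', y1'] \<noteq> 0 \<longrightarrow> pt l' m' y0' y1' \<in> points X - ?S)"
      using assms(1) h0 by blast
  qed blast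
qed

lemma Zer_closed: "closedin (zariski X) Zer"
proof -
  have "Zer = {pt l m y0 y1 | l m y0 y1. valid l m y0 y1 \<and> [l, m, y0, y1] ! 2 = 0}" unfolding zero_section_pt by auto
  moreover have "(\<lambda>z. z ! 2) \<in> poly_fun 4" by (rule poly_fun.coord) simp
  ultimately show ?thesis using closedin_lm[of "\<lambda>z. z ! 2"] by (fastforce simp: pt_eq)
qed

lemma Fib_closed: "closedin (zariski X) Fib"
proof -
  have "Fib = {pt l m y0 y1 | l m y0 y1. valid l m y0 y1 \<and> [l, m, y0, y1] ! 0 = 0}" unfolding fibre_pt by auto
  moreover have "(\<lambda>z. z ! 0) \<in> poly_fun 4" by (rule poly_fun.coord) simp
  ultimately show ?thesis using closedin_lm[of "\<lambda>z. z ! 0"] by (fastforce simp: pt_eq)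
qed

text \<open>A neighbourhood of the point at \<open>t = 0\<close> pulls back along the polynomial arc
  to a set that omits only finitely many parameters, so it contains points with
  \<open>t \<noteq> 0\<close>.\<close>

lemma in_closure_line:
  assumes "\<And>i. i < 4 \<Longrightarrow> poly (L i) 0 = [l, m, y0, y1] ! i" "valid l m y0 y1"
    and T: "\<And>t. t \<noteq> 0 \<Longrightarrow> pt (poly (L 0) t) (poly (L 1) t) (poly (L 2) t) (poly (L 3) t) \<in> S \<and>
      valid (poly (L 0) t) (poly (L 1) t) (poly (L 2) t) (poly (L 3) t)"
  shows "pt l m y0 y1 \<in> zariski X closure_of S"
  unfolding in_closure_of
proof (intro conjI allI impI)
  show "pt l m y0 y1 \<in> points X" using assms(2) unfolding points_X by blast
  fix O' assume O: "pt l m y0 y1 \<in> O' \<and> openin (zariski X) O'"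
  obtain h where h: "h \<in> poly_fun 4" "h [l, m, y0, y1] \<noteq> 0"
    "\<And>l' m' y0' y1'. valid l' m' y0' y1' \<Longrightarrow> h [l', m', y0', y1'] \<noteq> 0 \<Longrightarrow> pt l' m' y0' y1' \<in> O'"
    using O assms(2) unfolding openin_X by meson
  obtain H where H: "\<And>t. poly H t = h [poly (L 0) t, poly (L 1) t, poly (L 2) t, poly (L 3) t]"
    using poly_fun_poly[OF h(1), of L] by (auto simp: upt_4)
  have "poly H 0 \<noteq> 0" using h(2) assms(1)[of 0] assms(1)[of 1] assms(1)[of 2] assms(1)[of 3] by (simp add: H)
  then have "H * [:0, 1:] \<noteq> 0" by auto
  then obtain t where "poly (H * [:0, 1:]) t \<noteq> 0" using finite_avoid by blast
  then have "t \<noteq> 0" "poly H t \<noteq> 0" by auto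
  then show "\<exists>y. y \<in> S \<and> y \<in> O'" using T[of t] h(3) H by metis
qed

text \<open>The chart misses only the point of the zero section on the chosen fibre, which is the
  limit of an arc with \<open>l = t\<close>.\<close>

lemma Zer_clo: "Zer = cC.clo vV"
proof
  have "sC u 0 \<in> Zer" for u
    unfolding sC_def zero_section_pt by (intro CollectI exI[of _ 1] exI[of _ u]) (simp add: valid_def)
  then have "{sC u v | u v. ev2 vV u v = 0} \<subseteq> Zer" by auto
  then show "cC.clo vV \<subseteq> Zer" unfolding cC.clo_def using Zer_closed closure_of_minimal by blast
  show "Zer \<subseteq> cC.clo vV"
  proof
    fix x assume "x \<in> Zer"
    then obtain l m y1 where x: "x = pt l m 0 y1" "valid l m 0 y1" unfolding zero_section_pt by blast
    then have y: "y1 \<noteq> 0" by (simp add: valid_def)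
    have in_clo: "pt l m 0 y1 \<in> {sC u v | u v. ev2 vV u v = 0}" if "l \<noteq> 0" for l m
    proof -
      have "pt l m 0 y1 = sC (m / l) 0" unfolding sC_def pt_eq using that y
        by (intro exI[of _ "1 / l"] exI[of _ "l ^ n / y1"]) (simp add: power_divide)
      then show ?thesis by fastforce
    qed
    show "x \<in> cC.clo vV"
    proof (cases "l = 0")
      case False
      then show ?thesis using in_clo[OF False, of m] closure_of_subset[of "{sC u v | u v. ev2 vV u v = 0}" "zariski X"] cC.s_points
        unfolding cC.clo_def x by blast
    next
      case True
      then have m: "m \<noteq> 0" using x(2) by (simp add: valid_def)
      show ?thesis unfolding cC.clo_def x True
      proof (rule in_closure_line[where L = "\<lambda>i. [[:0, 1:], [:m:], 0, [:y1:]] ! i"])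
        show "poly ([[:0, 1:], [:m:], 0, [:y1:]] ! i) 0 = [0, m, 0, y1] ! i" if i: "i < 4" for i
        proof -
          consider "i = 0" | "i = 1" | "i = 2" | "i = 3" using i by linarith
          then show ?thesis by cases auto
        qed
        show "valid 0 m 0 y1" using x(2) True by simp
        fix t :: complex assume "t \<noteq> 0"
        then show "pt (poly ([[:0, 1:], [:m:], 0, [:y1:]] ! 0) t) (poly ([[:0, 1:], [:m:], 0, [:y1:]] ! 1) t)
          (poly ([[:0, 1:], [:m:], 0, [:y1:]] ! 2) t) (poly ([[:0, 1:], [:m:], 0, [:y1:]] ! 3) t) \<in> {sC u v | u v. ev2 vV u v = 0} \<and>
          valid (poly ([[:0, 1:], [:m:], 0, [:y1:]] ! 0) t) (poly ([[:0, 1:], [:m:], 0, [:y1:]] ! 1) t)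
          (poly ([[:0, 1:], [:m:], 0, [:y1:]] ! 2) t) (poly ([[:0, 1:], [:m:], 0, [:y1:]] ! 3) t)"
          using in_clo[of t m] y by (simp add: valid_def)
      qed
    qed
  qed
qed

lemma Fib_clo: "Fib = cF.clo vU"
proof
  have "sF 0 v \<in> Fib" for v
    unfolding sF_def fibre_pt by (intro CollectI exI[of _ 1] exI[of _ v]) (simp add: valid_def)
  then have "{sF u v | u v. ev2 vU u v = 0} \<subseteq> Fib" by auto
  then show "cF.clo vU \<subseteq> Fib" unfolding cF.clo_def using Fib_closed closure_of_minimal by blast
  show "Fib \<subseteq> cF.clo vU"
  proof
    fix x assume "x \<in> Fib"
    then obtain m y0 y1 where x: "x = pt 0 m y0 y1" "valid 0 m y0 y1" unfolding fibre_pt by blast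
    then have m: "m \<noteq> 0" by (simp add: valid_def)
    have in_clo: "pt 0 m y0 y1 \<in> {sF u v | u v. ev2 vU u v = 0}" if "y0 \<noteq> 0" for y0 y1
    proof -
      have "pt 0 m y0 y1 = sF 0 (y1 / (y0 * m ^ n))" unfolding sF_def pt_eq using that m
        by (intro exI[of _ "1 / m"] exI[of _ "1 / y0"]) (simp add: power_divide)
      then show ?thesis by fastforce
    qed
    show "x \<in> cF.clo vU"
    proof (cases "y0 = 0")
      case False
      then show ?thesis using in_clo[OF False, of y1] closure_of_subset[of "{sF u v | u v. ev2 vU u v = 0}" "zariski X"] cF.s_points
        unfolding cF.clo_def x by blast
    next
      case True
      then have y: "y1 \<noteq> 0" using x(2) by (simp add: valid_def)
      show ?thesis unfolding cF.clo_def x True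
      proof (rule in_closure_line[where L = "\<lambda>i. [0, [:m:], [:0, 1:], [:y1:]] ! i"])
        show "poly ([0, [:m:], [:0, 1:], [:y1:]] ! i) 0 = [0, m, 0, y1] ! i" if i: "i < 4" for i
        proof -
          consider "i = 0" | "i = 1" | "i = 2" | "i = 3" using i by linarith
          then show ?thesis by cases auto
        qed
        show "valid 0 m 0 y1" using x(2) True by simp
        fix t :: complex assume "t \<noteq> 0"
        then show "pt (poly ([0, [:m:], [:0, 1:], [:y1:]] ! 0) t) (poly ([0, [:m:], [:0, 1:], [:y1:]] ! 1) t)
          (poly ([0, [:m:], [:0, 1:], [:y1:]] ! 2) t) (poly ([0, [:m:], [:0, 1:], [:y1:]] ! 3) t) \<in> {sF u v | u v. ev2 vU u v = 0} \<and>
          valid (poly ([0, [:m:], [:0, 1:], [:y1:]] ! 0) t) (poly ([0, [:m:], [:0, 1:], [:y1:]] ! 1) t)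
          (poly ([0, [:m:], [:0, 1:], [:y1:]] ! 2) t) (poly ([0, [:m:], [:0, 1:], [:y1:]] ! 3) t)"
          using in_clo[of t y1] m by (simp add: valid_def)
      qed
    qed
  qed
qed

lemma Zer_Fib_U0: "Zer \<inter> U0 = {}" "Fib \<inter> U0 = {}"
proof -
  have "x \<notin> U0" if x: "x \<in> Zer" for x
  proof -
    obtain l m y1 where "x = pt l m 0 y1" "valid l m 0 y1" using x unfolding zero_section_pt by blast
    then show ?thesis using pt_U0 by simp
  qed
  then show "Zer \<inter> U0 = {}" by blast
  have "x \<notin> U0" if x: "x \<in> Fib" for x
  proof -
    obtain m y0 y1 where "x = pt 0 m y0 y1" "valid 0 m y0 y1" using x unfolding fibre_pt by blast
    then show ?thesis using pt_U0 by simp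
  qed
  then show "Fib \<inter> U0 = {}" by blast
qed

lemma U0_complement: "points X \<subseteq> U0 \<union> Zer \<union> Fib"
proof
  fix x assume "x \<in> points X"
  then obtain l m y0 y1 where x: "x = pt l m y0 y1" "valid l m y0 y1" unfolding points_X by blast
  show "x \<in> U0 \<union> Zer \<union> Fib"
  proof (cases "l \<noteq> 0 \<and> y0 \<noteq> 0")
    case True then show ?thesis using pt_U0[OF x(2)] x(1) by blast
  next
    case False
    then have "l = 0 \<or> y0 = 0" by blast
    then show ?thesis using x unfolding zero_section_pt fibre_pt by blast
  qed
qed

lemma Zer_neq_Fib: "Zer \<noteq> Fib"
proof
  assume "Zer = Fib"
  moreover have "pt 1 0 0 1 \<in> Zer" unfolding zero_section_pt valid_def by force
  ultimately obtain m y0 y1 where "pt 1 0 0 1 = pt 0 m y0 y1" unfolding fibre_pt by blast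
  then show False unfolding pt_eq by auto
qed

lemma Zer_Fib_prime: "prime_divisor X Zer" "prime_divisor X Fib"
  unfolding Zer_clo Fib_clo using cC.clo_prime_divisor[OF irreducible_vV] cF.clo_prime_divisor[OF irreducible_vU] by auto

text \<open>An irreducible set outside the chart \<open>s0\<close> lies in one of the two boundary
  curves, and maximality gives equality.\<close>

lemma prime_divisor_cases:
  assumes "prime_divisor X Y"
  obtains g where "irreducible g" "Y = c0.clo g" | "Y = Zer" | "Y = Fib"
proof -
  have Y: "irreducible_closed (zariski X) Y" "Y \<subset> points X"
    "\<And>Z. irreducible_closed (zariski X) Z \<Longrightarrow> Y \<subset> Z \<Longrightarrow> \<not> Z \<subset> points X"
    using assms by (simp add: prime_divisor_def, simp add: prime_divisor_def, unfold prime_divisor_def, metis)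
  have Z: "irreducible_closed (zariski X) Zer" "Zer \<subset> points X" "irreducible_closed (zariski X) Fib" "Fib \<subset> points X"
    using Zer_Fib_prime by (simp_all add: prime_divisor_def)
  show thesis
  proof (cases "Y \<inter> U0 = {}")
    case False
    then obtain u v where "s0 u v \<in> Y" by (auto simp: c0.D_1)
    then show ?thesis using c0.prime_divisor_clo[OF assms] that(1) by metis
  next
    case True
    have "Y \<subseteq> Zer \<or> Y \<subseteq> Fib"
    proof (rule ccontr)
      assume "\<not> ?thesis"
      then have "(points X - Zer) \<inter> Y \<noteq> {}" "(points X - Fib) \<inter> Y \<noteq> {}" using Y(2) by blast+
      moreover have "openin (zariski X) (points X - Zer)" "openin (zariski X) (points X - Fib)"
        using Zer_closed Fib_closed by (auto simp: openin_diff)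
      ultimately have "(points X - Zer) \<inter> (points X - Fib) \<inter> Y \<noteq> {}" using Y(1) unfolding irreducible_closed_alt by blast
      then show False using U0_complement True by blast
    qed
    then show ?thesis using Y(3) Z that(2,3) by blast
  qed
qed

lemma Dv_simps: "Dv Zer = int a" "Dv Fib = int b" "Y \<noteq> Zer \<Longrightarrow> Y \<noteq> Fib \<Longrightarrow> Dv Y = 0"
  using Zer_neq_Fib by (auto simp: Dv_def of_prime_def)

lemma clo_neq: "irreducible g \<Longrightarrow> c0.clo g \<noteq> Zer" "irreducible g \<Longrightarrow> c0.clo g \<noteq> Fib"
proof -
  assume "irreducible g"
  then obtain u v where "s0 u v \<in> c0.clo g" using c0.clo_point_ex by blast
  moreover have "s0 u v \<in> U0" by (auto simp: c0.D_1)
  ultimately show "c0.clo g \<noteq> Zer" "c0.clo g \<noteq> Fib" using Zer_Fib_U0 by blast+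
qed

lemma has_order_mono:
  assumes "has_order X Y U f k" "U' \<subseteq> U" "\<And>x. x \<in> U' \<Longrightarrow> f' x = f x"
  shows "has_order X Y U' f' k"
proof -
  obtain V t u where V: "uniformizer X Y V t" "regular X V u" "\<forall>x\<in>V. u x \<noteq> 0"
    "\<forall>x\<in>U \<inter> V. t x \<noteq> 0 \<longrightarrow> f x = u x * t x powi k" using assms(1) unfolding has_order_def by blast
  have "\<forall>x\<in>U' \<inter> V. t x \<noteq> 0 \<longrightarrow> f' x = u x * t x powi k" using V(4) assms(2,3) by auto
  then show ?thesis unfolding has_order_def using V(1-3) by blast
qed

lemma multiplicity_vars: "multiplicity vV (vV ^ m) = m" "multiplicity vU (vU ^ m) = m"
  using irreducible_vV irreducible_vU by (auto intro!: multiplicity_same_power simp: irreducible_def)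

text \<open>The divisor of the section with coefficients \<open>k\<close>, read off in each of three charts.\<close>

definition represents :: "complex list set set \<Rightarrow> (complex list set \<Rightarrow> complex) \<Rightarrow> (nat \<Rightarrow> nat \<Rightarrow> complex) \<Rightarrow> bool" where
  "represents U s k \<longleftrightarrow> openin (zariski X) U \<and> U \<noteq> {} \<and> (\<forall>x\<in>U \<inter> U0. s x = rf k x)"

lemma represents_U0: "represents U0 (rf k) k"
  using c0.openin_D[of 1] c0.D_1 by (auto simp: represents_def)

lemma represents_order:
  assumes k: "A k \<noteq> 0" and r: "represents U s k" and g: "irreducible g"
  shows "has_order X (c0.clo g) U s e \<Longrightarrow> e = int (multiplicity g (A k))"
    "has_order X (cC.clo g) U s e \<Longrightarrow> e = int (multiplicity g (AC k)) - int (multiplicity g (vV ^ a))"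
    "has_order X (cF.clo g) U s e \<Longrightarrow> e = int (multiplicity g (AF k)) - int (multiplicity g (vU ^ b))"
proof -
  have o: "openin (zariski X) (U \<inter> U0)" using r c0.openin_D by (auto simp: represents_def)
  have "\<exists>u v. s0 u v \<in> U" using c0.dense r by (auto simp: represents_def)
  then have ne: "U \<inter> U0 \<noteq> {}" by (auto simp: c0.D_1)
  have s: "s x = rf k x" if "x \<in> U \<inter> U0" for x using r that by (auto simp: represents_def)
  note nz = A_nonzero_transfer[OF k]
  show "e = int (multiplicity g (A k))" if "has_order X (c0.clo g) U s e"
    using c0.has_order_clo_unique[OF g k one_neq_zero _ o ne has_order_mono[OF that, of "U \<inter> U0" s]] s
    by (simp add: rf_s0)
  show "e = int (multiplicity g (AC k)) - int (multiplicity g (vV ^ a))" if "has_order X (cC.clo g) U s e"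
    by (rule cC.has_order_clo_unique[OF g nz(1) _ _ o ne has_order_mono[OF that, of "U \<inter> U0" s]])
      (use s rf_sC sC_U0 in auto)
  show "e = int (multiplicity g (AF k)) - int (multiplicity g (vU ^ b))" if "has_order X (cF.clo g) U s e"
    by (rule cF.has_order_clo_unique[OF g nz(2) _ _ o ne has_order_mono[OF that, of "U \<inter> U0" s]])
      (use s rf_sF sF_U0 in auto)
qed

lemma rf_order:
  assumes k: "A k \<noteq> 0"
  shows "irreducible g \<Longrightarrow> has_order X (c0.clo g) U0 (rf k) (int (multiplicity g (A k)))"
    "has_order X Zer U0 (rf k) (int (multiplicity vV (AC k)) - int a)"
    "has_order X Fib U0 (rf k) (int (multiplicity vU (AF k)) - int b)"
proof -
  note nz = A_nonzero_transfer[OF k]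
  show "has_order X (c0.clo g) U0 (rf k) (int (multiplicity g (A k)))" if "irreducible g"
    using c0.has_order_clo[OF that k one_neq_zero, of U0 "rf k"] by (simp add: rf_s0)
  have "has_order X (cC.clo vV) U0 (rf k) (int (multiplicity vV (AC k)) - int (multiplicity vV (vV ^ a)))"
    by (rule cC.has_order_clo[OF irreducible_vV nz(1)]) (use rf_sC sC_U0 in auto)
  then show "has_order X Zer U0 (rf k) (int (multiplicity vV (AC k)) - int a)"
    unfolding Zer_clo[symmetric] multiplicity_vars .
  have "has_order X (cF.clo vU) U0 (rf k) (int (multiplicity vU (AF k)) - int (multiplicity vU (vU ^ b)))"
    by (rule cF.has_order_clo[OF irreducible_vU nz(2)]) (use rf_sF sF_U0 in auto)
  then show "has_order X Fib U0 (rf k) (int (multiplicity vU (AF k)) - int b)"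
    unfolding Fib_clo[symmetric] multiplicity_vars .
qed

text \<open>The divisor of \<open>rf k\<close> plus \<open>Dv\<close>; the description is legitimate
  because orders exist and are unique (\<open>rf_order\<close>,
  \<open>represents_order\<close>).\<close>

definition Ek :: "(nat \<Rightarrow> nat \<Rightarrow> complex) \<Rightarrow> complex list set divisor" where
  "Ek k Y = (if prime_divisor X Y then (THE e. has_order X Y U0 (rf k) e) + Dv Y else 0)"

lemma Ek_clo: "A k \<noteq> 0 \<Longrightarrow> irreducible g \<Longrightarrow> Ek k (c0.clo g) = int (multiplicity g (A k))"
proof -
  assume *: "A k \<noteq> 0" "irreducible g"
  have "(THE e. has_order X (c0.clo g) U0 (rf k) e) = int (multiplicity g (A k))"
    by (rule the_equality[where P = "has_order X (c0.clo g) U0 (rf k)"])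
      (use rf_order(1)[OF *] represents_order(1)[OF *(1) represents_U0 *(2)] in blast)+
  then show ?thesis using c0.clo_prime_divisor[OF *(2)] clo_neq[OF *(2)] by (simp add: Ek_def Dv_simps)
qed

lemma Ek_has_order:
  assumes k: "A k \<noteq> 0" and Y: "prime_divisor X Y"
  shows "has_order X Y U0 (rf k) (Ek k Y - Dv Y)" "0 \<le> Ek k Y"
    "represents U s k \<Longrightarrow> has_order X Y U s e \<Longrightarrow> e = Ek k Y - Dv Y"
proof -
  have "\<exists>e. has_order X Y U0 (rf k) e \<and> 0 \<le> e + Dv Y \<and> (\<forall>U s e'. represents U s k \<longrightarrow> has_order X Y U s e' \<longrightarrow> e' = e)"
    using Y
  proof (cases rule: prime_divisor_cases)
    case (1 g)
    show ?thesis unfolding 1(2) Dv_simps(3)[OF clo_neq[OF 1(1)]]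
      by (intro exI[of _ "int (multiplicity g (A k))"] conjI rf_order(1)[OF k 1(1)])
        (use represents_order(1)[OF k _ 1(1)] in auto)
  next
    case 2
    show ?thesis unfolding 2 Dv_simps
      by (intro exI[of _ "int (multiplicity vV (AC k)) - int a"] conjI rf_order(2)[OF k])
        (use represents_order(2)[OF k _ irreducible_vV] Zer_clo multiplicity_vars in auto)
  next
    case 3
    show ?thesis unfolding 3 Dv_simps
      by (intro exI[of _ "int (multiplicity vU (AF k)) - int b"] conjI rf_order(3)[OF k])
        (use represents_order(3)[OF k _ irreducible_vU] Fib_clo multiplicity_vars in auto)
  qed
  then obtain e where e: "has_order X Y U0 (rf k) e" "0 \<le> e + Dv Y"
    "\<And>U s e'. represents U s k \<Longrightarrow> has_order X Y U s e' \<Longrightarrow> e' = e" by blast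
  have "(THE e. has_order X Y U0 (rf k) e) = e"
    by (rule the_equality[where P = "has_order X Y U0 (rf k)"]) (use e represents_U0 in blast)+
  then have "Ek k Y = e + Dv Y" using Y by (simp add: Ek_def)
  then show "has_order X Y U0 (rf k) (Ek k Y - Dv Y)" "0 \<le> Ek k Y"
    "represents U s k \<Longrightarrow> has_order X Y U s e' \<Longrightarrow> e' = Ek k Y - Dv Y" for U s e'
    using e by auto
qed

lemma Ek_nonprime: "\<not> prime_divisor X Y \<Longrightarrow> Ek k Y - Dv Y = 0"
proof -
  assume "\<not> prime_divisor X Y"
  moreover from this have "Dv Y = 0" using Zer_Fib_prime by (intro Dv_simps(3)) auto
  ultimately show ?thesis by (simp add: Ek_def)
qed

lemma represents_Ek:
  assumes "A k \<noteq> 0" "represents U s k" "has_divisor X U s (\<lambda>Y. E Y - Dv Y)"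
  shows "E = Ek k"
proof
  fix Y
  show "E Y = Ek k Y"
  proof (cases "prime_divisor X Y")
    case True
    then have "has_order X Y U s (E Y - Dv Y)" using assms(3) by (simp add: has_divisor_def)
    then show ?thesis using Ek_has_order(3)[OF assms(1) True assms(2)] by force
  next
    case False
    then have "E Y - Dv Y = 0" using assms(3) unfolding has_divisor_def by metis
    then show ?thesis using Ek_nonprime[OF False, of k] by simp
  qed
qed

lemma Ek_has_divisor: "A k \<noteq> 0 \<Longrightarrow> has_divisor X U0 (rf k) (\<lambda>Y. Ek k Y - Dv Y)"
  unfolding has_divisor_def
proof (intro conjI allI)
  assume k: "A k \<noteq> 0"
  show "regular X U0 (rf k)" by (rule c0.regular_D[of 1 1 _ "A k"]) (auto simp: rf_s0)
  show "openin (zariski X) U0" by (rule c0.openin_D)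
  obtain u v where "ev2 (A k) u v \<noteq> 0" using ev2_nonzero_ex[OF k] by blast
  then show "\<exists>x\<in>U0. rf k x \<noteq> 0" by (intro bexI[of _ "s0 u v"]) (auto simp: rf_s0 c0.D_1)
  show "if prime_divisor X Y then has_order X Y U0 (rf k) (Ek k Y - Dv Y) else Ek k Y - Dv Y = 0" for Y
    using Ek_has_order(1)[OF k] Ek_nonprime by simp
qed

lemma Ek_linear_system: "A k \<noteq> 0 \<Longrightarrow> Ek k \<in> linear_system X Dv"
proof -
  assume k: "A k \<noteq> 0"
  have "0 \<le> Ek k Y" for Y using Ek_has_order(2)[OF k] by (cases "prime_divisor X Y") (auto simp: Ek_def)
  then show ?thesis unfolding linear_system_def using Ek_has_divisor[OF k] by blast
qed

end

context ruled_system
begin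

text \<open>Equal divisors give equal multiplicities of all irreducible polynomials in the chart
  \<open>s0\<close>, and the units of the polynomial ring are constants.\<close>

lemma Ek_inj:
  assumes "A k \<noteq> 0" "A k' \<noteq> 0" "Ek k = Ek k'" "supported k" "supported k'"
  obtains c where "c \<noteq> 0" "k' = (\<lambda>i j. c * k i j)"
proof -
  have "multiplicity g (A k) = multiplicity g (A k')" if "irreducible g" for g
    using Ek_clo[OF assms(1) that] Ek_clo[OF assms(2) that] assms(3) by simp
  then obtain c where c: "c \<noteq> 0" "A k' = [:[:c:]:] * A k" using multiplicity_eq_imp_smult assms(1,2) by blast
  have "k' i j = c * k i j" for i j
    using coeff_A[OF assms(4), of j i] coeff_A[OF assms(5), of j i] c(2) by simp
  then show thesis using that c(1) by blast
qed

text \<open>A zero inside one of the three charts lies on an irreducible factor of the local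
  equation. The charts miss only the point \<open>l = y0 = 0\<close>, where the section reduces to
  the monomial with coefficient \<open>k (b - n * a) a\<close> and so does not vanish.\<close>

lemma zero_in_support:
  assumes k: "A k \<noteq> 0" and corner: "k (b - n * a) a \<noteq> 0" and z: "valid l m y0 y1" "Pev k l m y0 y1 = 0"
  shows "pt l m y0 y1 \<in> div_support (Ek k)"
proof -
  note nz = A_nonzero_transfer[OF k]
  have scale: "Pev k l' m' y0' y1' = 0" if eq: "pt l m y0 y1 = pt l' m' y0' y1'" for l' m' y0' y1'
  proof -
    from eq[unfolded pt_eq] obtain c d where cd: "l' = c * l \<and> m' = c * m \<and> y0' = d * y0 \<and> y1' = c ^ n * d * y1"
      by (elim exE) (rule that; simp only:)
    have "Pev k (c * l) (c * m) (d * y0) (c ^ n * d * y1) = 0" unfolding Pev_scale z(2) by simp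
    then show ?thesis using cd by simp
  qed
  consider "l \<noteq> 0" "y0 \<noteq> 0" | "l \<noteq> 0" "y0 = 0" | "l = 0" "y0 \<noteq> 0" | "l = 0" "y0 = 0" by blast
  then show ?thesis
  proof cases
    case 1
    then obtain u v where uv: "pt l m y0 y1 = s0 u v" using pt_U0[OF z(1)] by (auto simp: c0.D_1)
    then have "ev2 (A k) u v = 0" using scale unfolding s0_def ev2_A by blast
    then obtain g where g: "irreducible g" "g dvd A k" "ev2 g u v = 0" using root_factor[OF k] by blast
    have "multiplicity g (A k) \<noteq> 0" using g k by (metis irreducible_def multiplicity_eq_zero_iff)
    then have "Ek k (c0.clo g) \<noteq> 0" using Ek_clo[OF k g(1)] by simp
    then show ?thesis unfolding div_support_def uv using c0.mem_clo g(3) by blast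
  next
    case 2
    then have y: "y1 \<noteq> 0" using z(1) by (simp add: valid_def)
    have uv: "pt l m y0 y1 = sC (m / l) 0" unfolding sC_def pt_eq using 2 y
        by (intro exI[of _ "1 / l"] exI[of _ "l ^ n / y1"]) (simp add: power_divide)
    then have "ev2 (AC k) (m / l) 0 = 0" using scale unfolding sC_def ev2_A by blast
    then obtain g where g: "irreducible g" "g dvd AC k" "ev2 g (m / l) 0 = 0" using root_factor[OF nz(1)] by blast
    let ?Y = "cC.clo g"
    have Y: "prime_divisor X ?Y" by (rule cC.clo_prime_divisor[OF g(1)])
    have "sC u v \<notin> Fib" for u v
    proof
      assume "sC u v \<in> Fib"
      then obtain m y0 y1 where "pt 1 u v 1 = pt 0 m y0 y1" unfolding sC_def fibre_pt by blast
      then show False unfolding pt_eq by auto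
    qed
    then have "?Y \<noteq> Fib" using cC.clo_point_ex[OF g(1)] by metis
    \<comment> \<open>In this chart \<open>Dv\<close> is the divisor of \<open>v ^ a\<close>, which
      cancels the denominator of \<open>rf k\<close>.\<close>
    have "Dv ?Y = int (multiplicity g (vV ^ a))"
    proof (cases "?Y = Zer")
      case True
      then have "vV dvd g" "g dvd vV" using cC.clo_subset_iff[OF irreducible_vV] cC.clo_subset_iff[OF g(1)]
        unfolding Zer_clo by blast+
      then have "multiplicity g (vV ^ a) = a"
        using multiplicity_irreducible[OF g(1) irreducible_vV] multiplicity_power[OF g(1), of vV a] by simp
      then show ?thesis using True Dv_simps by simp
    next
      case False
      have "\<not> g dvd vV" using False cC.clo_mono[of g vV] cC.clo_mono[of vV g] cC.irreducible_dvd_sym[OF g(1) irreducible_vV]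
        unfolding Zer_clo by blast
      then have "multiplicity g vV = 0" by (rule not_dvd_imp_multiplicity_0)
      then show ?thesis using Dv_simps(3)[OF False \<open>?Y \<noteq> Fib\<close>] multiplicity_power[OF g(1), of vV a] by simp
    qed
    moreover have "Ek k ?Y - Dv ?Y = int (multiplicity g (AC k)) - int (multiplicity g (vV ^ a))"
      by (rule represents_order(2)[OF k represents_U0 g(1) Ek_has_order(1)[OF k Y]])
    moreover have "multiplicity g (AC k) \<noteq> 0" using g nz by (metis irreducible_def multiplicity_eq_zero_iff)
    ultimately have "Ek k ?Y \<noteq> 0" by simp
    then show ?thesis unfolding div_support_def uv using cC.mem_clo g(3) by blast
  next
    case 3
    then have m: "m \<noteq> 0" using z(1) by (simp add: valid_def)
    have uv: "pt l m y0 y1 = sF 0 (y1 / (y0 * m ^ n))" unfolding sF_def pt_eq using 3 m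
        by (intro exI[of _ "1 / m"] exI[of _ "1 / y0"]) (simp add: power_divide)
    let ?v = "y1 / (y0 * m ^ n)"
    have "ev2 (AF k) 0 ?v = 0" using uv scale unfolding sF_def ev2_A by blast
    then obtain g where g: "irreducible g" "g dvd AF k" "ev2 g 0 ?v = 0" using root_factor[OF nz(2)] by blast
    let ?Y = "cF.clo g"
    have Y: "prime_divisor X ?Y" by (rule cF.clo_prime_divisor[OF g(1)])
    have "sF u v \<notin> Zer" for u v
    proof
      assume "sF u v \<in> Zer"
      then obtain l m y1 where "pt u 1 1 v = pt l m 0 y1" unfolding sF_def zero_section_pt by blast
      then show False unfolding pt_eq by auto
    qed
    then have "?Y \<noteq> Zer" using cF.clo_point_ex[OF g(1)] by metis
    have "Dv ?Y = int (multiplicity g (vU ^ b))"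
    proof (cases "?Y = Fib")
      case True
      then have "vU dvd g" "g dvd vU" using cF.clo_subset_iff[OF irreducible_vU] cF.clo_subset_iff[OF g(1)]
        unfolding Fib_clo by blast+
      then have "multiplicity g (vU ^ b) = b"
        using multiplicity_irreducible[OF g(1) irreducible_vU] multiplicity_power[OF g(1), of vU b] by simp
      then show ?thesis using True Dv_simps by simp
    next
      case False
      have "\<not> g dvd vU" using False cF.clo_mono[of g vU] cF.clo_mono[of vU g] cF.irreducible_dvd_sym[OF g(1) irreducible_vU]
        unfolding Fib_clo by blast
      then have "multiplicity g vU = 0" by (rule not_dvd_imp_multiplicity_0)
      then show ?thesis using Dv_simps(3)[OF \<open>?Y \<noteq> Zer\<close> False] multiplicity_power[OF g(1), of vU b] by simp
    qed
    moreover have "Ek k ?Y - Dv ?Y = int (multiplicity g (AF k)) - int (multiplicity g (vU ^ b))"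
      by (rule represents_order(3)[OF k represents_U0 g(1) Ek_has_order(1)[OF k Y]])
    moreover have "multiplicity g (AF k) \<noteq> 0" using g nz by (metis irreducible_def multiplicity_eq_zero_iff)
    ultimately have "Ek k ?Y \<noteq> 0" by simp
    then show ?thesis unfolding div_support_def uv using cF.mem_clo g(3) by blast
  next
    case 4
    then have nz: "m \<noteq> 0" "y1 \<noteq> 0" using z(1) by (auto simp: valid_def)
    have "Pev k 0 m 0 y1 = (\<Sum>p\<in>Idx. if p = (b - n * a, a) then k (b - n * a) a * (m ^ (b - n * a) * y1 ^ a) else 0)"
      unfolding Pev_def
    proof (intro sum.cong refl, unfold split_paired_all prod.case)
      fix i j assume "(i, j) \<in> Idx"
      then have ij: "j \<le> a" "i + n * j \<le> b" by (auto simp: Idx_def)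
      show "k i j * mono i j 0 m 0 y1 = (if (i, j) = (b - n * a, a) then k (b - n * a) a * (m ^ (b - n * a) * y1 ^ a) else 0)"
        using ij by (auto simp: mono_def power_0_left)
    qed
    also have "\<dots> = k (b - n * a) a * (m ^ (b - n * a) * y1 ^ a)" using finite_Idx Idx_corner(2)[of a] by simp
    finally show ?thesis using z(2) 4 nz corner by simp
  qed
qed

end

context ruled
begin

lemma openin_nonvanishing:
  assumes "regular X U f" shows "openin (zariski X) {x \<in> U. f x \<noteq> 0}"
  unfolding openin_X
proof (intro conjI allI impI)
  have U: "openin (zariski X) U" using assms unfolding regular_X by blast
  show "{x \<in> U. f x \<noteq> 0} \<subseteq> points X" using openin_subset[OF U] by blast
  fix l m y0 y1 assume z: "valid l m y0 y1" "pt l m y0 y1 \<in> {x \<in> U. f x \<noteq> 0}"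
  then have zU: "pt l m y0 y1 \<in> U" by simp
  obtain e where e: "e \<in> poly_fun 4" "e [l, m, y0, y1] \<noteq> 0"
    "\<And>l' m' y0' y1'. valid l' m' y0' y1' \<Longrightarrow> e [l', m', y0', y1'] \<noteq> 0 \<Longrightarrow> pt l' m' y0' y1' \<in> U"
    using U z(1) zU unfolding openin_X by meson
  obtain g h where gh: "g \<in> poly_fun 4" "h \<in> poly_fun 4" "h [l, m, y0, y1] \<noteq> 0"
    "\<And>l' m' y0' y1'. valid l' m' y0' y1' \<Longrightarrow> pt l' m' y0' y1' \<in> U \<Longrightarrow> h [l', m', y0', y1'] \<noteq> 0 \<Longrightarrow>
      f (pt l' m' y0' y1') = g [l', m', y0', y1'] / h [l', m', y0', y1']"
    using conjunct2[OF assms[unfolded regular_X], rule_format, OF z(1) zU] by blast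
  show "\<exists>h\<in>poly_fun 4. h [l, m, y0, y1] \<noteq> 0 \<and> (\<forall>l' m' y0' y1'. valid l' m' y0' y1' \<longrightarrow>
      h [l', m', y0', y1'] \<noteq> 0 \<longrightarrow> pt l' m' y0' y1' \<in> {x \<in> U. f x \<noteq> 0})"
  proof (rule bexI[of _ "\<lambda>z. e z * (g z * h z)"], intro conjI allI impI)
    show "e [l, m, y0, y1] * (g [l, m, y0, y1] * h [l, m, y0, y1]) \<noteq> 0"
      using e(2) gh(3) gh(4)[OF z(1) zU] z(2) by auto
    fix l' m' y0' y1' assume z': "valid l' m' y0' y1'" "e [l', m', y0', y1'] * (g [l', m', y0', y1'] * h [l', m', y0', y1']) \<noteq> 0"
    then have "pt l' m' y0' y1' \<in> U" using e(3) by simp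
    then show "pt l' m' y0' y1' \<in> {x \<in> U. f x \<noteq> 0}" using gh(4)[OF z'(1)] z'(2) by simp
  qed (intro poly_fun.intros e(1) gh(1,2))
qed

end

lemma ev2_monom: "ev2 (monom p j) u v = poly p u * v ^ j"
  by (simp add: ev2_def poly_monom)

lemma ev2_double_sum:
  obtains S where "finite S" "S = {(i, j). coeff (coeff f j) i \<noteq> 0}"
    "\<And>u v. ev2 f u v = (\<Sum>(i, j)\<in>S. coeff (coeff f j) i * (u ^ i * v ^ j))"
proof -
  define d where "d = Max ((\<lambda>j. degree (coeff f j)) ` {..degree f})"
  have d: "degree (coeff f j) \<le> d" for j
  proof (cases "j \<le> degree f")
    case True then show ?thesis unfolding d_def by (intro Max_ge) auto
  qed (simp add: coeff_eq_0)
  let ?T = "{..d} \<times> {..degree f}" and ?S = "{(i, j). coeff (coeff f j) i \<noteq> 0}"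
  have ST: "?S \<subseteq> ?T"
  proof clarify
    fix i j assume c: "coeff (coeff f j) i \<noteq> 0"
    then have "coeff f j \<noteq> 0" by auto
    then have "j \<le> degree f" by (rule le_degree)
    moreover have "i \<le> d" using le_degree[OF c] d[of j] by linarith
    ultimately show "i \<in> {..d} \<and> j \<in> {..degree f}" by simp
  qed
  have fin: "finite ?S" using finite_subset[OF ST] by simp
  have "ev2 f u v = (\<Sum>(i, j)\<in>?S. coeff (coeff f j) i * (u ^ i * v ^ j))" for u v
  proof -
    have "ev2 f u v = (\<Sum>j\<le>degree f. poly (coeff f j) u * v ^ j)"
      using arg_cong[OF poly_as_sum_of_monoms[of f], of "\<lambda>g. ev2 g u v"] by (simp add: ev2_sum ev2_monom)
    also have "\<dots> = (\<Sum>j\<le>degree f. \<Sum>i\<le>d. coeff (coeff f j) i * (u ^ i * v ^ j))"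
    proof (intro sum.cong refl)
      fix j
      have "poly (coeff f j) u = (\<Sum>i\<le>d. coeff (coeff f j) i * u ^ i)"
        using arg_cong[OF poly_as_sum_of_monoms'[OF d[of j]], of "\<lambda>g. poly g u"] by (simp add: poly_sum poly_monom)
      then show "poly (coeff f j) u * v ^ j = (\<Sum>i\<le>d. coeff (coeff f j) i * (u ^ i * v ^ j))"
        by (simp add: sum_distrib_right mult.assoc)
    qed
    also have "\<dots> = (\<Sum>i\<le>d. \<Sum>j\<le>degree f. coeff (coeff f j) i * (u ^ i * v ^ j))" by (rule sum.swap)
    also have "\<dots> = (\<Sum>(i, j)\<in>?T. coeff (coeff f j) i * (u ^ i * v ^ j))" by (simp add: sum.cartesian_product)
    also have "\<dots> = (\<Sum>(i, j)\<in>?S. coeff (coeff f j) i * (u ^ i * v ^ j))"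
      by (rule sum.mono_neutral_right) (use ST in auto)
    finally show ?thesis .
  qed
  then show thesis using that fin by blast
qed

context ruled_system
begin

text \<open>Effectivity on the chart \<open>s0\<close> makes the rational function a polynomial
  there; its poles, of order at most \<open>a\<close> along the zero section and at most
  \<open>b\<close> along the fibre, confine the exponents to the trapezoid. So the linear system
  consists of the divisors \<open>Ek k\<close>.\<close>

lemma section_polynomial:
  assumes E: "\<And>Y. 0 \<le> E Y" and s: "has_divisor X U s (\<lambda>Y. E Y - Dv Y)"
  obtains k where "supported k" "A k \<noteq> 0" "represents U s k"
proof -
  have reg: "regular X U s" and U: "openin (zariski X) U" and nz: "\<exists>x\<in>U. s x \<noteq> 0"
    and ord: "\<And>Y. prime_divisor X Y \<Longrightarrow> has_order X Y U s (E Y - Dv Y)"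
    using s unfolding has_divisor_def by (blast, blast, blast, metis)
  have "{x \<in> U. s x \<noteq> 0} \<noteq> {}" using nz by blast
  then obtain u0 v0 where p0: "s0 u0 v0 \<in> U" "s (s0 u0 v0) \<noteq> 0"
    using c0.dense[OF openin_nonvanishing[OF reg]] by blast
  obtain P Q where PQ: "ev2 Q u0 v0 \<noteq> 0" "\<And>u v. s0 u v \<in> U \<Longrightarrow> ev2 Q u v \<noteq> 0 \<Longrightarrow> s (s0 u v) = ev2 P u v / ev2 Q u v"
    using c0.regular_in[OF reg p0(1)] by blast
  obtain e where e: "ev2 e u0 v0 \<noteq> 0" "\<And>u v. ev2 e u v \<noteq> 0 \<Longrightarrow> s0 u v \<in> U"
    using c0.open_in[OF U p0(1)] by blast
  have nzP: "e \<noteq> 0" "Q \<noteq> 0" "P \<noteq> 0" using e PQ p0 by auto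
  then have "gcd P Q \<noteq> 0" by simp
  then obtain P' Q' where pq: "P = P' * gcd P Q" "Q = Q' * gcd P Q" "coprime P' Q'" using gcd_coprime_exists by blast
  have nz': "P' \<noteq> 0" "Q' \<noteq> 0" using nzP pq(1,2) by auto
  have cross: "P * Q' = P' * Q" by (subst pq(1), subst (2) pq(2)) (simp only: mult_ac)
  have rel: "s (s0 u v) * ev2 Q' u v = ev2 P' u v" if uv: "s0 u v \<in> U" for u v
  proof -
    obtain P1 Q1 where 1: "ev2 Q1 u v \<noteq> 0" "\<And>u v. s0 u v \<in> U \<Longrightarrow> ev2 Q1 u v \<noteq> 0 \<Longrightarrow> s (s0 u v) = ev2 P1 u v / ev2 Q1 u v"
      using c0.regular_in[OF reg uv] by blast
    have "Q1 \<noteq> 0" using 1 by auto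
    have "P1 * Q' = P' * Q1"
    proof (rule ev2_eqI)
      show "e * Q * Q1 \<noteq> 0" using nzP \<open>Q1 \<noteq> 0\<close> by simp
      fix u v assume "ev2 (e * Q * Q1) u v \<noteq> 0"
      then have n: "ev2 e u v \<noteq> 0" "ev2 Q u v \<noteq> 0" "ev2 Q1 u v \<noteq> 0" by auto
      have "ev2 P1 u v * ev2 Q u v = ev2 P u v * ev2 Q1 u v"
        using 1(2)[OF e(2)[OF n(1)] n(3)] PQ(2)[OF e(2)[OF n(1)] n(2)] n by (simp add: frac_eq_eq)
      moreover have "ev2 P u v * ev2 Q' u v = ev2 P' u v * ev2 Q u v" using arg_cong[OF cross, of "\<lambda>p. ev2 p u v"] by simp
      ultimately have "ev2 Q u v * (ev2 P1 u v * ev2 Q' u v) = ev2 Q u v * (ev2 P' u v * ev2 Q1 u v)" by algebra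
      then show "ev2 (P1 * Q') u v = ev2 (P' * Q1) u v" using n(2) by simp
    qed
    then have "ev2 P1 u v * ev2 Q' u v = ev2 P' u v * ev2 Q1 u v" by (metis ev2_simps(3))
    then show ?thesis using 1(2)[OF uv 1(1)] 1(1) by (simp add: divide_eq_eq)
  qed
  \<comment> \<open>A prime factor of the reduced denominator would define a curve in the chart on
    which \<open>E\<close> is negative.\<close>
  have "is_unit Q'"
  proof (rule ccontr)
    assume "\<not> is_unit Q'"
    then obtain g where g: "prime g" "g dvd Q'" using prime_divisor_exists nz' by blast
    then have gi: "irreducible g" by (auto intro: prime_elem_imp_irreducible)
    then have "\<not> g dvd P'" using pq(3) g(2) coprime_common_divisor by (metis irreducible_def)
    then have m: "multiplicity g P' = 0" by (rule not_dvd_imp_multiplicity_0)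
    have "multiplicity g Q' \<noteq> 0" using g(2) nz' gi by (metis irreducible_def multiplicity_eq_zero_iff)
    moreover have "E (c0.clo g) - Dv (c0.clo g) = int (multiplicity g P') - int (multiplicity g Q')"
      by (rule c0.has_order_clo_unique[OF gi nz' rel U _ ord[OF c0.clo_prime_divisor[OF gi]]]) (use nz in auto)
    ultimately show False using E[of "c0.clo g"] m Dv_simps(3)[OF clo_neq[OF gi]] by simp
  qed
  then obtain q where q: "q \<noteq> 0" "Q' = [:[:q:]:]" using bipoly_unit by blast
  define A0 where "A0 = [:[:1 / q:]:] * P'"
  have A0: "A0 \<noteq> 0" using nz' q by (simp add: A0_def)
  have sA0: "s (s0 u v) = ev2 A0 u v" if "s0 u v \<in> U" for u v
    using rel[OF that] q by (simp add: A0_def eq_divide_eq)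
  let ?U = "U \<inter> U0"
  have oU: "openin (zariski X) ?U" using U c0.openin_D by blast
  have neU: "?U \<noteq> {}" using p0 by (auto simp: c0.D_1)
  have ordU: "has_order X Y ?U s (E Y - Dv Y)" if "prime_divisor X Y" for Y
    by (rule has_order_mono[OF ord[OF that]]) auto
  \<comment> \<open>the order along the zero section bounds the degree in \<open>v\<close>\<close>
  let ?J = "degree A0"
  \<comment> \<open>\<open>A0\<close> at \<open>v = 1 / w\<close>, multiplied by
    \<open>w ^ ?J\<close>: at \<open>w = 0\<close> only the leading coefficient survives, so
    \<open>AZ\<close> is not divisible by \<open>vV\<close>.\<close>
  define AZ where "AZ = (\<Sum>j\<le>?J. [:coeff A0 j:] * vV ^ (?J - j))"
  have AZ0: "ev2 AZ u 0 = poly (lead_coeff A0) u" for u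
  proof -
    have "ev2 AZ u 0 = (\<Sum>j\<le>?J. if j = ?J then poly (coeff A0 j) u else 0)"
      unfolding AZ_def ev2_sum by (intro sum.cong refl) (auto simp: power_0_left)
    then show ?thesis by simp
  qed
  have AZw: "s (sC u w) * ev2 (vV ^ ?J) u w = ev2 AZ u w" if "sC u w \<in> ?U" for u w
  proof -
    have w: "w \<noteq> 0" using that sC_U0 by blast
    have "ev2 A0 u (1 / w) = (\<Sum>j\<le>?J. poly (coeff A0 j) u * (1 / w) ^ j)"
      using arg_cong[OF poly_as_sum_of_monoms[of A0], of "\<lambda>g. ev2 g u (1 / w)"] by (simp add: ev2_sum ev2_monom)
    then have "ev2 A0 u (1 / w) * w ^ ?J = (\<Sum>j\<le>?J. poly (coeff A0 j) u * ((1 / w) ^ j * w ^ ?J))"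
      by (simp add: sum_distrib_right mult.assoc)
    also have "\<dots> = ev2 AZ u w"
      unfolding AZ_def ev2_sum using w by (intro sum.cong refl) (simp add: power_diff[OF w] power_divide)
    finally show ?thesis using sA0[of u "1 / w"] that by (simp add: sC_s0[OF w])
  qed
  have "lead_coeff A0 \<noteq> 0" using A0 by simp
  then obtain u1 where "poly (lead_coeff A0) u1 \<noteq> 0" using poly_all_0_iff_0 by blast
  then have "ev2 AZ u1 0 \<noteq> 0" using AZ0 by simp
  then have nvV: "AZ \<noteq> 0" "\<not> vV dvd AZ" using not_dvd_of_ev2[of vV u1 0 AZ] by auto
  have pZ: "prime_divisor X (cC.clo vV)" using Zer_Fib_prime Zer_clo Fib_clo by simp
  have "E (cC.clo vV) - Dv (cC.clo vV) = int (multiplicity vV AZ) - int (multiplicity vV (vV ^ ?J))"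
    by (rule cC.has_order_clo_unique[OF irreducible_vV nvV(1) _ AZw oU neU ordU[OF pZ]]) auto
  then have "E Zer - int a = - int ?J"
    unfolding Zer_clo[symmetric] Dv_simps multiplicity_vars not_dvd_imp_multiplicity_0[OF nvV(2)] by simp
  then have J: "?J \<le> a" using E[of Zer] by linarith
  \<comment> \<open>the order along the fibre bounds the weighted degree\<close>
  obtain S where S: "finite S" "S = {(i, j). coeff (coeff A0 j) i \<noteq> 0}"
    "\<And>u v. ev2 A0 u v = (\<Sum>(i, j)\<in>S. coeff (coeff A0 j) i * (u ^ i * v ^ j))"
    using ev2_double_sum[of A0] by blast
  have "S \<noteq> {}"
  proof
    assume "S = {}"
    then have "A0 = 0" using S(3) ev2_nonzero_ex[of A0] by auto
    then show False using A0 by simp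
  qed
  define M where "M = Max ((\<lambda>(i, j). i + n * j) ` S)"
  have Mge: "i + n * j \<le> M" if "(i, j) \<in> S" for i j
    unfolding M_def using S(1) that by (intro Max_ge) auto
  have "M \<in> (\<lambda>(i, j). i + n * j) ` S" unfolding M_def using S(1) \<open>S \<noteq> {}\<close> by (intro Max_in) auto
  then obtain i1 j1 where ij1: "(i1, j1) \<in> S" "M = i1 + n * j1" by auto
  define AB where "AB = (\<Sum>(i, j)\<in>S. [:[:coeff (coeff A0 j) i:]:] * (vU ^ (M - i - n * j) * vV ^ j))"
  have AB_ev: "ev2 AB u v = (\<Sum>(i, j)\<in>S. coeff (coeff A0 j) i * (u ^ (M - i - n * j) * v ^ j))" for u v
    unfolding AB_def ev2_sum by (intro sum.cong refl) auto
  have ABw: "s (sF u v) * ev2 (vU ^ M) u v = ev2 AB u v" if "sF u v \<in> ?U" for u v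
  proof -
    have u: "u \<noteq> 0" using that sF_U0 by blast
    have "ev2 A0 (1 / u) (v / u ^ n) * u ^ M = (\<Sum>(i, j)\<in>S. coeff (coeff A0 j) i * ((1 / u) ^ i * (v / u ^ n) ^ j) * u ^ M)"
      unfolding S(3) by (simp add: sum_distrib_right case_prod_unfold)
    also have "\<dots> = ev2 AB u v" unfolding AB_ev
    proof (intro sum.cong refl, unfold split_paired_all prod.case)
      fix i j assume "(i, j) \<in> S"
      then have "M = (M - i - n * j) + (i + n * j)" using Mge[of i j] by simp
      then have "u ^ M = u ^ (M - i - n * j) * (u ^ i * (u ^ n) ^ j)" by (metis power_add power_mult)
      then show "coeff (coeff A0 j) i * ((1 / u) ^ i * (v / u ^ n) ^ j) * u ^ M = coeff (coeff A0 j) i * (u ^ (M - i - n * j) * v ^ j)"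
        using u by (simp add: power_divide)
    qed
    finally show ?thesis using sA0[of "1 / u" "v / u ^ n"] that by (simp add: sF_s0[OF u])
  qed
  \<comment> \<open>The part of top weighted degree, which is \<open>AB\<close> at
    \<open>u = 0\<close>. For each \<open>j\<close> at most one \<open>i\<close> has weight
    \<open>M\<close>, so nothing cancels.\<close>
  define R where "R = (\<Sum>(i, j)\<in>S. if i + n * j = M then monom (coeff (coeff A0 j) i) j else 0)"
  have "coeff R j1 = (\<Sum>p\<in>S. if p = (i1, j1) then coeff (coeff A0 j1) i1 else 0)"
    unfolding R_def coeff_sum by (intro sum.cong refl) (auto simp: ij1(2) split: prod.splits)
  then have "coeff R j1 \<noteq> 0" using ij1(1) S(1) S(2) by simp
  then have "R \<noteq> 0" by auto
  then obtain v1 where "poly R v1 \<noteq> 0" using poly_all_0_iff_0 by blast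
  moreover have "poly R v1 = ev2 AB 0 v1"
    unfolding R_def AB_ev poly_sum
  proof (intro sum.cong refl, unfold split_paired_all prod.case)
    fix i j assume "(i, j) \<in> S"
    then have "M - i - n * j = 0 \<longleftrightarrow> i + n * j = M" using Mge[of i j] by auto
    then show "poly (if i + n * j = M then monom (coeff (coeff A0 j) i) j else 0) v1 =
        coeff (coeff A0 j) i * (0 ^ (M - i - n * j) * v1 ^ j)"
      by (auto simp: poly_monom power_0_left)
  qed
  ultimately have "ev2 AB 0 v1 \<noteq> 0" by simp
  then have nvU: "AB \<noteq> 0" "\<not> vU dvd AB" using not_dvd_of_ev2[of vU 0 v1 AB] by auto
  have pF: "prime_divisor X (cF.clo vU)" using Zer_Fib_prime Zer_clo Fib_clo by simp
  have "E (cF.clo vU) - Dv (cF.clo vU) = int (multiplicity vU AB) - int (multiplicity vU (vU ^ M))"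
    by (rule cF.has_order_clo_unique[OF irreducible_vU nvU(1) _ ABw oU neU ordU[OF pF]]) auto
  then have "E Fib - int b = - int M"
    unfolding Fib_clo[symmetric] Dv_simps multiplicity_vars not_dvd_imp_multiplicity_0[OF nvU(2)] by simp
  then have Mb: "M \<le> b" using E[of Fib] by linarith
  define k where "k i j = coeff (coeff A0 j) i" for i j
  have sup: "supported k" unfolding supported_def
  proof (intro allI impI)
    fix i j assume ij: "(i, j) \<notin> Idx"
    show "k i j = 0"
    proof (rule ccontr)
      assume "k i j \<noteq> 0"
      then have c: "coeff (coeff A0 j) i \<noteq> 0" by (simp add: k_def)
      then have "(i, j) \<in> S" by (simp add: S(2))
      then have "i + n * j \<le> b" using Mge[of i j] Mb by simp
      moreover have "coeff A0 j \<noteq> 0" using c by auto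
      then have "j \<le> a" using le_degree[of A0 j] J by simp
      ultimately show False using ij by (simp add: Idx_def)
    qed
  qed
  have "A k = A0" by (intro poly_eqI) (simp add: coeff_A[OF sup] k_def)
  then have "represents U s k" using U neU sA0 by (auto simp: represents_def c0.D_1 rf_s0)
  then show thesis using that sup \<open>A k = A0\<close> A0 by blast
qed

end

section \<open>General members of the linear system\<close>

text \<open>Closedness is tested on homogeneous coefficients, whereas expressions are evaluated at
  normalized ones; a power of \<open>k 0 0\<close> clears the denominators.\<close>

lemma poly_fun_pexp:
  assumes k: "\<And>i j. k i j \<in> poly_fun m"
  shows "\<exists>F\<in>poly_fun m. \<exists>N. \<forall>c. k 0 0 c \<noteq> 0 \<longrightarrow> F c = k 0 0 c ^ N * eval_pexp e (\<lambda>i j. k i j c / k 0 0 c)"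
proof (induction e)
  case (Const c)
  show ?case by (intro bexI[of _ "\<lambda>_. of_int c"] exI[of _ 0]) (auto intro: poly_fun.intros)
next
  case (Var i j)
  show ?case by (intro bexI[of _ "k i j"] exI[of _ 1]) (auto intro: k)
next
  case (Add e f)
  then obtain F N G M where F: "F \<in> poly_fun m" "\<And>c. k 0 0 c \<noteq> 0 \<Longrightarrow> F c = k 0 0 c ^ N * eval_pexp e (\<lambda>i j. k i j c / k 0 0 c)"
    and G: "G \<in> poly_fun m" "\<And>c. k 0 0 c \<noteq> 0 \<Longrightarrow> G c = k 0 0 c ^ M * eval_pexp f (\<lambda>i j. k i j c / k 0 0 c)" by blast
  show ?case
  proof (intro bexI exI allI impI)
    show "(\<lambda>c. k 0 0 c ^ M * F c + k 0 0 c ^ N * G c) \<in> poly_fun m"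
      by (intro poly_fun.intros poly_fun_power k F G)
    fix c assume "k 0 0 c \<noteq> 0"
    then show "k 0 0 c ^ M * F c + k 0 0 c ^ N * G c = k 0 0 c ^ (N + M) * eval_pexp (Add e f) (\<lambda>i j. k i j c / k 0 0 c)"
      using F(2) G(2) by (simp add: power_add algebra_simps)
  qed
next
  case (Mul e f)
  then obtain F N G M where F: "F \<in> poly_fun m" "\<And>c. k 0 0 c \<noteq> 0 \<Longrightarrow> F c = k 0 0 c ^ N * eval_pexp e (\<lambda>i j. k i j c / k 0 0 c)"
    and G: "G \<in> poly_fun m" "\<And>c. k 0 0 c \<noteq> 0 \<Longrightarrow> G c = k 0 0 c ^ M * eval_pexp f (\<lambda>i j. k i j c / k 0 0 c)" by blast
  show ?case
  proof (intro bexI exI allI impI)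
    show "(\<lambda>c. F c * G c) \<in> poly_fun m"
      by (intro poly_fun.intros poly_fun_power k F G)
    fix c assume "k 0 0 c \<noteq> 0"
    then show "F c * G c = k 0 0 c ^ (N + M) * eval_pexp (Mul e f) (\<lambda>i j. k i j c / k 0 0 c)"
      using F(2) G(2) by (simp add: power_add algebra_simps)
  qed
qed

lemma poly_fun_sum: "(\<And>i. i \<in> S \<Longrightarrow> f i \<in> poly_fun m) \<Longrightarrow> (\<lambda>c. \<Sum>i\<in>S. f i c) \<in> poly_fun m"
  by (induction S rule: infinite_finite_induct) (auto intro: poly_fun.intros)

lemma closedin_zero_locus:
  assumes "H \<in> poly_fun m" shows "closedin (zariski (affine_space m)) {c. length c = m \<and> H c = 0}"
proof -
  have "{c. length c = m} - {c. length c = m \<and> H c = 0} = open_locus m {H}" by (auto simp: open_locus_def)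
  moreover have "openin (zariski (affine_space m)) (open_locus m {H})"
    unfolding openin_affine_space using assms by blast
  ultimately show ?thesis unfolding closedin_def points_affine_space by auto
qed

context ruled_system
begin

text \<open>The hyperplane \<open>k 0 0 = 0\<close> is included, so that outside these sets the
  equation can be normalized.\<close>

definition degenerate :: "pexp \<Rightarrow> (nat \<Rightarrow> nat \<Rightarrow> complex) \<Rightarrow> bool" where
  "degenerate e k \<longleftrightarrow> k 0 0 = 0 \<or> eval_pexp e (\<lambda>i j. k i j / k 0 0) = 0"

definition Zset :: "pexp \<Rightarrow> complex list set divisor set" where
  "Zset e = {Ek k | k. supported k \<and> A k \<noteq> 0 \<and> degenerate e k}"

lemma Ek_Zset:
  assumes "supported k" "A k \<noteq> 0" shows "Ek k \<in> Zset e \<longleftrightarrow> degenerate e k"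
proof
  assume "Ek k \<in> Zset e"
  then obtain k' where k': "Ek k = Ek k'" "supported k'" "A k' \<noteq> 0" "degenerate e k'" unfolding Zset_def by blast
  obtain c where c: "c \<noteq> 0" "k = (\<lambda>i j. c * k' i j)" using Ek_inj[OF k'(3) assms(2) k'(1)[symmetric] k'(2) assms(1)] .
  show "degenerate e k" using k'(4) c by (simp add: degenerate_def)
qed (use assms in \<open>auto simp: Zset_def\<close>)

lemma rf_zero_imp:
  assumes "represents U s k" "\<And>x. x \<in> U \<Longrightarrow> s x = 0" shows "A k = 0"
proof -
  have U: "openin (zariski X) U" "U \<noteq> {}" using assms by (auto simp: represents_def)
  then obtain u v where "s0 u v \<in> U" using c0.dense by blast
  then obtain e where e: "ev2 e u v \<noteq> 0" "\<And>u v. ev2 e u v \<noteq> 0 \<Longrightarrow> s0 u v \<in> U" using c0.open_in[OF U(1)] by blast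
  show ?thesis
  proof (rule ev2_eqI)
    show "e \<noteq> 0" using e by auto
    fix u v assume "ev2 e u v \<noteq> 0"
    then have "s0 u v \<in> U" using e by blast
    moreover have "s0 u v \<in> U0" by (auto simp: c0.D_1)
    ultimately have "rf k (s0 u v) = 0" using assms by (auto simp: represents_def)
    then show "ev2 (A k) u v = ev2 0 u v" by (simp add: rf_s0)
  qed
qed

text \<open>In a linear family every member is a polynomial section, with coefficients linear in the
  parameters \<open>c\<close>. The condition becomes the vanishing of one polynomial in
  \<open>c\<close>, the product of the coefficient at \<open>(0, 0)\<close> with a homogenized
  expression.\<close>

lemma Zset_closed: "closed_in_linear_system X Dv (Zset e)"
  unfolding closed_in_linear_system_def
proof (intro conjI allI impI)
  show "Zset e \<subseteq> linear_system X Dv" unfolding Zset_def using Ek_linear_system by blast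
  fix m U and s :: "nat \<Rightarrow> complex list set \<Rightarrow> complex"
  assume *: "openin (zariski X) U \<and> U \<noteq> {} \<and> (\<forall>i<m. regular X U (s i)) \<and>
    (\<forall>c. length c = m \<longrightarrow> in_cone X Dv (linear_system X Dv) U (lin_comb s c))"
  have cone: "(\<forall>x\<in>U. f x = 0) \<or> (\<exists>k. supported k \<and> A k \<noteq> 0 \<and> represents U f k)"
    if f: "in_cone X Dv (linear_system X Dv) U f" for f
  proof (cases "\<forall>x\<in>U. f x = 0")
    case False
    then obtain E where E: "E \<in> linear_system X Dv" "has_divisor X U f (\<lambda>Y. E Y - Dv Y)"
      using f unfolding in_cone_def by blast
    have "\<And>Y. 0 \<le> E Y" using E(1) unfolding linear_system_def by blast
    then show ?thesis using section_polynomial[OF _ E(2)] by metis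
  qed simp
  have "\<exists>k. supported k \<and> (\<forall>x\<in>U \<inter> U0. s i x = rf k x)" if i: "i < m" for i
  proof -
    \<comment> \<open>Unit vectors recover the single functions from the hypothesis on
      combinations.\<close>
    let ?c = "(replicate m 0)[i := 1] :: complex list"
    have "lin_comb s ?c x = s i x" for x
    proof -
      have "lin_comb s ?c x = (\<Sum>l<m. if l = i then s i x else 0)"
        unfolding lin_comb_def by (rule sum.cong) (auto simp: nth_list_update)
      then show ?thesis using i by simp
    qed
    then have "lin_comb s ?c = s i" by blast
    moreover have "length ?c = m" by simp
    ultimately have "in_cone X Dv (linear_system X Dv) U (s i)" using * by metis
    from cone[OF this] show ?thesis
    proof
      assume "\<forall>x\<in>U. s i x = 0"
      moreover have "rf (\<lambda>i j. 0) x = 0" if "x \<in> U0" for x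
        using that by (auto simp: c0.D_1 rf_s0 A_def Pev_def)
      ultimately show ?thesis by (intro exI[of _ "\<lambda>i j. 0"]) (auto simp: supported_def)
    next
      assume "\<exists>k. supported k \<and> A k \<noteq> 0 \<and> represents U (s i) k"
      then show ?thesis unfolding represents_def by blast
    qed
  qed
  then obtain \<kappa> where \<kappa>: "\<And>i. i < m \<Longrightarrow> supported (\<kappa> i)" "\<And>i x. i < m \<Longrightarrow> x \<in> U \<inter> U0 \<Longrightarrow> s i x = rf (\<kappa> i) x"
    by metis
  define Kc where "Kc c = (\<lambda>i j. \<Sum>l<m. c ! l * \<kappa> l i j)" for c :: "complex list"
  have Ksup: "supported (Kc c)" for c using \<kappa>(1) by (auto simp: supported_def Kc_def)
  have Krep: "represents U (lin_comb s c) (Kc c)" if c: "length c = m" for c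
    unfolding represents_def
  proof (intro conjI ballI)
    fix x assume x: "x \<in> U \<inter> U0"
    then obtain u v where uv: "x = s0 u v" by (auto simp: c0.D_1)
    have "rf (Kc c) x = (\<Sum>(i, j)\<in>Idx. (\<Sum>l<m. c ! l * \<kappa> l i j) * mono i j 1 u 1 v)"
      unfolding uv rf_s0 ev2_A Pev_def Kc_def ..
    also have "\<dots> = (\<Sum>(i, j)\<in>Idx. \<Sum>l<m. c ! l * (\<kappa> l i j * mono i j 1 u 1 v))"
      by (simp add: sum_distrib_right mult.assoc)
    also have "\<dots> = (\<Sum>l<m. \<Sum>(i, j)\<in>Idx. c ! l * (\<kappa> l i j * mono i j 1 u 1 v))"
      unfolding case_prod_unfold by (rule sum.swap)
    also have "\<dots> = (\<Sum>l<m. c ! l * rf (\<kappa> l) x)"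
      unfolding uv rf_s0 ev2_A Pev_def by (simp add: sum_distrib_left case_prod_unfold)
    also have "\<dots> = lin_comb s c x" unfolding lin_comb_def c using \<kappa>(2) x by (intro sum.cong) auto
    finally show "lin_comb s c x = rf (Kc c) x" by simp
  qed (use * in auto)
  have cone_iff: "in_cone X Dv (Zset e) U (lin_comb s c) \<longleftrightarrow> degenerate e (Kc c)" if c: "length c = m" for c
  proof (cases "A (Kc c) = 0")
    case True
    have "\<forall>x\<in>U. lin_comb s c x = 0"
    proof (rule ccontr)
      assume "\<not> ?thesis"
      moreover have "in_cone X Dv (linear_system X Dv) U (lin_comb s c)" using * c by blast
      ultimately obtain k where k: "supported k" "A k \<noteq> 0" "represents U (lin_comb s c) k" using cone by blast
      have eq: "rf k x = rf (Kc c) x" if "x \<in> U \<inter> U0" for x using k(3) Krep[OF c] that unfolding represents_def by metis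
      have z: "rf (Kc c) x = 0" if "x \<in> U0" for x using that True by (auto simp: c0.D_1 rf_s0)
      have "openin (zariski X) (U \<inter> U0)" using * c0.openin_D by blast
      moreover obtain u v where "s0 u v \<in> U" using * c0.dense[of U] by blast
      then have "s0 u v \<in> U \<inter> U0" by (auto simp: c0.D_1)
      then have "U \<inter> U0 \<noteq> {}" by blast
      ultimately have "represents (U \<inter> U0) (rf k) k" by (simp add: represents_def)
      then have "A k = 0" by (rule rf_zero_imp) (use eq z in auto)
      then show False using k by simp
    qed
    \<comment> \<open>The zero function belongs to every cone, and zero coefficients count as
      degenerate, so both sides of the equivalence hold here.\<close>
    moreover have "Kc c 0 0 = 0" using coeff_A[OF Ksup, of c 0 0] True by simp
    ultimately show ?thesis by (simp add: in_cone_def degenerate_def)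
  next
    case False
    have nz: "\<not> (\<forall>x\<in>U. lin_comb s c x = 0)" using rf_zero_imp[OF Krep[OF c]] False by blast
    have "in_cone X Dv (linear_system X Dv) U (lin_comb s c)" using * c by blast
    then obtain E where E: "has_divisor X U (lin_comb s c) (\<lambda>Y. E Y - Dv Y)" using nz unfolding in_cone_def by blast
    have EE: "E' = Ek (Kc c)" if "has_divisor X U (lin_comb s c) (\<lambda>Y. E' Y - Dv Y)" for E'
      by (rule represents_Ek[OF False Krep[OF c] that])
    have "in_cone X Dv (Zset e) U (lin_comb s c) \<longleftrightarrow> Ek (Kc c) \<in> Zset e"
      unfolding in_cone_def using nz E EE by metis
    then show ?thesis using Ek_Zset[OF Ksup False] by simp
  qed
  define kk where "kk i j = (\<lambda>c. \<Sum>l<m. c ! l * \<kappa> l i j)" for i j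
  have kk: "kk i j \<in> poly_fun m" for i j
    unfolding kk_def by (intro poly_fun_sum poly_fun.intros) auto
  obtain F N where F: "F \<in> poly_fun m" "\<And>c. kk 0 0 c \<noteq> 0 \<Longrightarrow> F c = kk 0 0 c ^ N * eval_pexp e (\<lambda>i j. kk i j c / kk 0 0 c)"
    using poly_fun_pexp[of kk m e] kk by blast
  have "degenerate e (Kc c) \<longleftrightarrow> kk 0 0 c * F c = 0" for c
  proof -
    have "Kc c = (\<lambda>i j. kk i j c)" by (simp add: Kc_def kk_def)
    then show ?thesis using F(2)[of c] by (cases "kk 0 0 c = 0") (simp_all add: degenerate_def)
  qed
  then have "{c. length c = m \<and> in_cone X Dv (Zset e) U (lin_comb s c)} = {c. length c = m \<and> kk 0 0 c * F c = 0}"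
    using cone_iff by blast
  moreover have "(\<lambda>c. kk 0 0 c * F c) \<in> poly_fun m" by (intro poly_fun.intros kk F)
  ultimately show "closedin (zariski (affine_space m)) {c. length c = m \<and> in_cone X Dv (Zset e) U (lin_comb s c)}"
    by (simp only: closedin_zero_locus)
qed

lemma Zset_proper:
  fixes r :: "nat \<Rightarrow> nat \<Rightarrow> complex"
  assumes "r \<in> normalized" "eval_pexp e r \<noteq> 0" shows "Zset e \<noteq> linear_system X Dv"
proof -
  have r: "supported r" "r 0 0 = 1" using assms by (auto simp: normalized_def)
  then have "A r \<noteq> 0" using coeff_A[OF r(1), of 0 0] by auto
  moreover have "\<not> degenerate e r" using r assms by (simp add: degenerate_def)
  ultimately show ?thesis using Ek_linear_system Ek_Zset[OF r(1)] by blast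
qed

lemma normalized_single: "single 0 0 \<in> normalized"
  using supported_single[of 0 0] Idx_corner(1)[of 0] by (simp add: normalized_def single_def)

theorem general_divisor:
  assumes "\<And>k. supported k \<Longrightarrow> k 0 0 \<noteq> 0 \<Longrightarrow> generic_in normalized (\<lambda>i j. k i j / k 0 0) \<Longrightarrow> P (Ek k)"
  shows "sufficiently_general X Dv P"
proof -
  \<comment> \<open>Expressions vanishing on all of \<open>normalized\<close> would remove
    everything; they are replaced by \<open>Const 1\<close>, whose degenerate set is the hyperplane
    \<open>k 0 0 = 0\<close>.\<close>
  define pick where "pick e = (if \<exists>r\<in>normalized. eval_pexp e r \<noteq> (0 :: complex) then e else Const 1)" for e
  have pick: "\<exists>r\<in>normalized. eval_pexp (pick e) r \<noteq> (0 :: complex)" for e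
    using normalized_single by (auto simp: pick_def)
  show ?thesis unfolding sufficiently_general_def
  proof (intro exI[of _ "\<lambda>i. Zset (pick (from_nat i))"] conjI allI ballI)
    show "closed_in_linear_system X Dv (Zset (pick (from_nat i)))" for i by (rule Zset_closed)
    show "Zset (pick (from_nat i)) \<noteq> linear_system X Dv" for i using pick Zset_proper by blast
    fix E assume E: "E \<in> linear_system X Dv - (\<Union>i. Zset (pick (from_nat i)))"
    then obtain U f where f: "has_divisor X U f (\<lambda>Y. E Y - Dv Y)" "\<And>Y. 0 \<le> E Y" unfolding linear_system_def by blast
    obtain k where k: "supported k" "A k \<noteq> 0" "represents U f k" using section_polynomial[OF f(2,1)] by blast
    have Ek: "E = Ek k" by (rule represents_Ek[OF k(2,3) f(1)])
    have "E \<notin> Zset (pick e)" for e using E by (metis DiffD2 UNIV_I UN_iff from_nat_to_nat)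
    then have nd: "\<not> degenerate (pick e) k" for e using Ek_Zset[OF k(1,2)] Ek by blast
    have k0: "k 0 0 \<noteq> 0" using nd[of "Const 1"] by (auto simp: degenerate_def)
    have "generic_in normalized (\<lambda>i j. k i j / k 0 0)"
      unfolding generic_in_def
    proof (intro conjI allI impI ballI)
      show "(\<lambda>i j. k i j / k 0 0) \<in> normalized" using k(1) k0 by (auto simp: normalized_def supported_def)
      fix e and r' :: "nat \<Rightarrow> nat \<Rightarrow> complex" assume e: "eval_pexp e (\<lambda>i j. k i j / k 0 0) = 0" "r' \<in> normalized"
      show "eval_pexp e r' = 0"
      proof (rule ccontr)
        assume "eval_pexp e r' \<noteq> 0"
        then have "\<exists>r\<in>normalized. eval_pexp e r \<noteq> (0 :: complex)" using e(2) by blast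
        then have "pick e = e" by (simp only: pick_def if_True)
        then show False using nd[of e] e(1) by (simp add: degenerate_def)
      qed
    qed
    then show "P E" unfolding Ek using assms k(1) k0 by blast
  qed
qed

lemma generic_zero_in_support:
  assumes k: "supported k" "k 0 0 \<noteq> 0" and gen: "generic_in normalized (\<lambda>i j. k i j / k 0 0)"
    and z: "valid l m y0 y1" "Pev (\<lambda>i j. k i j / k 0 0) l m y0 y1 = 0"
  shows "pt l m y0 y1 \<in> div_support (Ek k)"
proof (rule zero_in_support)
  show "A k \<noteq> 0" using coeff_A[OF k(1), of 0 0] k(2) by auto
  show "valid l m y0 y1" by (rule z)
  have "Pev (\<lambda>i j. k i j / k 0 0) l m y0 y1 = Pev k l m y0 y1 / k 0 0"
    unfolding Pev_def by (simp add: sum_divide_distrib case_prod_unfold)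
  then show "Pev k l m y0 y1 = 0" using z(2) k(2) by simp
  show "k (b - n * a) a \<noteq> 0"
  proof
    assume "k (b - n * a) a = 0"
    then have "eval_pexp (Var (b - n * a) a) (\<lambda>i j. k i j / k 0 0) = 0" by simp
    then have *: "eval_pexp (Var (b - n * a) a) r = 0" if "r \<in> normalized" for r :: "nat \<Rightarrow> nat \<Rightarrow> complex"
      using gen that unfolding generic_in_def by blast
    \<comment> \<open>A normalized family with nonzero coefficient at the last vertex; it shows that
      the vanishing of this coefficient is not a relation on \<open>normalized\<close>.\<close>
    let ?r = "\<lambda>i j. single 0 0 i j + single (b - n * a) a i j :: complex"
    have "supported (single 0 0 :: nat \<Rightarrow> nat \<Rightarrow> complex)"
      "supported (single (b - n * a) a :: nat \<Rightarrow> nat \<Rightarrow> complex)"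
      using supported_single Idx_corner[of 0] Idx_corner[of a] by auto
    then have "supported ?r" unfolding supported_def by simp
    moreover have "?r 0 0 = 1" using a4 by (simp add: single_def)
    ultimately have "?r \<in> normalized" by (simp add: normalized_def)
    from *[OF this] show False using a4 by (simp add: single_def)
  qed
qed

end

section \<open>Maps from the punctured line\<close>

lemma morphism_subvar_incl:
  assumes m: "morphism N (subvar X S) \<nu>" and reg: "\<And>V f. regular X V f \<Longrightarrow> openin (zariski X) V"
  shows "morphism N X \<nu>" "\<And>x. x \<in> points N \<Longrightarrow> \<nu> x \<in> S"
proof -
  have c: "continuous_map (zariski N) (subtopology (zariski X) S) \<nu>"
    using m by (simp add: morphism_def zariski_subvar)
  show S: "\<nu> x \<in> S" if "x \<in> points N" for x using c that by (auto simp: continuous_map_in_subtopology)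
  show "morphism N X \<nu>" unfolding morphism_def
  proof (intro conjI allI impI)
    show "continuous_map (zariski N) (zariski X) \<nu>" using c by (simp add: continuous_map_in_subtopology)
    fix V f assume f: "regular X V f"
    have eq: "preim N \<nu> (V \<inter> S) = preim N \<nu> V" using S by auto
    have "regular (subvar X S) (V \<inter> S) f" unfolding regular_subvar
    proof (intro conjI ballI)
      show "openin (subtopology (zariski X) S) (V \<inter> S)" using reg[OF f] by (auto simp: openin_subtopology)
      show "\<exists>W g. openin (zariski X) W \<and> x \<in> W \<and> regular X W g \<and> (\<forall>y\<in>W \<inter> (V \<inter> S). f y = g y)"
        if "x \<in> V \<inter> S" for x using f reg[OF f] that by blast
    qed
    then have "regular N (preim N \<nu> (V \<inter> S)) (f \<circ> \<nu>)" using m unfolding morphism_def by blast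
    then show "regular N (preim N \<nu> V) (f \<circ> \<nu>)" unfolding eq .
  qed
qed

lemma Cstar_coords: "{[x] | x :: complex. x \<noteq> 0} \<subseteq> {z. length z = 1}" by auto

lemma points_Cstar: "points Cstar = {[x] | x. x \<noteq> 0}"
  unfolding Cstar_def by (rule points_sub_affine[OF Cstar_coords])

lemma poly_fun_1: "f \<in> poly_fun 1 \<Longrightarrow> \<exists>F :: complex poly. \<forall>t. poly F t = f [t]"
  using poly_fun_poly[of f 1 "\<lambda>_. [:0, 1:]"] by simp

lemma openin_Cstar:
  assumes "openin (zariski Cstar) W" "[t] \<in> W" "t \<noteq> 0"
  obtains h where "poly h t \<noteq> 0" "\<And>t'. t' \<noteq> 0 \<Longrightarrow> poly h t' \<noteq> 0 \<Longrightarrow> [t'] \<in> W"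
proof -
  obtain g where g: "g \<in> poly_fun 1" "g [t] \<noteq> 0" "\<And>w. w \<in> {[x] | x. x \<noteq> 0} \<Longrightarrow> g w \<noteq> 0 \<Longrightarrow> w \<in> W"
    using assms(1,2) unfolding Cstar_def zariski_subvar openin_sub_affine[OF Cstar_coords] by blast
  obtain h where h: "\<And>t. poly h t = g [t]" using poly_fun_1[OF g(1)] by blast
  show thesis
  proof (rule that[of h])
    show "poly h t \<noteq> 0" using h g by simp
    show "[t'] \<in> W" if "t' \<noteq> 0" "poly h t' \<noteq> 0" for t' using g(3)[of "[t']"] that h by simp
  qed
qed

lemma regular_Cstar:
  assumes "regular Cstar W f" "[t] \<in> W" "t \<noteq> 0"
  obtains g h where "poly h t \<noteq> 0" "\<And>t'. [t'] \<in> W \<Longrightarrow> poly h t' \<noteq> 0 \<Longrightarrow> f [t'] = poly g t' / poly h t'"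
proof -
  obtain g' h' where gh: "g' \<in> poly_fun 1" "h' \<in> poly_fun 1" "h' [t] \<noteq> 0" "\<And>w. w \<in> W \<Longrightarrow> h' w \<noteq> 0 \<Longrightarrow> f w = g' w / h' w"
    using assms(1,2) unfolding Cstar_def regular_sub_affine[OF Cstar_coords] by blast
  obtain g where g: "\<And>t. poly g t = g' [t]" using poly_fun_1[OF gh(1)] by blast
  obtain h where h: "\<And>t. poly h t = h' [t]" using poly_fun_1[OF gh(2)] by blast
  show thesis by (rule that[of h g]) (use gh g h in auto)
qed

lemma (in chart) Cstar_local_coords:
  assumes m: "morphism Cstar X \<nu>" and t: "t \<noteq> 0" "\<nu> [t] = s u v"
  obtains f g f' g' h where "poly g t \<noteq> 0" "poly g' t \<noteq> 0" "poly h t \<noteq> 0"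
    "\<And>t'. t' \<noteq> 0 \<Longrightarrow> poly h t' \<noteq> 0 \<Longrightarrow> poly g t' \<noteq> 0 \<and> poly g' t' \<noteq> 0 \<and>
      \<nu> [t'] = s (poly f t' / poly g t') (poly f' t' / poly g' t')"
proof -
  let ?W = "preim Cstar \<nu> (D 1)"
  have reg: "regular X (D 1) (lift (\<lambda>u v. u))" "regular X (D 1) (lift (\<lambda>u v. v))"
    by (rule regular_D[of 1 1 _ "[:[:0, 1:]:]"]; simp add: lift) (rule regular_D[of 1 1 _ "[:0, 1:]"]; simp add: lift)
  have rW: "regular Cstar ?W (lift (\<lambda>u v. u) \<circ> \<nu>)" "regular Cstar ?W (lift (\<lambda>u v. v) \<circ> \<nu>)"
    using m reg unfolding morphism_def by blast+
  have "continuous_map (zariski Cstar) (zariski X) \<nu>" using m by (simp add: morphism_def)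
  then have oW: "openin (zariski Cstar) ?W" using openin_D[of 1] by (simp add: continuous_map_def)
  have tW: "[t] \<in> ?W" using t by (auto simp: points_Cstar D_1)
  obtain f g where fg: "poly g t \<noteq> 0" "\<And>t'. [t'] \<in> ?W \<Longrightarrow> poly g t' \<noteq> 0 \<Longrightarrow> (lift (\<lambda>u v. u) \<circ> \<nu>) [t'] = poly f t' / poly g t'"
    by (rule regular_Cstar[OF rW(1) tW t(1)], rule that)
  obtain f' g' where fg': "poly g' t \<noteq> 0" "\<And>t'. [t'] \<in> ?W \<Longrightarrow> poly g' t' \<noteq> 0 \<Longrightarrow> (lift (\<lambda>u v. v) \<circ> \<nu>) [t'] = poly f' t' / poly g' t'"
    by (rule regular_Cstar[OF rW(2) tW t(1)], rule that)
  obtain h where h: "poly h t \<noteq> 0" "\<And>t'. t' \<noteq> 0 \<Longrightarrow> poly h t' \<noteq> 0 \<Longrightarrow> [t'] \<in> ?W"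
    by (rule openin_Cstar[OF oW tW t(1)], rule that)
  show thesis
  proof (rule that[of g g' "h * g * g'" f f'])
    show "poly g t \<noteq> 0" "poly g' t \<noteq> 0" "poly (h * g * g') t \<noteq> 0" using fg fg' h by auto
    fix t' assume t': "t' \<noteq> 0" "poly (h * g * g') t' \<noteq> 0"
    then have n: "poly g t' \<noteq> 0" "poly g' t' \<noteq> 0" "[t'] \<in> ?W" using h(2) by auto
    then obtain u v where uv: "\<nu> [t'] = s u v" by (auto simp: D_1)
    have "u = poly f t' / poly g t'" "v = poly f' t' / poly g' t'"
      using fg(2)[OF n(3,1)] fg'(2)[OF n(3,2)] by (simp_all add: uv lift)
    then show "poly g t' \<noteq> 0 \<and> poly g' t' \<noteq> 0 \<and> \<nu> [t'] = s (poly f t' / poly g t') (poly f' t' / poly g' t')"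
      using n uv by simp
  qed
qed

lemma coprime_proportional:
  fixes f g f' g' :: "complex poly"
  assumes "coprime f g" "coprime f' g'" "f * g' = g * f'"
  obtains k where "k \<noteq> 0" "f' = [:k:] * f" "g' = [:k:] * g"
proof (cases "f = 0")
  case True
  then have g: "is_unit g" using assms(1) by simp
  then have "g \<noteq> 0" by auto
  then have f': "f' = 0" using assms(3) True by simp
  then have "is_unit g'" using assms(2) by simp
  then obtain c c' where "g = [:c:]" "c \<noteq> 0" "g' = [:c':]" "c' \<noteq> 0"
    using g by (auto simp: is_unit_poly_iff dvd_field_iff)
  then show thesis using that[of "c' / c"] True f' by simp
next
  case False
  have "f dvd f' * g" using assms(3) by (metis dvd_triv_left mult.commute)
  then have 1: "f dvd f'" using coprime_dvd_mult_left_iff[OF assms(1), of f'] by simp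
  have "f' dvd f * g'" using assms(3) by (metis dvd_triv_right)
  then have 2: "f' dvd f" using coprime_dvd_mult_left_iff[OF assms(2), of f] by simp
  obtain u where u: "f' = f * u" using 1 by blast
  have "f * u dvd f * 1" using 2 u by simp
  then have "is_unit u" using False dvd_times_left_cancel_iff[of f u 1] by simp
  then obtain k where k: "u = [:k:]" "k \<noteq> 0" by (auto simp: is_unit_poly_iff dvd_field_iff)
  have "f * g' = f * ([:k:] * g)" using assms(3) unfolding u k(1) by (simp only: mult_ac)
  then have "g' = [:k:] * g" using False by (simp only: mult_cancel_left simp_thms)
  then show thesis using that[of k] k u by (simp add: mult.commute)
qed

lemma poly_eq_off_roots:
  fixes f g h :: "complex poly"
  assumes "h \<noteq> 0" "\<And>t. poly h t \<noteq> 0 \<Longrightarrow> poly f t = poly g t" shows "f = g"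
proof -
  have "poly (h * (f - g)) t = 0" for t using assms(2)[of t] by auto
  then have "h * (f - g) = 0" using poly_all_0_iff_0 by blast
  then show ?thesis using assms(1) by simp
qed

text \<open>After the power of \<open>t\<close> is split off, no root is left, and the rest is
  constant by the fundamental theorem of algebra. This turns avoidance of the divisor into the
  equation \<open>avoid\<close> of \<open>generic_curve\<close>.\<close>

lemma poly_no_roots_monom:
  fixes p :: "complex poly"
  assumes "\<And>t. t \<noteq> 0 \<Longrightarrow> poly p t \<noteq> 0"
  obtains c m where "c \<noteq> 0" "p = monom c m"
proof -
  have "p \<noteq> 0" using assms[of 1] by auto
  then obtain q where q: "p = [:-0, 1:] ^ order 0 p * q" "\<not> [:-0, 1:] dvd q" using order_decomp by blast
  have "poly q t \<noteq> 0" for t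
  proof (cases "t = 0")
    case True then show ?thesis using q(2) by (simp add: poly_eq_0_iff_dvd)
  next
    case False
    then show ?thesis using assms[OF False] arg_cong[OF q(1), of "\<lambda>p. poly p t"] by auto
  qed
  then have "constant (poly q)" using fundamental_theorem_of_algebra by blast
  then obtain c where c: "q = [:c:]" using constant_degree degree_eq_zeroE by metis
  have "c \<noteq> 0" using \<open>\<And>t. poly q t \<noteq> 0\<close>[of 0] c by simp
  moreover have "p = monom c (order 0 p)" using q(1) unfolding c by (simp add: monom_altdef)
  ultimately show thesis using that by blast
qed

context ruled
begin

text \<open>The chart around the point \<open>l = y0 = 0\<close>, the only one that
  \<open>s0\<close>, \<open>sC\<close> and \<open>sF\<close> miss.\<close>

definition sG :: "complex \<Rightarrow> complex \<Rightarrow> complex list set" where "sG u v = pt u 1 v 1"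

lemma chart_sG: "chart X sG"
proof (rule chartI[where L = "[:[:0, 1:]:]" and M = 1 and S = "[:0, 1:]" and T = 1
      and nu = "\<lambda>z. z ! 0" and du = "\<lambda>z. z ! 1" and nv = "\<lambda>z. z ! 2 * z ! 1 ^ n" and dv = "\<lambda>z. z ! 3"])
  show "sG u v = pt (ev2 [:[:0, 1:]:] u v) (ev2 1 u v) (ev2 [:0, 1:] u v) (ev2 1 u v)" for u v
    by (simp add: sG_def)
  show "pt l m y0 y1 = sG ([l, m, y0, y1] ! 0 / [l, m, y0, y1] ! 1) ([l, m, y0, y1] ! 2 * [l, m, y0, y1] ! 1 ^ n / [l, m, y0, y1] ! 3)"
    if "[l, m, y0, y1] ! 1 \<noteq> 0" "[l, m, y0, y1] ! 3 \<noteq> 0" for l m y0 y1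
    unfolding sG_def pt_eq by (rule exI[of _ "1 / m"], rule exI[of _ "m ^ n / y1"]) (use that in \<open>simp add: power_divide\<close>)
  show "[l, m, y0, y1] ! 1 \<noteq> 0 \<and> [l, m, y0, y1] ! 3 \<noteq> 0 \<and>
    [l, m, y0, y1] ! 0 / [l, m, y0, y1] ! 1 = u \<and> [l, m, y0, y1] ! 2 * [l, m, y0, y1] ! 1 ^ n / [l, m, y0, y1] ! 3 = v"
    if eq: "pt l m y0 y1 = sG u v" for l m y0 y1 u v
  proof -
    obtain c d where cd: "c \<noteq> 0" "d \<noteq> 0" "u = c * l" "1 = c * m" "v = d * y0" "1 = c ^ n * d * y1"
      using eq unfolding sG_def pt_eq by blast
    have l: "m \<noteq> 0" "y1 \<noteq> 0" using cd(4,6) by auto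
    have c: "c = 1 / m" using inverse_unique'[OF cd(4)] by simp
    have "d = m ^ n / y1" using cd(6) l unfolding c by (simp add: power_divide divide_eq_eq eq_divide_eq)
    then show ?thesis unfolding cd(3,5) using l c by simp
  qed
qed (auto simp: valid_def intro!: poly_fun.intros poly_fun_power)

lemma chart_cover:
  assumes "x \<in> points X"
  obtains u v where "x = s0 u v" | u v where "x = sC u v" | u v where "x = sF u v" | u v where "x = sG u v"
proof -
  obtain l m y0 y1 where x: "x = pt l m y0 y1" "valid l m y0 y1" using assms unfolding points_X by blast
  consider "l \<noteq> 0" "y0 \<noteq> 0" | "l \<noteq> 0" "y1 \<noteq> 0" | "m \<noteq> 0" "y0 \<noteq> 0" | "m \<noteq> 0" "y1 \<noteq> 0"
    using x(2) unfolding valid_def by blast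
  then show thesis
  proof cases
    case 1
    then have "x = s0 (m / l) (y1 / (y0 * l ^ n))" unfolding x(1) s0_def pt_eq
      by (intro exI[of _ "1 / l"] exI[of _ "1 / y0"]) (simp add: power_divide)
    then show ?thesis by (rule that(1))
  next
    case 2
    then have "x = sC (m / l) (y0 * l ^ n / y1)" unfolding x(1) sC_def pt_eq
      by (intro exI[of _ "1 / l"] exI[of _ "l ^ n / y1"]) (simp add: power_divide)
    then show ?thesis by (rule that(2))
  next
    case 3
    then have "x = sF (l / m) (y1 / (y0 * m ^ n))" unfolding x(1) sF_def pt_eq
      by (intro exI[of _ "1 / m"] exI[of _ "1 / y0"]) (simp add: power_divide)
    then show ?thesis by (rule that(3))
  next
    case 4
    then have "x = sG (l / m) (y0 * m ^ n / y1)" unfolding x(1) sG_def pt_eq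
      by (intro exI[of _ "1 / m"] exI[of _ "m ^ n / y1"]) (simp add: power_divide)
    then show ?thesis by (rule that(4))
  qed
qed

section \<open>Lifting maps from the punctured line to coprime coordinates\<close>

abbreviation "ptp L1 L2 L3 L4 t \<equiv> pt (poly L1 t) (poly L2 t) (poly L3 t) (poly L4 t)"
abbreviation "validp L1 L2 L3 L4 t \<equiv> valid (poly L1 t) (poly L2 t) (poly L3 t) (poly L4 t)"

lemma Cstar_local_lift:
  assumes m: "morphism Cstar X \<nu>" and t: "t \<noteq> 0"
  obtains L1 L2 L3 L4 h where "validp L1 L2 L3 L4 t" "poly h t \<noteq> 0"
    "\<And>t'. t' \<noteq> 0 \<Longrightarrow> poly h t' \<noteq> 0 \<Longrightarrow> \<nu> [t'] = ptp L1 L2 L3 L4 t'"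
proof -
  have "continuous_map (zariski Cstar) (zariski X) \<nu>" using m by (simp add: morphism_def)
  moreover have "[t] \<in> points Cstar" using t by (simp add: points_Cstar)
  ultimately have "\<nu> [t] \<in> points X" by (auto simp: continuous_map_def)
  then show thesis
  proof (cases rule: chart_cover)
    case (1 u v)
    interpret chart X s0 by (rule chart_s0)
    obtain f g f' g' h where c: "poly g t \<noteq> 0" "poly g' t \<noteq> 0" "poly h t \<noteq> 0"
      "\<And>t'. t' \<noteq> 0 \<Longrightarrow> poly h t' \<noteq> 0 \<Longrightarrow> poly g t' \<noteq> 0 \<and> poly g' t' \<noteq> 0 \<and>
        \<nu> [t'] = s0 (poly f t' / poly g t') (poly f' t' / poly g' t')"
      using Cstar_local_coords[OF m t 1] by metis
    show ?thesis
    proof (rule that[of g f g' "g ^ n * f'" h])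
      show "validp g f g' (g ^ n * f') t" "poly h t \<noteq> 0" using c by (auto simp: valid_def)
      fix t' assume t': "t' \<noteq> 0" "poly h t' \<noteq> 0"
      note n = c(4)[OF t']
      show "\<nu> [t'] = ptp g f g' (g ^ n * f') t'"
        unfolding n[THEN conjunct2, THEN conjunct2] s0_def pt_eq using n
        by (intro exI[of _ "poly g t'"] exI[of _ "poly g' t'"]) simp
    qed
  next
    case (2 u v)
    interpret chart X sC by (rule chart_sC)
    obtain f g f' g' h where c: "poly g t \<noteq> 0" "poly g' t \<noteq> 0" "poly h t \<noteq> 0"
      "\<And>t'. t' \<noteq> 0 \<Longrightarrow> poly h t' \<noteq> 0 \<Longrightarrow> poly g t' \<noteq> 0 \<and> poly g' t' \<noteq> 0 \<and>
        \<nu> [t'] = sC (poly f t' / poly g t') (poly f' t' / poly g' t')"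
      using Cstar_local_coords[OF m t 2] by metis
    show ?thesis
    proof (rule that[of g f f' "g ^ n * g'" h])
      show "validp g f f' (g ^ n * g') t" "poly h t \<noteq> 0" using c by (auto simp: valid_def)
      fix t' assume t': "t' \<noteq> 0" "poly h t' \<noteq> 0"
      note n = c(4)[OF t']
      show "\<nu> [t'] = ptp g f f' (g ^ n * g') t'"
        unfolding n[THEN conjunct2, THEN conjunct2] sC_def pt_eq using n
        by (intro exI[of _ "poly g t'"] exI[of _ "poly g' t'"]) simp
    qed
  next
    case (3 u v)
    interpret chart X sF by (rule chart_sF)
    obtain f g f' g' h where c: "poly g t \<noteq> 0" "poly g' t \<noteq> 0" "poly h t \<noteq> 0"
      "\<And>t'. t' \<noteq> 0 \<Longrightarrow> poly h t' \<noteq> 0 \<Longrightarrow> poly g t' \<noteq> 0 \<and> poly g' t' \<noteq> 0 \<and>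
        \<nu> [t'] = sF (poly f t' / poly g t') (poly f' t' / poly g' t')"
      using Cstar_local_coords[OF m t 3] by metis
    show ?thesis
    proof (rule that[of f g g' "g ^ n * f'" h])
      show "validp f g g' (g ^ n * f') t" "poly h t \<noteq> 0" using c by (auto simp: valid_def)
      fix t' assume t': "t' \<noteq> 0" "poly h t' \<noteq> 0"
      note n = c(4)[OF t']
      show "\<nu> [t'] = ptp f g g' (g ^ n * f') t'"
        unfolding n[THEN conjunct2, THEN conjunct2] sF_def pt_eq using n
        by (intro exI[of _ "poly g t'"] exI[of _ "poly g' t'"]) simp
    qed
  next
    case (4 u v)
    interpret chart X sG by (rule chart_sG)
    obtain f g f' g' h where c: "poly g t \<noteq> 0" "poly g' t \<noteq> 0" "poly h t \<noteq> 0"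
      "\<And>t'. t' \<noteq> 0 \<Longrightarrow> poly h t' \<noteq> 0 \<Longrightarrow> poly g t' \<noteq> 0 \<and> poly g' t' \<noteq> 0 \<and>
        \<nu> [t'] = sG (poly f t' / poly g t') (poly f' t' / poly g' t')"
      using Cstar_local_coords[OF m t 4] by metis
    show ?thesis
    proof (rule that[of f g f' "g ^ n * g'" h])
      show "validp f g f' (g ^ n * g') t" "poly h t \<noteq> 0" using c by (auto simp: valid_def)
      fix t' assume t': "t' \<noteq> 0" "poly h t' \<noteq> 0"
      note n = c(4)[OF t']
      show "\<nu> [t'] = ptp f g f' (g ^ n * g') t'"
        unfolding n[THEN conjunct2, THEN conjunct2] sG_def pt_eq using n
        by (intro exI[of _ "poly g t'"] exI[of _ "poly g' t'"]) simp
    qed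
  qed
qed

lemma reduce_lift:
  assumes "validp L1 L2 L3 L4 t"
  obtains x0 x1 y0 y1 g where "coprime x0 x1" "coprime y0 y1" "poly g t \<noteq> 0"
    "\<And>t'. poly g t' \<noteq> 0 \<Longrightarrow> ptp L1 L2 L3 L4 t' = ptp x0 x1 y0 y1 t'"
proof -
  have v: "poly L1 t \<noteq> 0 \<or> poly L2 t \<noteq> 0" "poly L3 t \<noteq> 0 \<or> poly L4 t \<noteq> 0" using assms by (auto simp: valid_def)
  define e where "e = gcd L1 L2"
  have "e \<noteq> 0" using v(1) by (auto simp: e_def)
  then obtain x0 x1 where x: "L1 = x0 * e" "L2 = x1 * e" "coprime x0 x1" using gcd_coprime_exists unfolding e_def by blast
  have et: "poly e t \<noteq> 0" using v(1) x by auto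
  \<comment> \<open>Dividing the base coordinates by \<open>e\<close> also divides the last
    coordinate by \<open>e ^ n\<close>; multiplying both fibre coordinates by \<open>e ^ n\<close>
    undoes this and leaves \<open>e ^ n * L3\<close> and \<open>L4\<close>.\<close>
  define f where "f = gcd (e ^ n * L3) L4"
  have nz: "poly (e ^ n * L3) t \<noteq> 0 \<or> poly L4 t \<noteq> 0" using v(2) et by auto
  then have "f \<noteq> 0" by (auto simp: f_def)
  then obtain y0 y1 where y: "e ^ n * L3 = y0 * f" "L4 = y1 * f" "coprime y0 y1" using gcd_coprime_exists unfolding f_def by blast
  have ft: "poly f t \<noteq> 0" using nz unfolding y(1,2) by auto
  show thesis
  proof (rule that[OF x(3) y(3), of "e * f"])
    show "poly (e * f) t \<noteq> 0" using et ft by simp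
    fix t' assume "poly (e * f) t' \<noteq> 0"
    then have n: "poly e t' \<noteq> 0" "poly f t' \<noteq> 0" by auto
    have y0: "poly e t' ^ n * poly L3 t' = poly y0 t' * poly f t'" using arg_cong[OF y(1), of "\<lambda>p. poly p t'"] by simp
    show "ptp L1 L2 L3 L4 t' = ptp x0 x1 y0 y1 t'" unfolding pt_eq
    proof (intro exI conjI)
      show "1 / poly e t' \<noteq> 0" "poly e t' ^ n / poly f t' \<noteq> 0" using n by auto
      show "poly x0 t' = 1 / poly e t' * poly L1 t'" "poly x1 t' = 1 / poly e t' * poly L2 t'" using n by (simp_all add: x(1,2))
      show "poly y0 t' = poly e t' ^ n / poly f t' * poly L3 t'" using y0 n by (simp add: eq_divide_eq)
      show "poly y1 t' = (1 / poly e t') ^ n * (poly e t' ^ n / poly f t') * poly L4 t'" using n by (simp add: y(2) power_divide)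
    qed
  qed
qed

text \<open>Where two lifts agree they differ by an element of the torus; coprimality makes these
  elements constant, so agreement off finitely many parameters extends to all.\<close>

lemma coprime_lift_unique:
  assumes cop: "coprime x0 x1" "coprime y0 y1" "coprime x0' x1'" "coprime y0' y1'"
    and h: "h \<noteq> 0" and eq: "\<And>t. poly h t \<noteq> 0 \<Longrightarrow> ptp x0 x1 y0 y1 t = ptp x0' x1' y0' y1' t"
  shows "ptp x0 x1 y0 y1 t = ptp x0' x1' y0' y1' t"
proof -
  have "x0 * x1' = x1 * x0'"
  proof (rule poly_eq_off_roots[OF h])
    fix t assume "poly h t \<noteq> 0"
    then obtain c where "poly x0' t = c * poly x0 t" "poly x1' t = c * poly x1 t" using eq unfolding pt_eq by blast
    then show "poly (x0 * x1') t = poly (x1 * x0') t" by simp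
  qed
  then obtain k where k: "k \<noteq> 0" "x0' = [:k:] * x0" "x1' = [:k:] * x1" using coprime_proportional cop(1,3) by blast
  have "y0 * y1' = ([:k ^ n:] * y1) * y0'"
  proof (rule poly_eq_off_roots[OF h])
    fix t assume "poly h t \<noteq> 0"
    then obtain c d where cd: "poly x0' t = c * poly x0 t" "poly x1' t = c * poly x1 t"
      "poly y0' t = d * poly y0 t" "poly y1' t = c ^ n * d * poly y1 t" using eq unfolding pt_eq by blast
    have "c = k" using coprime_poly_no_common_root[OF cop(1), of t] cd(1,2) k by auto
    then show "poly (y0 * y1') t = poly (([:k ^ n:] * y1) * y0') t" using cd(3,4) by simp
  qed
  moreover have "coprime y0 ([:k ^ n:] * y1)"
  proof -
    have "is_unit [:k ^ n:]" using k(1) by (auto simp: is_unit_poly_iff dvd_field_iff)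
    then show ?thesis using cop(2) by (simp only: coprime_mult_right_iff is_unit_right_imp_coprime simp_thms)
  qed
  ultimately obtain q where q: "q \<noteq> 0" "y0' = [:q:] * y0" "y1' = [:q:] * ([:k ^ n:] * y1)"
    using coprime_proportional cop(4) by blast
  show ?thesis unfolding pt_eq k(2,3) q(2,3) using k(1) q(1) by (intro exI[of _ k] exI[of _ q]) simp
qed

text \<open>The lift found near \<open>t = 1\<close> is global: near any other parameter there is a
  coprime lift too, and \<open>coprime_lift_unique\<close> identifies the two.\<close>

lemma Cstar_lift:
  assumes m: "morphism Cstar X \<nu>"
  obtains x0 x1 y0 y1 where "coprime x0 x1" "coprime y0 y1" "\<And>t. t \<noteq> 0 \<Longrightarrow> \<nu> [t] = ptp x0 x1 y0 y1 t"
proof -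
  have loc: "\<exists>x0 x1 y0 y1 h. coprime x0 x1 \<and> coprime y0 y1 \<and> poly h t \<noteq> 0 \<and>
      (\<forall>t'. t' \<noteq> 0 \<longrightarrow> poly h t' \<noteq> 0 \<longrightarrow> \<nu> [t'] = ptp x0 x1 y0 y1 t')" if t: "t \<noteq> 0" for t
  proof -
    obtain L1 L2 L3 L4 h where L: "validp L1 L2 L3 L4 t" "poly h t \<noteq> 0"
      "\<And>t'. t' \<noteq> 0 \<Longrightarrow> poly h t' \<noteq> 0 \<Longrightarrow> \<nu> [t'] = ptp L1 L2 L3 L4 t'"
      using Cstar_local_lift[OF m t] by metis
    obtain x0 x1 y0 y1 g where x: "coprime x0 x1" "coprime y0 y1" "poly g t \<noteq> 0"
      "\<And>t'. poly g t' \<noteq> 0 \<Longrightarrow> ptp L1 L2 L3 L4 t' = ptp x0 x1 y0 y1 t'"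
      using reduce_lift[OF L(1)] by metis
    have "\<nu> [t'] = ptp x0 x1 y0 y1 t'" if "t' \<noteq> 0" "poly (h * g) t' \<noteq> 0" for t'
      using L(3)[of t'] x(4)[of t'] that by simp
    moreover have "poly (h * g) t \<noteq> 0" using L(2) x(3) by simp
    ultimately show ?thesis using x(1,2) by blast
  qed
  obtain x0 x1 y0 y1 h where x: "coprime x0 x1" "coprime y0 y1" "poly h 1 \<noteq> 0"
    "\<And>t'. t' \<noteq> 0 \<Longrightarrow> poly h t' \<noteq> 0 \<Longrightarrow> \<nu> [t'] = ptp x0 x1 y0 y1 t'"
    using loc[of 1] by auto
  show thesis
  proof (rule that[OF x(1,2)])
    fix t :: complex assume t: "t \<noteq> 0"
    obtain x0' x1' y0' y1' h' where x': "coprime x0' x1'" "coprime y0' y1'" "poly h' t \<noteq> 0"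
      "\<And>t'. t' \<noteq> 0 \<Longrightarrow> poly h' t' \<noteq> 0 \<Longrightarrow> \<nu> [t'] = ptp x0' x1' y0' y1' t'"
      using loc[OF t] by auto
    have "ptp x0 x1 y0 y1 t = ptp x0' x1' y0' y1' t"
    proof (rule coprime_lift_unique[OF x(1,2) x'(1,2)])
      show "[:0, 1:] * h * h' \<noteq> 0" using x(3) x'(3) by auto
      show "ptp x0 x1 y0 y1 t' = ptp x0' x1' y0' y1' t'" if "poly ([:0, 1:] * h * h') t' \<noteq> 0" for t'
        using x(4)[of t'] x'(4)[of t'] that by simp
    qed
    then show "\<nu> [t] = ptp x0 x1 y0 y1 t" using x'(3,4) t by simp
  qed
qed

end

context ruled_system
begin

theorem no_Cstar:
  assumes k: "supported k" "k 0 0 \<noteq> 0" and gen: "generic_in normalized (\<lambda>i j. k i j / k 0 0)"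
    and m: "morphism Cstar X \<nu>" and avoid: "\<And>t. t \<noteq> 0 \<Longrightarrow> \<nu> [t] \<notin> div_support (Ek k)"
    and nonconst: "t1 \<noteq> 0" "t2 \<noteq> 0" "\<nu> [t1] \<noteq> \<nu> [t2]"
  shows False
proof -
  define r where "r = (\<lambda>i j. k i j / k 0 0)"
  obtain x0 x1 y0 y1 where x: "coprime x0 x1" "coprime y0 y1" "\<And>t. t \<noteq> 0 \<Longrightarrow> \<nu> [t] = ptp x0 x1 y0 y1 t"
    using Cstar_lift[OF m] by metis
  have val: "validp x0 x1 y0 y1 t" for t
    unfolding valid_def using coprime_poly_no_common_root x(1,2) by blast
  let ?p = "Pev (\<lambda>i j. [:r i j:]) x0 x1 y0 y1"
  have "poly ?p t \<noteq> 0" if t: "t \<noteq> 0" for t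
  proof
    assume "poly ?p t = 0"
    then have "Pev (\<lambda>i j. k i j / k 0 0) (poly x0 t) (poly x1 t) (poly y0 t) (poly y1 t) = 0"
      unfolding poly_Pev r_def .
    from generic_zero_in_support[OF k gen val this] show False using avoid[OF t] x(3)[OF t] by simp
  qed
  then obtain c m0 where c: "c \<noteq> 0" "?p = monom c m0" by (rule poly_no_roots_monom)
  have x01: "x0 \<noteq> 0 \<or> x1 \<noteq> 0" "y0 \<noteq> 0 \<or> y1 \<noteq> 0" using x(1,2) by auto
  define d where "d = int (max (degree x0) (degree x1))"
  have dx: "degb x0 d" "degb x1 d" unfolding d_def by (rule degb_mono[OF degb_degree], simp)+
  have lx: "lcoef x0 d \<noteq> 0 \<or> lcoef x1 d \<noteq> 0"
  proof (cases "degree x0 \<ge> degree x1")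
    case True
    show ?thesis
    proof (cases "x0 = 0")
      case True2: True
      then have "degree x1 = 0" using True by simp
      then have "lcoef x1 d = lead_coeff x1" using True2 by (simp add: lcoef_def d_def)
      then show ?thesis using x01(1) True2 by simp
    next
      case False
      have "lcoef x0 d = lead_coeff x0" using True by (simp add: lcoef_def d_def)
      then show ?thesis using False by simp
    qed
  next
    case False
    then have "lcoef x1 d = lead_coeff x1" "x1 \<noteq> 0" by (auto simp: lcoef_def d_def)
    then show ?thesis by simp
  qed
  \<comment> \<open>The least \<open>e\<close> that satisfies both degree bounds, that is the
    maximum of \<open>degree y0\<close> and \<open>degree y1 - n * d\<close> over the nonzero
    coordinates; it may be negative.\<close>
  have "\<exists>e. degb y0 e \<and> degb y1 (e + int n * d) \<and> (lcoef y0 e \<noteq> 0 \<or> lcoef y1 (e + int n * d) \<noteq> 0)"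
  proof -
    have lead: "lcoef f (int (degree f)) \<noteq> 0" if "f \<noteq> 0" for f :: "complex poly" using that by (simp add: lcoef_def)
    consider "y0 \<noteq> 0" "y1 = 0 \<or> int (degree y1) \<le> int (degree y0) + int n * d"
      | "y1 \<noteq> 0" "y0 = 0 \<or> int (degree y0) \<le> int (degree y1) - int n * d" using x01(2) by linarith
    then show ?thesis
    proof cases
      case 1
      then have "degb y1 (int (degree y0) + int n * d)" using degb_mono[OF degb_degree] by (elim disjE) auto
      then show ?thesis using lead[OF 1(1)] degb_degree by blast
    next
      case 2
      then have "degb y0 (int (degree y1) - int n * d)" using degb_mono[OF degb_degree] by (elim disjE) auto
      then show ?thesis using lead[OF 2(1)] degb_degree[of y1]
        by (intro exI[of _ "int (degree y1) - int n * d"]) simp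
    qed
  qed
  then obtain e where e: "degb y0 e" "degb y1 (e + int n * d)" "lcoef y0 e \<noteq> 0 \<or> lcoef y1 (e + int n * d) \<noteq> 0" by blast
  have "d > 0 \<or> (d = 0 \<and> e > 0)"
  proof (rule ccontr)
    assume n: "\<not> ?thesis"
    then have d: "d = 0" by (auto simp: d_def)
    then have "degree x0 = 0" "degree x1 = 0" by (auto simp: d_def)
    moreover have "e \<le> 0" using n d by simp
    then have "degb y0 0" "degb y1 0" using e(1,2) d degb_mono[of y0 e 0] degb_mono[of y1 e 0] by auto
    then have "degree y0 = 0" "degree y1 = 0" by (cases "y0 = 0"; cases "y1 = 0"; simp add: degb_iff_degree)+
    ultimately have "poly x0 t1 = poly x0 t2" "poly x1 t1 = poly x1 t2" "poly y0 t1 = poly y0 t2" "poly y1 t1 = poly y1 t2"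
      by (auto elim!: degree_eq_zeroE)
    then show False using nonconst x(3) by simp
  qed
  then have "generic_curve_axioms n a b r x0 x1 y0 y1 c m0 d e"
    using gen dx lx x c e unfolding generic_curve_axioms_def r_def by blast
  then interpret generic_curve n a b r x0 x1 y0 y1 c m0 d e
    using bidegree_axioms by (intro generic_curve.intro)
  show False by (rule contradiction)
qed

end

section \<open>Regular functions on Weierstrass curves\<close>

lemma subvar_restrict: "subvar X S = subvar X (points X \<inter> S)"
  unfolding subvar_def by (simp only: subtopology_restrict[of "zariski X"])

definition proj_coords :: "nat \<Rightarrow> complex list set" where
  "proj_coords m = {z. length z = Suc m \<and> (\<exists>i\<le>m. z ! i \<noteq> 0)}"

lemma proj_space_alt: "proj_space m = quotient_by (subvar (affine_space (Suc m)) (proj_coords m)) proj_point"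
proof -
  have "points (affine_space (Suc m)) \<inter> {z. \<exists>i\<le>m. z ! i \<noteq> 0} = proj_coords m"
    by (auto simp: points_affine_space proj_coords_def)
  then show ?thesis unfolding proj_space_def by (subst subvar_restrict) simp
qed

lemma proj_coords_length: "proj_coords m \<subseteq> {z. length z = Suc m}" by (auto simp: proj_coords_def)

lemma proj_coords_2: "[x, y, z] \<in> proj_coords 2 \<longleftrightarrow> [x, y, z] \<noteq> [0, 0, 0]"
proof -
  have "(\<exists>i\<le>2. [x, y, z] ! i \<noteq> 0) \<longleftrightarrow> x \<noteq> 0 \<or> y \<noteq> 0 \<or> z \<noteq> 0"
  proof
    assume "\<exists>i\<le>2. [x, y, z] ! i \<noteq> 0"
    then obtain i where i: "i \<le> 2" "[x, y, z] ! i \<noteq> 0" by blast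
    then consider "i = 0" | "i = 1" | "i = 2" by linarith
    then show "x \<noteq> 0 \<or> y \<noteq> 0 \<or> z \<noteq> 0" using i(2) by cases auto
  next
    assume "x \<noteq> 0 \<or> y \<noteq> 0 \<or> z \<noteq> 0"
    then show "\<exists>i\<le>2. [x, y, z] ! i \<noteq> 0"
      by (elim disjE) (rule exI[of _ 0], simp, rule exI[of _ 1], simp, rule exI[of _ 2], simp)
  qed
  then show ?thesis by (simp add: proj_coords_def)
qed

lemma proj_point_self: "z \<in> proj_point z"
  unfolding proj_point_def by (intro CollectI exI[of _ 1]) (simp add: map_idI)

lemma proj_point_scale: "c \<noteq> 0 \<Longrightarrow> proj_point [c * x, c * y, c * z] = proj_point [x, y, z]"
proof (intro set_eqI iffI)
  fix w assume c: "c \<noteq> 0" and "w \<in> proj_point [c * x, c * y, c * z]"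
  then obtain d where "d \<noteq> 0" "w = [d * (c * x), d * (c * y), d * (c * z)]" by (auto simp: proj_point_def)
  then show "w \<in> proj_point [x, y, z]" unfolding proj_point_def using c by (intro CollectI exI[of _ "d * c"]) (simp add: mult_ac)
next
  fix w assume c: "c \<noteq> 0" and "w \<in> proj_point [x, y, z]"
  then obtain d where "d \<noteq> 0" "w = [d * x, d * y, d * z]" by (auto simp: proj_point_def)
  then show "w \<in> proj_point [c * x, c * y, c * z]" unfolding proj_point_def using c
    by (intro CollectI exI[of _ "d / c"]) simp
qed

lemma poly_fun_continuous:
  assumes "f \<in> poly_fun 3"
  shows "continuous_on UNIV (\<lambda>(x, y, z). f [x, y, z])"
  using assms
proof induction
  case (coord i)
  then consider "i = 0" | "i = 1" | "i = 2" by linarith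
  then show ?case by cases (auto simp: case_prod_unfold intro!: continuous_intros)
qed (auto simp: case_prod_unfold intro!: continuous_intros)

text \<open>In lowest terms a bounded fraction has no poles, since a root of the denominator would
  also be one of the numerator; and a nonconstant polynomial attains values beyond any
  bound.\<close>

lemma bounded_ratio_const:
  fixes f h :: "complex poly"
  assumes h: "h \<noteq> 0" and b: "\<And>x. poly h x \<noteq> 0 \<Longrightarrow> norm (poly f x) \<le> M * norm (poly h x)"
  obtains c where "f = [:c:] * h"
proof -
  have "gcd f h \<noteq> 0" using h by simp
  then obtain f' h' where fh: "f = f' * gcd f h" "h = h' * gcd f h" "coprime f' h'" using gcd_coprime_exists by blast
  have h': "h' \<noteq> 0" using fh(2) h by auto
  \<comment> \<open>By continuity the inequality survives cancellation of the gcd, also at the roots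
    of \<open>h\<close>.\<close>
  have le: "norm (poly f' x) \<le> M * norm (poly h' x)" for x
  proof -
    let ?S = "{x. norm (poly f' x) \<le> M * norm (poly h' x)}"
    have "closed ?S" by (intro closed_Collect_le continuous_intros)
    have "- {x. poly h x = 0} \<subseteq> ?S"
    proof
      fix x assume "x \<in> - {x. poly h x = 0}"
      then have x: "poly h x \<noteq> 0" by simp
      then have g: "poly (gcd f h) x \<noteq> 0" by (subst (asm) fh(2)) simp
      have "norm (poly f' x) * norm (poly (gcd f h) x) \<le> M * norm (poly h' x) * norm (poly (gcd f h) x)"
        using b[OF x] arg_cong[OF fh(1), of "\<lambda>p. poly p x"] arg_cong[OF fh(2), of "\<lambda>p. poly p x"] by (simp add: norm_mult)
      then show "x \<in> ?S" using g by simp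
    qed
    then have "closure (- {x. poly h x = 0}) \<subseteq> ?S" using \<open>closed ?S\<close> by (rule closure_minimal)
    moreover have "interior {x. poly h x = 0} = {}" using poly_roots_finite[OF h]
      by (metis interior_subset finite_subset open_interior finite_imp_not_open)
    ultimately show ?thesis by (auto simp: closure_complement)
  qed
  have "constant (poly h')"
  proof (rule ccontr)
    assume "\<not> constant (poly h')"
    then obtain x where "poly h' x = 0" using fundamental_theorem_of_algebra by blast
    then show False using le[of x] coprime_poly_no_common_root[OF fh(3), of x] by simp
  qed
  then obtain k where k: "h' = [:k:]" using constant_degree degree_eq_zeroE by metis
  then have k0: "k \<noteq> 0" using h' by auto
  have "constant (poly f')"
  proof (rule ccontr)
    assume "\<not> constant (poly f')"
    let ?w = "of_real (\<bar>M\<bar> * norm k + 1) :: complex"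
    have "\<not> constant (poly (f' - [:?w:]))" using \<open>\<not> constant (poly f')\<close> by (auto simp: constant_def)
    then obtain x where "poly (f' - [:?w:]) x = 0" using fundamental_theorem_of_algebra by blast
    then have fx: "poly f' x = ?w" by simp
    have "norm ?w = \<bar>M\<bar> * norm k + 1" by (simp only: norm_of_real) (simp add: add_nonneg_nonneg)
    moreover have "M * norm k \<le> \<bar>M\<bar> * norm k" by (simp add: mult_right_mono)
    ultimately show False using le[of x] k fx by simp
  qed
  then obtain l where l: "f' = [:l:]" using constant_degree degree_eq_zeroE by metis
  have g: "f = [:l:] * gcd f h" "h = [:k:] * gcd f h" using fh(1,2) unfolding k l .
  have "[:l / k:] * h = [:l / k:] * ([:k:] * gcd f h)" using arg_cong[OF g(2)] .
  also have "\<dots> = [:l:] * gcd f h" using k0 by simp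
  also have "\<dots> = f" using g(1) by simp
  finally have "f = [:l / k:] * h" by simp
  then show thesis using that by blast
qed

text \<open>The two sides would have degrees of different parity; in other words, \<open>y\<close>
  is not a rational function of \<open>x\<close>.\<close>

lemma cubic_parity:
  fixes f g :: "complex poly"
  assumes "f ^ 2 = g ^ 2 * [:B, A, 0, 1:]" shows "f = 0" "g = 0"
proof -
  show g: "g = 0"
  proof (rule ccontr)
    assume g: "g \<noteq> 0"
    have q0: "[:B, A, 0, 1:] \<noteq> 0" by simp
    have g2: "g ^ 2 \<noteq> 0" using g by simp
    have "degree (g ^ 2 * [:B, A, 0, 1:]) = 2 * degree g + 3" unfolding degree_mult_eq[OF g2 q0] degree_power_eq[OF g] by simp
    moreover have "f \<noteq> 0" using assms g2 q0 by (metis mult_eq_0_iff power_zero_numeral)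
    then have "degree (f ^ 2) = 2 * degree f" by (simp add: degree_power_eq)
    ultimately show False using assms by (metis even_add even_mult_iff even_numeral odd_numeral)
  qed
  then show "f = 0" using assms by simp
qed

lemma tendsto_zero_square:
  fixes g :: "nat \<Rightarrow> complex"
  assumes "(\<lambda>k. g k ^ 2) \<longlonglongrightarrow> 0" shows "g \<longlonglongrightarrow> 0"
proof -
  have "(\<lambda>k. norm (g k) ^ 2) \<longlonglongrightarrow> 0" using tendsto_norm_zero[OF assms] by (simp add: norm_power)
  then have "(\<lambda>k. norm (g k)) \<longlonglongrightarrow> 0" by simp
  then show ?thesis by (rule tendsto_norm_zero_cancel)
qed

locale weierstrass =
  fixes A B :: complex
begin

definition cubic :: "complex poly" where "cubic = [:B, A, 0, 1:]"

definition on_cone :: "complex \<Rightarrow> complex \<Rightarrow> complex \<Rightarrow> bool" where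
  "on_cone x y z \<longleftrightarrow> [x, y, z] \<noteq> [0, 0, 0] \<and> y^2 * z = x^3 + A * x * z^2 + B * z^3"

abbreviation "E \<equiv> weierstrass_curve A B"

lemma poly_cubic: "poly cubic x = B + A * x + x ^ 3"
  by (simp add: cubic_def power3_eq_cube algebra_simps)

lemma on_cone_affine: "on_cone x y 1 \<longleftrightarrow> y ^ 2 = poly cubic x"
  by (auto simp: on_cone_def poly_cubic algebra_simps)

lemma on_cone_scale: "c \<noteq> 0 \<Longrightarrow> on_cone x y z \<Longrightarrow> on_cone (c * x) (c * y) (c * z)"
proof -
  assume c: "c \<noteq> 0" and o: "on_cone x y z"
  then have "y^2 * z = x^3 + A * x * z^2 + B * z^3" by (simp add: on_cone_def)
  then have "(c * y)^2 * (c * z) = (c * x)^3 + A * (c * x) * (c * z)^2 + B * (c * z)^3" by algebra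
  then show ?thesis using c o by (auto simp: on_cone_def)
qed

lemma points_E: "points E = {proj_point [x, y, z] | x y z. on_cone x y z}"
proof -
  have "proj_point [x, y, z] \<in> points (proj_space 2)" if "on_cone x y z" for x y z
    unfolding proj_space_alt points_quotient_by points_sub_affine[OF proj_coords_length]
    using that proj_coords_2 by (auto simp: on_cone_def)
  then show ?thesis unfolding weierstrass_curve_def zariski_subvar by (auto simp: on_cone_def)
qed

lemma regular_E:
  assumes f: "regular E (points E) f" and p: "on_cone x y z"
  obtains g h where "g \<in> poly_fun 3" "h \<in> poly_fun 3" "h [x, y, z] \<noteq> 0"
    "\<And>x' y' z'. on_cone x' y' z' \<Longrightarrow> h [x', y', z'] \<noteq> 0 \<Longrightarrow> f (proj_point [x', y', z']) = g [x', y', z'] / h [x', y', z']"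
proof -
  have pt: "proj_point [x, y, z] \<in> points E" using p points_E by blast
  obtain W g0 where W: "openin (zariski (proj_space 2)) W" "proj_point [x, y, z] \<in> W" "regular (proj_space 2) W g0"
    "\<forall>y\<in>W \<inter> points E. f y = g0 y"
    using f pt unfolding weierstrass_curve_def regular_subvar by blast
  have c: "[x, y, z] \<in> proj_coords 2" using p proj_coords_2 by (simp add: on_cone_def)
  have S: "Suc 2 = 3" by simp
  note O1 = iffD1[OF openin_quotient_affine[OF proj_coords_length[of 2], of proj_point, folded proj_space_alt] W(1), unfolded S]
  note O2 = iffD1[OF regular_quotient_affine[OF proj_coords_length[of 2], of proj_point, folded proj_space_alt] W(3), unfolded S]
  obtain k where k: "k \<in> poly_fun 3" "k [x, y, z] \<noteq> 0" "\<And>w. w \<in> proj_coords 2 \<Longrightarrow> k w \<noteq> 0 \<Longrightarrow> proj_point w \<in> W"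
    using mp[OF bspec[OF conjunct2[OF O1] c] W(2)] by blast
  obtain g h where gh: "g \<in> poly_fun 3" "h \<in> poly_fun 3" "h [x, y, z] \<noteq> 0"
    "\<And>w. w \<in> proj_coords 2 \<Longrightarrow> proj_point w \<in> W \<Longrightarrow> h w \<noteq> 0 \<Longrightarrow> g0 (proj_point w) = g w / h w"
    using mp[OF bspec[OF conjunct2[OF O2] c] W(2)] by blast
  show thesis
  proof (rule that[of "\<lambda>w. g w * k w" "\<lambda>w. h w * k w"])
    show "h [x, y, z] * k [x, y, z] \<noteq> 0" using gh k by simp
    fix x' y' z' assume o: "on_cone x' y' z'" "h [x', y', z'] * k [x', y', z'] \<noteq> 0"
    then have c': "[x', y', z'] \<in> proj_coords 2" using proj_coords_2 by (simp add: on_cone_def)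
    then have "proj_point [x', y', z'] \<in> W" using k(3) o(2) by auto
    moreover have "proj_point [x', y', z'] \<in> points E" using o(1) points_E by blast
    ultimately show "f (proj_point [x', y', z']) = g [x', y', z'] * k [x', y', z'] / (h [x', y', z'] * k [x', y', z'])"
      using W(4) gh(4)[OF c'] o(2) by auto
  qed (intro poly_fun.intros gh k)+
qed

text \<open>Reducing \<open>y ^ 2\<close> by the equation of the curve makes every polynomial
  function linear in \<open>y\<close>.\<close>

lemma poly_fun_curve:
  assumes "g \<in> poly_fun 3"
  shows "\<exists>\<alpha> \<beta>. \<forall>x y. y ^ 2 = poly cubic x \<longrightarrow> g [x, y, 1] = poly \<alpha> x + poly \<beta> x * y"
  using assms
proof induction
  case (const c) then show ?case by (rule exI[of _ "[:c:]"], rule exI[of _ 0]) simp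
next
  case (coord i)
  then consider "i = 0" | "i = 1" | "i = 2" by linarith
  then show ?case
  proof cases
    case 1 show ?thesis unfolding 1 by (rule exI[of _ "[:0, 1:]"], rule exI[of _ 0]) simp
  next
    case 2 show ?thesis unfolding 2 by (rule exI[of _ 0], rule exI[of _ 1]) simp
  next
    case 3 show ?thesis unfolding 3 by (rule exI[of _ 1], rule exI[of _ 0]) simp
  qed
next
  case (add f g)
  then obtain a1 b1 a2 b2 where ab:
    "\<And>x y. y ^ 2 = poly cubic x \<Longrightarrow> f [x, y, 1] = poly a1 x + poly b1 x * y"
    "\<And>x y. y ^ 2 = poly cubic x \<Longrightarrow> g [x, y, 1] = poly a2 x + poly b2 x * y" by blast
  show ?case by (rule exI[of _ "a1 + a2"], rule exI[of _ "b1 + b2"]) (simp add: ab algebra_simps)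
next
  case (mult f g)
  then obtain a1 b1 a2 b2 where ab:
    "\<And>x y. y ^ 2 = poly cubic x \<Longrightarrow> f [x, y, 1] = poly a1 x + poly b1 x * y"
    "\<And>x y. y ^ 2 = poly cubic x \<Longrightarrow> g [x, y, 1] = poly a2 x + poly b2 x * y" by blast
  show ?case
  proof (rule exI[of _ "a1 * a2 + b1 * b2 * cubic"], rule exI[of _ "a1 * b2 + b1 * a2"], intro allI impI)
    fix x y assume y: "y ^ 2 = poly cubic x"
    show "f [x, y, 1] * g [x, y, 1] = poly (a1 * a2 + b1 * b2 * cubic) x + poly (a1 * b2 + b1 * a2) x * y"
      unfolding ab[OF y] by (simp add: y[symmetric] power2_eq_square algebra_simps)
  qed
qed

lemma sqrt_ex: "\<exists>y :: complex. y ^ 2 = c"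
proof -
  have "\<not> constant (poly [:-c, 0, 1:])" by (simp add: constant_degree)
  then obtain y where "poly [:-c, 0, 1:] y = 0" using fundamental_theorem_of_algebra by blast
  then show ?thesis by (auto simp: power2_eq_square)
qed

context
  fixes f :: "complex list set \<Rightarrow> complex"
  assumes f: "regular E (points E) f"
begin

text \<open>The function pulled back to the cone over the curve, where the metric topology of
  complex triples provides continuity and compactness.\<close>

definition F :: "complex \<times> complex \<times> complex \<Rightarrow> complex" where
  "F = (\<lambda>(x, y, z). f (proj_point [x, y, z]))"

definition cone :: "(complex \<times> complex \<times> complex) set" where "cone = {(x, y, z). on_cone x y z}"

lemma F_continuous: "continuous_on cone F"
  unfolding continuous_on_def
proof
  fix p assume p: "p \<in> cone"
  obtain x y z where xyz: "p = (x, y, z)" by (cases p)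
  then have o: "on_cone x y z" using p by (simp add: cone_def)
  obtain g h where gh: "g \<in> poly_fun 3" "h \<in> poly_fun 3" "h [x, y, z] \<noteq> 0"
    "\<And>x' y' z'. on_cone x' y' z' \<Longrightarrow> h [x', y', z'] \<noteq> 0 \<Longrightarrow> f (proj_point [x', y', z']) = g [x', y', z'] / h [x', y', z']"
    by (rule regular_E[OF f o], rule that)
  let ?g = "\<lambda>(x, y, z). g [x, y, z]" and ?h = "\<lambda>(x, y, z). h [x, y, z]"
  have ct: "(?g \<longlongrightarrow> ?g p) (at p within cone)" "(?h \<longlongrightarrow> ?h p) (at p within cone)"
    using poly_fun_continuous[OF gh(1)] poly_fun_continuous[OF gh(2)]
    unfolding continuous_on_def by (blast intro: tendsto_within_subset)+
  have hp: "?h p \<noteq> 0" using gh(3) xyz by simp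
  have lim: "((\<lambda>q. ?g q / ?h q) \<longlongrightarrow> ?g p / ?h p) (at p within cone)" by (rule tendsto_divide[OF ct hp])
  have ev: "\<forall>\<^sub>F q in at p within cone. ?h q \<noteq> 0" using ct(2) hp by (rule tendsto_imp_eventually_ne)
  have "\<forall>\<^sub>F q in at p within cone. q \<in> cone" by (simp add: eventually_at_filter)
  with ev have "\<forall>\<^sub>F q in at p within cone. ?g q / ?h q = F q"
  proof eventually_elim
    case (elim q)
    then show ?case using gh(4) by (auto simp: cone_def F_def split: prod.splits)
  qed
  moreover have "F p = ?g p / ?h p" using gh(4)[OF o gh(3)] xyz by (simp add: F_def)
  ultimately show "(F \<longlongrightarrow> F p) (at p within cone)" using lim Lim_transform_eventually by fastforce
qed

text \<open>The unit vectors of the cone form a compact set, and every point of the curve has such a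
  representative.\<close>

lemma F_bounded: obtains M where "\<And>x y z. on_cone x y z \<Longrightarrow> norm (f (proj_point [x, y, z])) \<le> M"
proof -
  define K where "K = sphere (0 :: complex \<times> complex \<times> complex) 1 \<inter> {p. (fst (snd p))^2 * snd (snd p) =
    (fst p)^3 + A * fst p * (snd (snd p))^2 + B * (snd (snd p))^3}"
  have "closed {p :: complex \<times> complex \<times> complex. (fst (snd p))^2 * snd (snd p) =
    (fst p)^3 + A * fst p * (snd (snd p))^2 + B * (snd (snd p))^3}"
    by (intro closed_Collect_eq continuous_intros)
  then have cK: "compact K" unfolding K_def by (intro compact_Int_closed compact_sphere)
  have KC: "K \<subseteq> cone"
  proof
    fix p assume p: "p \<in> K"
    obtain x y z where xyz: "p = (x, y, z)" by (cases p)
    have "[x, y, z] \<noteq> [0, 0, 0]" using p xyz by (auto simp: K_def zero_prod_def[symmetric])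
    then show "p \<in> cone" using p xyz by (simp add: K_def cone_def on_cone_def)
  qed
  have "compact (F ` K)" using compact_continuous_image[OF continuous_on_subset[OF F_continuous KC] cK] .
  then have "bounded (F ` K)" by (rule compact_imp_bounded)
  then obtain M where M: "\<And>p. p \<in> K \<Longrightarrow> norm (F p) \<le> M" unfolding bounded_iff by blast
  show thesis
  proof (rule that[of M])
    fix x y z assume o: "on_cone x y z"
    define t where "t = norm (x, y, z)"
    have "(x, y, z) \<noteq> 0" using o by (auto simp: on_cone_def zero_prod_def)
    then have t: "t > 0" by (simp add: t_def)
    let ?c = "of_real (1 / t) :: complex"
    have c: "?c \<noteq> 0" using t by simp
    have "(?c * x, ?c * y, ?c * z) = (1 / t) *\<^sub>R (x, y, z)" by (simp add: scaleR_conv_of_real)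
    then have "norm (?c * x, ?c * y, ?c * z) = 1" using t by (simp only: norm_scaleR) (simp add: t_def)
    moreover have "on_cone (?c * x) (?c * y) (?c * z)" by (rule on_cone_scale[OF c o])
    ultimately have "(?c * x, ?c * y, ?c * z) \<in> K" by (simp add: K_def on_cone_def)
    from M[OF this] show "norm (f (proj_point [x, y, z])) \<le> M" unfolding F_def by (simp only: prod.case proj_point_scale[OF c])
  qed
qed

text \<open>Multiplying by the conjugate of the denominator gives
  \<open>f = (\<alpha> + \<beta> * y) / H\<close>. The values at \<open>y\<close> and
  \<open>- y\<close> together bound \<open>\<alpha> / H\<close> and the square of
  \<open>\<beta> * y / H\<close>, both rational functions of \<open>x\<close>, hence constant;
  parity then forces \<open>\<beta> = 0\<close>.\<close>

lemma f_affine_const: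
  assumes "y0 ^ 2 = poly cubic x0"
  obtains H where "H \<noteq> 0"
    "\<And>x y. y ^ 2 = poly cubic x \<Longrightarrow> poly H x \<noteq> 0 \<Longrightarrow> f (proj_point [x, y, 1]) = f (proj_point [x0, y0, 1])"
proof -
  have o: "on_cone x0 y0 1" using assms on_cone_affine by simp
  obtain g h where gh: "g \<in> poly_fun 3" "h \<in> poly_fun 3" "h [x0, y0, 1] \<noteq> 0"
    "\<And>x' y' z'. on_cone x' y' z' \<Longrightarrow> h [x', y', z'] \<noteq> 0 \<Longrightarrow> f (proj_point [x', y', z']) = g [x', y', z'] / h [x', y', z']"
    by (rule regular_E[OF f o], rule that)
  obtain g1 g2 where g: "\<And>x y. y ^ 2 = poly cubic x \<Longrightarrow> g [x, y, 1] = poly g1 x + poly g2 x * y"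
    using poly_fun_curve[OF gh(1)] by blast
  obtain h1 h2 where h: "\<And>x y. y ^ 2 = poly cubic x \<Longrightarrow> h [x, y, 1] = poly h1 x + poly h2 x * y"
    using poly_fun_curve[OF gh(2)] by blast
  \<comment> \<open>The norm of the denominator \<open>h1 + h2 * y\<close> over the polynomials in
    \<open>x\<close>.\<close>
  define H where "H = h1 ^ 2 - h2 ^ 2 * cubic"
  have H: "H \<noteq> 0"
  proof
    assume "H = 0"
    then have "h1 ^ 2 = h2 ^ 2 * [:B, A, 0, 1:]" by (simp add: H_def cubic_def)
    then have "h1 = 0" "h2 = 0" using cubic_parity by blast+
    then show False using h[OF assms] gh(3) by simp
  qed
  define \<alpha> \<beta> where "\<alpha> = g1 * h1 - g2 * h2 * cubic" and "\<beta> = g2 * h1 - g1 * h2"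
  have f_eq: "f (proj_point [x, y, 1]) * poly H x = poly \<alpha> x + poly \<beta> x * y"
    if y: "y ^ 2 = poly cubic x" and Hx: "poly H x \<noteq> 0" for x y
  proof -
    have nh: "(poly h1 x + poly h2 x * y) * (poly h1 x - poly h2 x * y) = poly H x"
      by (simp add: H_def y[symmetric] power2_eq_square algebra_simps)
    then have "poly h1 x + poly h2 x * y \<noteq> 0" using Hx by auto
    then have "f (proj_point [x, y, 1]) * (poly h1 x + poly h2 x * y) = poly g1 x + poly g2 x * y"
      using gh(4)[of x y 1] on_cone_affine y g[OF y] h[OF y] by simp
    then have "f (proj_point [x, y, 1]) * poly H x = (poly g1 x + poly g2 x * y) * (poly h1 x - poly h2 x * y)"
      unfolding nh[symmetric] by (metis mult.assoc)
    also have "\<dots> = poly \<alpha> x + poly \<beta> x * y" by (simp add: \<alpha>_def \<beta>_def y[symmetric] power2_eq_square algebra_simps)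
    finally show ?thesis .
  qed
  obtain M where M: "\<And>x y z. on_cone x y z \<Longrightarrow> norm (f (proj_point [x, y, z])) \<le> M" using F_bounded by blast
  have bnd: "norm (poly \<alpha> x) \<le> M * norm (poly H x)" "norm (poly (\<beta> ^ 2 * cubic) x) \<le> M ^ 2 * norm (poly (H ^ 2) x)"
    if Hx: "poly H x \<noteq> 0" for x
  proof -
    obtain y where y: "y ^ 2 = poly cubic x" using sqrt_ex by blast
    then have y': "(- y) ^ 2 = poly cubic x" by simp
    let ?u = "f (proj_point [x, y, 1])" and ?w = "f (proj_point [x, - y, 1])"
    have uw: "norm ?u \<le> M" "norm ?w \<le> M" using M on_cone_affine y y' by blast+
    note e = f_eq[OF y Hx] f_eq[OF y' Hx]
    have "2 * poly \<alpha> x = (?u + ?w) * poly H x" using e by (simp add: algebra_simps)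
    then have "2 * norm (poly \<alpha> x) = norm (?u + ?w) * norm (poly H x)" by (metis norm_mult norm_numeral)
    also have "\<dots> \<le> (M + M) * norm (poly H x)" using uw by (intro mult_right_mono norm_triangle_le) auto
    finally show "norm (poly \<alpha> x) \<le> M * norm (poly H x)" by (simp add: algebra_simps)
    have "2 * (poly \<beta> x * y) = (?u - ?w) * poly H x" using e by (simp add: algebra_simps)
    then have "2 * norm (poly \<beta> x * y) = norm (?u - ?w) * norm (poly H x)" by (metis norm_mult norm_numeral)
    also have "\<dots> \<le> (M + M) * norm (poly H x)" using uw norm_triangle_ineq4[of ?u ?w] by (intro mult_right_mono) auto
    finally have "norm (poly \<beta> x * y) \<le> M * norm (poly H x)" by (simp add: algebra_simps)
    then have "norm (poly \<beta> x * y) ^ 2 \<le> (M * norm (poly H x)) ^ 2" by (intro power_mono) auto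
    moreover have "norm (poly (\<beta> ^ 2 * cubic) x) = norm (poly \<beta> x * y) ^ 2"
      by (simp add: y[symmetric] norm_mult norm_power power_mult_distrib)
    ultimately show "norm (poly (\<beta> ^ 2 * cubic) x) \<le> M ^ 2 * norm (poly (H ^ 2) x)"
      by (simp add: norm_power power_mult_distrib)
  qed
  obtain c where c: "\<alpha> = [:c:] * H" using bounded_ratio_const[OF H bnd(1)] by blast
  have "H ^ 2 \<noteq> 0" using H by simp
  moreover have "norm (poly (\<beta> ^ 2 * cubic) x) \<le> M ^ 2 * norm (poly (H ^ 2) x)" if "poly (H ^ 2) x \<noteq> 0" for x
    using bnd(2)[of x] that by simp
  ultimately obtain c' where c': "\<beta> ^ 2 * cubic = [:c':] * H ^ 2" using bounded_ratio_const by blast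
  obtain s where s: "s ^ 2 = c'" using sqrt_ex by blast
  have "([:s:] * H) ^ 2 = \<beta> ^ 2 * [:B, A, 0, 1:]" using c' s by (simp add: cubic_def power_mult_distrib power2_eq_square smult_smult flip: s)
  then have \<beta>: "\<beta> = 0" by (rule cubic_parity)
  have const: "f (proj_point [x, y, 1]) = c" if y: "y ^ 2 = poly cubic x" "poly H x \<noteq> 0" for x y
    using f_eq[OF y] y(2) by (simp add: c \<beta>)
  \<comment> \<open>at the base point itself, \<open>H\<close> may vanish, but \<open>g = c h\<close> holds on the whole curve\<close>
  have z: "(g1 - [:c:] * h1) ^ 2 = (g2 - [:c:] * h2) ^ 2 * [:B, A, 0, 1:]"
  proof (rule poly_eq_off_roots[OF H])
    fix x assume Hx: "poly H x \<noteq> 0"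
    obtain y where y: "y ^ 2 = poly cubic x" using sqrt_ex by blast
    have nh: "(poly h1 x + poly h2 x * y) * (poly h1 x - poly h2 x * y) = poly H x"
      by (simp add: H_def y[symmetric] power2_eq_square algebra_simps)
    then have "poly h1 x + poly h2 x * y \<noteq> 0" using Hx by auto
    then have "c * (poly h1 x + poly h2 x * y) = poly g1 x + poly g2 x * y"
      using gh(4)[of x y 1] on_cone_affine y g[OF y] h[OF y] const[OF y Hx] by simp
    then have "poly (g1 - [:c:] * h1) x = - poly (g2 - [:c:] * h2) x * y" by (simp add: algebra_simps)
    then have "poly (g1 - [:c:] * h1) x ^ 2 = poly (g2 - [:c:] * h2) x ^ 2 * y ^ 2"
      by (simp only: power_mult_distrib power2_minus)
    then show "poly ((g1 - [:c:] * h1) ^ 2) x = poly ((g2 - [:c:] * h2) ^ 2 * [:B, A, 0, 1:]) x"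
      by (simp only: poly_power poly_mult y cubic_def)
  qed
  have "g1 = [:c:] * h1" "g2 = [:c:] * h2" using cubic_parity[OF z] by simp_all
  then have "g [x0, y0, 1] = c * h [x0, y0, 1]" using g[OF assms] h[OF assms] by (simp add: algebra_simps)
  then have "f (proj_point [x0, y0, 1]) = c" using gh(4)[OF o gh(3)] gh(3) by simp
  then show thesis using that[OF H] const by simp
qed

lemma f_affine_const2:
  assumes "y0 ^ 2 = poly cubic x0" "y1 ^ 2 = poly cubic x1"
  shows "f (proj_point [x0, y0, 1]) = f (proj_point [x1, y1, 1])"
proof -
  obtain H where H: "H \<noteq> 0" "\<And>x y. y ^ 2 = poly cubic x \<Longrightarrow> poly H x \<noteq> 0 \<Longrightarrow> f (proj_point [x, y, 1]) = f (proj_point [x0, y0, 1])"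
    using f_affine_const[OF assms(1)] by blast
  obtain H' where H': "H' \<noteq> 0" "\<And>x y. y ^ 2 = poly cubic x \<Longrightarrow> poly H' x \<noteq> 0 \<Longrightarrow> f (proj_point [x, y, 1]) = f (proj_point [x1, y1, 1])"
    using f_affine_const[OF assms(2)] by blast
  have "H * H' \<noteq> 0" using H H' by simp
  then obtain x where "poly (H * H') x \<noteq> 0" using poly_all_0_iff_0 by blast
  moreover obtain y where "y ^ 2 = poly cubic x" using sqrt_ex by blast
  ultimately show ?thesis using H(2)[of y x] H'(2)[of y x] by simp
qed

text \<open>The affine points with \<open>x = 1, 2, ...\<close> tend to \<open>[0, 1, 0]\<close>
  after division by \<open>y\<close>, because \<open>y ^ 2\<close> grows like \<open>x ^ 3\<close>;
  continuity on the cone does the rest.\<close>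

lemma f_infinity:
  assumes "y1 ^ 2 = poly cubic x1"
  shows "f (proj_point [0, 1, 0]) = f (proj_point [x1, y1, 1])"
proof -
  define x :: "nat \<Rightarrow> complex" where "x k = of_nat (Suc k)" for k
  have "\<forall>k. \<exists>y. y ^ 2 = poly cubic (x k)" using sqrt_ex by blast
  then obtain y where y: "\<And>k. y k ^ 2 = poly cubic (x k)" by metis
  define w where "w k = inverse (x k)" for k
  have w0: "w \<longlonglongrightarrow> 0" unfolding w_def x_def by (rule LIMSEQ_Suc[OF lim_inverse_n])
  have x0: "x k \<noteq> 0" for k unfolding x_def by (simp del: of_nat_Suc)
  let ?d = "\<lambda>k. 1 + A * w k ^ 2 + B * w k ^ 3"
  have d: "?d \<longlonglongrightarrow> 1 + A * 0 ^ 2 + B * 0 ^ 3" by (intro tendsto_intros w0)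
  have q: "poly cubic (x k) = x k ^ 3 * ?d k" for k
  proof -
    have "x k * w k = 1" using x0 by (simp add: w_def)
    then show ?thesis unfolding poly_cubic by algebra
  qed
  have l1: "(\<lambda>k. w k / ?d k) \<longlonglongrightarrow> 0 / (1 + A * 0 ^ 2 + B * 0 ^ 3)" by (intro tendsto_divide w0 d) simp
  have l3: "(\<lambda>k. w k ^ 3 / ?d k) \<longlonglongrightarrow> 0 ^ 3 / (1 + A * 0 ^ 2 + B * 0 ^ 3)" by (intro tendsto_divide tendsto_power w0 d) simp
  have "(x k / y k) ^ 2 = w k / ?d k" "(1 / y k) ^ 2 = w k ^ 3 / ?d k" for k
  proof -
    have "u ^ 2 / (u ^ 3 * v) = inverse u / v" "1 / (u ^ 3 * v) = inverse u ^ 3 / v" if "u \<noteq> 0" for u v :: complex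
      using that by (simp_all add: power2_eq_square power3_eq_cube field_simps)
    from this[OF x0, of k "?d k"] show "(x k / y k) ^ 2 = w k / ?d k" "(1 / y k) ^ 2 = w k ^ 3 / ?d k"
      by (simp_all only: power_divide y q w_def power_one)
  qed
  then have sq: "(\<lambda>k. (x k / y k) ^ 2) \<longlonglongrightarrow> 0" "(\<lambda>k. (1 / y k) ^ 2) \<longlonglongrightarrow> 0" using l1 l3 by simp_all
  have lim: "(\<lambda>k. x k / y k) \<longlonglongrightarrow> 0" "(\<lambda>k. 1 / y k) \<longlonglongrightarrow> 0"
    by (rule tendsto_zero_square[OF sq(1)], rule tendsto_zero_square[OF sq(2)])
  have "\<forall>\<^sub>F k in sequentially. ?d k \<noteq> 0" using d by (rule tendsto_imp_eventually_ne) simp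
  then have ev: "\<forall>\<^sub>F k in sequentially. y k \<noteq> 0"
  proof eventually_elim
    case (elim k)
    then have "y k ^ 2 \<noteq> 0" using x0[of k] unfolding y q by simp
    then show ?case by auto
  qed
  let ?p = "\<lambda>k. (x k / y k, 1 :: complex, 1 / y k)"
  have pc: "\<forall>\<^sub>F k in sequentially. ?p k \<in> cone \<and> F (?p k) = f (proj_point [x1, y1, 1])"
    using ev
  proof eventually_elim
    case (elim k)
    have o: "on_cone (x k) (y k) 1" using y on_cone_affine by simp
    have inv: "1 / y k \<noteq> 0" using elim by simp
    have "on_cone (1 / y k * x k) (1 / y k * y k) (1 / y k * 1)" by (rule on_cone_scale[OF inv o])
    then have c: "?p k \<in> cone" using elim by (simp add: cone_def)
    have "proj_point [1 / y k * x k, 1 / y k * y k, 1 / y k * 1] = proj_point [x k, y k, 1]" by (rule proj_point_scale[OF inv])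
    then have "F (?p k) = f (proj_point [x k, y k, 1])" using elim by (simp add: F_def)
    then show ?case using c f_affine_const2[OF y assms] by simp
  qed
  have "?p \<longlonglongrightarrow> (0, 1, 0)" by (intro tendsto_Pair lim tendsto_const)
  moreover have "(0, 1, 0) \<in> cone" by (simp add: cone_def on_cone_def)
  moreover have "\<forall>\<^sub>F k in sequentially. ?p k \<in> cone" by (rule eventually_mono[OF pc]) (rule conjunct1)
  ultimately have "(\<lambda>k. F (?p k)) \<longlonglongrightarrow> F (0, 1, 0)" by (rule continuous_on_tendsto_compose[OF F_continuous])
  moreover have "(\<lambda>k. F (?p k)) \<longlonglongrightarrow> f (proj_point [x1, y1, 1])"
    by (rule tendsto_eventually) (rule eventually_mono[OF pc], rule conjunct2)
  ultimately have "F (0, 1, 0) = f (proj_point [x1, y1, 1])" by (rule LIMSEQ_unique)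
  then show ?thesis by (simp add: F_def)
qed

lemma regular_function_const:
  assumes "p \<in> points E" "q \<in> points E" shows "f p = f q"
proof -
  obtain y1 where y1: "y1 ^ 2 = poly cubic 0" using sqrt_ex by blast
  have "f p = f (proj_point [0, y1, 1])" if "p \<in> points E" for p
  proof -
    obtain x y z where p: "p = proj_point [x, y, z]" "on_cone x y z" using \<open>p \<in> points E\<close> points_E by blast
    show ?thesis
    proof (cases "z = 0")
      case True
      then have "x = 0" "y \<noteq> 0" using p(2) by (auto simp: on_cone_def)
      then have "p = proj_point [0, 1, 0]" using proj_point_scale[of y 0 1 0] p(1) True by simp
      then show ?thesis using f_infinity[OF y1] by simp
    next
      case False
      then have inv: "1 / z \<noteq> 0" by simp
      have "p = proj_point [x / z, y / z, 1]" using proj_point_scale[OF inv, of x y z] p(1) False by simp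
      moreover have "on_cone (x / z) (y / z) 1" using on_cone_scale[OF inv p(2)] False by simp
      ultimately show ?thesis using f_affine_const2[OF _ y1] on_cone_affine by blast
    qed
  qed
  then show ?thesis using assms by metis
qed

end

end

section \<open>The complement of a general curve\<close>

text \<open>The Veronese embedding of the projective line is injective: an extreme form and its
  neighbour determine the ratio.\<close>

lemma forms_proportional:
  fixes u v u' v' \<mu> \<mu>' :: complex
  assumes N: "0 < N" and nz: "u \<noteq> 0 \<or> v \<noteq> 0" "u' \<noteq> 0 \<or> v' \<noteq> 0" "\<mu> \<noteq> 0" "\<mu>' \<noteq> 0"
    and eq: "\<And>j. j \<le> N \<Longrightarrow> \<mu>' * (u' ^ (N - j) * v' ^ j) = \<mu> * (u ^ (N - j) * v ^ j)"
  obtains d where "d \<noteq> 0" "u' = d * u" "v' = d * v"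
proof -
  obtain M where M: "N = Suc M" using N gr0_implies_Suc by blast
  show thesis
  proof (cases "u = 0")
    case True
    then have v: "v \<noteq> 0" using nz by blast
    have e: "\<mu>' * v' ^ N = \<mu> * v ^ N" using eq[of N] by simp
    then have v': "v' \<noteq> 0" using v nz N by (metis mult_eq_0_iff power_eq_0_iff)
    have "\<mu>' * (u' * v' ^ M) = 0" using eq[of M] True by (simp add: M)
    then have "u' = 0" using v' nz by simp
    then show ?thesis using that[of "v' / v"] True v v' by simp
  next
    case False
    have e: "\<mu>' * u' ^ N = \<mu> * u ^ N" using eq[of 0] by simp
    then have u': "u' \<noteq> 0" using False nz N by (metis mult_eq_0_iff power_eq_0_iff)
    have "\<mu>' * (u' ^ M * v') = \<mu> * (u ^ M * v)" using eq[of 1] by (simp add: M)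
    then have "\<mu>' * u' ^ N * v' = \<mu> * (u ^ M * v) * u'" unfolding M by (simp add: mult_ac)
    then have "\<mu> * u ^ M * (u * v') = \<mu> * u ^ M * (v * u')" unfolding e unfolding M by (simp add: mult_ac)
    then have "u * v' = v * u'" using False nz by simp
    then show ?thesis using that[of "u' / u"] False u' by (simp add: field_simps)
  qed
qed

context ruled_system
begin

lemma mono_scale:
  assumes "(i, j) \<in> Idx"
  shows "mono i j (c * l) (c * m) (d * y0) (c ^ n * d * y1) = c ^ b * d ^ a * mono i j l m y0 (y1 :: complex)"
  using Pev_scale[of "single i j" c l m d y0 y1] unfolding Pev_single[OF assms] .

text \<open>A row of the trapezoid separates the points of the base; once these agree, one of the
  two sides joining the rows separates the points of the fibre.\<close>

lemma monomials_separate_points: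
  assumes v: "valid l m y0 y1" "valid l' m' y0' y1'" and s: "s \<noteq> 0"
    and eq: "\<And>i j. (i, j) \<in> Idx \<Longrightarrow> mono i j l' m' y0' y1' = s * mono i j l m y0 y1"
  shows "pt l m y0 y1 = pt l' m' y0' y1'"
proof -
  \<comment> \<open>The row \<open>j = 0\<close> or \<open>j = a\<close>, chosen so that its power
    of the fibre coordinates is nonzero at the first point; both rows have positive length.\<close>
  define J where "J = (if y0 \<noteq> 0 then 0 else a)"
  define Y Y' where "Y = y0 ^ (a - J) * y1 ^ J" and "Y' = y0' ^ (a - J) * y1' ^ J"
  have J: "J \<le> a" by (simp add: J_def)
  have "n * J \<le> n * a" using J by simp
  then have B: "0 < b - n * J" using ban mult.commute[of a n] by linarith
  have Y: "Y \<noteq> 0" using v(1) a4 by (auto simp: Y_def J_def valid_def)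
  have idx: "(i, J) \<in> Idx" if "i \<le> b - n * J" for i using that B J by (simp add: Idx_def)
  have x_eq: "Y' * (l' ^ (b - n * J - i) * m' ^ i) = s * Y * (l ^ (b - n * J - i) * m ^ i)" if "i \<le> b - n * J" for i
  proof -
    have "b - i - n * J = b - n * J - i" by simp
    then show ?thesis using eq[OF idx[OF that]] unfolding mono_def Y_def Y'_def by (simp only: mult_ac)
  qed
  have "Y' \<noteq> 0"
  proof
    assume "Y' = 0"
    then have "l ^ (b - n * J - i) * m ^ i = 0" if "i \<le> b - n * J" for i using x_eq[OF that] s Y by simp
    from this[of 0] this[of "b - n * J"] show False using v(1) B by (auto simp: valid_def)
  qed
  then obtain c where c: "c \<noteq> 0" "l' = c * l" "m' = c * m"
    using forms_proportional[OF B _ _ _ _ x_eq] v s Y unfolding valid_def by (metis mult_eq_0_iff)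
  define w where "w = y1' / c ^ n"
  have y1': "y1' = c ^ n * w" using c by (simp add: w_def)
  \<comment> \<open>A nonzero base coordinate picks the side: \<open>(0, j)\<close> for
    \<open>l\<close>, \<open>(b - n * j, j)\<close> for \<open>m\<close>.\<close>
  obtain e where e: "e \<noteq> 0" "e = l \<or> e = m" using v(1) unfolding valid_def by blast
  have y_eq: "c ^ b * (y0' ^ (a - j) * w ^ j) = s * (y0 ^ (a - j) * y1 ^ j)" if j: "j \<le> a" for j
  proof -
    have nj: "n * j \<le> b" by (rule n_mult_le[OF j])
    have "(c * e) ^ (b - n * j) * y0' ^ (a - j) * y1' ^ j = s * (e ^ (b - n * j) * y0 ^ (a - j) * y1 ^ j)"
      using e(2) eq[OF Idx_corner(1)[OF j]] eq[OF Idx_corner(2)[OF j]] nj unfolding mono_def c by auto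
    moreover have "c ^ b = c ^ (b - n * j) * (c ^ n) ^ j" using nj
      by (simp add: power_mult[symmetric] power_add[symmetric])
    ultimately have "e ^ (b - n * j) * (c ^ b * (y0' ^ (a - j) * w ^ j)) = e ^ (b - n * j) * (s * (y0 ^ (a - j) * y1 ^ j))"
      unfolding y1' power_mult_distrib by (simp only: mult_ac)
    then show ?thesis using e(1) by simp
  qed
  have "y0' \<noteq> 0 \<or> w \<noteq> 0" "y0 \<noteq> 0 \<or> y1 \<noteq> 0" using v c by (auto simp: valid_def w_def)
  moreover have "0 < a" "c ^ b \<noteq> 0" using a4 c by auto
  ultimately obtain d where d: "d \<noteq> 0" "y0' = d * y0" "w = d * y1"
    using forms_proportional[OF _ _ _ _ _ y_eq] s by metis
  have "y1' = c ^ n * d * y1" unfolding y1' d(3) by simp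
  then show ?thesis unfolding pt_eq using c d by blast
qed

lemma poly_fun_mono: "(\<lambda>z. mono i j (z ! 0) (z ! 1) (z ! 2) (z ! 3)) \<in> poly_fun 4"
  unfolding mono_def by (intro poly_fun.intros poly_fun_power) simp_all

lemma poly_fun_Pev: "(\<lambda>z. Pev k (z ! 0) (z ! 1) (z ! 2) (z ! 3)) \<in> poly_fun 4"
  unfolding Pev_def case_prod_unfold by (intro poly_fun_sum poly_fun.mult poly_fun.const poly_fun_mono)

text \<open>The complement of a curve in \<open>|aC+bF|\<close> is affine: the monomials divided by the equation of the
  curve separate its points.\<close>

definition nonvanishing :: "(nat \<Rightarrow> nat \<Rightarrow> complex) \<Rightarrow> complex list set set" where
  "nonvanishing k = {pt l m y0 y1 | l m y0 y1. valid l m y0 y1 \<and> Pev k l m y0 y1 \<noteq> 0}"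

text \<open>Numerator and denominator have the same weights under the torus, so the choice of
  coordinates does not matter.\<close>

definition ratio :: "(nat \<Rightarrow> nat \<Rightarrow> complex) \<Rightarrow> nat \<Rightarrow> nat \<Rightarrow> complex list set \<Rightarrow> complex" where
  "ratio k i j x = (SOME z. \<exists>l m y0 y1. x = pt l m y0 y1 \<and> z = mono i j l m y0 y1 / Pev k l m y0 y1)"

lemma pt_nonvanishing: "valid l m y0 y1 \<Longrightarrow> pt l m y0 y1 \<in> nonvanishing k \<longleftrightarrow> Pev k l m y0 y1 \<noteq> 0"
proof
  assume "pt l m y0 y1 \<in> nonvanishing k"
  then obtain l' m' y0' y1' where p: "pt l m y0 y1 = pt l' m' y0' y1'" "Pev k l' m' y0' y1' \<noteq> 0"
    unfolding nonvanishing_def by blast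
  obtain c d where "l' = c * l" "m' = c * m" "y0' = d * y0" "y1' = c ^ n * d * y1" using p(1) unfolding pt_eq by blast
  then show "Pev k l m y0 y1 \<noteq> 0" using p(2) Pev_scale by simp
qed (auto simp: nonvanishing_def)

lemma ratio_pt:
  assumes ij: "(i, j) \<in> Idx"
  shows "ratio k i j (pt l m y0 y1) = mono i j l m y0 y1 / Pev k l m y0 y1"
  unfolding ratio_def
proof (rule some_equality)
  fix z assume "\<exists>l' m' y0' y1'. pt l m y0 y1 = pt l' m' y0' y1' \<and> z = mono i j l' m' y0' y1' / Pev k l' m' y0' y1'"
  then obtain l' m' y0' y1' where p: "pt l m y0 y1 = pt l' m' y0' y1'" "z = mono i j l' m' y0' y1' / Pev k l' m' y0' y1'"
    by blast
  obtain c d where cd: "c \<noteq> 0" "d \<noteq> 0" "l' = c * l" "m' = c * m" "y0' = d * y0" "y1' = c ^ n * d * y1"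
    using p(1) unfolding pt_eq by blast
  show "z = mono i j l m y0 y1 / Pev k l m y0 y1" unfolding p(2) cd(3-6) mono_scale[OF ij] Pev_scale using cd(1,2) by simp
qed blast

lemma openin_nonvanishing_Pev: "openin (zariski X) (nonvanishing k)"
  unfolding openin_X
proof (intro conjI allI impI)
  show "nonvanishing k \<subseteq> points X" unfolding nonvanishing_def points_X by blast
  fix l m y0 y1 assume "valid l m y0 y1" "pt l m y0 y1 \<in> nonvanishing k"
  then have "Pev k l m y0 y1 \<noteq> 0" using pt_nonvanishing by blast
  then show "\<exists>h\<in>poly_fun 4. h [l, m, y0, y1] \<noteq> 0 \<and>
    (\<forall>l' m' y0' y1'. valid l' m' y0' y1' \<longrightarrow> h [l', m', y0', y1'] \<noteq> 0 \<longrightarrow> pt l' m' y0' y1' \<in> nonvanishing k)"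
    by (intro bexI[OF _ poly_fun_Pev[of k]]) (simp add: pt_nonvanishing)
qed

lemma regular_ratio:
  assumes ij: "(i, j) \<in> Idx" shows "regular X (nonvanishing k) (ratio k i j)"
  unfolding regular_X
proof (intro conjI allI impI openin_nonvanishing_Pev)
  fix l m y0 y1 assume "valid l m y0 y1" "pt l m y0 y1 \<in> nonvanishing k"
  then have "Pev k l m y0 y1 \<noteq> 0" using pt_nonvanishing by blast
  then show "\<exists>g\<in>poly_fun 4. \<exists>h\<in>poly_fun 4. h [l, m, y0, y1] \<noteq> 0 \<and>
    (\<forall>l' m' y0' y1'. valid l' m' y0' y1' \<longrightarrow> pt l' m' y0' y1' \<in> nonvanishing k \<longrightarrow> h [l', m', y0', y1'] \<noteq> 0 \<longrightarrow>
      ratio k i j (pt l' m' y0' y1') = g [l', m', y0', y1'] / h [l', m', y0', y1'])"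
    by (intro bexI[OF _ poly_fun_mono[of i j]] bexI[OF _ poly_fun_Pev[of k]]) (simp add: ratio_pt[OF ij])
qed

theorem no_elliptic:
  assumes k: "supported k" "k 0 0 \<noteq> 0" and gen: "generic_in normalized (\<lambda>i j. k i j / k 0 0)"
    and mor: "morphism (weierstrass_curve \<alpha> \<beta>) X \<nu>"
    and avoid: "\<And>x. x \<in> points (weierstrass_curve \<alpha> \<beta>) \<Longrightarrow> \<nu> x \<notin> div_support (Ek k)"
    and x: "x \<in> points (weierstrass_curve \<alpha> \<beta>)" "x' \<in> points (weierstrass_curve \<alpha> \<beta>)"
  shows "\<nu> x = \<nu> x'"
proof -
  interpret E: weierstrass \<alpha> \<beta> .
  define r where "r = (\<lambda>i j. k i j / k 0 0)"
  have nv: "\<exists>l m y0 y1. valid l m y0 y1 \<and> \<nu> x = pt l m y0 y1 \<and> Pev r l m y0 y1 \<noteq> 0" if x: "x \<in> points E.E" for x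
  proof -
    have "\<nu> x \<in> points X" using mor x unfolding morphism_def continuous_map_def by blast
    then obtain l m y0 y1 where p: "\<nu> x = pt l m y0 y1" "valid l m y0 y1" unfolding points_X by blast
    then show ?thesis using generic_zero_in_support[OF k gen p(2)] avoid[OF x] unfolding r_def by metis
  qed
  then have "preim E.E \<nu> (nonvanishing r) = points E.E" unfolding nonvanishing_def by blast
  then have reg: "regular E.E (points E.E) (ratio r i j \<circ> \<nu>)" if "(i, j) \<in> Idx" for i j
    using mor regular_ratio[OF that, of r] unfolding morphism_def by metis
  obtain l m y0 y1 where p: "valid l m y0 y1" "\<nu> x = pt l m y0 y1" "Pev r l m y0 y1 \<noteq> 0" using nv[OF x(1)] by blast
  obtain l' m' y0' y1' where p': "valid l' m' y0' y1'" "\<nu> x' = pt l' m' y0' y1'" "Pev r l' m' y0' y1' \<noteq> 0"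
    using nv[OF x(2)] by blast
  have "pt l m y0 y1 = pt l' m' y0' y1'"
  proof (rule monomials_separate_points[OF p(1) p'(1)])
    show "Pev r l' m' y0' y1' / Pev r l m y0 y1 \<noteq> 0" using p p' by simp
    fix i j assume ij: "(i, j) \<in> Idx"
    have "mono i j l m y0 y1 / Pev r l m y0 y1 = mono i j l' m' y0' y1' / Pev r l' m' y0' y1'"
      using E.regular_function_const[OF reg[OF ij] x] by (simp add: p(2) p'(2) ratio_pt[OF ij])
    then show "mono i j l' m' y0' y1' = Pev r l' m' y0' y1' / Pev r l m y0 y1 * mono i j l m y0 y1"
      using p(3) p'(3) by (simp add: frac_eq_eq mult.commute eq_divide_eq)
  qed
  then show ?thesis using p(2) p'(2) by simp
qed

end

text \<open>Over some nonempty open \<open>V\<close> the map is invertible. If it were constant, the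
  preimage of \<open>V\<close> would be all of \<open>N\<close>, where it would be both constant and
  injective.\<close>

lemma normalization_nonconst:
  assumes norm: "is_normalization N Y \<nu>" and x: "x \<in> points N" "x' \<in> points N" "x \<noteq> x'"
  shows "\<exists>y\<in>points N. \<exists>y'\<in>points N. \<nu> y \<noteq> \<nu> y'"
proof (rule ccontr)
  assume "\<not> ?thesis"
  then have const: "\<nu> y = \<nu> y'" if "y \<in> points N" "y' \<in> points N" for y y' using that by blast
  obtain V where V: "openin (zariski Y) V" "V \<noteq> {}" "isomorphism (subvar N (preim N \<nu> V)) (subvar Y V) \<nu>"
    using norm unfolding is_normalization_def birational_morphism_def by blast
  obtain \<psi> where \<psi>: "morphism (subvar Y V) (subvar N (preim N \<nu> V)) \<psi>"
    "\<And>x. x \<in> points (subvar N (preim N \<nu> V)) \<Longrightarrow> \<psi> (\<nu> x) = x"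
    using V(3) unfolding isomorphism_def by blast
  obtain y where y: "y \<in> V" using V(2) by blast
  then have "y \<in> points (subvar Y V)" using openin_subset[OF V(1)] by (auto simp: zariski_subvar)
  then have "\<psi> y \<in> points (subvar N (preim N \<nu> V))" using \<psi>(1) unfolding morphism_def continuous_map_def by blast
  then have "\<psi> y \<in> points N" "\<nu> (\<psi> y) \<in> V" by (simp_all add: zariski_subvar)
  then have "\<nu> x \<in> V" "\<nu> x' \<in> V" using const x by metis+
  then have "x \<in> points (subvar N (preim N \<nu> V))" "x' \<in> points (subvar N (preim N \<nu> V))"
    using x by (simp_all add: zariski_subvar)
  then have "\<psi> (\<nu> x) = x" "\<psi> (\<nu> x') = x'" using \<psi>(2) by blast+
  then show False using const[OF x(1,2)] x(3) by simp
qed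

lemma (in weierstrass) two_points: "\<exists>x\<in>points E. \<exists>x'\<in>points E. x \<noteq> x'"
proof -
  obtain y where y: "y ^ 2 = poly cubic 0" using sqrt_ex by blast
  have "on_cone 0 1 0" by (simp add: on_cone_def)
  moreover have "on_cone 0 y 1" using y on_cone_affine by blast
  ultimately have "proj_point [0, 1, 0] \<in> points E" "proj_point [0, y, 1] \<in> points E" unfolding points_E by blast+
  moreover have "[0, y, 1] \<notin> proj_point [0, 1, 0]" by (auto simp: proj_point_def)
  then have "proj_point [0, y, 1] \<noteq> proj_point [0, 1, 0]" using proj_point_self by metis
  ultimately show ?thesis by blast
qed

lemma points_proj_line:
  assumes "p \<in> points (proj_space 1)"
  obtains p0 p1 where "p = proj_point [p0, p1]" "p0 \<noteq> 0 \<or> p1 \<noteq> 0"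
proof -
  obtain z where z: "p = proj_point z" "length z = Suc 1" "\<exists>i\<le>1. z ! i \<noteq> 0"
    using assms unfolding proj_space_alt points_quotient_by points_sub_affine[OF proj_coords_length]
    by (auto simp: proj_coords_def)
  obtain p0 p1 where "z = [p0, p1]" using z(2) by (auto simp: length_Suc_conv)
  moreover obtain i where i: "i \<le> 1" "z ! i \<noteq> 0" using z(3) by blast
  then have "i = 0 \<or> i = 1" by linarith
  ultimately show thesis using that[of p0 p1] z(1) i(2) by auto
qed

theorem corollary1p2:
  fixes n :: nat and a b :: int and p :: "complex list set"
  assumes "a \<ge> 4" and "b \<ge> max (4 + int n) (3 + a * int n)"
    and "p \<in> points (proj_space 1)"
  shows "sufficiently_general (ruled_surface n)
           (\<lambda>Y. a * of_prime (zero_section n) Y + b * of_prime (fibre n p) Y)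
           (\<lambda>D. algebraic_hyperbolic
                  (subvar (ruled_surface n) (points (ruled_surface n) - div_support D)))"
proof -
  obtain p0 p1 where p: "p = proj_point [p0, p1]" "p0 \<noteq> 0 \<or> p1 \<noteq> 0" using assms(3) by (rule points_proj_line)
  \<comment> \<open>A Bezout pair for the homogeneous coordinates of \<open>p\<close>, completing
    the equation \<open>l\<close> of the fibre to coordinates on the base.\<close>
  obtain g0 g1 where g: "p1 * g1 + p0 * g0 = 1"
  proof (cases "p0 = 0")
    case True then show ?thesis using that[of "1 / p1" 0] p(2) by simp
  next
    case False then show ?thesis using that[of 0 "1 / p0"] by simp
  qed
  define a' b' where "a' = nat a" and "b' = nat b"
  have "0 \<le> a * int n" using assms(1) by simp
  then have ab: "a = int a'" "b = int b'" using assms(1,2) by (simp_all add: a'_def b'_def)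
  have "3 + int (a' * n) \<le> int b'" "4 + int n \<le> int b'" using assms(2) unfolding ab by simp_all
  then interpret ruled_system n p0 p1 g0 g1 a' b'
    using assms(1) g unfolding ab by unfold_locales linarith+
  have "sufficiently_general X Dv (\<lambda>D. algebraic_hyperbolic (subvar X (points X - div_support D)))"
  proof (rule general_divisor)
    fix k :: "nat \<Rightarrow> nat \<Rightarrow> complex"
    assume k: "supported k" "k 0 0 \<noteq> 0" "generic_in normalized (\<lambda>i j. k i j / k 0 0)"
    let ?Y = "subvar X (points X - div_support (Ek k))"
    \<comment> \<open>Two inclusions are composed, of \<open>G\<close> in the complement and of the
      complement in \<open>X\<close>; a normalization map thus becomes a morphism to
      \<open>X\<close> that avoids the divisor.\<close>
    have mor: "morphism N X \<nu>" "\<And>x. x \<in> points N \<Longrightarrow> \<nu> x \<notin> div_support (Ek k)"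
      if "is_normalization N (subvar ?Y G) \<nu>" for N :: "'n fspace" and G \<nu>
    proof -
      have m: "morphism N (subvar ?Y G) \<nu>"
        using that unfolding is_normalization_def finite_morphism_def by blast
      have "openin (zariski ?Y) V" if "regular ?Y V f" for V f
        using that unfolding regular_subvar zariski_subvar by blast
      then have m: "morphism N ?Y \<nu>" by (rule morphism_subvar_incl(1)[OF m])
      have reg: "openin (zariski X) V" if "regular X V f" for V f using that unfolding regular_X by blast
      show "morphism N X \<nu>" by (rule morphism_subvar_incl(1)[OF m reg])
      show "\<nu> x \<notin> div_support (Ek k)" if "x \<in> points N" for x
        using morphism_subvar_incl(2)[OF m, of x] reg that by blast
    qed
    show "algebraic_hyperbolic ?Y" unfolding algebraic_hyperbolic_def
    proof (rule notI, elim exE conjE disjE)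
      fix G assume "elliptic_normalization (subvar ?Y G)"
      then obtain \<alpha> \<beta> \<nu> where N: "is_normalization (weierstrass_curve \<alpha> \<beta>) (subvar ?Y G) \<nu>"
        unfolding elliptic_normalization_def by blast
      interpret E: weierstrass \<alpha> \<beta> .
      obtain x x' where "x \<in> points E.E" "x' \<in> points E.E" "\<nu> x \<noteq> \<nu> x'"
        using E.two_points normalization_nonconst[OF N] by metis
      then show False using no_elliptic[OF k mor[OF N]] by blast
    next
      fix G assume "Cstar_normalization (subvar ?Y G)"
      then obtain \<nu> where N: "is_normalization Cstar (subvar ?Y G) \<nu>" unfolding Cstar_normalization_def by blast
      have "[1] \<in> points Cstar" "[2] \<in> points Cstar" "[1] \<noteq> [2 :: complex]" by (simp_all add: points_Cstar)
      then obtain x x' where x: "x \<in> points Cstar" "x' \<in> points Cstar" "\<nu> x \<noteq> \<nu> x'"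
        using normalization_nonconst[OF N] by metis
      obtain t1 t2 where t: "x = [t1]" "t1 \<noteq> 0" "x' = [t2]" "t2 \<noteq> 0" using x(1,2) unfolding points_Cstar by blast
      have "\<nu> [t] \<notin> div_support (Ek k)" if "t \<noteq> 0" for t using mor(2)[OF N] that unfolding points_Cstar by blast
      then show False using no_Cstar[OF k mor(1)[OF N] _ t(2,4)] x(3) t(1,3) by blast
    qed
  qed
  then show ?thesis unfolding Dv_def ab p(1) .
qed

end
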